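(* Let $f:S_d\to[0,+\infty]$ be convex, positively $1$-homogeneous and lower semicontinuous, with $\operatorname{dom}(f)\subset S_d^+$, $\operatorname{dom}(f)\neq\emptyset$, and $\operatorname{dom}(f)\cap S_d^{++}$ dense in $\operatorname{dom}(f)$. For each $\mu,\nu\in\mathcal P_2(\mathbb R^d)$, $$F(\mu,\nu)=\sup\left\{\int_{\mathbb R^d}\psi\,d\nu-\int_{\mathbb R^d}\psi\,d\mu \;:\; \psi\in C_b^2(\mathbb R^d),\ -\psi=(-\psi)^G \text{ on }\mathbb R^d\right\}.$$
   Context: $S_d$ is the space of real symmetric $d\times d$ matrices with inner product $A:B=\operatorname{tr}(A^{T}B)$ and norm $\|A\|=\sqrt{A:A}$; $S_d^+$ (resp. $S_d^{++}$) is the set of nonnegative (resp. positive) definite ones. $\operatorname{dom}(f)=\{M\in S_d: f(M)<+\infty\}$. Positively $1$-homogeneous means $f(tA)=tf(A)$ for all $A\in S_d$, $t\ge 0$. $\mathcal P_2(\mathbb R^d)$ is the set of Borel probability measures on $\mathbb R^d$ with finite second moment; $\mathcal P_2((0,1)\times\mathbb R^d)$ is the set of Borel probability measures $\varrho$ on $(0,1)\times\mathbb R^d$ with $\int |x|^2\,d\varrho(t,x)<\infty$. $\mathcal M((0,1)\times\mathbb R^d,S_d^+)$ is the set of $S_d$-valued Borel measures $\lambda$ on $(0,1)\times\mathbb R^d$ with $\lambda(E)\in S_d^+$ for every Borel $E$; $|\cdot|$ of a measure is its total variation measure. $C_b^2(\mathbb R^d)$ is the space of twice continuously differentiable functions on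 $\mathbb R^d$ with uniformly bounded Hessian (the function itself need not be bounded). $C_b^{1,2}((0,1)\times\mathbb R^d)$ is the space of functions $\varphi$ that are once continuously differentiable in $t$ and twice in $x$ with $\partial_t\varphi$ and $\nabla_x^2\varphi$ uniformly bounded. Fokker-Planck equation. A pair $(\varrho,\lambda)\in\mathcal P_2((0,1)\times\mathbb R^d)\times\mathcal M((0,1)\times\mathbb R^d,S_d^+)$ which can be disintegrated as $\varrho=\varrho_t\otimes\mathcal L^1|_{(0,1)}$, $\lambda=\lambda_t\otimes\mathcal L^1|_{(0,1)}$ solves $\partial_t\varrho=\operatorname{tr}(\frac12\nabla^2\lambda)$ if $\int_0^1|\lambda_t|(\mathbb R^d)\,dt<\infty$ and $$\int_0^1\int_{\mathbb R^d}\partial_t\varphi\,d\varrho_t\,dt=-\int_0^1\int_{\mathbb R^d}\tfrac12\nabla_x^2\varphi:d\lambda_t\,dt$$ for all $\varphi\in C_b^{1,2}((0,1)\times\mathbb R^d)$ whose closed support is contained in $(0,1)\times\mathbb R^d$. For such a solution $t\mapsto\varrho_t$ has a narrowly continuous representative on $[0,1]$ with values in $\mathcal P_2(\mathbb R^d)$, which is always used; $\varrho_0,\varrho_1$ denote its endpoint values. Dynamic cost: $$F(\mu,\nu)=\inf\left\{\int_0^1\int_{\mathbb R^d}f\left(\frac{d\lambda_t}{d|\lambda_t|}\right)d|\lambda_t|\,dt \;:\; \partial_t\varrho=\operatorname{tr}\left(\tfrac12\nabla^2\lambda\right),\ \varrho_0=\mu,\ \varrho_1=\nu\right\},$$ with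 $\inf\emptyset=+\infty$. $G$-transform. $G(x,p)=F(\delta_x,p)$ for $x\in\mathbb R^d$, $p\in\mathcal P_2(\mathbb R^d)$. For a universally measurable $\varphi:\mathbb R^d\to\mathbb R$ with $|\varphi(x)|\le C(1+|x|^2)$ for some $C>0$, $$\varphi^G(x)=\inf\left\{\int_{\mathbb R^d}\varphi\,dp+G(x,p): p\in\mathcal P_2(\mathbb R^d)\right\}.$$ *)

theory Defs
  imports "HOL-Probability.Probability"
begin

text \<open>
  Matrices are elements of \<^typ>\<open>real^'d^'d\<close>, whose library inner product and norm are the
  Frobenius ones, i.e. \<open>A \<bullet> B = tr (A\<^sup>T B)\<close>.
\<close>

definition sym_mats :: "(real^'d^'d) set" where
  "sym_mats = {A. transpose A = A}"

definition psd_mats :: "(real^'d^'d) set" where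
  "psd_mats = {A \<in> sym_mats. \<forall>v. 0 \<le> v \<bullet> (A *v v)}"

definition pd_mats :: "(real^'d^'d) set" where
  "pd_mats = {A \<in> sym_mats. \<forall>v. v \<noteq> 0 \<longrightarrow> 0 < v \<bullet> (A *v v)}"


section \<open>Extended-real-valued functions on symmetric matrices\<close>

text \<open>
  A function from the symmetric matrices to \<open>[0, \<infinity>]\<close> is a function on all matrices of which
  only the values on \<^const>\<open>sym_mats\<close> are ever used.  In \<^typ>\<open>ennreal\<close>, \<open>0 * \<infinity> = 0\<close>; in
  particular positive homogeneity includes \<open>f 0 = 0\<close>.
\<close>

definition eff_dom :: "(real^'d^'d \<Rightarrow> ennreal) \<Rightarrow> (real^'d^'d) set" where
  "eff_dom f = {A \<in> sym_mats. f A < \<infinity>}"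

definition convex_fun :: "(real^'d^'d \<Rightarrow> ennreal) \<Rightarrow> bool" where
  "convex_fun f \<longleftrightarrow> (\<forall>A\<in>sym_mats. \<forall>B\<in>sym_mats. \<forall>u\<in>{0..1}.
     f ((1 - u) *\<^sub>R A + u *\<^sub>R B) \<le> ennreal (1 - u) * f A + ennreal u * f B)"

definition pos_homogeneous :: "(real^'d^'d \<Rightarrow> ennreal) \<Rightarrow> bool" where
  "pos_homogeneous f \<longleftrightarrow> (\<forall>A\<in>sym_mats. \<forall>t\<ge>0. f (t *\<^sub>R A) = ennreal t * f A)"

definition lsc_fun :: "(real^'d^'d \<Rightarrow> ennreal) \<Rightarrow> bool" where
  "lsc_fun f \<longleftrightarrow> (\<forall>A\<in>sym_mats. f A \<le> Liminf (at A within sym_mats) f)"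


section \<open>Matrix-valued measures\<close>

text \<open>
  A matrix-valued measure on the measurable space \<open>M\<close> is a set function, of which only the
  values on \<^term>\<open>sets M\<close> matter.  Taking all \<open>A i\<close> empty in the additivity condition gives
  \<open>\<lambda> {} = 0\<close>.
\<close>

definition psd_measures :: "'a measure \<Rightarrow> ('a set \<Rightarrow> real^'d^'d) set" where
  "psd_measures M = {l. (\<forall>E\<in>sets M. l E \<in> psd_mats) \<and>
     (\<forall>A::nat \<Rightarrow> 'a set. range A \<subseteq> sets M \<longrightarrow> disjoint_family A \<longrightarrow>
        (\<lambda>i. l (A i)) sums l (\<Union>i. A i))}"

definition total_variation :: "'a measure \<Rightarrow> ('a set \<Rightarrow> real^'d^'d) \<Rightarrow> 'a measure" where
  "total_variation M l = measure_of (space M) (sets M)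
     (\<lambda>E. SUP A\<in>{A::nat \<Rightarrow> 'a set. range A \<subseteq> sets M \<and> disjoint_family A \<and> (\<Union>i. A i) = E}.
        \<Sum>i. ennreal (norm (l (A i))))"

text \<open>A version of \<open>dl/d|l|\<close>; it is determined up to \<open>|l|\<close>-null sets.\<close>

definition polar_density :: "'a measure \<Rightarrow> ('a set \<Rightarrow> real^'d^'d) \<Rightarrow> 'a \<Rightarrow> real^'d^'d" where
  "polar_density M l = (SOME g. g \<in> borel_measurable M \<and> (\<forall>x. g x \<in> sym_mats) \<and>
     integrable (total_variation M l) g \<and>
     (\<forall>E\<in>sets M. l E = (LINT x:E|total_variation M l. g x)))"

text \<open>The integral \<open>\<integral> \<Phi> : dl\<close>.\<close>

definition mat_integral ::
    "'a measure \<Rightarrow> ('a set \<Rightarrow> real^'d^'d) \<Rightarrow> ('a \<Rightarrow> real^'d^'d) \<Rightarrow> real" where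
  "mat_integral M l \<Phi> = (LINT x|total_variation M l. \<Phi> x \<bullet> polar_density M l x)"


section \<open>Probability measures with finite second moment\<close>

definition P2 :: "(real^'d) measure set" where
  "P2 = {p. prob_space p \<and> sets p = sets borel \<and> (\<integral>\<^sup>+x. ennreal ((norm x)\<^sup>2) \<partial>p) < \<infinity>}"

definition time_space :: "(real \<times> (real^'d)) measure" where
  "time_space = restrict_space borel ({0<..<1} \<times> UNIV)"

definition P2_time_space :: "(real \<times> (real^'d)) measure set" where
  "P2_time_space = {\<rho>. prob_space \<rho> \<and> sets \<rho> = sets time_space \<and>
     (\<integral>\<^sup>+z. ennreal ((norm (snd z))\<^sup>2) \<partial>\<rho>) < \<infinity>}"


section \<open>Smooth functions\<close>

text \<open>
  \<open>C2b \<psi>\<close>: twice continuously differentiable with bounded Hessian; \<open>\<psi>\<close> itself may be unbounded.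
\<close>

definition C2b :: "(real^'d \<Rightarrow> real) \<Rightarrow> bool" where
  "C2b \<psi> \<longleftrightarrow> (\<exists>(g :: real^'d \<Rightarrow> real^'d) (H :: real^'d \<Rightarrow> real^'d^'d).
     (\<forall>x. (\<psi> has_derivative (\<lambda>h. g x \<bullet> h)) (at x)) \<and>
     (\<forall>x. (g has_derivative (\<lambda>h. H x *v h)) (at x)) \<and>
     continuous_on UNIV H \<and> bounded (range H))"

text \<open>
  \<open>C12b \<phi> \<phi>t g H\<close>: on \<open>(0,1) \<times> \<real>\<^sup>d\<close> the function \<open>\<phi>\<close> has time derivative \<open>\<phi>t\<close>, spatial gradient
  \<open>g\<close> and spatial Hessian \<open>H\<close>, all jointly continuous, with \<open>\<phi>t\<close> and \<open>H\<close> bounded.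
\<close>

definition C12b :: "(real \<times> (real^'d) \<Rightarrow> real) \<Rightarrow> (real \<times> (real^'d) \<Rightarrow> real) \<Rightarrow>
    (real \<times> (real^'d) \<Rightarrow> real^'d) \<Rightarrow> (real \<times> (real^'d) \<Rightarrow> real^'d^'d) \<Rightarrow> bool" where
  "C12b \<phi> \<phi>t g H \<longleftrightarrow>
     (\<forall>t\<in>{0<..<1}. \<forall>x.
        ((\<lambda>s. \<phi> (s, x)) has_real_derivative \<phi>t (t, x)) (at t) \<and>
        ((\<lambda>y. \<phi> (t, y)) has_derivative (\<lambda>h. g (t, x) \<bullet> h)) (at x) \<and>
        ((\<lambda>y. g (t, y)) has_derivative (\<lambda>h. H (t, x) *v h)) (at x)) \<and>
     continuous_on ({0<..<1} \<times> UNIV) \<phi> \<and> continuous_on ({0<..<1} \<times> UNIV) \<phi>t \<and>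
     continuous_on ({0<..<1} \<times> UNIV) g \<and> continuous_on ({0<..<1} \<times> UNIV) H \<and>
     bounded (\<phi>t ` ({0<..<1} \<times> UNIV)) \<and> bounded (H ` ({0<..<1} \<times> UNIV))"


section \<open>The Fokker-Planck equation\<close>

text \<open>\<open>\<rho> = r\<^sub>t \<otimes> \<L>\<^sup>1\<close> on \<open>(0,1)\<close>.\<close>

definition disintegrates_prob ::
    "(real \<times> (real^'d)) measure \<Rightarrow> (real \<Rightarrow> (real^'d) measure) \<Rightarrow> bool" where
  "disintegrates_prob \<rho> r \<longleftrightarrow>
     r \<in> measurable (restrict_space borel {0<..<1}) (prob_algebra borel) \<and>
     (\<forall>E\<in>sets time_space.
        emeasure \<rho> E = (\<integral>\<^sup>+t\<in>{0<..<1}. emeasure (r t) (Pair t -` E) \<partial>lborel))"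

text \<open>\<open>\<Lambda> = l\<^sub>t \<otimes> \<L>\<^sup>1\<close> on \<open>(0,1)\<close>.\<close>

definition disintegrates_psd :: "((real \<times> (real^'d)) set \<Rightarrow> real^'d^'d) \<Rightarrow>
    (real \<Rightarrow> (real^'d) set \<Rightarrow> real^'d^'d) \<Rightarrow> bool" where
  "disintegrates_psd \<Lambda> l \<longleftrightarrow>
     (\<forall>t\<in>{0<..<1}. l t \<in> psd_measures borel) \<and>
     (\<forall>B\<in>sets borel. (\<lambda>t. l t B) \<in> borel_measurable (restrict_space borel {0<..<1})) \<and>
     (\<forall>E\<in>sets time_space.
        set_integrable lborel {0<..<1} (\<lambda>t. l t (Pair t -` E)) \<and>
        \<Lambda> E = (LINT t:{0<..<1}|lborel. l t (Pair t -` E)))"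

text \<open>
  The pair \<open>(\<rho>, \<Lambda>)\<close>, with disintegrations \<open>r\<close> and \<open>l\<close>, solves
  \<open>\<partial>\<^sub>t \<rho> = tr (1/2 \<nabla>\<^sup>2 \<Lambda>)\<close>.  The support condition on test functions does not ask for
  compactness in space.
\<close>

definition fokker_planck :: "(real \<times> (real^'d)) measure \<Rightarrow>
    ((real \<times> (real^'d)) set \<Rightarrow> real^'d^'d) \<Rightarrow> (real \<Rightarrow> (real^'d) measure) \<Rightarrow>
    (real \<Rightarrow> (real^'d) set \<Rightarrow> real^'d^'d) \<Rightarrow> bool" where
  "fokker_planck \<rho> \<Lambda> r l \<longleftrightarrow>
     \<rho> \<in> P2_time_space \<and> \<Lambda> \<in> psd_measures time_space \<and>
     disintegrates_prob \<rho> r \<and> disintegrates_psd \<Lambda> l \<and>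
     (\<integral>\<^sup>+t\<in>{0<..<1}. emeasure (total_variation borel (l t)) UNIV \<partial>lborel) < \<infinity> \<and>
     (\<forall>\<phi> \<phi>t g H. C12b \<phi> \<phi>t g H \<longrightarrow>
        closure {(t, x). t \<in> {0<..<1} \<and> \<phi> (t, x) \<noteq> 0} \<subseteq> {0<..<1} \<times> UNIV \<longrightarrow>
        (LINT t:{0<..<1}|lborel. (LINT x|r t. \<phi>t (t, x))) =
        - (LINT t:{0<..<1}|lborel. mat_integral borel (l t) (\<lambda>x. (1/2) *\<^sub>R H (t, x))))"

text \<open>The narrowly continuous representative on \<open>[0,1]\<close> is unique if it exists.\<close>

definition narrowly_continuous :: "(real \<Rightarrow> (real^'d) measure) \<Rightarrow> bool" where
  "narrowly_continuous r \<longleftrightarrow> (\<forall>t\<in>{0..1}. r t \<in> P2) \<and>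
     (\<forall>h::real^'d \<Rightarrow> real. continuous_on UNIV h \<longrightarrow> bounded (range h) \<longrightarrow>
        continuous_on {0..1} (\<lambda>t. LINT x|r t. h x))"


section \<open>Dynamic cost and G-transform\<close>

definition action :: "(real^'d^'d \<Rightarrow> ennreal) \<Rightarrow> (real \<Rightarrow> (real^'d) set \<Rightarrow> real^'d^'d) \<Rightarrow> ennreal"
  where "action f l = (\<integral>\<^sup>+t\<in>{0<..<1}.
     (\<integral>\<^sup>+x. f (polar_density borel (l t) x) \<partial>total_variation borel (l t)) \<partial>lborel)"

definition dyn_cost ::
    "(real^'d^'d \<Rightarrow> ennreal) \<Rightarrow> (real^'d) measure \<Rightarrow> (real^'d) measure \<Rightarrow> ennreal" where
  "dyn_cost f \<mu> \<nu> = Inf {action f l | \<rho> \<Lambda> r l.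
     fokker_planck \<rho> \<Lambda> r l \<and> narrowly_continuous r \<and> r 0 = \<mu> \<and> r 1 = \<nu>}"

definition G_cost :: "(real^'d^'d \<Rightarrow> ennreal) \<Rightarrow> real^'d \<Rightarrow> (real^'d) measure \<Rightarrow> ennreal" where
  "G_cost f x p = dyn_cost f (return borel x) p"

text \<open>
  Meant for universally measurable \<open>\<phi>\<close> of at most quadratic growth, which are integrable with
  respect to the completion of every \<open>p \<in> P2\<close>.
\<close>

definition G_transform ::
    "(real^'d^'d \<Rightarrow> ennreal) \<Rightarrow> (real^'d \<Rightarrow> real) \<Rightarrow> real^'d \<Rightarrow> ereal" where
  "G_transform f \<phi> x =
     (INF p\<in>P2. ereal (LINT y|completion p. \<phi> y) + enn2ereal (G_cost f x p))"

end

theory Submission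
  imports Defs
begin

text \<open>
  Call a matrix \<open>k\<close> a slope of \<open>f\<close> if \<open>k : A \<le> f(A)\<close> for all symmetric \<open>A\<close>.  Being convex, positively
  homogeneous and lower semicontinuous, \<open>f\<close> is the supremum of its slopes (\<open>slope_above\<close>).  The theorem
  is then linear programming duality for a problem without time, with unknown a measure \<open>\<lambda>\<close> with
  values in \<open>S\<^sub>d\<^sup>+\<close>:

    minimise \<open>\<integral> f(d\<lambda>/d|\<lambda>|) d|\<lambda>|\<close>  subject to  \<open>\<nu> - \<mu> = tr (1/2 \<nabla>\<^sup>2 \<lambda>)\<close>,

  whose dual is to maximise \<open>\<integral> \<psi> d\<nu> - \<integral> \<psi> d\<mu>\<close> over the \<open>\<psi>\<close> with \<open>1/2 \<nabla>\<^sup>2\<psi>(x)\<close> a slope for every \<open>x\<close>.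

  The dynamic cost is at most the static one, because a feasible \<open>\<lambda>\<close>, held constant in time, drives
  the affine interpolation \<open>(1 - t) \<mu> + t \<nu>\<close> (\<open>static_upper_bound\<close>).  It is at least the dual value,
  because \<open>t \<mapsto> \<integral> \<psi> d\<rho>\<^sub>t\<close> has derivative \<open>\<integral> 1/2 \<nabla>\<^sup>2\<psi> : d\<lambda>\<^sub>t\<close> along every solution of the Fokker-Planck
  equation, and a slope tested against \<open>d\<lambda>\<^sub>t/d|\<lambda>\<^sub>t|\<close> is below \<open>f\<close> (\<open>weak_duality\<close>).

  The condition \<open>-\<psi> = (-\<psi>)\<^sup>G\<close> is equivalent to \<open>1/2 \<nabla>\<^sup>2\<psi>\<close> being a slope everywhere
  (\<open>G_transform_iff_slopes\<close>).  One direction is weak duality for the pairs \<open>\<delta>\<^sub>x, p\<close>.  For the other, a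
  point mass at \<open>x\<close> is spread by a measure \<open>A m\<close> with a fixed positive definite \<open>A\<close> and \<open>m\<close> concentrated
  near \<open>x\<close> (\<open>point_mass_spreading\<close>), at the cost of \<open>f(A)\<close> times the mass of \<open>m\<close>; this gives
  \<open>1/2 \<nabla>\<^sup>2\<psi>(x) : A \<le> f(A)\<close>, and the positive definite matrices of the domain are enough to detect slopes
  (\<open>slope_if_pd\<close>).

  What remains is a feasible \<open>\<lambda>\<close> whose cost is at most the dual value \<open>D\<close> (\<open>strong_duality\<close>).  The
  Hahn-Banach theorem yields a linear functional \<open>L\<close> on bounded continuous matrix fields with
  \<open>L (1/2 \<nabla>\<^sup>2\<psi>) = \<integral> \<psi> d\<nu> - \<integral> \<psi> d\<mu>\<close>, with \<open>L \<le> D\<close> on fields of slopes, and positive with respect to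
  \<open>S\<^sub>d\<^sup>+\<close> (\<open>ex_dual_functional\<close>).  Functions \<open>\<psi>\<close> that vanish on a large ball and are uniformly convex far
  out show that \<open>L\<close> has no mass at infinity, since \<open>\<nu>\<close> has a finite second moment.  Hence \<open>L\<close> is the
  integral against a measure \<open>\<lambda>\<close> (\<open>matrix_representation\<close>, by way of the Daniell-Stone theorem), and
  the bound on continuous fields of slopes extends to measurable ones, whose supremum is the cost
  of \<open>\<lambda>\<close> (\<open>action_bound\<close>).
\<close>

section \<open>Linear functionals below sublinear ones\<close>

definition sublinear :: "('a::real_vector \<Rightarrow> real) \<Rightarrow> bool" where
  "sublinear p \<longleftrightarrow> (\<forall>x y. p (x + y) \<le> p x + p y) \<and> (\<forall>t x. 0 < t \<longrightarrow> p (t *\<^sub>R x) = t * p x)"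

lemma sublinear_zero:
  assumes "sublinear p" shows "p 0 = 0"
proof -
  have "p (2 *\<^sub>R 0) = 2 * p 0" using assms unfolding sublinear_def by (metis zero_less_numeral)
  then show ?thesis by simp
qed

lemma sublinear_neg:
  assumes "sublinear p" shows "- p (- x) \<le> p x"
proof -
  have "p (x + - x) \<le> p x + p (- x)" using assms unfolding sublinear_def by blast
  then show ?thesis using sublinear_zero[OF assms] by simp
qed

lemma sublinear_scale:
  assumes "sublinear p" "0 \<le> t" shows "p (t *\<^sub>R x) = t * p x"
  using assms sublinear_zero[OF assms(1)] unfolding sublinear_def by (cases "t = 0") auto

text \<open>
  The infimum over \<open>t \<ge> 0\<close> of \<open>q (x + t y) - t q y\<close> is again sublinear and below \<open>q\<close>, hence equal to \<open>q\<close>;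
  \<open>t = 1\<close> gives \<open>q x \<le> q (x + y) - q y\<close>.
\<close>

lemma minimal_sublinear_additive:
  assumes q: "sublinear q" and min: "\<And>q'. sublinear q' \<Longrightarrow> (\<forall>x. q' x \<le> q x) \<Longrightarrow> q' = q"
  shows "q (x + y) = q x + q y"
proof -
  define r where "r = (\<lambda>x. INF t\<in>{0..}. q (x + t *\<^sub>R y) - t * q y)"
  have sub: "q (a + b) \<le> q a + q b" for a b using q unfolding sublinear_def by blast
  have bdd: "bdd_below ((\<lambda>t. q (x + t *\<^sub>R y) - t * q y) ` {0..})" for x
  proof (rule bdd_belowI2)
    fix t :: real assume "t \<in> {0..}"
    then have "t * q y = q ((x + t *\<^sub>R y) + (- x))" using sublinear_scale[OF q] by simp
    also have "\<dots> \<le> q (x + t *\<^sub>R y) + q (- x)" by (rule sub)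
    finally show "- q (- x) \<le> q (x + t *\<^sub>R y) - t * q y" by simp
  qed
  have r_le: "r x \<le> q (x + t *\<^sub>R y) - t * q y" if "0 \<le> t" for x t
    unfolding r_def using that by (intro cINF_lower[OF bdd]) auto
  have r_ge: "c \<le> r x" if "\<And>t. 0 \<le> t \<Longrightarrow> c \<le> q (x + t *\<^sub>R y) - t * q y" for c x
    unfolding r_def using that by (intro cINF_greatest) auto
  have "sublinear r"
    unfolding sublinear_def
  proof (intro conjI allI impI)
    fix a b
    have "r (a + b) - (q (b + t *\<^sub>R y) - t * q y) \<le> r a" if t: "0 \<le> t" for t
    proof (rule r_ge)
      fix s :: real assume s: "0 \<le> s"
      have "r (a + b) \<le> q ((a + b) + (s + t) *\<^sub>R y) - (s + t) * q y" using s t by (intro r_le) auto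
      also have "(a + b) + (s + t) *\<^sub>R y = (a + s *\<^sub>R y) + (b + t *\<^sub>R y)" by (simp add: algebra_simps)
      also have "q \<dots> \<le> q (a + s *\<^sub>R y) + q (b + t *\<^sub>R y)" by (rule sub)
      finally show "r (a + b) - (q (b + t *\<^sub>R y) - t * q y) \<le> q (a + s *\<^sub>R y) - s * q y"
        by (simp add: algebra_simps)
    qed
    then have "r (a + b) - r a \<le> r b" by (intro r_ge) (smt (verit))
    then show "r (a + b) \<le> r a + r b" by simp
  next
    fix t :: real and x assume t: "0 < t"
    have *: "r (t *\<^sub>R x) \<le> t * r x" if t: "0 < t" for t x
    proof -
      have "r (t *\<^sub>R x) / t \<le> r x"
      proof (rule r_ge)
        fix s :: real assume s: "0 \<le> s"
        have "r (t *\<^sub>R x) \<le> q (t *\<^sub>R x + (t * s) *\<^sub>R y) - (t * s) * q y" using s t by (intro r_le) auto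
        also have "t *\<^sub>R x + (t * s) *\<^sub>R y = t *\<^sub>R (x + s *\<^sub>R y)" by (simp add: algebra_simps)
        also have "q \<dots> = t * q (x + s *\<^sub>R y)" using t by (intro sublinear_scale[OF q]) simp
        finally show "r (t *\<^sub>R x) / t \<le> q (x + s *\<^sub>R y) - s * q y"
          using t by (simp add: field_simps)
      qed
      then show ?thesis using t by (simp add: field_simps)
    qed
    have "r ((1 / t) *\<^sub>R (t *\<^sub>R x)) \<le> (1 / t) * r (t *\<^sub>R x)" using t by (intro *) auto
    then have "t * r x \<le> r (t *\<^sub>R x)" using t by (simp add: field_simps)
    with *[OF t, of x] show "r (t *\<^sub>R x) = t * r x" by simp
  qed
  moreover have "\<forall>x. r x \<le> q x" using r_le[of 0] by simp
  ultimately have "r = q" by (rule min)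
  then have "q x \<le> q (x + y) - q y" using r_le[of 1 x] by simp
  then show ?thesis using sub[of x y] by simp
qed

text \<open>
  By Zorn's lemma there is a minimal sublinear function below \<open>p\<close>, and a minimal one is linear.
\<close>

lemma hahn_banach_sublinear:
  fixes p :: "'a::real_vector \<Rightarrow> real"
  assumes p: "sublinear p"
  shows "\<exists>L. linear L \<and> (\<forall>x. L x \<le> p x)"
proof -
  define A where "A = {q. sublinear q \<and> (\<forall>x. q x \<le> p x)}"
  define P :: "('a \<Rightarrow> real) \<Rightarrow> ('a \<Rightarrow> real) \<Rightarrow> bool" where "P = (\<lambda>q q'. \<forall>x. q' x \<le> q x)"
  have "\<exists>m\<in>A. \<forall>a\<in>A. P m a \<longrightarrow> a = m"
  proof (rule predicate_Zorn)
    show "partial_order_on A (relation_of P A)"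
      by (rule partial_order_on_relation_ofI) (auto simp: P_def intro: order_trans intro!: ext antisym)
    fix C assume C: "C \<in> Chains (relation_of P A)"
    then have CA: "C \<subseteq> A" by (auto simp: Chains_def relation_of_def)
    have tot: "P a b \<or> P b a" if "a \<in> C" "b \<in> C" for a b
      using C that by (auto simp: Chains_def relation_of_def)
    show "\<exists>u\<in>A. \<forall>a\<in>C. P a u"
    proof (cases "C = {}")
      case True
      then show ?thesis using p by (auto simp: A_def)
    next
      case False
      define u where "u = (\<lambda>x. INF q\<in>C. q x)"
      have bdd: "bdd_below ((\<lambda>q. q x) ` C)" for x
      proof (rule bdd_belowI2)
        fix q assume "q \<in> C"
        then have "sublinear q" "q (- x) \<le> p (- x)" using CA by (auto simp: A_def)
        then show "- p (- x) \<le> q x" using sublinear_neg[of q x] by linarith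
      qed
      have u_le: "u x \<le> q x" if "q \<in> C" for q x
        unfolding u_def using that by (intro cINF_lower[OF bdd]) auto
      have u_ge: "c \<le> u x" if "\<And>q. q \<in> C \<Longrightarrow> c \<le> q x" for c x
        unfolding u_def using that False by (intro cINF_greatest) auto
      have "sublinear u"
        unfolding sublinear_def
      proof (intro conjI allI impI)
        fix a b
        have "u (a + b) - q2 b \<le> u a" if q2: "q2 \<in> C" for q2
        proof (rule u_ge)
          fix q1 assume q1: "q1 \<in> C"
          obtain q where q: "q \<in> C" "q a \<le> q1 a" "q b \<le> q2 b"
            using tot[OF q1 q2] q1 q2 unfolding P_def by (metis order_refl)
          have "u (a + b) \<le> q (a + b)" using q by (intro u_le)
          also have "\<dots> \<le> q a + q b" using q CA by (auto simp: A_def sublinear_def)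
          finally show "u (a + b) - q2 b \<le> q1 a" using q by linarith
        qed
        then have "u (a + b) - u a \<le> u b" by (intro u_ge) (smt (verit))
        then show "u (a + b) \<le> u a + u b" by simp
      next
        fix t :: real and x assume t: "0 < t"
        have eq: "q (t *\<^sub>R x) = t * q x" if "q \<in> C" for q
          using that CA t by (auto simp: A_def sublinear_def)
        show "u (t *\<^sub>R x) = t * u x"
        proof (rule antisym)
          have "u (t *\<^sub>R x) / t \<le> u x"
            using eq u_le[of _ "t *\<^sub>R x"] t by (intro u_ge) (auto simp: field_simps)
          then show "u (t *\<^sub>R x) \<le> t * u x" using t by (simp add: field_simps)
          show "t * u x \<le> u (t *\<^sub>R x)"
          proof (rule u_ge)
            fix q assume q: "q \<in> C"
            have "t * u x \<le> t * q x" using t by (intro mult_left_mono u_le[OF q]) auto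
            then show "t * u x \<le> q (t *\<^sub>R x)" unfolding eq[OF q] .
          qed
        qed
      qed
      moreover have "\<forall>x. u x \<le> p x"
      proof
        fix x
        obtain q where q: "q \<in> C" using False by blast
        then have "q x \<le> p x" using CA by (auto simp: A_def)
        then show "u x \<le> p x" using u_le[OF q, of x] by linarith
      qed
      ultimately show ?thesis using u_le by (auto simp: A_def P_def)
    qed
  qed
  then obtain q where q: "sublinear q" "\<forall>x. q x \<le> p x"
    and min: "\<And>a. a \<in> A \<Longrightarrow> P q a \<Longrightarrow> a = q" by (auto simp: A_def)
  have add: "q (x + y) = q x + q y" for x y
  proof (rule minimal_sublinear_additive[OF q(1)])
    fix q' assume "sublinear q'" "\<forall>x. q' x \<le> q x"
    moreover from this have "q' x \<le> p x" for x using q(2) order_trans by blast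
    ultimately show "q' = q" by (intro min) (auto simp: A_def P_def)
  qed
  have neg: "q (- x) = - q x" for x
    using add[of x "- x"] sublinear_zero[OF q(1)] by simp
  have "q (t *\<^sub>R x) = t * q x" for t x
    using sublinear_scale[OF q(1), of t x] sublinear_scale[OF q(1), of "- t" x] neg[of "t *\<^sub>R x"]
    by (cases "0 \<le> t") auto
  then have "linear q" using add by (intro linearI) auto
  then show ?thesis using q by blast
qed

section \<open>Positive functionals on bounded continuous functions\<close>

definition region :: "('a::topological_space \<Rightarrow>\<^sub>C real) \<Rightarrow> ('a \<Rightarrow>\<^sub>C real) \<Rightarrow> ('a \<times> real) set" where
  "region g h = {(x, t). g x \<le> t \<and> t < h x}"

definition fiber_length :: "('a \<times> real) set \<Rightarrow> 'a \<Rightarrow> real" where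
  "fiber_length S x = measure lborel (Pair x -` S)"

lemma Bcontfun_apply:
  fixes u :: "'a::topological_space \<Rightarrow> 'b::real_normed_vector"
  assumes "continuous_on UNIV u" "\<And>x. norm (u x) \<le> B"
  shows "apply_bcontfun (Bcontfun u) = u"
  using bcontfun_normI[OF assms] by (rule Bcontfun_inverse)

lemma bcontfun_abs_le: "\<bar>apply_bcontfun (g::'a::topological_space \<Rightarrow>\<^sub>C real) x\<bar> \<le> norm g"
  using norm_bounded[of g x] by simp

lemma ex_bmax:
  fixes g h :: "'a::topological_space \<Rightarrow>\<^sub>C real"
  shows "\<exists>k::'a \<Rightarrow>\<^sub>C real. \<forall>x. k x = max (g x) (h x)"
proof (intro exI allI, subst Bcontfun_apply)
  show "continuous_on UNIV (\<lambda>x. max (g x) (h x))" by (intro continuous_intros) auto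
  show "norm (max (g x) (h x)) \<le> norm g + norm h" for x
    using bcontfun_abs_le[of g x] bcontfun_abs_le[of h x]
      abs_ge_zero[of "g x"] abs_ge_zero[of "h x"] unfolding real_norm_def max_def by (split if_split) linarith
qed auto

lemma ex_bmin:
  fixes g h :: "'a::topological_space \<Rightarrow>\<^sub>C real"
  shows "\<exists>k::'a \<Rightarrow>\<^sub>C real. \<forall>x. k x = min (g x) (h x)"
proof (intro exI allI, subst Bcontfun_apply)
  show "continuous_on UNIV (\<lambda>x. min (g x) (h x))" by (intro continuous_intros) auto
  show "norm (min (g x) (h x)) \<le> norm g + norm h" for x
    using bcontfun_abs_le[of g x] bcontfun_abs_le[of h x]
      abs_ge_zero[of "g x"] abs_ge_zero[of "h x"] unfolding real_norm_def min_def by (split if_split) linarith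
qed auto

lemma fiber_region: "Pair x -` region g h = {g x ..< h x}"
  by (auto simp: region_def)

lemma fiber_length_region: "fiber_length (region g h) x = max 0 (h x - g x)"
  unfolding fiber_length_def fiber_region by (cases "g x \<le> h x") auto

lemma ex_fiber_length_region:
  fixes g h :: "'a::topological_space \<Rightarrow>\<^sub>C real"
  shows "\<exists>k::'a \<Rightarrow>\<^sub>C real. \<forall>x. k x = fiber_length (region g h) x"
  using ex_bmax[of 0 "h - g"] by (simp add: fiber_length_region)

text \<open>
  The regions between the graphs of two functions form a semiring, and a positive functional
  assigns to a region its value at the fiber length.  Caratheodory's extension of this set function
  is the product of the measure to be found with Lebesgue measure.
\<close>

lemma semiring_regions:
  "semiring_of_sets UNIV {region g h | g h :: 'a::topological_space \<Rightarrow>\<^sub>C real. True}" (is "semiring_of_sets UNIV ?R")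
proof
  show "?R \<subseteq> Pow UNIV" by auto
  show "{} \<in> ?R"
    by (auto simp: region_def intro!: exI[of _ 0])
next
  fix a b assume "a \<in> ?R" "b \<in> ?R"
  then obtain g h g' h' :: "'a \<Rightarrow>\<^sub>C real" where ab: "a = region g h" "b = region g' h'" by blast
  obtain m1 :: "'a \<Rightarrow>\<^sub>C real" where m1: "\<And>x. apply_bcontfun m1 x = max (g x) (g' x)" using ex_bmax[of g g'] by blast
  obtain m2 :: "'a \<Rightarrow>\<^sub>C real" where m2: "\<And>x. apply_bcontfun m2 x = min (h x) (h' x)" using ex_bmin[of h h'] by blast
  have "a \<inter> b = region m1 m2" by (auto simp: ab region_def m1 m2)
  then show "a \<inter> b \<in> ?R" by blast
  obtain m3 :: "'a \<Rightarrow>\<^sub>C real" where m3: "\<And>x. apply_bcontfun m3 x = min (h x) (g' x)" using ex_bmin[of h g'] by blast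
  obtain m4 :: "'a \<Rightarrow>\<^sub>C real" where m4: "\<And>x. apply_bcontfun m4 x = max (m1 x) (h' x)" using ex_bmax[of m1 h'] by blast
  show "\<exists>C\<subseteq>?R. finite C \<and> disjoint C \<and> a - b = \<Union>C"
  proof (intro exI[of _ "{region g m3, region m4 h}"] conjI)
    have "region g m3 \<inter> region m4 h = {}" by (auto simp: region_def m1 m3 m4)
    then show "disjoint {region g m3, region m4 h}" by (auto simp: disjoint_def)
    show "a - b = \<Union>{region g m3, region m4 h}"
      by (auto simp: ab region_def m1 m3 m4)
  qed auto
qed

lemma sum_unit_slices:
  fixes y :: real assumes "0 \<le> y"
  shows "(\<Sum>k<n. min 1 (max 0 (y - real k))) = min y (real n)"
  using assms by (induction n) (auto simp: min_def max_def)

text \<open>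
  Additivity of the set function on regions: if a region is a disjoint union of regions, then the
  fiber lengths sum up pointwise, so the remainders decrease to 0.  The measure of \<open>E\<close> is then the
  extended measure of \<open>E \<times> [0, 1)\<close>.  That it represents \<open>I\<close> follows by cutting a function with values in
  \<open>[0, 1]\<close> into \<open>n\<close> slices of height \<open>1/n\<close>, each squeezed between two indicators.
\<close>

lemma daniell_stone:
  fixes I :: "('a::metric_space \<Rightarrow>\<^sub>C real) \<Rightarrow> real"
  assumes lin: "linear I"
    and pos: "\<And>g. (\<forall>x. 0 \<le> apply_bcontfun g x) \<Longrightarrow> 0 \<le> I g"
    and cont: "\<And>G::nat \<Rightarrow> 'a \<Rightarrow>\<^sub>C real. (\<And>x. decseq (\<lambda>n. apply_bcontfun (G n) x)) \<Longrightarrow>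
      (\<And>x. (\<lambda>n. apply_bcontfun (G n) x) \<longlonglongrightarrow> 0) \<Longrightarrow> (\<lambda>n. I (G n)) \<longlonglongrightarrow> 0"
  shows "\<exists>M. sets M = sets borel \<and> finite_measure M \<and> (\<forall>g. I g = (\<integral>x. apply_bcontfun g x \<partial>M))"
proof -
  define R :: "('a \<times> real) set set" where "R = {region g h | g h. True}"
  interpret semiring_of_sets UNIV R unfolding R_def by (rule semiring_regions)
  define len where "len = (\<lambda>S::('a \<times> real) set. Bcontfun (fiber_length S))"
  have len: "apply_bcontfun (len S) = fiber_length S" if "S \<in> R" for S
  proof -
    from that obtain g h where S: "S = region g h" by (auto simp: R_def)
    obtain k :: "'a \<Rightarrow>\<^sub>C real" where "\<And>x. k x = fiber_length (region g h) x"
      using ex_fiber_length_region by blast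
    then have "fiber_length S = apply_bcontfun k" by (auto simp: S)
    then show ?thesis by (simp add: len_def apply_bcontfun_inverse)
  qed
  define m0 where "m0 = (\<lambda>S. ennreal (I (len S)))"
  have len_nn: "0 \<le> I (len S)" if "S \<in> R" for S
    by (rule pos) (simp add: len[OF that] fiber_length_def)
  have fibS: "Pair x -` S \<in> sets lborel" "emeasure lborel (Pair x -` S) < \<infinity>" if "S \<in> R" for S x
    using that by (auto simp: R_def fiber_region less_top intro!: emeasure_bounded_finite[simplified])
  have "positive R m0"
  proof -
    have "len {} = 0" unfolding len_def fiber_length_def
      by (simp add: zero_bcontfun_def)
    then show ?thesis using linear_0[OF lin] by (simp add: positive_def m0_def)
  qed
  moreover have "countably_additive R m0"
    unfolding countably_additive_def
  proof (intro allI impI)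
    fix A :: "nat \<Rightarrow> ('a \<times> real) set"
    assume A: "range A \<subseteq> R" "disjoint_family A" "\<Union> (range A) \<in> R"
    define G where "G = (\<lambda>n. len (\<Union> (range A)) - (\<Sum>i<n. len (A i)))"
    have AR: "A i \<in> R" for i using A by auto
    have sumapp: "apply_bcontfun (\<Sum>i<n. len (A i)) x = (\<Sum>i<n. fiber_length (A i) x)" for n x
      by (induction n) (auto simp: plus_bcontfun.rep_eq len[OF AR])
    have sums: "(\<lambda>i. fiber_length (A i) x) sums fiber_length (\<Union> (range A)) x" for x
    proof -
      have "(\<lambda>i. measure lborel (Pair x -` A i)) sums measure lborel (\<Union>i. Pair x -` A i)"
      proof (rule measure_UNION)
        show "disjoint_family (\<lambda>i. Pair x -` A i)"
          using A(2) by (auto simp: disjoint_family_on_def)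
        have "(\<Union>i. Pair x -` A i) = Pair x -` \<Union> (range A)" by auto
        then show "emeasure lborel (\<Union>i. Pair x -` A i) \<noteq> \<infinity>" using fibS[OF A(3), of x] by simp
      qed (use fibS AR in auto)
      also have "(\<Union>i. Pair x -` A i) = Pair x -` \<Union> (range A)" by auto
      finally show ?thesis by (simp add: fiber_length_def)
    qed
    have Gx: "apply_bcontfun (G n) x = fiber_length (\<Union> (range A)) x - (\<Sum>i<n. fiber_length (A i) x)" for n x
      by (simp only: G_def minus_bcontfun.rep_eq sumapp len[OF A(3)])
    have "(\<lambda>n. I (G n)) \<longlonglongrightarrow> 0"
    proof (rule cont)
      fix x
      show "decseq (\<lambda>n. G n x)"
        unfolding Gx by (rule decseq_SucI) (simp add: fiber_length_def)
      have "(\<lambda>n. fiber_length (\<Union> (range A)) x - (\<Sum>i<n. fiber_length (A i) x)) \<longlonglongrightarrow> 0"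
        using tendsto_diff[OF tendsto_const[of "fiber_length (\<Union> (range A)) x"] sums[of x, unfolded sums_def]]
        by simp
      then show "(\<lambda>n. G n x) \<longlonglongrightarrow> 0"
        unfolding Gx .
    qed
    moreover have "I (G n) = I (len (\<Union> (range A))) - (\<Sum>i<n. I (len (A i)))" for n
      by (simp add: G_def linear_diff[OF lin] linear_sum[OF lin])
    ultimately have "(\<lambda>n. I (len (\<Union> (range A))) - (\<Sum>i<n. I (len (A i)))) \<longlonglongrightarrow> 0" by simp
    from tendsto_diff[OF tendsto_const[of "I (len (\<Union> (range A)))"] this]
    have "(\<lambda>i. I (len (A i))) sums I (len (\<Union> (range A)))" by (simp add: sums_def)
    then show "(\<Sum>i. m0 (A i)) = m0 (\<Union> (range A))"
      unfolding m0_def by (intro suminf_ennreal_eq) (auto intro: len_nn AR)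
  qed
  ultimately obtain m where m: "\<And>S. S \<in> R \<Longrightarrow> m S = m0 S" "measure_space UNIV (sigma_sets UNIV R) m"
    using caratheodory[of m0] by blast
  define N where "N = measure_of UNIV (sigma_sets UNIV R) m"
  have sN: "sets N = sigma_sets UNIV R" "space N = UNIV"
    by (simp_all add: N_def sigma_sets_sigma_sets_eq)
  have emN: "emeasure N S = m S" if "S \<in> sigma_sets UNIV R" for S
    using m(2) that unfolding N_def measure_space_def
    by (intro emeasure_measure_of_sigma) auto
  have RN: "S \<in> sets N" if "S \<in> R" for S using that by (simp add: sN)
  have N_sub: "region 0 c \<in> sets N \<and> emeasure N (region 0 c) = ennreal (I c)"
    if "\<And>x. 0 \<le> apply_bcontfun c x" for c
  proof -
    have R: "region 0 c \<in> R" by (auto simp: R_def)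
    have "len (region 0 c) = c"
      using that by (intro bcontfun_eqI) (simp add: len[OF R] fiber_length_region)
    then show ?thesis using R by (simp add: RN emN m(1) m0_def)
  qed
  obtain one :: "'a \<Rightarrow>\<^sub>C real" where one: "\<And>x. one x = 1"
    using const_bcontfun.rep_eq by metis
  define \<Omega> :: "('a \<times> real) set" where "\<Omega> = UNIV \<times> {0..<1}"
  have reg_one: "region 0 one = \<Omega>" by (auto simp: region_def one \<Omega>_def)
  have \<Omega>N: "\<Omega> \<in> sets N" "emeasure N \<Omega> = ennreal (I one)" using N_sub[of one] by (auto simp: one reg_one)
  (* the regions under 0 and min 1 (n dist(x, - U)) increase to the product of U with [0, 1) *)
  have openN: "U \<times> {0..<1} \<in> sets N" if U: "open U" for U :: "'a set"
  proof (cases "U = UNIV")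
    case True then show ?thesis using \<Omega>N by (simp add: \<Omega>_def)
  next
    case False
    define c :: "nat \<Rightarrow> 'a \<Rightarrow>\<^sub>C real" where "c = (\<lambda>n. Bcontfun (\<lambda>x. min 1 (real n * infdist x (- U))))"
    have c: "apply_bcontfun (c n) x = min 1 (real n * infdist x (- U))" for n x
      unfolding c_def by (subst Bcontfun_apply[where B = 1]) (auto intro!: continuous_intros simp: infdist_nonneg)
    have "U \<times> {0..<1} = (\<Union>n. region 0 (c n))"
    proof (intro equalityI subsetI)
      fix z assume "z \<in> U \<times> {0..<1::real}"
      then obtain x t where z: "z = (x, t)" "x \<in> U" "0 \<le> t" "t < 1" by auto
      have "infdist x (- U) > 0"
        using z(2) U False by (intro infdist_pos_not_in_closed) (auto simp: closed_def)
      then obtain n where "t / infdist x (- U) < real n" using reals_Archimedean2 by blast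
      then have "t < real n * infdist x (- U)" using \<open>infdist x (- U) > 0\<close> by (simp add: field_simps)
      then show "z \<in> (\<Union>n. region 0 (c n))" using z by (auto simp: region_def c intro!: exI[of _ n])
    next
      fix z assume "z \<in> (\<Union>n. region 0 (c n))"
      then obtain n x t where z: "z = (x, t)" "0 \<le> t" "t < min 1 (real n * infdist x (- U))"
        by (auto simp: region_def c)
      have "x \<notin> - U"
      proof
        assume "x \<in> - U"
        then have "infdist x (- U) = 0" by (rule infdist_zero)
        then show False using z by simp
      qed
      then show "z \<in> U \<times> {0..<1}" using z by auto
    qed
    moreover have "region 0 (c n) \<in> sets N" for n using N_sub[of "c n"] by (simp add: c infdist_nonneg)
    ultimately show ?thesis by auto
  qed
  define M where "M = distr (restrict_space N \<Omega>) borel fst"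
  have mfst: "fst \<in> measurable (restrict_space N \<Omega>) borel"
  proof (rule borel_measurableI)
    fix S :: "'a set" assume "open S"
    have "fst -` S \<inter> space (restrict_space N \<Omega>) = \<Omega> \<inter> (S \<times> {0..<1})"
      by (auto simp: space_restrict_space sN \<Omega>_def)
    then show "fst -` S \<inter> space (restrict_space N \<Omega>) \<in> sets (restrict_space N \<Omega>)"
      using openN[OF \<open>open S\<close>] by (auto simp: sets_restrict_space)
  qed
  have sM: "sets M = sets borel" by (simp add: M_def)
  have emM: "emeasure M E = emeasure N (fst -` E \<inter> \<Omega>)" "fst -` E \<inter> \<Omega> \<in> sets N" if "E \<in> sets borel" for E
  proof -
    have "emeasure M E = emeasure (restrict_space N \<Omega>) (fst -` E \<inter> \<Omega>)"
      unfolding M_def by (subst emeasure_distr[OF mfst that]) (simp add: space_restrict_space sN)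
    also have "\<dots> = emeasure N (fst -` E \<inter> \<Omega>)"
      using \<Omega>N by (intro emeasure_restrict_space) (auto simp: sN)
    finally show "emeasure M E = emeasure N (fst -` E \<inter> \<Omega>)" .
    show "fst -` E \<inter> \<Omega> \<in> sets N"
      using measurable_sets[OF mfst that] \<Omega>N by (auto simp: sets_restrict_space_iff space_restrict_space sN)
  qed
  have MU: "emeasure M UNIV = ennreal (I one)" using emM[of UNIV] \<Omega>N by simp
  have spM: "space M = UNIV" using sets_eq_imp_space_eq[OF sM] by simp
  interpret M: finite_measure M by (rule finite_measureI) (simp add: spM MU)
  have I1: "I one = measure M UNIV" using MU pos[of one] by (simp add: measure_def one)
  have I_le_M: "I c \<le> measure M E" if "E \<in> sets borel" "\<And>x. 0 \<le> apply_bcontfun c x"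
    "\<And>x. apply_bcontfun c x \<le> indicator E x" for c E
  proof -
    have "region 0 c \<subseteq> fst -` E \<inter> \<Omega>"
    proof
      fix z assume "z \<in> region 0 c"
      then show "z \<in> fst -` E \<inter> \<Omega>" using that(3)[of "fst z"]
        by (cases z) (auto simp: region_def \<Omega>_def split: split_indicator_asm)
    qed
    then have "ennreal (I c) \<le> emeasure M E"
      using N_sub[OF that(2)] emM[OF that(1)] by (metis emeasure_mono)
    then show ?thesis by (simp add: M.emeasure_eq_measure)
  qed
  have mg: "integrable M (\<lambda>x. apply_bcontfun g x)" for g :: "'a \<Rightarrow>\<^sub>C real"
  proof (rule M.integrable_const_bound)
    show "AE x in M. norm (apply_bcontfun g x) \<le> norm g" by (simp add: bcontfun_abs_le)
    show "apply_bcontfun g \<in> borel_measurable M"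
      using sM measurable_cong_sets[OF sM refl] by (auto intro!: borel_measurable_continuous_onI)
  qed
  have step: "I g \<le> (\<integral>x. g x \<partial>M)" if g: "\<And>x. 0 \<le> apply_bcontfun g x" "\<And>x. g x \<le> 1" for g
  proof (rule field_le_epsilon)
    fix e :: real assume "0 < e"
    obtain n where n: "measure M UNIV / e < real n" using reals_Archimedean2 by blast
    moreover have "0 \<le> measure M UNIV / e" using \<open>0 < e\<close> by simp
    ultimately have n0: "0 < real n" by linarith
    (* n times the k-th slice of g, which lies between the indicators of E (k + 1) and E k *)
    define c :: "nat \<Rightarrow> 'a \<Rightarrow>\<^sub>C real"
      where "c = (\<lambda>k. Bcontfun (\<lambda>x. min 1 (max 0 (real n * g x - real k))))"
    have c: "apply_bcontfun (c k) x = min 1 (max 0 (real n * g x - real k))" for k x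
      unfolding c_def by (subst Bcontfun_apply[where B = 1]) (auto intro!: continuous_intros)
    define E where "E = (\<lambda>k::nat. {x. real k < real n * g x})"
    have E[measurable]: "E k \<in> sets borel" for k
      unfolding E_def by (intro borel_open open_Collect_less continuous_intros) auto
    have csum: "(\<Sum>k<n. apply_bcontfun (c k) x) = real n * g x" for x
      using g(1)[of x] mult_left_mono[OF g(2), of "real n" x] unfolding c
      by (subst sum_unit_slices) auto
    have "(\<Sum>k<n. c k) = real n *\<^sub>R g"
    proof (rule bcontfun_eqI)
      fix x
      have "apply_bcontfun (\<Sum>k<m. c k) x = (\<Sum>k<m. apply_bcontfun (c k) x)" for m
        by (induction m) (auto simp: plus_bcontfun.rep_eq)
      then show "apply_bcontfun (\<Sum>k<n. c k) x = apply_bcontfun (real n *\<^sub>R g) x"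
        by (simp add: csum scaleR_bcontfun.rep_eq)
    qed
    then have "real n * I g = (\<Sum>k<n. I (c k))"
      by (metis linear_scale[OF lin] linear_sum[OF lin] real_scaleR_def)
    also have "\<dots> \<le> (\<Sum>k<n. measure M (E k))"
      by (intro sum_mono I_le_M E) (auto simp: c E_def indicator_def)
    also have "\<dots> \<le> (\<Sum>k<Suc n. measure M (E k))" by simp
    also have "\<dots> = measure M (E 0) + (\<Sum>k<n. measure M (E (Suc k)))"
      by (subst sum.lessThan_Suc_shift) simp
    also have "\<dots> \<le> measure M UNIV + (\<Sum>k<n. \<integral>x. c k x \<partial>M)"
    proof (intro add_mono sum_mono)
      show "measure M (E 0) \<le> measure M UNIV" by (rule M.finite_measure_mono) (auto simp: sM)
      fix k
      have "measure M (E (Suc k)) = (\<integral>x. indicator (E (Suc k)) x \<partial>M)" by (simp add: spM)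
      also have "\<dots> \<le> (\<integral>x. c k x \<partial>M)"
      proof (rule integral_mono[OF _ mg])
        show "integrable M (indicat_real (E (Suc k)))"
          using E by (intro integrable_real_indicator) (auto simp: sM M.emeasure_finite less_top[symmetric])
      qed (auto simp: c E_def indicator_def)
      finally show "measure M (E (Suc k)) \<le> (\<integral>x. c k x \<partial>M)" .
    qed
    also have "(\<Sum>k<n. \<integral>x. c k x \<partial>M) = (\<integral>x. (\<Sum>k<n. c k x) \<partial>M)"
      by (rule Bochner_Integration.integral_sum[symmetric]) (rule mg)
    also have "\<dots> = real n * (\<integral>x. g x \<partial>M)" by (simp add: csum)
    finally have "I g \<le> measure M UNIV / real n + (\<integral>x. g x \<partial>M)" using n0 by (simp add: field_simps)
    moreover have "measure M UNIV / real n \<le> e" using n n0 \<open>0 < e\<close> by (simp add: field_simps)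
    ultimately show "I g \<le> (\<integral>x. g x \<partial>M) + e" by linarith
  qed
  have unit: "I g = (\<integral>x. g x \<partial>M)" if g: "\<And>x. 0 \<le> apply_bcontfun g x" "\<And>x. g x \<le> 1" for g
  proof (rule antisym[OF step[OF g]])
    have "I (one - g) \<le> (\<integral>x. (one - g) x \<partial>M)"
      using g by (intro step) (auto simp: minus_bcontfun.rep_eq one)
    also have "\<dots> = measure M UNIV - (\<integral>x. g x \<partial>M)"
      using mg by (simp add: minus_bcontfun.rep_eq one spM)
    finally show "(\<integral>x. g x \<partial>M) \<le> I g" by (simp add: linear_diff[OF lin] I1)
  qed
  have "I g = (\<integral>x. g x \<partial>M)" for g
  proof -
    define b where "b = 2 * norm g + 1"
    have b: "0 < b" by (simp add: b_def add_nonneg_pos)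
    define g' where "g' = (1 / b) *\<^sub>R (g + norm g *\<^sub>R one)"
    have g': "apply_bcontfun g' x = (g x + norm g) / b" for x
      by (simp add: g'_def scaleR_bcontfun.rep_eq plus_bcontfun.rep_eq one)
    have "I g' = (\<integral>x. g' x \<partial>M)"
    proof (rule unit)
      fix x
      show "0 \<le> apply_bcontfun g' x" "g' x \<le> 1"
        using bcontfun_abs_le[of g x] b by (auto simp: g' b_def field_simps)
    qed
    also have "\<dots> = ((\<integral>x. g x \<partial>M) + norm g * measure M UNIV) / b"
      using mg by (simp add: g' spM)
    finally show ?thesis
      using b by (simp add: g'_def linear_scale[OF lin] linear_add[OF lin] I1)
  qed
  then show ?thesis using sM M.finite_measure_axioms by blast
qed

section \<open>Positive semidefinite matrices\<close>

definition outer :: "real^'d \<Rightarrow> real^'d \<Rightarrow> real^'d^'d" where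
  "outer v w = (\<chi> i j. v $ i * w $ j)"

definition unit_mat :: "'d::finite \<Rightarrow> 'd \<Rightarrow> real^'d^'d" where
  "unit_mat i j = axis i (axis j 1)"

lemma mat_inner_sum: "(A::real^'d^'d) \<bullet> B = (\<Sum>i\<in>UNIV. \<Sum>j\<in>UNIV. A $ i $ j * B $ i $ j)"
  by (simp add: inner_vec_def)

lemma inner_outer: "(A::real^'d^'d) \<bullet> outer v w = v \<bullet> (A *v w)"
  by (simp add: mat_inner_sum outer_def inner_vec_def matrix_vector_mult_def sum_distrib_left algebra_simps)

lemma inner_mat_1: "(A::real^'d^'d) \<bullet> mat 1 = trace A"
  by (simp add: mat_inner_sum mat_def trace_def if_distrib[of "(*) _"] cong: if_cong)

lemma inner_unit_mat: "(A::real^'d^'d) \<bullet> unit_mat i j = A $ i $ j"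
  by (simp add: unit_mat_def inner_axis)

lemma unit_mat_nth: "unit_mat i j $ a $ b = (if a = i \<and> b = j then 1 else 0)"
  by (simp add: unit_mat_def axis_def)

lemma mat_expand: "(A::real^'d^'d) = (\<Sum>i\<in>UNIV. \<Sum>j\<in>UNIV. (A $ i $ j) *\<^sub>R unit_mat i j)"
proof -
  have "(\<Sum>i\<in>UNIV. \<Sum>j\<in>UNIV. A $ i $ j * unit_mat i j $ a $ b) = A $ a $ b" for a b
  proof -
    have "(\<Sum>i\<in>UNIV. \<Sum>j\<in>UNIV. A $ i $ j * unit_mat i j $ a $ b)
        = (\<Sum>i\<in>UNIV. \<Sum>j\<in>UNIV. if j = b then (if i = a then A $ i $ j else 0) else 0)"
      by (intro sum.cong refl) (auto simp: unit_mat_nth)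
    then show ?thesis by simp
  qed
  then show ?thesis by (simp add: vec_eq_iff)
qed

lemma sym_matsD: "A \<in> sym_mats \<Longrightarrow> A $ i $ j = A $ j $ i"
  by (metis (mono_tags, lifting) mem_Collect_eq sym_mats_def transpose_def vec_lambda_beta)

lemma sym_matsI: "(\<And>i j. A $ i $ j = A $ j $ i) \<Longrightarrow> A \<in> sym_mats"
  by (simp add: sym_mats_def transpose_def vec_eq_iff)

lemma subspace_sym_mats: "subspace sym_mats"
  by (auto simp: subspace_def sym_matsD intro!: sym_matsI)

lemma sym_mats_scaleR: "A \<in> sym_mats \<Longrightarrow> c *\<^sub>R A \<in> sym_mats"
  by (rule subspace_scale[OF subspace_sym_mats])

lemma sym_mats_add: "A \<in> sym_mats \<Longrightarrow> B \<in> sym_mats \<Longrightarrow> A + B \<in> sym_mats"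
  by (rule subspace_add[OF subspace_sym_mats])

lemma psd_sym: "A \<in> psd_mats \<Longrightarrow> A \<in> sym_mats"
  by (simp add: psd_mats_def)

lemma psd_quadratic_binomial:
  assumes A: "A \<in> psd_mats"
  shows "0 \<le> a\<^sup>2 * A $ i $ i + 2 * a * b * A $ i $ j + b\<^sup>2 * A $ j $ j"
proof -
  define v where "v = a *\<^sub>R axis i 1 + b *\<^sub>R (axis j 1 :: real^'a)"
  have e: "axis k 1 \<bullet> (A *v axis l 1) = A $ k $ l" for k l :: 'a
    by (simp add: matrix_vector_mult_basis column_def inner_axis')
  have "v \<bullet> (A *v v) = a\<^sup>2 * A $ i $ i + 2 * a * b * A $ i $ j + b\<^sup>2 * A $ j $ j"
    using sym_matsD[OF psd_sym[OF A], of i j]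
    by (simp add: v_def matrix_vector_right_distrib scaleR_matrix_vector_assoc[symmetric]
        matrix_vector_mult_scaleR inner_add_left inner_add_right e power2_eq_square algebra_simps)
  moreover have "0 \<le> v \<bullet> (A *v v)" using A by (simp add: psd_mats_def)
  ultimately show ?thesis by simp
qed

lemma psd_diag_nonneg: "A \<in> psd_mats \<Longrightarrow> 0 \<le> A $ i $ i"
  using psd_quadratic_binomial[of A 1 i 0 i] by simp

text \<open>
  The principal \<open>2 \<times> 2\<close> minors of a positive semidefinite matrix are nonnegative.
\<close>

lemma psd_entry_sq:
  assumes A: "A \<in> psd_mats"
  shows "(A $ i $ j)\<^sup>2 \<le> A $ i $ i * A $ j $ j"
proof -
  let ?p = "A $ i $ i" and ?c = "A $ i $ j" and ?r = "A $ j $ j"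
  show ?thesis
  proof (cases "?p = 0")
    case False
    then have p: "?p > 0" using psd_diag_nonneg[OF A, of i] by simp
    have "0 \<le> ?p * (?p * ?r - ?c\<^sup>2)"
      using psd_quadratic_binomial[OF A, of "- ?c" i ?p j] by (simp add: power2_eq_square algebra_simps)
    then show ?thesis using p by (simp add: zero_le_mult_iff)
  next
    case True
    have "?c = 0"
    proof (rule ccontr)
      assume c: "?c \<noteq> 0"
      then show False
        using psd_quadratic_binomial[OF A, of "- ((?r + 1) / (2 * ?c))" i 1 j] True by simp
    qed
    then show ?thesis using True by simp
  qed
qed

lemma psd_norm_le_trace:
  assumes A: "A \<in> psd_mats"
  shows "norm A \<le> trace A"
proof -
  have tr: "0 \<le> trace A" unfolding trace_def by (intro sum_nonneg psd_diag_nonneg[OF A])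
  have "(norm A)\<^sup>2 = (\<Sum>i\<in>UNIV. \<Sum>j\<in>UNIV. (A $ i $ j)\<^sup>2)"
    unfolding power2_norm_eq_inner mat_inner_sum by (simp only: power2_eq_square)
  also have "\<dots> \<le> (\<Sum>i\<in>UNIV. \<Sum>j\<in>UNIV. A $ i $ i * A $ j $ j)"
    by (intro sum_mono psd_entry_sq[OF A])
  also have "\<dots> = (trace A)\<^sup>2"
    by (simp add: trace_def power2_eq_square sum_product)
  finally show ?thesis using tr by (rule power2_le_imp_le)
qed

lemma psd_trace_nonneg: "A \<in> psd_mats \<Longrightarrow> 0 \<le> trace A"
  using psd_norm_le_trace[of A] norm_ge_zero[of A] by linarith

lemma psd_entry_le_trace: "A \<in> psd_mats \<Longrightarrow> \<bar>A $ i $ j\<bar> \<le> trace A"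
  using psd_norm_le_trace[of A] component_le_norm_cart[of "A $ i" j]
    Finite_Cartesian_Product.norm_nth_le[of A i] by linarith

section \<open>Polar decomposition\<close>

lemma finite_measure_from_sums:
  assumes nn: "\<And>E. E \<in> sets M \<Longrightarrow> 0 \<le> m E"
    and sums: "\<And>A::nat \<Rightarrow> 'a set. range A \<subseteq> sets M \<Longrightarrow> disjoint_family A \<Longrightarrow> (\<lambda>i. m (A i)) sums m (\<Union>i. A i)"
  shows "\<exists>N. sets N = sets M \<and> finite_measure N \<and> (\<forall>E\<in>sets M. measure N E = m E)"
proof -
  define N where "N = measure_of (space M) (sets M) (\<lambda>E. ennreal (m E))"
  have sN: "sets N = sets M" "space N = space M" by (simp_all add: N_def)
  have m0: "m {} = 0"
    using sums_unique[OF sums[of "\<lambda>_. {}"]] sums_summable[OF sums[of "\<lambda>_. {}"]]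
    by (simp add: disjoint_family_on_def summable_const_iff)
  have em: "emeasure N E = ennreal (m E)" if E: "E \<in> sets M" for E
  proof (rule emeasure_measure_of[OF N_def])
    show "countably_additive (sets N) (\<lambda>E. ennreal (m E))"
      unfolding countably_additive_def sN
    proof (intro allI impI)
      fix A :: "nat \<Rightarrow> 'a set" assume A: "range A \<subseteq> sets M" "disjoint_family A" "\<Union> (range A) \<in> sets M"
      show "(\<Sum>i. ennreal (m (A i))) = ennreal (m (\<Union> (range A)))"
        using A nn sums[OF A(1,2)] by (intro suminf_ennreal_eq) auto
    qed
    show "positive (sets N) (\<lambda>E. ennreal (m E))" by (simp add: positive_def m0)
  qed (use E sets.space_closed sN in auto)
  have "finite_measure N" by (rule finite_measureI) (simp add: sN em)
  moreover have "measure N E = m E" if "E \<in> sets M" for E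
    using em[OF that] nn[OF that] by (simp add: measure_def)
  ultimately show ?thesis using sN by blast
qed

lemma psd_measure_sums:
  "l \<in> psd_measures M \<Longrightarrow> range A \<subseteq> sets M \<Longrightarrow> disjoint_family A \<Longrightarrow> (\<lambda>i. l (A i)) sums l (\<Union>i::nat. A i)"
  by (simp add: psd_measures_def)

lemma psd_measure_psd: "l \<in> psd_measures M \<Longrightarrow> E \<in> sets M \<Longrightarrow> l E \<in> psd_mats"
  by (simp add: psd_measures_def)

lemma trace_sums: "f sums s \<Longrightarrow> (\<lambda>i. trace (f i)) sums trace (s::real^'d^'d)"
  unfolding inner_mat_1[symmetric] by (rule bounded_linear.sums[OF bounded_linear_inner_left])

lemma ex_trace_measure:
  assumes l: "l \<in> psd_measures M"
  shows "\<exists>\<tau>. sets \<tau> = sets M \<and> finite_measure \<tau> \<and> (\<forall>E\<in>sets M. measure \<tau> E = trace (l E))"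
  by (rule finite_measure_from_sums)
     (auto intro!: psd_trace_nonneg psd_measure_psd[OF l] trace_sums psd_measure_sums[OF l])

lemma ex_bounded_density:
  assumes \<tau>: "finite_measure \<tau>" and N: "finite_measure N" and s: "sets N = sets \<tau>"
    and le: "\<And>E. E \<in> sets \<tau> \<Longrightarrow> measure N E \<le> C * measure \<tau> E"
  shows "\<exists>D. integrable \<tau> D \<and> (\<forall>E\<in>sets \<tau>. measure N E = (LINT x:E|\<tau>. D x))"
proof -
  interpret \<tau>: finite_measure \<tau> by fact
  interpret N: finite_measure N by fact
  have ac: "absolutely_continuous \<tau> N"
    unfolding absolutely_continuous_def
  proof
    fix E assume E: "E \<in> null_sets \<tau>"
    then have "measure N E \<le> 0" using le[of E] by (auto simp: null_sets_def measure_def)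
    then have "measure N E = 0" by (simp add: measure_le_0_iff)
    then show "E \<in> null_sets N" using E s by (auto simp: null_sets_def N.emeasure_eq_measure)
  qed
  obtain D where D: "D \<in> borel_measurable \<tau>" "AE x in \<tau>. RN_deriv \<tau> N x = ennreal (D x)" "\<And>x. 0 \<le> D x"
    using \<tau>.real_RN_deriv[OF N ac s] by metis
  have "density \<tau> D = density \<tau> (RN_deriv \<tau> N)"
    using D by (intro density_cong) auto
  then have dens: "density \<tau> D = N" using \<tau>.density_RN_deriv[OF ac s] by simp
  have em: "ennreal (measure N E) = (\<integral>\<^sup>+x. ennreal (indicator E x * D x) \<partial>\<tau>)" if "E \<in> sets \<tau>" for E
  proof -
    have "emeasure N E = (\<integral>\<^sup>+x. ennreal (D x) * indicator E x \<partial>\<tau>)"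
      using that D emeasure_density[of "\<lambda>x. ennreal (D x)" \<tau> E] by (simp add: dens)
    also have "\<dots> = (\<integral>\<^sup>+x. ennreal (indicator E x * D x) \<partial>\<tau>)"
      by (intro nn_integral_cong) (auto split: split_indicator)
    finally show ?thesis by (simp add: N.emeasure_eq_measure)
  qed
  have "(\<integral>\<^sup>+x. ennreal (D x) \<partial>\<tau>) < \<infinity>"
  proof -
    have "ennreal (measure N (space \<tau>)) = (\<integral>\<^sup>+x. ennreal (D x) \<partial>\<tau>)"
      unfolding em[OF sets.top] by (intro nn_integral_cong) simp
    then show ?thesis by (metis ennreal_less_top infinity_ennreal_def)
  qed
  then have int: "integrable \<tau> D" using D by (intro integrableI_nonneg) auto
  have "measure N E = (LINT x:E|\<tau>. D x)" if E: "E \<in> sets \<tau>" for E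
  proof -
    have "ennreal (measure N E) = ennreal (\<integral>x. indicator E x * D x \<partial>\<tau>)"
      unfolding em[OF E] using integrable_mult_indicator[OF E int] D
      by (intro nn_integral_eq_integral) auto
    then show ?thesis by (simp add: set_lebesgue_integral_def D integral_nonneg_AE)
  qed
  then show ?thesis using int by blast
qed

text \<open>
  The entries are dominated by the trace, so adding the trace turns each entry into a positive
  measure to which the Radon-Nikodym theorem with respect to the trace measure applies.
\<close>

lemma ex_matrix_density:
  fixes l :: "'a set \<Rightarrow> real^'d^'d"
  assumes l: "l \<in> psd_measures M"
  shows "\<exists>\<tau> \<theta>. sets \<tau> = sets M \<and> finite_measure \<tau> \<and> integrable \<tau> \<theta> \<and> (\<forall>x. \<theta> x \<in> sym_mats) \<and>
    (\<forall>E\<in>sets M. l E = (LINT x:E|\<tau>. \<theta> x))"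
proof -
  obtain \<tau> where \<tau>: "sets \<tau> = sets M" "finite_measure \<tau>" and tr: "\<And>E. E \<in> sets M \<Longrightarrow> measure \<tau> E = trace (l E)"
    using ex_trace_measure[OF l] by blast
  interpret finite_measure \<tau> by fact
  have "\<exists>D. integrable \<tau> D \<and> (\<forall>E\<in>sets \<tau>. trace (l E) + l E $ i $ j = (LINT x:E|\<tau>. D x))" for i j
  proof -
    have ent: "\<bar>l E $ i $ j\<bar> \<le> trace (l E)" if "E \<in> sets M" for E
      by (rule psd_entry_le_trace[OF psd_measure_psd[OF l that]])
    have "\<exists>N. sets N = sets M \<and> finite_measure N \<and> (\<forall>E\<in>sets M. measure N E = trace (l E) + l E $ i $ j)"
    proof (rule finite_measure_from_sums)
      fix E assume "E \<in> sets M" then show "0 \<le> trace (l E) + l E $ i $ j" using ent[of E] by linarith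
    next
      fix A :: "nat \<Rightarrow> 'a set" assume A: "range A \<subseteq> sets M" "disjoint_family A"
      show "(\<lambda>k. trace (l (A k)) + l (A k) $ i $ j) sums (trace (l (\<Union>k. A k)) + l (\<Union>k. A k) $ i $ j)"
        unfolding inner_unit_mat[symmetric] using psd_measure_sums[OF l A]
        by (intro sums_add trace_sums bounded_linear.sums[OF bounded_linear_inner_left])
    qed
    then obtain N where N: "sets N = sets M" "finite_measure N"
      "\<And>E. E \<in> sets M \<Longrightarrow> measure N E = trace (l E) + l E $ i $ j" by blast
    have "\<exists>D. integrable \<tau> D \<and> (\<forall>E\<in>sets \<tau>. measure N E = (LINT x:E|\<tau>. D x))"
    proof (rule ex_bounded_density)
      fix E assume "E \<in> sets \<tau>"
      then show "measure N E \<le> 2 * measure \<tau> E" using N(3) tr \<tau>(1) ent[of E] by auto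
    qed (use N \<tau> in auto)
    then show ?thesis using N(3) \<tau>(1) by auto
  qed
  then obtain D where D: "\<And>i j. integrable \<tau> (D i j)"
    "\<And>i j E. E \<in> sets \<tau> \<Longrightarrow> trace (l E) + l E $ i $ j = (LINT x:E|\<tau>. D i j x)"
    by metis
  define h where "h = (\<lambda>i j x. (D i j x + D j i x) / 2 - 1)"
  define \<theta> where "\<theta> = (\<lambda>x. \<Sum>i\<in>UNIV. \<Sum>j\<in>UNIV. h i j x *\<^sub>R unit_mat i j)"
  have h: "integrable \<tau> (h i j)" for i j
    unfolding h_def using D(1) by (intro Bochner_Integration.integrable_diff integrable_divide Bochner_Integration.integrable_add) auto
  have ih: "(LINT x:E|\<tau>. h i j x) = l E $ i $ j" if E: "E \<in> sets \<tau>" for E i j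
  proof -
    have "(LINT x:E|\<tau>. h i j x) = ((LINT x:E|\<tau>. D i j x) + (LINT x:E|\<tau>. D j i x)) / 2 - (LINT x:E|\<tau>. 1)"
    proof -
      have "set_integrable \<tau> E (D i j)" for i j
        using integrable_mult_indicator[OF E D(1)] by (simp add: set_integrable_def)
      moreover have "set_integrable \<tau> E (\<lambda>_. 1::real)" using E
        by (simp add: set_integrable_def integrable_indicator_iff emeasure_finite less_top[symmetric])
      ultimately show ?thesis unfolding h_def
        by (simp add: set_integral_diff set_integral_add set_integrable_def[symmetric] add_divide_distrib set_integral_divide_zero)
    qed
    also have "(LINT x:E|\<tau>. 1::real) = trace (l E)"
      using E tr \<tau>(1) by (simp add: set_lebesgue_integral_def)
    finally show ?thesis
      using D(2)[OF E, of i j, symmetric] D(2)[OF E, of j i, symmetric] sym_matsD[OF psd_sym[OF psd_measure_psd[OF l]], of E i j] E \<tau>(1)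
      by (simp add: add_divide_distrib)
  qed
  have \<theta>: "integrable \<tau> \<theta>" unfolding \<theta>_def using h by auto
  have "\<theta> x = (\<chi> i j. h i j x)" for x
    using mat_expand[of "\<chi> i j. h i j x"] by (simp add: \<theta>_def)
  then have nth: "\<theta> x $ i $ j = h i j x" for x i j by simp
  have "\<theta> x \<in> sym_mats" for x by (rule sym_matsI) (simp add: nth h_def)
  moreover have "l E = (LINT x:E|\<tau>. \<theta> x)" if E: "E \<in> sets M" for E
  proof -
    have i: "integrable \<tau> (\<lambda>x. indicat_real E x * h i j x)" for i j
      using integrable_mult_indicator[OF _ h[of i j], of E] E \<tau>(1) by simp
    have "(LINT x:E|\<tau>. \<theta> x) = (\<integral>x. (\<Sum>i\<in>UNIV. \<Sum>j\<in>UNIV. (indicat_real E x * h i j x) *\<^sub>R unit_mat i j) \<partial>\<tau>)"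
      unfolding set_lebesgue_integral_def \<theta>_def by (simp add: scaleR_sum_right)
    also have "\<dots> = (\<Sum>i\<in>UNIV. \<Sum>j\<in>UNIV. (LINT x:E|\<tau>. h i j x) *\<^sub>R unit_mat i j)"
      using i by (simp add: set_lebesgue_integral_def)
    also have "\<dots> = l E" using E \<tau>(1) mat_expand[of "l E"] by (simp add: ih)
    finally show ?thesis by simp
  qed
  ultimately show ?thesis using \<tau> \<theta> by blast
qed

lemma measurable_sets_eq: "f \<in> measurable A C \<Longrightarrow> sets A = sets B \<Longrightarrow> f \<in> measurable B C"
  using measurable_cong_sets by blast

lemma norm_integral_le_integral:
  fixes f :: "'a \<Rightarrow> 'b::{banach, second_countable_topology}"
  assumes "integrable M f" "integrable M g" "\<And>x. x \<in> space M \<Longrightarrow> norm (f x) \<le> g x"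
  shows "norm (\<integral>x. f x \<partial>M) \<le> (\<integral>x. g x \<partial>M)"
  using integral_norm_bound[of M f] integral_mono[OF integrable_norm[OF assms(1)] assms(2,3)] by linarith

lemma norm_set_integral_le:
  fixes \<theta> :: "'a \<Rightarrow> 'b::{banach, second_countable_topology}"
  assumes \<theta>: "integrable \<tau> \<theta>" and E: "E \<in> sets \<tau>"
  shows "ennreal (norm (LINT x:E|\<tau>. \<theta> x)) \<le> emeasure (density \<tau> (\<lambda>x. ennreal (norm (\<theta> x)))) E"
proof -
  have i: "integrable \<tau> (\<lambda>x. norm (indicat_real E x *\<^sub>R \<theta> x))"
    using integrable_mult_indicator[OF E \<theta>] by (rule integrable_norm)
  have "ennreal (norm (LINT x:E|\<tau>. \<theta> x)) \<le> ennreal (\<integral>x. norm (indicat_real E x *\<^sub>R \<theta> x) \<partial>\<tau>)"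
    unfolding set_lebesgue_integral_def by (intro ennreal_leI integral_norm_bound)
  also have "\<dots> = (\<integral>\<^sup>+x. ennreal (norm (indicat_real E x *\<^sub>R \<theta> x)) \<partial>\<tau>)"
    using i by (intro nn_integral_eq_integral[symmetric]) auto
  also have "\<dots> = (\<integral>\<^sup>+x. ennreal (norm (\<theta> x)) * indicator E x \<partial>\<tau>)"
    by (intro nn_integral_cong) (auto split: split_indicator)
  also have "\<dots> = emeasure (density \<tau> (\<lambda>x. ennreal (norm (\<theta> x)))) E"
    using \<theta> E by (intro emeasure_density[symmetric]) auto
  finally show ?thesis .
qed

text \<open>
  The variation of \<open>\<theta> \<tau>\<close> is \<open>|\<theta>| \<tau>\<close>: cutting a set into countably many pieces on each of which
  \<open>\<theta>\<close> oscillates by at most \<open>2 \<epsilon>\<close> loses at most \<open>2 \<epsilon>\<close> times the mass of \<open>\<tau>\<close>.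
\<close>

lemma total_variation_density:
  fixes l :: "'a set \<Rightarrow> real^'d^'d"
  assumes \<tau>: "finite_measure \<tau>" "sets \<tau> = sets M" and \<theta>: "integrable \<tau> \<theta>"
    and l: "\<And>E. E \<in> sets M \<Longrightarrow> l E = (LINT x:E|\<tau>. \<theta> x)"
  shows "total_variation M l = density \<tau> (\<lambda>x. ennreal (norm (\<theta> x)))"
    and "\<And>E. E \<in> sets M \<Longrightarrow> emeasure (total_variation M l) E =
      (SUP A\<in>{A::nat \<Rightarrow> 'a set. range A \<subseteq> sets M \<and> disjoint_family A \<and> (\<Union>i. A i) = E}. \<Sum>i. ennreal (norm (l (A i))))"
proof -
  interpret finite_measure \<tau> by fact
  define V where "V = density \<tau> (\<lambda>x. ennreal (norm (\<theta> x)))"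
  have m[measurable]: "\<theta> \<in> borel_measurable \<tau>" using \<theta> by auto
  have sV: "sets V = sets M" "space V = space M" using \<tau>(2) sets_eq_imp_space_eq[OF \<tau>(2)] by (auto simp: V_def)
  have le: "ennreal (norm (l A)) \<le> emeasure V A" if "A \<in> sets M" for A
    unfolding l[OF that] V_def using that \<tau>(2) by (intro norm_set_integral_le \<theta>) auto
  have eq: "(SUP A\<in>{A::nat \<Rightarrow> 'a set. range A \<subseteq> sets M \<and> disjoint_family A \<and> (\<Union>i. A i) = E}.
      \<Sum>i. ennreal (norm (l (A i)))) = emeasure V E" (is "?S = _") if E: "E \<in> sets M" for E
  proof (rule antisym)
    show "?S \<le> emeasure V E"
    proof (rule SUP_least)
      fix A :: "nat \<Rightarrow> 'a set" assume A: "A \<in> {A. range A \<subseteq> sets M \<and> disjoint_family A \<and> (\<Union>i. A i) = E}"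
      have "(\<Sum>i. ennreal (norm (l (A i)))) \<le> (\<Sum>i. emeasure V (A i))"
        using A by (intro suminf_le le) auto
      also have "\<dots> = emeasure V (\<Union>i. A i)" using A by (intro suminf_emeasure) (auto simp: sV)
      finally show "(\<Sum>i. ennreal (norm (l (A i)))) \<le> emeasure V E" using A by simp
    qed
    show "emeasure V E \<le> ?S"
    proof (rule ennreal_le_epsilon)
      fix e :: real assume e: "0 < e"
      define \<epsilon> where "\<epsilon> = e / 2 / (measure \<tau> E + 1)"
      have \<epsilon>: "0 < \<epsilon>" using e by (simp add: \<epsilon>_def add_nonneg_pos)
      obtain D :: "(real^'d^'d) set" where D: "countable D" "\<And>X. open X \<Longrightarrow> X \<noteq> {} \<Longrightarrow> \<exists>d\<in>D. d \<in> X"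
        using countable_dense_setE by blast
      have "D \<noteq> {}" using D(2)[of UNIV] by auto
      define c where "c = from_nat_into D"
      define B where "B = (\<lambda>n. {x \<in> E. norm (\<theta> x - c n) < \<epsilon>})"
      have B: "B n \<in> sets M" for n
      proof -
        have "{x \<in> space \<tau>. norm (\<theta> x - c n) < \<epsilon>} \<in> sets \<tau>" by measurable
        moreover have "B n = E \<inter> {x \<in> space \<tau>. norm (\<theta> x - c n) < \<epsilon>}"
          using sets.sets_into_space[OF E] sets_eq_imp_space_eq[OF \<tau>(2)] by (auto simp: B_def)
        ultimately show ?thesis using E \<tau>(2) by auto
      qed
      have UB: "(\<Union>n. B n) = E"
      proof -
        have "\<exists>n. norm (\<theta> x - c n) < \<epsilon>" for x
        proof -
          obtain d where "d \<in> D" "d \<in> ball (\<theta> x) \<epsilon>" using D(2)[of "ball (\<theta> x) \<epsilon>"] \<epsilon> by auto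
          then show ?thesis using from_nat_into_surj[OF D(1)] by (metis c_def dist_norm mem_ball)
        qed
        then show ?thesis by (auto simp: B_def)
      qed
      define A where "A = disjointed B"
      have A: "range A \<subseteq> sets M" "disjoint_family A" "(\<Union>i. A i) = E"
        using B UB unfolding A_def by (auto intro!: sets.range_disjointed_sets disjoint_family_disjointed simp: UN_disjointed_eq)
      have AM: "A n \<in> sets \<tau>" for n using A(1) \<tau>(2) by auto
      have bd: "norm (\<theta> x - c n) < \<epsilon>" if "x \<in> A n" for x n
        using that disjointed_subset[of B n] by (auto simp: A_def B_def)
      have piece: "emeasure V (A n) \<le> ennreal (norm (l (A n))) + ennreal (2 * \<epsilon>) * emeasure \<tau> (A n)" for n
      proof -
        have i: "integrable \<tau> (\<lambda>x. indicat_real (A n) x *\<^sub>R \<theta> x)" "integrable \<tau> (indicat_real (A n))"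
          using integrable_mult_indicator[OF AM \<theta>] AM by (auto simp: emeasure_finite less_top[symmetric])
        have "l (A n) - measure \<tau> (A n) *\<^sub>R c n = (\<integral>x. indicat_real (A n) x *\<^sub>R (\<theta> x - c n) \<partial>\<tau>)"
        proof -
          have "measure \<tau> (A n) *\<^sub>R c n = (\<integral>x. indicat_real (A n) x *\<^sub>R c n \<partial>\<tau>)"
            by (subst integral_scaleR_left) (use i AM in auto)
          moreover have "l (A n) = (\<integral>x. indicat_real (A n) x *\<^sub>R \<theta> x \<partial>\<tau>)"
            using l[of "A n"] A(1) by (auto simp: set_lebesgue_integral_def)
          ultimately show ?thesis using i
            by (simp add: scaleR_diff_right)
        qed
        also have "norm \<dots> \<le> (\<integral>x. indicat_real (A n) x * \<epsilon> \<partial>\<tau>)"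
        proof (rule norm_integral_le_integral)
          show "integrable \<tau> (\<lambda>x. indicat_real (A n) x *\<^sub>R (\<theta> x - c n))"
            using i by (simp add: scaleR_diff_right)
          show "integrable \<tau> (\<lambda>x. indicat_real (A n) x * \<epsilon>)" using i by auto
          fix x
          show "norm (indicat_real (A n) x *\<^sub>R (\<theta> x - c n)) \<le> indicat_real (A n) x * \<epsilon>"
            using bd[of x n] by (auto split: split_indicator)
        qed
        also have "\<dots> = \<epsilon> * measure \<tau> (A n)" using AM by simp
        finally have 1: "norm (l (A n) - measure \<tau> (A n) *\<^sub>R c n) \<le> \<epsilon> * measure \<tau> (A n)" .
        have "emeasure V (A n) = (\<integral>\<^sup>+x. ennreal (norm (\<theta> x)) * indicator (A n) x \<partial>\<tau>)"
          unfolding V_def using AM by (intro emeasure_density) auto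
        also have "\<dots> \<le> (\<integral>\<^sup>+x. ennreal (norm (c n) + \<epsilon>) * indicator (A n) x \<partial>\<tau>)"
        proof (rule nn_integral_mono)
          fix x
          have "norm (\<theta> x) \<le> norm (c n) + \<epsilon>" if "x \<in> A n"
            using bd[OF that] norm_triangle_sub[of "\<theta> x" "c n"] by linarith
          then show "ennreal (norm (\<theta> x)) * indicator (A n) x \<le> ennreal (norm (c n) + \<epsilon>) * indicator (A n) x"
            by (auto split: split_indicator intro!: ennreal_leI)
        qed
        also have "\<dots> = ennreal (norm (c n) + \<epsilon>) * emeasure \<tau> (A n)"
          using AM by (rule nn_integral_cmult_indicator)
        also have "\<dots> = ennreal ((norm (c n) + \<epsilon>) * measure \<tau> (A n))"
          using \<epsilon> by (simp add: emeasure_eq_measure ennreal_mult)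
        also have "\<dots> \<le> ennreal (norm (l (A n)) + (2 * \<epsilon>) * measure \<tau> (A n))"
        proof (rule ennreal_leI)
          have "norm (measure \<tau> (A n) *\<^sub>R c n) \<le> norm (l (A n)) + norm (l (A n) - measure \<tau> (A n) *\<^sub>R c n)"
            using norm_triangle_ineq4[of "l (A n)" "l (A n) - measure \<tau> (A n) *\<^sub>R c n"] by simp
          then show "(norm (c n) + \<epsilon>) * measure \<tau> (A n) \<le> norm (l (A n)) + (2 * \<epsilon>) * measure \<tau> (A n)"
            using 1 by (simp add: algebra_simps)
        qed
        also have "\<dots> = ennreal (norm (l (A n))) + ennreal (2 * \<epsilon>) * emeasure \<tau> (A n)"
          using \<epsilon> by (simp add: emeasure_eq_measure ennreal_mult ennreal_plus)
        finally show ?thesis .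
      qed
      have "emeasure V E = (\<Sum>n. emeasure V (A n))"
        using A by (subst suminf_emeasure) (auto simp: sV)
      also have "\<dots> \<le> (\<Sum>n. ennreal (norm (l (A n))) + ennreal (2 * \<epsilon>) * emeasure \<tau> (A n))"
        by (intro suminf_le piece) auto
      also have "\<dots> = (\<Sum>n. ennreal (norm (l (A n)))) + (\<Sum>n. ennreal (2 * \<epsilon>) * emeasure \<tau> (A n))"
        by (rule suminf_add[symmetric]) auto
      finally have V_le: "emeasure V E \<le> (\<Sum>n. ennreal (norm (l (A n)))) + (\<Sum>n. ennreal (2 * \<epsilon>) * emeasure \<tau> (A n))" .
      have "(\<Sum>n. ennreal (2 * \<epsilon>) * emeasure \<tau> (A n)) = ennreal (2 * \<epsilon>) * emeasure \<tau> E"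
      proof -
        have "(\<Sum>n. emeasure \<tau> (A n)) = emeasure \<tau> E" using A \<tau>(2) by (subst suminf_emeasure) auto
        then show ?thesis by simp
      qed
      also have "\<dots> \<le> ennreal e"
      proof -
        have "2 * \<epsilon> * measure \<tau> E = e * (measure \<tau> E / (measure \<tau> E + 1))"
        proof -
          have "measure \<tau> E + 1 > 0" by (simp add: add_nonneg_pos)
          then show ?thesis unfolding \<epsilon>_def by (simp add: divide_simps)
        qed
        also have "\<dots> \<le> e * 1" using e by (intro mult_left_mono) (auto simp: divide_le_eq_1 add_nonneg_pos)
        finally show ?thesis using \<epsilon> by (simp add: emeasure_eq_measure ennreal_mult'[symmetric] ennreal_leI)
      qed
      finally have 2: "(\<Sum>n. ennreal (2 * \<epsilon>) * emeasure \<tau> (A n)) \<le> ennreal e" .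
      have "(\<Sum>n. ennreal (norm (l (A n)))) \<le> ?S"
        using A by (intro SUP_upper) auto
      with 2 V_le show "emeasure V E \<le> ?S + ennreal e" by (meson add_mono order_trans)
    qed
  qed
  have "total_variation M l = measure_of (space M) (sets M) (emeasure V)"
    unfolding total_variation_def
    by (rule measure_of_eq) (auto simp: sets.space_closed sets.sigma_sets_eq eq)
  also have "\<dots> = V" using measure_of_of_measure[of V] by (simp add: sV)
  finally show tv: "total_variation M l = density \<tau> (\<lambda>x. ennreal (norm (\<theta> x)))" by (simp add: V_def)
  show "emeasure (total_variation M l) E =
      (SUP A\<in>{A::nat \<Rightarrow> 'a set. range A \<subseteq> sets M \<and> disjoint_family A \<and> (\<Union>i. A i) = E}. \<Sum>i. ennreal (norm (l (A i))))"
    if "E \<in> sets M" for E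
    using eq[OF that] tv by (simp add: V_def)
qed

lemma polar_density_exists:
  fixes l :: "'a set \<Rightarrow> real^'d^'d"
  assumes l: "l \<in> psd_measures M"
  shows "\<exists>g. g \<in> borel_measurable M \<and> (\<forall>x. g x \<in> sym_mats) \<and>
     integrable (total_variation M l) g \<and> (\<forall>E\<in>sets M. l E = (LINT x:E|total_variation M l. g x))"
proof -
  obtain \<tau> \<theta> where \<tau>: "sets \<tau> = sets M" "finite_measure \<tau>" and \<theta>: "integrable \<tau> \<theta>" "\<And>x. \<theta> x \<in> sym_mats"
    and l\<theta>: "\<And>E. E \<in> sets M \<Longrightarrow> l E = (LINT x:E|\<tau>. \<theta> x)"
    using ex_matrix_density[OF l] by blast
  have T: "total_variation M l = density \<tau> (\<lambda>x. ennreal (norm (\<theta> x)))"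
    by (rule total_variation_density(1)[OF \<tau>(2,1) \<theta>(1) l\<theta>])
  define g where "g = (\<lambda>x. (1 / norm (\<theta> x)) *\<^sub>R \<theta> x)"
  have m[measurable]: "\<theta> \<in> borel_measurable \<tau>" using \<theta> by auto
  have g[measurable]: "g \<in> borel_measurable \<tau>" unfolding g_def by measurable
  have ng: "norm (\<theta> x) *\<^sub>R g x = \<theta> x" for x by (simp add: g_def)
  have "g \<in> borel_measurable M" by (rule measurable_sets_eq[OF g \<tau>(1)])
  moreover have "integrable (total_variation M l) g"
    unfolding T by (subst integrable_density) (auto simp: ng \<theta>)
  moreover have "g x \<in> sym_mats" for x unfolding g_def by (intro sym_mats_scaleR \<theta>)
  moreover have "l E = (LINT x:E|total_variation M l. g x)" if E: "E \<in> sets M" for E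
  proof -
    have "(LINT x:E|total_variation M l. g x) = (\<integral>x. norm (\<theta> x) *\<^sub>R (indicat_real E x *\<^sub>R g x) \<partial>\<tau>)"
      unfolding T set_lebesgue_integral_def using E \<tau>(1) by (subst integral_density) auto
    also have "\<dots> = (\<integral>x. indicat_real E x *\<^sub>R \<theta> x \<partial>\<tau>)"
      by (intro Bochner_Integration.integral_cong refl) (metis ng scaleR_left_commute)
    finally show ?thesis using l\<theta>[OF E] by (simp add: set_lebesgue_integral_def)
  qed
  ultimately show ?thesis by blast
qed

lemma
  fixes l :: "'a set \<Rightarrow> real^'d^'d"
  assumes l: "l \<in> psd_measures M"
  shows polar_density_measurable: "polar_density M l \<in> borel_measurable M"
    and polar_density_sym: "\<And>x. polar_density M l x \<in> sym_mats"
    and polar_density_integrable: "integrable (total_variation M l) (polar_density M l)"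
    and polar_density_integral: "\<And>E. E \<in> sets M \<Longrightarrow> l E = (LINT x:E|total_variation M l. polar_density M l x)"
  using someI_ex[OF polar_density_exists[OF l], folded polar_density_def] by blast+

lemma sets_total_variation[simp]: "sets (total_variation M l) = sets M"
  and space_total_variation[simp]: "space (total_variation M l) = space M"
  by (simp_all add: total_variation_def)

lemma emeasure_total_variation_le:
  assumes l: "l \<in> psd_measures M" and E: "E \<in> sets M"
  shows "emeasure (total_variation M l) E \<le> ennreal (trace (l E))"
proof -
  obtain \<tau> \<theta> where \<tau>: "sets \<tau> = sets M" "finite_measure \<tau>" and \<theta>: "integrable \<tau> \<theta>"
    and l\<theta>: "\<And>E. E \<in> sets M \<Longrightarrow> l E = (LINT x:E|\<tau>. \<theta> x)"
    using ex_matrix_density[OF l] by blast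
  have "(\<Sum>i. ennreal (norm (l (A i)))) \<le> ennreal (trace (l E))"
    if A: "range A \<subseteq> sets M" "disjoint_family A" "(\<Union>i. A i) = E" for A :: "nat \<Rightarrow> 'a set"
  proof -
    have psd: "l (A i) \<in> psd_mats" for i using A by (intro psd_measure_psd[OF l]) auto
    have "(\<Sum>i. ennreal (norm (l (A i)))) \<le> (\<Sum>i. ennreal (trace (l (A i))))"
      by (intro suminf_le ennreal_leI psd_norm_le_trace psd) auto
    also have "\<dots> = ennreal (trace (l E))"
      using trace_sums[OF psd_measure_sums[OF l A(1,2)]] psd A(3)
      by (intro suminf_ennreal_eq psd_trace_nonneg) auto
    finally show ?thesis .
  qed
  then show ?thesis
    by (subst total_variation_density(2)[OF \<tau>(2,1) \<theta> l\<theta> E]) (auto intro!: SUP_least)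
qed

lemma finite_total_variation:
  assumes l: "l \<in> psd_measures M" shows "finite_measure (total_variation M l)"
proof (rule finite_measureI)
  show "emeasure (total_variation M l) (space (total_variation M l)) \<noteq> \<infinity>"
    using emeasure_total_variation_le[OF l sets.top] by (auto simp: top_unique)
qed

lemma norm_le_total_variation:
  assumes l: "l \<in> psd_measures M" and E: "E \<in> sets M"
  shows "ennreal (norm (l E)) \<le> emeasure (total_variation M l) E"
proof -
  let ?T = "total_variation M l"
  have "?T = density ?T (\<lambda>x. ennreal (norm (polar_density M l x)))"
    by (rule total_variation_density(1)[OF finite_total_variation[OF l] _ polar_density_integrable[OF l]
        polar_density_integral[OF l]]) auto
  then show ?thesis
    using norm_set_integral_le[OF polar_density_integrable[OF l], of E] E polar_density_integral[OF l E] by simp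
qed

lemma integral_norm_polar_density:
  assumes l: "l \<in> psd_measures M"
  shows "(\<integral>x. norm (polar_density M l x) \<partial>total_variation M l) = measure (total_variation M l) (space M)"
proof -
  let ?T = "total_variation M l" and ?g = "polar_density M l"
  interpret finite_measure ?T by (rule finite_total_variation[OF l])
  have m: "?g \<in> borel_measurable ?T" using polar_density_integrable[OF l] by auto
  have "?T = density ?T (\<lambda>x. ennreal (norm (?g x)))"
    by (rule total_variation_density(1)[OF finite_total_variation[OF l] _ polar_density_integrable[OF l]
        polar_density_integral[OF l]]) auto
  then have "emeasure ?T (space M) = emeasure (density ?T (\<lambda>x. ennreal (norm (?g x)))) (space M)" by simp
  also have "\<dots> = (\<integral>\<^sup>+x. ennreal (norm (?g x)) * indicator (space ?T) x \<partial>?T)"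
    using m by (subst emeasure_density) auto
  also have "\<dots> = (\<integral>\<^sup>+x. ennreal (norm (?g x)) \<partial>?T)" by (intro nn_integral_cong) simp
  also have "\<dots> = ennreal (\<integral>x. norm (?g x) \<partial>?T)"
    using polar_density_integrable[OF l] by (intro nn_integral_eq_integral) auto
  finally show ?thesis by (simp add: emeasure_eq_measure)
qed

lemma density_unique_euclidean:
  fixes f f' :: "'a \<Rightarrow> 'b::euclidean_space"
  assumes f: "integrable M f" "integrable M f'"
    and eq: "\<And>A. A \<in> sets M \<Longrightarrow> (LINT x:A|M. f x) = (LINT x:A|M. f' x)"
  shows "AE x in M. f x = f' x"
proof -
  have "AE x in M. \<forall>b\<in>Basis. f x \<bullet> b = f' x \<bullet> b"
  proof (rule AE_finite_allI)
    fix b :: 'b assume "b \<in> Basis"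
    have s: "(LINT x:A|M. f x \<bullet> b) = (LINT x:A|M. f x) \<bullet> b" if A: "A \<in> sets M" and f: "integrable M f" for A and f :: "'a \<Rightarrow> 'b"
      unfolding set_lebesgue_integral_def using integrable_mult_indicator[OF A f]
      by (subst integral_inner_left[symmetric]) auto
    show "AE x in M. f x \<bullet> b = f' x \<bullet> b"
      by (rule density_unique_real) (auto simp: s f eq)
  qed simp
  then show ?thesis by eventually_elim (rule euclidean_eqI, auto)
qed

text \<open>
  Since \<open>|l| = |\<theta>| \<tau>\<close>, any density \<open>\<theta>\<close> determines the polar density as \<open>\<theta> / |\<theta>|\<close>; this is how polar
  densities of concrete measures are found.
\<close>

lemma polar_density_AE:
  fixes l :: "'a set \<Rightarrow> real^'d^'d"
  assumes l: "l \<in> psd_measures M"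
    and \<tau>: "finite_measure \<tau>" "sets \<tau> = sets M" and \<theta>: "integrable \<tau> \<theta>"
    and l\<theta>: "\<And>E. E \<in> sets M \<Longrightarrow> l E = (LINT x:E|\<tau>. \<theta> x)"
  shows "AE x in \<tau>. norm (\<theta> x) *\<^sub>R polar_density M l x = \<theta> x"
proof (rule density_unique_euclidean)
  have T: "total_variation M l = density \<tau> (\<lambda>x. ennreal (norm (\<theta> x)))"
    by (rule total_variation_density(1)[OF \<tau> \<theta> l\<theta>])
  have m[measurable]: "\<theta> \<in> borel_measurable \<tau>" using \<theta> by auto
  have [measurable]: "polar_density M l \<in> borel_measurable \<tau>"
    by (rule measurable_sets_eq[OF polar_density_measurable[OF l] \<tau>(2)[symmetric]])
  show "integrable \<tau> (\<lambda>x. norm (\<theta> x) *\<^sub>R polar_density M l x)"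
    using polar_density_integrable[OF l] unfolding T by (subst (asm) integrable_density) auto
  fix A assume A: "A \<in> sets \<tau>"
  have "(LINT x:A|\<tau>. norm (\<theta> x) *\<^sub>R polar_density M l x) = (\<integral>x. norm (\<theta> x) *\<^sub>R (indicat_real A x *\<^sub>R polar_density M l x) \<partial>\<tau>)"
    unfolding set_lebesgue_integral_def by (intro Bochner_Integration.integral_cong) auto
  also have "\<dots> = (LINT x:A|total_variation M l. polar_density M l x)"
    unfolding T set_lebesgue_integral_def using A by (subst integral_density) auto
  finally show "(LINT x:A|\<tau>. norm (\<theta> x) *\<^sub>R polar_density M l x) = (LINT x:A|\<tau>. \<theta> x)"
    using polar_density_integral[OF l, of A] l\<theta>[of A] A \<tau>(2) by simp
qed fact

lemma mat_integral_density:
  fixes l :: "'a set \<Rightarrow> real^'d^'d"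
  assumes l: "l \<in> psd_measures M"
    and \<tau>: "finite_measure \<tau>" "sets \<tau> = sets M" and \<theta>: "integrable \<tau> \<theta>"
    and l\<theta>: "\<And>E. E \<in> sets M \<Longrightarrow> l E = (LINT x:E|\<tau>. \<theta> x)"
    and \<Phi>: "\<Phi> \<in> borel_measurable M"
  shows "mat_integral M l \<Phi> = (\<integral>x. \<Phi> x \<bullet> \<theta> x \<partial>\<tau>)"
proof -
  have T: "total_variation M l = density \<tau> (\<lambda>x. ennreal (norm (\<theta> x)))"
    by (rule total_variation_density(1)[OF \<tau> \<theta> l\<theta>])
  have m[measurable]: "\<theta> \<in> borel_measurable \<tau>" using \<theta> by auto
  have [measurable]: "polar_density M l \<in> borel_measurable \<tau>" "\<Phi> \<in> borel_measurable \<tau>"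
    using measurable_sets_eq[OF polar_density_measurable[OF l] \<tau>(2)[symmetric]]
      measurable_sets_eq[OF \<Phi> \<tau>(2)[symmetric]] by auto
  have "mat_integral M l \<Phi> = (\<integral>x. norm (\<theta> x) *\<^sub>R (\<Phi> x \<bullet> polar_density M l x) \<partial>\<tau>)"
    unfolding mat_integral_def T by (rule integral_density) auto
  also have "\<dots> = (\<integral>x. \<Phi> x \<bullet> \<theta> x \<partial>\<tau>)"
    using polar_density_AE[OF l \<tau> \<theta> l\<theta>]
    by (intro integral_cong_AE) (auto elim!: eventually_mono simp: inner_scaleR_right[symmetric] simp del: inner_scaleR_right)
  finally show ?thesis .
qed

lemma integrable_inner_bounded:
  fixes \<Phi> g :: "'a \<Rightarrow> 'b::euclidean_space"
  assumes g: "integrable T g" and \<Phi>: "\<Phi> \<in> borel_measurable T" "\<And>x. norm (\<Phi> x) \<le> B"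
  shows "integrable T (\<lambda>x. \<Phi> x \<bullet> g x)"
proof (rule Bochner_Integration.integrable_bound)
  show "integrable T (\<lambda>x. B * norm (g x))" using g by auto
  have "norm (\<Phi> x \<bullet> g x) \<le> norm (B * norm (g x))" for x
    using Cauchy_Schwarz_ineq2[of "\<Phi> x" "g x"] mult_right_mono[OF \<Phi>(2)[of x], of "norm (g x)"] by auto
  then show "AE x in T. norm (\<Phi> x \<bullet> g x) \<le> norm (B * norm (g x))" by simp
qed (use assms in auto)

lemma mat_integral_integrable:
  assumes l: "l \<in> psd_measures M" and \<Phi>: "\<Phi> \<in> borel_measurable M" "\<And>x. norm (\<Phi> x) \<le> B"
  shows "integrable (total_variation M l) (\<lambda>x. \<Phi> x \<bullet> polar_density M l x)"
  using measurable_sets_eq[OF \<Phi>(1) sets_total_variation[symmetric]] \<Phi>(2)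
  by (intro integrable_inner_bounded[OF polar_density_integrable[OF l]]) auto

lemma abs_mat_integral_le:
  assumes l: "l \<in> psd_measures M" and \<Phi>: "\<Phi> \<in> borel_measurable M" "\<And>x. norm (\<Phi> x) \<le> B"
  shows "\<bar>mat_integral M l \<Phi>\<bar> \<le> B * measure (total_variation M l) (space M)"
proof -
  have "norm (mat_integral M l \<Phi>) \<le> (\<integral>x. B * norm (polar_density M l x) \<partial>total_variation M l)"
    unfolding mat_integral_def
  proof (rule norm_integral_le_integral)
    show "integrable (total_variation M l) (\<lambda>x. \<Phi> x \<bullet> polar_density M l x)"
      by (rule mat_integral_integrable[OF assms])
    show "integrable (total_variation M l) (\<lambda>x. B * norm (polar_density M l x))"
      using polar_density_integrable[OF l] by auto
    show "norm (\<Phi> x \<bullet> polar_density M l x) \<le> B * norm (polar_density M l x)" for x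
      using Cauchy_Schwarz_ineq2[of "\<Phi> x" "polar_density M l x"]
        mult_right_mono[OF \<Phi>(2)[of x], of "norm (polar_density M l x)"] by auto
  qed
  also have "\<dots> = B * measure (total_variation M l) (space M)"
    using integral_norm_polar_density[OF l] by simp
  finally show ?thesis by simp
qed

section \<open>Slopes\<close>

definition slopes :: "(real^'d^'d \<Rightarrow> ennreal) \<Rightarrow> (real^'d^'d) set" where
  "slopes f = {k. \<forall>A\<in>sym_mats. ennreal (k \<bullet> A) \<le> f A}"

lemma slopesD: "k \<in> slopes f \<Longrightarrow> A \<in> sym_mats \<Longrightarrow> ennreal (k \<bullet> A) \<le> f A"
  by (simp add: slopes_def)

lemma zero_slope: "0 \<in> slopes f"
  by (simp add: slopes_def)

lemma f_zero: "pos_homogeneous f \<Longrightarrow> f 0 = 0"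
  unfolding pos_homogeneous_def using subspace_0[OF subspace_sym_mats] by (metis ennreal_0 mult_zero_left order_refl scaleR_zero_left)

lemma slope_combination:
  fixes f :: "real^'d^'d \<Rightarrow> ennreal"
  assumes k: "\<And>i. i \<in> I \<Longrightarrow> k i \<in> slopes f" and c: "\<And>i. i \<in> I \<Longrightarrow> 0 \<le> c i" "sum c I \<le> 1"
  shows "(\<Sum>i\<in>I. c i *\<^sub>R k i) \<in> slopes f"
  unfolding slopes_def
proof (intro CollectI ballI)
  fix A assume A: "A \<in> (sym_mats :: (real^'d^'d) set)"
  show "ennreal ((\<Sum>i\<in>I. c i *\<^sub>R k i) \<bullet> A) \<le> f A"
  proof (cases "f A")
    case (real r)
    have "k i \<bullet> A \<le> r" if "i \<in> I" for i using slopesD[OF k[OF that] A] real by simp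
    then have "(\<Sum>i\<in>I. c i *\<^sub>R k i) \<bullet> A \<le> (\<Sum>i\<in>I. c i * r)"
      unfolding inner_sum_left inner_scaleR_left using c by (intro sum_mono mult_left_mono) auto
    also have "\<dots> = sum c I * r" by (simp add: sum_distrib_right)
    also have "\<dots> \<le> r" using c(2) real(1) mult_right_mono[of "sum c I" 1 r] by simp
    finally show ?thesis using real by (simp add: ennreal_leI)
  qed simp
qed

text \<open>
  Separate \<open>(A, c)\<close> from the epigraph of \<open>f\<close>, a closed convex cone.  A hyperplane that is not vertical
  becomes the graph of a slope once it is moved to the apex.  A vertical one is nonpositive on the domain of \<open>f\<close> and positive at \<open>A\<close>, and
  as \<open>f \<ge> 0\<close> every positive multiple of it is a slope.
\<close>

lemma slope_above:
  fixes f :: "real^'d^'d \<Rightarrow> ennreal"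
  assumes conv: "convex_fun f" and hom: "pos_homogeneous f" and lsc: "lsc_fun f"
    and A: "A \<in> sym_mats" and c: "0 \<le> c" "ennreal c < f A"
  shows "\<exists>k\<in>slopes f. c < k \<bullet> A"
proof -
  define S where "S = {(B, s). B \<in> sym_mats \<and> 0 \<le> s \<and> f B \<le> ennreal s}"
  have sub: "B \<in> sym_mats \<Longrightarrow> C \<in> sym_mats \<Longrightarrow> a *\<^sub>R B + b *\<^sub>R C \<in> sym_mats" for B C :: "real^'d^'d" and a b
    by (intro sym_mats_add sym_mats_scaleR)
  have "convex S"
  proof (rule convexI)
    fix x y :: "(real^'d^'d) \<times> real" and u v :: real
    assume xy: "x \<in> S" "y \<in> S" and uv: "0 \<le> u" "0 \<le> v" "u + v = 1"
    obtain B s C t where [simp]: "x = (B, s)" "y = (C, t)" by (cases x, cases y) auto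
    have u: "u = 1 - v" using uv by simp
    have "f (u *\<^sub>R B + v *\<^sub>R C) \<le> ennreal u * f B + ennreal v * f C"
      using conv xy uv unfolding convex_fun_def u by (auto simp: S_def)
    also have "\<dots> \<le> ennreal u * ennreal s + ennreal v * ennreal t"
      using xy by (intro add_mono mult_left_mono) (auto simp: S_def)
    also have "\<dots> = ennreal (u * s + v * t)"
      using xy uv by (simp add: S_def ennreal_mult ennreal_plus)
    finally show "u *\<^sub>R x + v *\<^sub>R y \<in> S" using xy uv by (auto simp: S_def intro!: sub)
  qed
  moreover have "closed S"
    unfolding closed_sequential_limits
  proof (intro allI impI, elim conjE)
    fix z :: "nat \<Rightarrow> (real^'d^'d) \<times> real" and l
    assume z: "\<forall>n. z n \<in> S" "z \<longlonglongrightarrow> l"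
    obtain B s where l: "l = (B, s)" by (cases l)
    have z1: "(\<lambda>n. fst (z n)) \<longlonglongrightarrow> B" and z2: "(\<lambda>n. snd (z n)) \<longlonglongrightarrow> s"
      using tendsto_fst[OF z(2)] tendsto_snd[OF z(2)] by (auto simp: l)
    have zS: "fst (z n) \<in> sym_mats" "0 \<le> snd (z n)" "f (fst (z n)) \<le> ennreal (snd (z n))" for n
      using z(1) by (auto simp: S_def case_prod_beta)
    have B: "B \<in> sym_mats"
      using closed_sequentially[OF closed_subspace[OF subspace_sym_mats] _ z1] zS by blast
    have s: "0 \<le> s" using z2 zS by (intro LIMSEQ_le_const) auto
    have "f B \<le> ennreal s"
    proof (rule ccontr)
      assume "\<not> f B \<le> ennreal s"
      then have "ennreal s < f B" by simp
      then obtain r where r: "ennreal s < r" "r < f B" using dense by blast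
      have "r < Liminf (at B within sym_mats) f" using r lsc B unfolding lsc_fun_def by force
      then have "eventually (\<lambda>C. r < f C) (at B within sym_mats)"
        by (rule less_LiminfD)
      then obtain U where U: "open U" "B \<in> U" "\<And>C. C \<in> U \<Longrightarrow> C \<noteq> B \<Longrightarrow> C \<in> sym_mats \<Longrightarrow> r < f C"
        unfolding eventually_at_topological by blast
      have "eventually (\<lambda>n. fst (z n) \<in> U) sequentially" using topological_tendstoD[OF z1 U(1,2)] .
      moreover have "eventually (\<lambda>n. ennreal (snd (z n)) < r) sequentially"
        using order_tendstoD(2)[OF tendsto_ennrealI[OF z2] r(1)] .
      ultimately have "eventually (\<lambda>n. False) sequentially"
      proof eventually_elim
        case (elim n)
        have "r < f (fst (z n))" using U(3)[of "fst (z n)"] elim(1) zS(1)[of n] r(2) by (cases "fst (z n) = B") auto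
        then show False using zS(3)[of n] elim(2) by auto
      qed
      then show False by simp
    qed
    then show "l \<in> S" using B s by (simp add: S_def l)
  qed
  moreover have "(A, c) \<notin> S" using c by (auto simp: S_def)
  ultimately obtain a b where ab: "a \<bullet> (A, c) < b" "\<And>x. x \<in> S \<Longrightarrow> a \<bullet> x > b"
    using separating_hyperplane_closed_point[of S "(A, c)"] by blast
  obtain a1 \<alpha> where a: "a = (a1, \<alpha>)" by (cases a)
  have zS: "(0, s) \<in> S" if "0 \<le> s" for s
    using that f_zero[OF hom] subspace_0[OF subspace_sym_mats] by (simp add: S_def)
  have b: "b < 0" using ab(2)[OF zS[of 0]] by (simp add: a)
  have cone: "(t *\<^sub>R B, t * s) \<in> S" if "(B, s) \<in> S" "0 \<le> t" for B s t
    using that hom unfolding S_def pos_homogeneous_def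
    by (auto intro!: sym_mats_scaleR simp: ennreal_mult mult_left_mono)
  have pos: "0 \<le> a1 \<bullet> B + \<alpha> * s" if BS: "(B, s) \<in> S" for B s
  proof (rule ccontr)
    assume n: "\<not> 0 \<le> a1 \<bullet> B + \<alpha> * s"
    define t where "t = b / (a1 \<bullet> B + \<alpha> * s)"
    have "0 \<le> t" using b n by (simp add: t_def divide_nonpos_neg)
    from ab(2)[OF cone[OF BS this]] have "b < t * (a1 \<bullet> B + \<alpha> * s)" by (simp add: a algebra_simps)
    then show False using n by (simp add: t_def)
  qed
  have \<alpha>: "0 \<le> \<alpha>" using pos[OF zS[of 1]] by simp
  have ltA: "a1 \<bullet> A + \<alpha> * c < 0" using ab(1) b by (simp add: a)
  have fin: "(B, enn2real (f B)) \<in> S" if "B \<in> sym_mats" "f B < \<infinity>" for B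
    using that by (simp add: S_def)
  show ?thesis
  proof (cases "\<alpha> = 0")
    case False
    then have \<alpha>: "0 < \<alpha>" using \<alpha> by simp
    show ?thesis
    proof (intro bexI)
      show "c < (- (1 / \<alpha>) *\<^sub>R a1) \<bullet> A" using ltA \<alpha> by (simp add: field_simps)
      show "- (1 / \<alpha>) *\<^sub>R a1 \<in> slopes f"
        unfolding slopes_def
      proof (intro CollectI ballI)
        fix B assume B: "B \<in> (sym_mats :: (real^'d^'d) set)"
        show "ennreal ((- (1 / \<alpha>) *\<^sub>R a1) \<bullet> B) \<le> f B"
        proof (cases "f B = \<infinity>")
          case False
          then have "f B < \<infinity>" by (simp add: less_top)
          from pos[OF fin[OF B this]] have "(- (1 / \<alpha>) *\<^sub>R a1) \<bullet> B \<le> enn2real (f B)"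
            using \<alpha> by (simp add: field_simps)
          then have "ennreal ((- (1 / \<alpha>) *\<^sub>R a1) \<bullet> B) \<le> ennreal (enn2real (f B))" by (rule ennreal_leI)
          moreover have "ennreal (enn2real (f B)) = f B" using \<open>f B < \<infinity>\<close> by simp
          ultimately show ?thesis by (simp only:)
        qed simp
      qed
    qed
  next
    case True
    then have A1: "a1 \<bullet> A < 0" using ltA by simp
    (* any multiple with t (- a1 \<bullet> A) > c will do *)
    define t where "t = (c + 1) / - (a1 \<bullet> A)"
    have t: "0 \<le> t" using A1 c by (simp add: t_def divide_nonneg_neg divide_nonneg_pos)
    show ?thesis
    proof (intro bexI)
      show "c < (- t *\<^sub>R a1) \<bullet> A" using A1 by (simp add: t_def)
      show "- t *\<^sub>R a1 \<in> slopes f"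
        unfolding slopes_def
      proof (intro CollectI ballI)
        fix B assume B: "B \<in> (sym_mats :: (real^'d^'d) set)"
        show "ennreal ((- t *\<^sub>R a1) \<bullet> B) \<le> f B"
        proof (cases "f B = \<infinity>")
          case False
          then have "f B < \<infinity>" by (simp add: less_top)
          from pos[OF fin[OF B this]] True t have "(- t *\<^sub>R a1) \<bullet> B \<le> 0"
            by simp
          then show ?thesis by (simp add: ennreal_neg)
        qed simp
      qed
    qed
  qed
qed

lemma countable_slopes:
  fixes f :: "real^'d^'d \<Rightarrow> ennreal"
  assumes f: "convex_fun f" "pos_homogeneous f" "lsc_fun f"
  shows "\<exists>K::nat \<Rightarrow> real^'d^'d. (\<forall>n. K n \<in> slopes f) \<and> (\<forall>A\<in>sym_mats. f A = (SUP n. ennreal (K n \<bullet> A)))"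
proof -
  obtain T where T: "countable T" "T \<subseteq> slopes f" "slopes f \<subseteq> closure T"
    using separable[of "slopes f"] by blast
  have "T \<noteq> {}" using T(3) zero_slope[of f] by auto
  define K where "K = from_nat_into T"
  have K: "K n \<in> slopes f" for n using from_nat_into[OF \<open>T \<noteq> {}\<close>] T(2) by (auto simp: K_def)
  moreover have "f A = (SUP n. ennreal (K n \<bullet> A))" if A: "A \<in> sym_mats" for A
  proof (rule antisym)
    show "(SUP n. ennreal (K n \<bullet> A)) \<le> f A" using slopesD[OF K A] by (rule SUP_least)
    show "f A \<le> (SUP n. ennreal (K n \<bullet> A))"
    proof (rule dense_le)
      fix r assume "r < f A"
      then obtain c where c: "r = ennreal c" "0 \<le> c" by (cases r) auto
      then obtain k where k: "k \<in> slopes f" "c < k \<bullet> A"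
        using slope_above[OF f A] \<open>r < f A\<close> by blast
      have "open {k. c < k \<bullet> A}" by (intro open_Collect_less continuous_intros)
      moreover have "k \<in> closure T \<inter> {k. c < k \<bullet> A}" using k T(3) by auto
      ultimately obtain k' where k': "k' \<in> T" "c < k' \<bullet> A"
        using open_Int_closure_eq_empty[of "{k. c < k \<bullet> A}" T] by blast
      then obtain n where "K n = k'" using from_nat_into_surj[OF T(1)] by (auto simp: K_def)
      then have "r \<le> ennreal (K n \<bullet> A)" using c k' by (simp add: ennreal_leI)
      then show "r \<le> (SUP n. ennreal (K n \<bullet> A))" by (rule SUP_upper2[OF UNIV_I])
    qed
  qed
  ultimately show ?thesis by blast
qed

text \<open>
  Moving from a matrix of the domain towards a positive definite one stays in the domain, and
  along the segment \<open>f\<close> is controlled by convexity; so being below \<open>f\<close> need only be checked on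
  positive definite matrices.
\<close>

lemma slope_if_pd:
  fixes f :: "real^'d^'d \<Rightarrow> ennreal"
  assumes conv: "convex_fun f" and dom: "eff_dom f \<subseteq> psd_mats"
    and P: "P \<in> eff_dom f \<inter> pd_mats"
    and k: "\<And>A. A \<in> eff_dom f \<inter> pd_mats \<Longrightarrow> ennreal (k \<bullet> A) \<le> f A"
  shows "k \<in> slopes f"
  unfolding slopes_def
proof (intro CollectI ballI)
  fix A assume A: "A \<in> (sym_mats :: (real^'d^'d) set)"
  show "ennreal (k \<bullet> A) \<le> f A"
  proof (cases "f A = \<infinity>")
    case False
    then have fA: "f A < \<infinity>" by (simp add: less_top)
    then have psd: "A \<in> psd_mats" using A dom by (auto simp: eff_dom_def)
    have Ps: "P \<in> sym_mats" "f P < \<infinity>" using P by (auto simp: eff_dom_def)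
    define a p where "a = enn2real (f A)" and "p = enn2real (f P)"
    have ap: "f A = ennreal a" "f P = ennreal p" "0 \<le> a" "0 \<le> p" using fA Ps by (auto simp: a_def p_def)
    have le: "(1 - u) * (k \<bullet> A) + u * (k \<bullet> P) \<le> (1 - u) * a + u * p" if u: "0 < u" "u \<le> 1" for u
    proof -
      let ?B = "(1 - u) *\<^sub>R A + u *\<^sub>R P"
      have fB: "f ?B \<le> ennreal (1 - u) * f A + ennreal u * f P"
        using conv A Ps u unfolding convex_fun_def by auto
      also have "\<dots> = ennreal ((1 - u) * a + u * p)"
        using ap u by (simp add: ennreal_mult ennreal_plus)
      finally have fB: "f ?B \<le> ennreal ((1 - u) * a + u * p)" .
      have B: "?B \<in> sym_mats" using A Ps by (intro sym_mats_add sym_mats_scaleR)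
      have "?B \<in> pd_mats"
        unfolding pd_mats_def
      proof (intro CollectI conjI allI impI B)
        fix v :: "real^'d" assume "v \<noteq> 0"
        then have "0 < v \<bullet> (P *v v)" "0 \<le> v \<bullet> (A *v v)" using P psd by (auto simp: pd_mats_def psd_mats_def)
        then have "0 < (1 - u) * (v \<bullet> (A *v v)) + u * (v \<bullet> (P *v v))"
          using u by (intro add_nonneg_pos) auto
        then show "0 < v \<bullet> (?B *v v)"
          by (simp add: matrix_vector_mult_add_rdistrib scaleR_matrix_vector_assoc[symmetric] inner_add_right)
      qed
      moreover have "?B \<in> eff_dom f" using fB B by (simp add: eff_dom_def order_le_less_trans)
      ultimately have "ennreal (k \<bullet> ?B) \<le> ennreal ((1 - u) * a + u * p)" using k[of ?B] fB by auto
      moreover have "0 \<le> (1 - u) * a + u * p" using u ap by simp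
      ultimately show ?thesis by (simp add: inner_add_right)
    qed
    have "((\<lambda>u. (1 - u) * (k \<bullet> A) + u * (k \<bullet> P)) \<longlongrightarrow> (1 - 0) * (k \<bullet> A) + 0 * (k \<bullet> P)) (at_right 0)"
      by (intro tendsto_intros)
    moreover have "((\<lambda>u. (1 - u) * a + u * p) \<longlongrightarrow> (1 - 0) * a + 0 * p) (at_right (0::real))"
      by (intro tendsto_intros)
    moreover have "eventually (\<lambda>u. (1 - u) * (k \<bullet> A) + u * (k \<bullet> P) \<le> (1 - u) * a + u * p) (at_right 0)"
      unfolding eventually_at_right_field using le by (intro exI[of _ 1]) auto
    ultimately have "(1 - 0) * (k \<bullet> A) + 0 * (k \<bullet> P) \<le> (1 - 0) * a + 0 * p"
      by (intro tendsto_le[OF trivial_limit_at_right_real])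
    then show ?thesis using ap by (simp add: ennreal_leI)
  qed simp
qed

section \<open>Twice differentiable functions with bounded Hessian\<close>

definition C2_with :: "(real^'d \<Rightarrow> real) \<Rightarrow> (real^'d \<Rightarrow> real^'d) \<Rightarrow> (real^'d \<Rightarrow> real^'d^'d) \<Rightarrow> bool" where
  "C2_with \<psi> g H \<longleftrightarrow>
     (\<forall>x. (\<psi> has_derivative (\<lambda>h. g x \<bullet> h)) (at x)) \<and>
     (\<forall>x. (g has_derivative (\<lambda>h. H x *v h)) (at x)) \<and>
     continuous_on UNIV H"

lemma C2b_iff: "C2b \<psi> \<longleftrightarrow> (\<exists>g H. C2_with \<psi> g H \<and> bounded (range H))"
  unfolding C2b_def C2_with_def by blast

lemma outer_mult: "outer v w *v h = (w \<bullet> h) *\<^sub>R v"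
  by (simp add: vec_eq_iff outer_def matrix_vector_mult_def inner_vec_def sum_distrib_left algebra_simps)

lemma norm_outer: "norm (outer v w) = norm v * norm w"
proof -
  have "(norm (outer v w))\<^sup>2 = (norm v * norm w)\<^sup>2"
    unfolding power2_norm_eq_inner power_mult_distrib mat_inner_sum
    by (simp add: outer_def inner_vec_def sum_product power2_eq_square algebra_simps)
  then show ?thesis by (simp add: power2_eq_iff_nonneg)
qed

lemma norm_matrix_vector_le: "norm (A *v h) \<le> norm A * norm (h::real^'d)" for A :: "real^'d^'d"
proof -
  have "\<bar>(A *v h) $ i\<bar> \<le> norm (A $ i) * norm h" for i
    using Cauchy_Schwarz_ineq2[of "A $ i" h] by (simp add: matrix_vector_mult_def inner_vec_def)
  then have "norm (A *v h) \<le> L2_set (\<lambda>i. norm (A $ i) * norm h) UNIV"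
    unfolding norm_vec_def by (intro L2_set_mono) auto
  also have "\<dots> = norm A * norm h"
    unfolding norm_vec_def[of A] by (rule L2_set_left_distrib[symmetric]) simp
  finally show ?thesis .
qed

lemma C2_add:
  assumes "C2_with \<psi> g H" "C2_with \<psi>' g' H'"
  shows "C2_with (\<lambda>x. \<psi> x + \<psi>' x) (\<lambda>x. g x + g' x) (\<lambda>x. H x + H' x)"
  unfolding C2_with_def inner_add_left matrix_vector_mult_add_rdistrib
  using assms by (auto simp: C2_with_def intro!: has_derivative_add continuous_intros)

lemma C2_scale:
  assumes "C2_with \<psi> g H"
  shows "C2_with (\<lambda>x. c * \<psi> x) (\<lambda>x. c *\<^sub>R g x) (\<lambda>x. c *\<^sub>R H x)"
  unfolding C2_with_def inner_scaleR_left scaleR_matrix_vector_assoc[symmetric]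
  using assms by (auto simp: C2_with_def intro!: has_derivative_mult_right has_derivative_scaleR_right continuous_intros)

lemma C2_continuous:
  assumes "C2_with \<psi> g H"
  shows "continuous_on UNIV \<psi>" "continuous_on UNIV g" "continuous_on UNIV H"
  using assms unfolding C2_with_def
  by (auto intro!: has_derivative_continuous_on intro: has_derivative_at_withinI)

lemma C2_mult:
  assumes \<psi>: "C2_with \<psi> g H" and u: "C2_with u gu Hu"
  shows "C2_with (\<lambda>x. \<psi> x * u x) (\<lambda>x. \<psi> x *\<^sub>R gu x + u x *\<^sub>R g x)
    (\<lambda>x. \<psi> x *\<^sub>R Hu x + outer (gu x) (g x) + (u x *\<^sub>R H x + outer (g x) (gu x)))"
  unfolding C2_with_def
proof (intro conjI allI)
  fix x
  have d: "(\<psi> has_derivative (\<lambda>h. g x \<bullet> h)) (at x)" "(g has_derivative (\<lambda>h. H x *v h)) (at x)"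
    "(u has_derivative (\<lambda>h. gu x \<bullet> h)) (at x)" "(gu has_derivative (\<lambda>h. Hu x *v h)) (at x)"
    using \<psi> u by (auto simp: C2_with_def)
  have e: "(\<lambda>h. (\<psi> x *\<^sub>R gu x + u x *\<^sub>R g x) \<bullet> h) = (\<lambda>h. \<psi> x * (gu x \<bullet> h) + (g x \<bullet> h) * u x)"
    by (simp add: fun_eq_iff inner_add_left)
  show "((\<lambda>x. \<psi> x * u x) has_derivative (\<lambda>h. (\<psi> x *\<^sub>R gu x + u x *\<^sub>R g x) \<bullet> h)) (at x)"
    unfolding e by (rule has_derivative_mult[OF d(1,3)])
  have e: "(\<lambda>h. (\<psi> x *\<^sub>R Hu x + outer (gu x) (g x) + (u x *\<^sub>R H x + outer (g x) (gu x))) *v h)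
    = (\<lambda>h. (\<psi> x *\<^sub>R (Hu x *v h) + (g x \<bullet> h) *\<^sub>R gu x) + (u x *\<^sub>R (H x *v h) + (gu x \<bullet> h) *\<^sub>R g x))"
    by (simp add: fun_eq_iff matrix_vector_mult_add_rdistrib outer_mult scaleR_matrix_vector_assoc)
  show "((\<lambda>x. \<psi> x *\<^sub>R gu x + u x *\<^sub>R g x) has_derivative
      (\<lambda>h. (\<psi> x *\<^sub>R Hu x + outer (gu x) (g x) + (u x *\<^sub>R H x + outer (g x) (gu x))) *v h)) (at x)"
    unfolding e by (intro has_derivative_add has_derivative_scaleR d)
next
  have "continuous_on UNIV (\<lambda>x. outer (a x) (b x))" if "continuous_on UNIV a" "continuous_on UNIV b" for a b :: "real^'a \<Rightarrow> real^'a"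
    unfolding outer_def using that by (intro continuous_intros) auto
  then show "continuous_on UNIV (\<lambda>x. \<psi> x *\<^sub>R Hu x + outer (gu x) (g x) + (u x *\<^sub>R H x + outer (g x) (gu x)))"
    using C2_continuous[OF \<psi>] C2_continuous[OF u] by (intro continuous_intros)
qed

lemma C2_radial:
  assumes h: "\<And>u. 0 \<le> u \<Longrightarrow> (h has_real_derivative h' u) (at u)"
    and h': "\<And>u. 0 \<le> u \<Longrightarrow> (h' has_real_derivative h'' u) (at u)"
    and h'': "continuous_on {0..} h''"
  shows "C2_with (\<lambda>x::real^'d. h (x \<bullet> x)) (\<lambda>x. (2 * h' (x \<bullet> x)) *\<^sub>R x)
    (\<lambda>x. (2 * h' (x \<bullet> x)) *\<^sub>R mat 1 + (4 * h'' (x \<bullet> x)) *\<^sub>R outer x x)"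
proof -
  have sq: "((\<lambda>x::real^'d. x \<bullet> x) has_derivative (\<lambda>h. 2 * (x \<bullet> h))) (at x)" for x
    by (auto intro!: derivative_eq_intros simp: inner_commute)
  have comp: "((\<lambda>x::real^'d. f (x \<bullet> x)) has_derivative (\<lambda>v. f' (x \<bullet> x) * (2 * (x \<bullet> v)))) (at x)"
    if "\<And>u. 0 \<le> u \<Longrightarrow> (f has_real_derivative f' u) (at u)" for f f' x
    using that[of "x \<bullet> x"] unfolding has_field_derivative_def
    by (intro has_derivative_compose[OF sq, of f]) auto
  have c': "continuous_on {0..} h'"
    using h' by (intro continuous_at_imp_continuous_on) (auto intro: DERIV_isCont)
  show ?thesis
    unfolding C2_with_def
  proof (intro conjI allI)
    fix x :: "real^'d"
    have e: "(\<lambda>v. (2 * h' (x \<bullet> x)) *\<^sub>R x \<bullet> v) = (\<lambda>v. h' (x \<bullet> x) * (2 * (x \<bullet> v)))" by (simp add: fun_eq_iff)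
    show "((\<lambda>x. h (x \<bullet> x)) has_derivative (\<lambda>v. (2 * h' (x \<bullet> x)) *\<^sub>R x \<bullet> v)) (at x)"
      unfolding e by (rule comp[OF h])
    have e: "(\<lambda>v. ((2 * h' (x \<bullet> x)) *\<^sub>R mat 1 + (4 * h'' (x \<bullet> x)) *\<^sub>R outer x x) *v v)
      = (\<lambda>v. (2 * h' (x \<bullet> x)) *\<^sub>R v + (2 * (h'' (x \<bullet> x) * (2 * (x \<bullet> v)))) *\<^sub>R x)"
      by (simp add: fun_eq_iff matrix_vector_mult_add_rdistrib outer_mult scaleR_matrix_vector_assoc[symmetric])
    show "((\<lambda>x. (2 * h' (x \<bullet> x)) *\<^sub>R x) has_derivative
      (\<lambda>v. ((2 * h' (x \<bullet> x)) *\<^sub>R mat 1 + (4 * h'' (x \<bullet> x)) *\<^sub>R outer x x) *v v)) (at x)"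
      unfolding e by (intro has_derivative_scaleR has_derivative_mult_right comp[OF h'] has_derivative_ident)
    have "continuous_on UNIV (\<lambda>x::real^'d. h' (x \<bullet> x))" "continuous_on UNIV (\<lambda>x::real^'d. h'' (x \<bullet> x))"
      by (auto intro!: continuous_on_compose2[OF c'] continuous_on_compose2[OF h''] continuous_intros)
    moreover have "continuous_on UNIV (\<lambda>x::real^'d. outer x x)"
      unfolding outer_def by (intro continuous_intros)
    ultimately show "continuous_on UNIV (\<lambda>x::real^'d. (2 * h' (x \<bullet> x)) *\<^sub>R mat 1 + (4 * h'' (x \<bullet> x)) *\<^sub>R outer x x)"
      by (intro continuous_intros)
  qed
qed

lemma C2_square: "C2_with (\<lambda>x::real^'d. x \<bullet> x) (\<lambda>x. 2 *\<^sub>R x) (\<lambda>x. 2 *\<^sub>R mat 1)"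
  using C2_radial[of "\<lambda>u. u" "\<lambda>u. 1" "\<lambda>u. 0", where 'd = 'd]
  by (auto simp: DERIV_ident)

text \<open>
  Integrating the bound on the Hessian once and twice.
\<close>

lemma C2b_growth:
  assumes \<psi>: "C2_with \<psi> g H" and B: "\<And>x. norm (H x) \<le> B"
  shows "norm (g x) \<le> norm (g 0) + B * norm x"
    and "\<bar>\<psi> x\<bar> \<le> \<bar>\<psi> 0\<bar> + norm x * (norm (g 0) + B * norm x)"
proof -
  have B0: "0 \<le> B" using B[of 0] norm_ge_zero order_trans by blast
  have g: "norm (g y) \<le> norm (g 0) + B * norm y" for y
  proof -
    have "norm (g y - g 0) \<le> B * norm (y - 0)"
    proof (rule differentiable_bound[where f' = "\<lambda>x h. H x *v h" and S = UNIV])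
      show "onorm (\<lambda>h. H x *v h) \<le> B" for x
      proof (rule onorm_le)
        fix h show "norm (H x *v h) \<le> B * norm h"
          using norm_matrix_vector_le[of "H x" h] mult_right_mono[OF B[of x], of "norm h"] by simp
      qed
    qed (use \<psi> in \<open>auto simp: C2_with_def intro: has_derivative_at_withinI\<close>)
    then show ?thesis using norm_triangle_sub[of "g y" "g 0"] by simp
  qed
  show "norm (g x) \<le> norm (g 0) + B * norm x" by (rule g)
  have "norm (\<psi> x - \<psi> 0) \<le> (norm (g 0) + B * norm x) * norm (x - 0)"
  proof (rule differentiable_bound[where f' = "\<lambda>y h. g y \<bullet> h" and S = "cball 0 (norm x)"])
    fix y :: "real^'a" assume y: "y \<in> cball 0 (norm x)"
    show "onorm (\<lambda>h. g y \<bullet> h) \<le> norm (g 0) + B * norm x"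
    proof (rule onorm_le)
      fix h
      have "norm (g y) \<le> norm (g 0) + B * norm x"
        using g[of y] mult_left_mono[OF _ B0, of "norm y" "norm x"] y by simp
      then show "norm (g y \<bullet> h) \<le> (norm (g 0) + B * norm x) * norm h"
        using Cauchy_Schwarz_ineq2[of "g y" h] mult_right_mono[of "norm (g y)" _ "norm h"] by fastforce
    qed
  qed (use \<psi> in \<open>auto simp: C2_with_def intro: has_derivative_at_withinI\<close>)
  then show "\<bar>\<psi> x\<bar> \<le> \<bar>\<psi> 0\<bar> + norm x * (norm (g 0) + B * norm x)" by (simp add: mult.commute)
qed

lemma C2b_quadratic_growth:
  assumes \<psi>: "C2_with \<psi> g H" and B: "bounded (range H)"
  shows "\<exists>C>0. \<forall>x. \<bar>\<psi> x\<bar> \<le> C * (1 + x \<bullet> x) \<and> norm (g x) \<le> C * (1 + norm x) \<and> norm (H x) \<le> C"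
proof -
  obtain B where B: "\<And>x. norm (H x) \<le> B" using B by (auto simp: bounded_iff)
  have B0: "0 \<le> B" using B[of 0] norm_ge_zero order_trans by blast
  define C where "C = \<bar>\<psi> 0\<bar> + norm (g 0) + B + 1"
  have "\<bar>\<psi> x\<bar> \<le> C * (1 + x \<bullet> x)" for x
  proof -
    define q where "q = x \<bullet> x"
    have q: "q = norm x * norm x" "0 \<le> q" by (simp_all add: q_def dot_square_norm power2_eq_square)
    have "norm x \<le> 1 + q"
      using zero_le_power2[of "norm x - 1"] q by (simp add: power2_eq_square algebra_simps)
        (use norm_ge_zero[of x] in linarith)
    then have 1: "norm x * norm (g 0) \<le> (1 + q) * norm (g 0)" by (rule mult_right_mono) simp
    have 2: "norm x * (B * norm x) = B * q" by (simp add: q)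
    have 3: "0 \<le> \<bar>\<psi> 0\<bar> * q" using q by simp
    have "C * (1 + q) = \<bar>\<psi> 0\<bar> + \<bar>\<psi> 0\<bar> * q + (1 + q) * norm (g 0) + B * q + B + 1 + q"
      by (simp add: C_def algebra_simps)
    then show ?thesis using C2b_growth(2)[OF \<psi> B, of x] B0 1 2 3 q(2)
      unfolding q_def[symmetric] distrib_left by linarith
  qed
  moreover have "norm (g x) \<le> C * (1 + norm x)" for x
  proof -
    have "norm (g 0) + B * norm x \<le> C * 1 + C * norm x"
      using B0 by (intro add_mono mult_right_mono) (auto simp: C_def)
    then show ?thesis using C2b_growth(1)[OF \<psi> B, of x] by (simp add: algebra_simps)
  qed
  moreover have "norm (H x) \<le> C" for x
    using B[of x] by (simp add: C_def) (smt (verit) norm_ge_zero)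
  moreover have "C > 0" using B0 by (simp add: C_def add_nonneg_pos)
  ultimately show ?thesis by blast
qed

lemma P2D:
  assumes "p \<in> P2"
  shows "prob_space p" "sets p = sets borel" "space p = UNIV" "integrable p (\<lambda>x. x \<bullet> x)"
proof -
  show p: "prob_space p" "sets p = sets borel" using assms by (auto simp: P2_def)
  show "space p = UNIV" using sets_eq_imp_space_eq[OF p(2)] by simp
  have m: "(\<lambda>x::real^'a. x \<bullet> x) \<in> borel_measurable p"
    by (rule measurable_sets_eq[OF _ p(2)[symmetric]]) measurable
  have "(\<integral>\<^sup>+x. ennreal (x \<bullet> x) \<partial>p) < \<infinity>" using assms by (simp add: P2_def power2_norm_eq_inner)
  then show "integrable p (\<lambda>x. x \<bullet> x)" using m by (intro integrableI_nonneg) auto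
qed

lemma P2_integrable_quadratic:
  fixes \<psi> :: "real^'d \<Rightarrow> real"
  assumes p: "p \<in> P2" and m: "\<psi> \<in> borel_measurable borel" and C: "\<And>x. \<bar>\<psi> x\<bar> \<le> C * (1 + x \<bullet> x)"
  shows "integrable p \<psi>"
proof (rule Bochner_Integration.integrable_bound)
  interpret prob_space p using P2D(1)[OF p] .
  show "integrable p (\<lambda>x. C * (1 + x \<bullet> x))" using P2D(4)[OF p] by auto
  show "\<psi> \<in> borel_measurable p" using measurable_sets_eq[OF m P2D(2)[OF p, symmetric]] .
  show "AE x in p. norm (\<psi> x) \<le> norm (C * (1 + x \<bullet> x))" using C by (intro AE_I2) (metis abs_ge_self order_trans real_norm_def)
qed

lemma C2b_integrable:
  assumes "C2b \<psi>" "p \<in> P2" shows "integrable p \<psi>"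
proof -
  obtain g H where H: "C2_with \<psi> g H" "bounded (range H)" using assms by (auto simp: C2b_iff)
  obtain C where C: "\<And>x. \<bar>\<psi> x\<bar> \<le> C * (1 + x \<bullet> x)"
    using C2b_quadratic_growth[OF H] by blast
  show ?thesis
    using C2_continuous(1)[OF H(1)] C
    by (intro P2_integrable_quadratic[OF assms(2)] borel_measurable_continuous_onI)
qed

section \<open>Integrals over the unit interval\<close>

definition U01 :: "real measure" where
  "U01 = restrict_space lborel {0<..<1}"

lemma space_U01[simp]: "space U01 = {0<..<1}"
  by (simp add: U01_def space_restrict_space)

lemma sets_U01: "sets U01 = sets (restrict_space borel {0<..<1})"
  unfolding U01_def by (intro sets_restrict_space_cong) simp

lemma prob_space_U01: "prob_space U01"
  by (rule prob_spaceI) (simp add: U01_def emeasure_restrict_space space_restrict_space)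

lemma set_integral_U01:
  fixes h :: "real \<Rightarrow> 'b::{banach, second_countable_topology}"
  shows "(LINT t:{0<..<1}|lborel. h t) = (\<integral>t. h t \<partial>U01)"
  unfolding U01_def set_lebesgue_integral_def by (subst integral_restrict_space) auto

lemma set_integrable_U01:
  fixes h :: "real \<Rightarrow> 'b::{banach, second_countable_topology}"
  shows "set_integrable lborel {0<..<1} h \<longleftrightarrow> integrable U01 h"
  unfolding U01_def set_integrable_def by (subst integrable_restrict_space) auto

lemma nn_integral_U01: "(\<integral>\<^sup>+t\<in>{0<..<1}. h t \<partial>lborel) = (\<integral>\<^sup>+t. h t \<partial>U01)"
  unfolding U01_def by (subst nn_integral_restrict_space) auto

lemma measurable_U01: "f \<in> measurable (restrict_space borel {0<..<1}) N \<longleftrightarrow> f \<in> measurable U01 N"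
  using measurable_cong_sets[OF sets_U01 refl] by blast

lemma U01_continuous_measurable:
  fixes f :: "real \<Rightarrow> 'b::topological_space"
  shows "continuous_on {0<..<1} f \<Longrightarrow> f \<in> borel_measurable U01"
  using borel_measurable_continuous_on_restrict measurable_U01 by blast

lemma U01_FTC:
  fixes F :: "real \<Rightarrow> real"
  assumes F: "\<And>t. t \<in> {0..1} \<Longrightarrow> (F has_real_derivative F' t) (at t)" and F': "continuous_on {0..1} F'"
  shows "(\<integral>t. F' t \<partial>U01) = F 1 - F 0"
proof -
  have "(LBINT t=ereal 0..ereal 1. F' t) = F 1 - F 0"
    by (rule interval_integral_FTC_finite)
       (use F F' in \<open>auto simp: has_real_derivative_iff_has_vector_derivative[symmetric] intro: has_field_derivative_at_within\<close>)
  then show ?thesis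
    by (subst (asm) interval_integral_Ioo) (auto simp: set_integral_U01[symmetric])
qed

text \<open>
  A function on \<open>[0, \<infinity>)\<close> with vanishing derivative at 0 extends by a constant to a \<open>C\<^sup>1\<close> function.
\<close>

lemma DERIV_max_comp:
  fixes k :: "real \<Rightarrow> real"
  assumes k: "\<And>v. 0 \<le> v \<Longrightarrow> (k has_real_derivative k' v) (at v)" and k0: "k' 0 = 0"
  shows "((\<lambda>s. k (max 0 (s - c))) has_real_derivative k' (max 0 (x - c))) (at x)"
proof -
  consider "x < c" | "x > c" | "x = c" by linarith
  then show ?thesis
  proof cases
    case 1
    have "((\<lambda>s. k 0) has_real_derivative 0) (at x)" by simp
    then have "((\<lambda>s. k (max 0 (s - c))) has_real_derivative 0) (at x)"
      by (rule has_field_derivative_transform_within_open[where S = "{..<c}"]) (use 1 in auto)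
    then show ?thesis using 1 k0 by simp
  next
    case 2
    have "((\<lambda>s. k (s - c)) has_real_derivative k' (x - c) * 1) (at x)"
      using 2 by (intro DERIV_chain2[OF k]) (auto intro!: derivative_eq_intros)
    then have "((\<lambda>s. k (max 0 (s - c))) has_real_derivative k' (x - c) * 1) (at x)"
      by (rule has_field_derivative_transform_within_open[where S = "{c<..}"]) (use 2 in auto)
    then show ?thesis using 2 by simp
  next
    case 3
    have "((\<lambda>h. (k (max 0 (x + h - c)) - k (max 0 (x - c))) / h) \<longlongrightarrow> 0) (at 0)"
    proof (rule Lim_null_comparison)
      have "((\<lambda>h. (k (0 + h) - k 0) / h) \<longlongrightarrow> 0) (at 0)" using k[of 0] k0 by (simp add: DERIV_def)
      then show "((\<lambda>h. \<bar>(k h - k 0) / h\<bar>) \<longlongrightarrow> 0) (at 0)" by (intro tendsto_rabs_zero) simp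
      have "norm ((k (max 0 (x + h - c)) - k (max 0 (x - c))) / h) \<le> \<bar>(k h - k 0) / h\<bar>" for h
        using 3 by (cases "0 < h") (auto simp del: abs_divide)
      then show "\<forall>\<^sub>F h in at 0. norm ((k (max 0 (x + h - c)) - k (max 0 (x - c))) / h) \<le> \<bar>(k h - k 0) / h\<bar>" by simp
    qed
    then show ?thesis using 3 k0 by (simp add: DERIV_def)
  qed
qed

lemma DERIV_max_sq: "((\<lambda>s::real. (max 0 (s - c))\<^sup>2) has_real_derivative 2 * max 0 (x - c)) (at x)"
  by (rule DERIV_max_comp[where k = "\<lambda>v. v\<^sup>2" and k' = "\<lambda>v. 2 * v"]) (auto intro!: derivative_eq_intros)

text \<open>A \<open>C\<^sup>1\<close> step from 0 to 1 whose derivative is the tent function on \<open>[0, 2]\<close>.\<close>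

definition tent :: "real \<Rightarrow> real" where
  "tent s = max 0 s - 2 * max 0 (s - 1) + max 0 (s - 2)"

definition smooth_step :: "real \<Rightarrow> real" where
  "smooth_step s = ((max 0 s)\<^sup>2 - 2 * (max 0 (s - 1))\<^sup>2 + (max 0 (s - 2))\<^sup>2) / 2"

lemma DERIV_smooth_step: "(smooth_step has_real_derivative tent s) (at s)"
proof -
  have "((\<lambda>s. ((max 0 (s - 0))\<^sup>2 - 2 * (max 0 (s - 1))\<^sup>2 + (max 0 (s - 2))\<^sup>2) / 2) has_real_derivative
     (2 * max 0 (s - 0) - 2 * (2 * max 0 (s - 1)) + 2 * max 0 (s - 2)) / 2) (at s)"
    by (intro DERIV_cdivide DERIV_add DERIV_diff DERIV_cmult DERIV_max_sq)
  then show ?thesis by (simp add: smooth_step_def[abs_def] tent_def diff_divide_distrib add_divide_distrib)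
qed

lemma continuous_tent: "continuous_on UNIV tent"
  unfolding tent_def[abs_def] by (intro continuous_intros)

lemma tent_nonneg: "0 \<le> tent s"
  by (auto simp: tent_def max_def)

lemma tent_outside: "s \<le> 0 \<or> 2 \<le> s \<Longrightarrow> tent s = 0"
  by (auto simp: tent_def max_def)

lemma smooth_step_neg: "s \<le> 0 \<Longrightarrow> smooth_step s = 0"
  by (simp add: smooth_step_def)

lemma smooth_step_ge_2: "2 \<le> s \<Longrightarrow> smooth_step s = 1"
  by (simp add: smooth_step_def power2_eq_square algebra_simps)

lemma smooth_step_mono: "s \<le> t \<Longrightarrow> smooth_step s \<le> smooth_step t"
  using DERIV_nonneg_imp_nondecreasing[of s t smooth_step] DERIV_smooth_step tent_nonneg by blast

lemma smooth_step_bounds: "0 \<le> smooth_step s" "smooth_step s \<le> 1"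
  using smooth_step_mono[of "min s 0" s] smooth_step_mono[of s "max s 2"]
    smooth_step_neg[of "min s 0"] smooth_step_ge_2[of "max s 2"] by auto

lemma U01_integrable_continuous:
  fixes h :: "real \<Rightarrow> real"
  assumes h: "continuous_on {0..1} h"
  shows "integrable U01 h"
proof -
  have "bounded (h ` {0..1})" using h by (intro compact_imp_bounded compact_continuous_image) auto
  then obtain B where B: "\<forall>t\<in>{0..1}. norm (h t) \<le> B" unfolding bounded_iff by blast
  have "h \<in> borel_measurable U01"
    using h by (intro U01_continuous_measurable) (rule continuous_on_subset, auto)
  then show ?thesis
    using prob_space_U01 B by (intro finite_measure.integrable_const_bound[where B = B])
      (auto simp: prob_space_def)
qed

lemma integral_continuous_bump:
  fixes \<alpha> k :: "real \<Rightarrow> real"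
  assumes \<alpha>: "continuous_on {0..1} \<alpha>" and k: "continuous_on {0..1} k" "\<And>t. 0 \<le> k t" "(\<integral>t. k t \<partial>U01) = 1"
    and near: "\<And>t. t \<in> {0..1} \<Longrightarrow> k t \<noteq> 0 \<Longrightarrow> \<bar>\<alpha> t - a\<bar> \<le> e"
  shows "\<bar>(\<integral>t. k t * \<alpha> t \<partial>U01) - a\<bar> \<le> e"
proof -
  have ik: "integrable U01 k" "integrable U01 (\<lambda>t. k t * \<alpha> t)" "integrable U01 (\<lambda>t. k t * (\<alpha> t - a))"
    using \<alpha> k by (auto intro!: U01_integrable_continuous continuous_intros)
  have "(\<integral>t. k t * \<alpha> t \<partial>U01) - a = (\<integral>t. k t * \<alpha> t \<partial>U01) - (\<integral>t. k t * a \<partial>U01)" using k(3) by simp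
  also have "\<dots> = (\<integral>t. k t * (\<alpha> t - a) \<partial>U01)"
    using ik by (subst Bochner_Integration.integral_diff[symmetric]) (auto simp: algebra_simps)
  also have "norm \<dots> \<le> (\<integral>t. k t * e \<partial>U01)"
  proof (rule norm_integral_le_integral)
    fix t assume "t \<in> space U01"
    then show "norm (k t * (\<alpha> t - a)) \<le> k t * e"
      using near[of t] k(2)[of t] by (cases "k t = 0") (auto simp: abs_mult intro!: mult_left_mono)
  qed (use ik in auto)
  also have "\<dots> = e" using k(3) by simp
  finally show ?thesis by simp
qed

text \<open>
  If \<open>\<alpha>' = \<beta>\<close> weakly on \<open>(0, 1)\<close> and \<open>\<alpha>\<close> is continuous up to the endpoints, then testing with
  smooth approximations of the indicator of \<open>(0, 1)\<close> gives the fundamental theorem of calculus.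
\<close>

lemma weak_derivative_FTC:
  fixes \<alpha> \<beta> :: "real \<Rightarrow> real"
  assumes \<alpha>: "continuous_on {0..1} \<alpha>" and \<beta>: "integrable U01 \<beta>"
    and weak: "\<And>\<eta> \<eta>' \<delta>. 0 < \<delta> \<Longrightarrow> (\<And>t. (\<eta> has_real_derivative \<eta>' t) (at t)) \<Longrightarrow> continuous_on UNIV \<eta>' \<Longrightarrow>
      (\<And>t. t < \<delta> \<or> t > 1 - \<delta> \<Longrightarrow> \<eta> t = 0) \<Longrightarrow> (\<integral>t. \<eta>' t * \<alpha> t \<partial>U01) = - (\<integral>t. \<eta> t * \<beta> t \<partial>U01)"
  shows "\<alpha> 1 - \<alpha> 0 = (\<integral>t. \<beta> t \<partial>U01)"
proof -
  (* For n >= 4 the step \<eta> n rises from 0 to 1 on [1/n, 3/n] and falls back on [1 - 3/n, 1 - 1/n]; its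
     derivative k0 n - k1 n is a difference of probability densities close to 0 and to 1. *)
  define k0 k1 where "k0 = (\<lambda>n t. n * tent (n * t - 1))" and "k1 = (\<lambda>n t. n * tent (n * t - n + 3))" for n t :: real
  define \<eta> where "\<eta> = (\<lambda>(n::real) t. smooth_step (n * t - 1) - smooth_step (n * t - n + 3))"
  have dk0: "((\<lambda>t. smooth_step (n * t - 1)) has_real_derivative k0 n t) (at t)" for n t
    unfolding k0_def by (rule DERIV_chain2[OF DERIV_smooth_step, THEN DERIV_cong]) (auto intro!: derivative_eq_intros)
  have dk1: "((\<lambda>t. smooth_step (n * t - n + 3)) has_real_derivative k1 n t) (at t)" for n t
    unfolding k1_def by (rule DERIV_chain2[OF DERIV_smooth_step, THEN DERIV_cong]) (auto intro!: derivative_eq_intros)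
  have ck: "continuous_on S (k0 n)" "continuous_on S (k1 n)" for n S
    unfolding k0_def k1_def by (auto intro!: continuous_intros continuous_on_compose2[OF continuous_tent])
  have pk: "0 \<le> k0 n t" "0 \<le> k1 n t" if "0 \<le> n" for n t using that by (auto simp: k0_def k1_def tent_nonneg)
  have ik0: "(\<integral>t. k0 n t \<partial>U01) = 1" if "4 \<le> n" for n
    using that by (subst U01_FTC[OF dk0 ck(1)]) (simp add: smooth_step_neg smooth_step_ge_2)
  have ik1: "(\<integral>t. k1 n t \<partial>U01) = 1" if "4 \<le> n" for n
    using that by (subst U01_FTC[OF dk1 ck(2)]) (simp add: smooth_step_neg smooth_step_ge_2)
  have eq: "(\<integral>t. k0 n t * \<alpha> t \<partial>U01) - (\<integral>t. k1 n t * \<alpha> t \<partial>U01) = - (\<integral>t. \<eta> n t * \<beta> t \<partial>U01)" if n: "4 \<le> n" for n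
  proof -
    have "(\<integral>t. (k0 n t - k1 n t) * \<alpha> t \<partial>U01) = - (\<integral>t. \<eta> n t * \<beta> t \<partial>U01)"
    proof (rule weak[of "1 / n"])
      show "(\<eta> n has_real_derivative k0 n t - k1 n t) (at t)" for t
        unfolding \<eta>_def by (intro DERIV_diff dk0 dk1)
      show "continuous_on UNIV (\<lambda>t. k0 n t - k1 n t)" by (intro continuous_intros ck)
      fix t assume "t < 1 / n \<or> t > 1 - 1 / n"
      then show "\<eta> n t = 0"
      proof
        assume "t < 1 / n"
        then have "n * t < 1" using n by (simp add: field_simps)
        then show ?thesis using n by (simp add: \<eta>_def smooth_step_neg)
      next
        assume "t > 1 - 1 / n"
        then have "n * t > n - 1" using n by (simp add: field_simps)
        then show ?thesis using n by (simp add: \<eta>_def smooth_step_ge_2)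
      qed
    qed (use n in auto)
    moreover have "integrable U01 (\<lambda>t. k n t * \<alpha> t)" if "k = k0 \<or> k = k1" for k
      using that \<alpha> ck by (auto intro!: U01_integrable_continuous continuous_intros)
    ultimately show ?thesis by (simp add: left_diff_distrib)
  qed
  have lim0: "(\<lambda>n. \<integral>t. k0 (real n) t * \<alpha> t \<partial>U01) \<longlonglongrightarrow> \<alpha> 0"
    unfolding LIMSEQ_def
  proof (intro allI impI)
    fix e :: real assume "0 < e"
    then obtain d where d: "0 < d" "\<And>t. t \<in> {0..1} \<Longrightarrow> dist t 0 < d \<Longrightarrow> dist (\<alpha> t) (\<alpha> 0) < e / 2"
      using \<alpha>[unfolded continuous_on_iff, rule_format, of 0 "e / 2"] by auto
    obtain N where N: "3 / d < real N" using reals_Archimedean2 by blast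
    have "\<bar>(\<integral>t. k0 (real n) t * \<alpha> t \<partial>U01) - \<alpha> 0\<bar> \<le> e / 2" if n: "n \<ge> max N 4" for n
    proof (rule integral_continuous_bump[OF \<alpha> ck(1) pk(1) ik0])
      fix t :: real assume t: "t \<in> {0..1}" "k0 (real n) t \<noteq> 0"
      have "3 / d < real n" using N n by linarith
      then have "3 < real n * d" using d by (simp add: field_simps)
      moreover have "real n * t < 3"
      proof (rule ccontr)
        assume "\<not> real n * t < 3"
        then have "tent (real n * t - 1) = 0" by (intro tent_outside) auto
        then show False using t by (simp add: k0_def)
      qed
      ultimately have "real n * t < real n * d" by linarith
      then have "t < d" by (simp add: mult_less_cancel_left)
      then show "\<bar>\<alpha> t - \<alpha> 0\<bar> \<le> e / 2" using d(2)[of t] t by (simp add: dist_real_def)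
    qed (use n in auto)
    then show "\<exists>no. \<forall>n\<ge>no. dist (\<integral>t. k0 (real n) t * \<alpha> t \<partial>U01) (\<alpha> 0) < e"
      using \<open>0 < e\<close> by (intro exI[of _ "max N 4"]) (fastforce simp: dist_real_def)
  qed
  have lim1: "(\<lambda>n. \<integral>t. k1 (real n) t * \<alpha> t \<partial>U01) \<longlonglongrightarrow> \<alpha> 1"
    unfolding LIMSEQ_def
  proof (intro allI impI)
    fix e :: real assume "0 < e"
    then obtain d where d: "0 < d" "\<And>t. t \<in> {0..1} \<Longrightarrow> dist t 1 < d \<Longrightarrow> dist (\<alpha> t) (\<alpha> 1) < e / 2"
      using \<alpha>[unfolded continuous_on_iff, rule_format, of 1 "e / 2"] by auto
    obtain N where N: "3 / d < real N" using reals_Archimedean2 by blast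
    have "\<bar>(\<integral>t. k1 (real n) t * \<alpha> t \<partial>U01) - \<alpha> 1\<bar> \<le> e / 2" if n: "n \<ge> max N 4" for n
    proof (rule integral_continuous_bump[OF \<alpha> ck(2) pk(2) ik1])
      fix t :: real assume t: "t \<in> {0..1}" "k1 (real n) t \<noteq> 0"
      have "3 / d < real n" using N n by linarith
      then have "3 < real n * d" using d by (simp add: field_simps)
      moreover have "real n * t > real n - 3"
      proof (rule ccontr)
        assume "\<not> real n * t > real n - 3"
        then have "tent (real n * t - real n + 3) = 0" by (intro tent_outside) auto
        then show False using t by (simp add: k1_def)
      qed
      ultimately have "real n * (1 - t) < real n * d" by (simp add: algebra_simps)
      then have "1 - t < d" by (simp add: mult_less_cancel_left)
      then show "\<bar>\<alpha> t - \<alpha> 1\<bar> \<le> e / 2" using d(2)[of t] t by (simp add: dist_real_def)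
    qed (use n in auto)
    then show "\<exists>no. \<forall>n\<ge>no. dist (\<integral>t. k1 (real n) t * \<alpha> t \<partial>U01) (\<alpha> 1) < e"
      using \<open>0 < e\<close> by (intro exI[of _ "max N 4"]) (fastforce simp: dist_real_def)
  qed
  have lim\<eta>: "(\<lambda>n. \<integral>t. \<eta> (real n) t * \<beta> t \<partial>U01) \<longlonglongrightarrow> (\<integral>t. \<beta> t \<partial>U01)"
  proof (rule integral_dominated_convergence[where w = "\<lambda>t. norm (\<beta> t)"])
    have c\<eta>: "continuous_on S (\<eta> n)" for n S
      unfolding \<eta>_def by (intro continuous_at_imp_continuous_on ballI isCont_diff DERIV_isCont[OF dk0] DERIV_isCont[OF dk1])
    have m: "\<beta> \<in> borel_measurable U01" using \<beta> by auto
    show "(\<lambda>t. \<eta> (real n) t * \<beta> t) \<in> borel_measurable U01" for n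
      by (intro borel_measurable_times U01_continuous_measurable c\<eta> m)
    show "integrable U01 (\<lambda>t. norm (\<beta> t))" using \<beta> by auto
    have b: "\<bar>\<eta> n t\<bar> \<le> 1" for n t
      using smooth_step_bounds[of "n * t - 1"] smooth_step_bounds[of "n * t - n + 3"] by (simp add: \<eta>_def)
    show "AE t in U01. norm (\<eta> (real n) t * \<beta> t) \<le> norm (\<beta> t)" for n
      using b mult_right_mono[OF b abs_ge_zero] by (auto simp: abs_mult)
    show "AE t in U01. (\<lambda>n. \<eta> (real n) t * \<beta> t) \<longlonglongrightarrow> \<beta> t"
    proof (rule AE_I2)
      fix t :: real assume "t \<in> space U01"
      then have t: "0 < t" "t < 1" by auto
      obtain N1 N2 where N: "3 / t < real N1" "3 / (1 - t) < real N2" using reals_Archimedean2 by metis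
      have "\<eta> (real n) t = 1" if "n \<ge> max N1 N2" for n
      proof -
        have "3 / t < real n" "3 / (1 - t) < real n" using N that by linarith+
        then have "3 < real n * t" "3 < real n * (1 - t)" using t by (auto simp: field_simps)
        then show ?thesis by (simp add: \<eta>_def smooth_step_neg smooth_step_ge_2 algebra_simps)
      qed
      then have "eventually (\<lambda>n. \<eta> (real n) t * \<beta> t = \<beta> t) sequentially"
        by (intro eventually_sequentiallyI[of "max N1 N2"]) auto
      then show "(\<lambda>n. \<eta> (real n) t * \<beta> t) \<longlonglongrightarrow> \<beta> t" by (rule tendsto_eventually)
    qed
  qed (use \<beta> in auto)
  have "(\<lambda>n. - (\<integral>t. \<eta> (real n) t * \<beta> t \<partial>U01)) \<longlonglongrightarrow> \<alpha> 0 - \<alpha> 1"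
  proof (rule Lim_transform_eventually[OF tendsto_diff[OF lim0 lim1]])
    show "eventually (\<lambda>n. (\<integral>t. k0 (real n) t * \<alpha> t \<partial>U01) - (\<integral>t. k1 (real n) t * \<alpha> t \<partial>U01)
        = - (\<integral>t. \<eta> (real n) t * \<beta> t \<partial>U01)) sequentially"
      using eq by (intro eventually_sequentiallyI[of 4]) auto
  qed
  from LIMSEQ_unique[OF this tendsto_minus[OF lim\<eta>]] show ?thesis by simp
qed

section \<open>Weak duality\<close>

text \<open>
  Dividing by \<open>1 + \<epsilon> (1 + |x|\<^sup>2)\<close> makes a function of quadratic growth bounded while keeping its
  Hessian bounded uniformly in \<open>\<epsilon>\<close>.
\<close>

lemma C2b_truncation:
  fixes \<psi> :: "real^'d \<Rightarrow> real"
  assumes \<psi>: "C2_with \<psi> g H" and B: "bounded (range H)"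
  shows "\<exists>C \<psi>' g' H'. \<forall>n::nat. C2_with (\<psi>' n) (g' n) (H' n) \<and> bounded (range (\<psi>' n)) \<and>
    (\<forall>x. \<bar>\<psi>' n x\<bar> \<le> \<bar>\<psi> x\<bar> \<and> norm (H' n x) \<le> C \<and> (\<lambda>n. \<psi>' n x) \<longlonglongrightarrow> \<psi> x \<and> (\<lambda>n. H' n x) \<longlonglongrightarrow> H x)"
proof -
  obtain C where C: "C > 0" "\<And>x. \<bar>\<psi> x\<bar> \<le> C * (1 + x \<bullet> x)" "\<And>x. norm (g x) \<le> C * (1 + norm x)" "\<And>x. norm (H x) \<le> C"
    using C2b_quadratic_growth[OF \<psi> B] by blast
  define \<epsilon> where "\<epsilon> = (\<lambda>n. 1 / real (Suc n))"
  have \<epsilon>: "0 < \<epsilon> n" for n by (simp add: \<epsilon>_def)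
  have \<epsilon>0: "\<epsilon> \<longlonglongrightarrow> 0" using LIMSEQ_Suc[OF lim_1_over_n] by (simp add: \<epsilon>_def)
  define q where "q = (\<lambda>n (x::real^'d). 1 / (1 + \<epsilon> n * (1 + x \<bullet> x)))"
  have den: "0 < 1 + \<epsilon> n * (1 + x \<bullet> x)" for n and x :: "real^'d" using \<epsilon>[of n] by (simp add: add_pos_nonneg)
  have q: "0 < q n x" "q n x \<le> 1" "\<epsilon> n * (1 + x \<bullet> x) * q n x \<le> 1" for n x
    using den[of n x] \<epsilon>[of n] by (auto simp: q_def field_simps add_nonneg_nonneg)
  define gq where "gq = (\<lambda>n x. (2 * (- \<epsilon> n * (q n x)\<^sup>2)) *\<^sub>R (x::real^'d))"
  define Hq where "Hq = (\<lambda>n x. (2 * (- \<epsilon> n * (q n x)\<^sup>2)) *\<^sub>R (mat 1 :: real^'d^'d) + (4 * (2 * (\<epsilon> n)\<^sup>2 * (q n x)^3)) *\<^sub>R outer x x)"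
  have C2q: "C2_with (q n) (gq n) (Hq n)" for n
  proof -
    let ?h = "\<lambda>u. 1 / (1 + \<epsilon> n * (1 + u))"
    have pos: "1 + \<epsilon> n * (1 + u) > 0" if "0 \<le> u" for u using that \<epsilon>[of n] by (simp add: add_pos_nonneg)
    have "C2_with (\<lambda>x::real^'d. ?h (x \<bullet> x)) (\<lambda>x. (2 * (- \<epsilon> n * (?h (x \<bullet> x))\<^sup>2)) *\<^sub>R x)
       (\<lambda>x. (2 * (- \<epsilon> n * (?h (x \<bullet> x))\<^sup>2)) *\<^sub>R mat 1 + (4 * (2 * (\<epsilon> n)\<^sup>2 * (?h (x \<bullet> x))^3)) *\<^sub>R outer x x)"
    proof (rule C2_radial)
      fix u :: real assume u: "0 \<le> u"
      show d: "(?h has_real_derivative - \<epsilon> n * (?h u)\<^sup>2) (at u)"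
        using pos[OF u] by (auto intro!: derivative_eq_intros simp: power2_eq_square)
      show "((\<lambda>u. - \<epsilon> n * (?h u)\<^sup>2) has_real_derivative 2 * (\<epsilon> n)\<^sup>2 * (?h u)^3) (at u)"
        by (rule DERIV_cong[OF DERIV_cmult[OF DERIV_power[OF d]]]) (simp add: power2_eq_square power3_eq_cube)
    next
      show "continuous_on {0..} (\<lambda>u. 2 * (\<epsilon> n)\<^sup>2 * (?h u)^3)"
        using pos by (intro continuous_intros) (auto simp: less_imp_neq[symmetric])
    qed
    then show ?thesis unfolding q_def gq_def Hq_def .
  qed
  define \<psi>' where "\<psi>' = (\<lambda>n x. \<psi> x * q n x)"
  define g' where "g' = (\<lambda>n x. \<psi> x *\<^sub>R gq n x + q n x *\<^sub>R g x)"
  define H' where "H' = (\<lambda>n x. \<psi> x *\<^sub>R Hq n x + outer (gq n x) (g x) + (q n x *\<^sub>R H x + outer (g x) (gq n x)))"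
  have C2': "C2_with (\<psi>' n) (g' n) (H' n)" for n
    unfolding \<psi>'_def g'_def H'_def by (rule C2_mult[OF \<psi> C2q])
  have bdd: "bounded (range (\<psi>' n))" for n
  proof (rule boundedI)
    fix y assume "y \<in> range (\<psi>' n)"
    then obtain x where y: "y = \<psi> x * q n x" by (auto simp: \<psi>'_def)
    have "\<bar>\<psi> x * q n x\<bar> \<le> C * (1 + x \<bullet> x) * q n x"
      using C(2)[of x] q(1)[of n x] by (simp add: abs_mult)
    also have "\<dots> = C / \<epsilon> n * (\<epsilon> n * (1 + x \<bullet> x) * q n x)" using \<epsilon>[of n] by simp
    also have "\<dots> \<le> C / \<epsilon> n * 1" using q(3)[where n = n and x = x] C(1) \<epsilon>[of n] by (intro mult_left_mono) auto
    finally show "norm y \<le> C / \<epsilon> n" by (simp add: y)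
  qed
  have le: "\<bar>\<psi>' n x\<bar> \<le> \<bar>\<psi> x\<bar>" for n x
    using q(1,2)[of n x] by (simp add: \<psi>'_def abs_mult mult_left_le)
  have norms: "norm x * (1 + norm x) \<le> 2 * (1 + x \<bullet> x)" for x :: "real^'d"
    using zero_le_power2[of "norm x - 1"] by (simp add: dot_square_norm power2_eq_square algebra_simps)
      (use norm_ge_zero[of x] mult_nonneg_nonneg[of "norm x" "norm x"] in linarith)
  let ?s = "norm (mat 1 :: real^'d^'d)"
  have Hb: "norm (H' n x) \<le> (2 * ?s * C + 8 * C) + 8 * C + C" for n x
  proof -
    let ?e = "\<epsilon> n" and ?q = "q n x" and ?w = "1 + x \<bullet> x"
    have w: "0 < ?w" by (simp add: add_pos_nonneg)
    have eq: "0 \<le> ?e * ?w * ?q" "?e * ?w * ?q \<le> 1" "0 < ?q" "?q \<le> 1" "0 < ?e" using \<epsilon>[of n] q[of n x] w by auto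
    define a where "a = ?e * ?w * ?q"
    have a: "0 \<le> a" "a \<le> 1" using eq by (simp_all only: a_def)
    have aq: "a * ?q \<le> 1" "a * a * ?q \<le> 1"
      using a eq by (auto intro!: mult_le_one)
    have n1: "norm (\<psi> x *\<^sub>R Hq n x) \<le> 2 * ?s * C + 8 * C"
    proof -
      have "norm (Hq n x) \<le> 2 * (?e * ?q\<^sup>2) * ?s + 4 * (2 * ?e\<^sup>2 * ?q^3) * (norm x * norm x)"
        unfolding Hq_def using eq by (intro norm_triangle_le add_mono) (auto simp: norm_outer abs_mult)
      also have "norm x * norm x \<le> ?w" by (simp add: dot_square_norm power2_eq_square)
      finally have "norm (Hq n x) \<le> 2 * (?e * ?q\<^sup>2) * ?s + 4 * (2 * ?e\<^sup>2 * ?q^3) * ?w"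
        using eq by (simp add: mult_left_mono)
      then have "\<bar>\<psi> x\<bar> * norm (Hq n x) \<le> (C * ?w) * (2 * (?e * ?q\<^sup>2) * ?s + 4 * (2 * ?e\<^sup>2 * ?q^3) * ?w)"
        using C(1,2) w by (intro mult_mono) auto
      also have "\<dots> = 2 * ?s * C * ((?e * ?w * ?q) * ?q) + 8 * C * ((?e * ?w * ?q) * (?e * ?w * ?q) * ?q)"
        by (simp add: power2_eq_square power3_eq_cube algebra_simps)
      also have "\<dots> \<le> 2 * ?s * C * 1 + 8 * C * 1"
        using aq C(1) unfolding a_def[symmetric] by (intro add_mono mult_left_mono) auto
      finally show ?thesis by simp
    qed
    have n2: "norm (gq n x) * norm (g x) \<le> 4 * C"
    proof -
      have "norm (gq n x) * norm (g x) \<le> (2 * ?e * ?q\<^sup>2 * norm x) * (C * (1 + norm x))"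
        using eq C(3)[of x] by (intro mult_mono) (auto simp: gq_def abs_mult)
      also have "\<dots> = (2 * C * ?e * ?q\<^sup>2) * (norm x * (1 + norm x))" by (simp add: algebra_simps)
      also have "\<dots> \<le> (2 * C * ?e * ?q\<^sup>2) * (2 * ?w)" using eq C(1) by (intro mult_left_mono norms) auto
      also have "\<dots> = 4 * C * ((?e * ?w * ?q) * ?q)" by (simp add: power2_eq_square algebra_simps)
      also have "\<dots> \<le> 4 * C * 1" using aq C(1) unfolding a_def[symmetric] by (intro mult_left_mono) auto
      finally show ?thesis by simp
    qed
    have n3: "norm (q n x *\<^sub>R H x) \<le> C"
      using eq C(4)[of x] by (simp add: mult_left_le_one_le order_trans[OF mult_left_le_one_le])
    have "norm (H' n x) \<le> norm (\<psi> x *\<^sub>R Hq n x) + norm (outer (gq n x) (g x)) + (norm (q n x *\<^sub>R H x) + norm (outer (g x) (gq n x)))"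
      unfolding H'_def by (intro norm_triangle_mono order_refl norm_triangle_ineq)
    then show ?thesis using n1 n2 n3 by (simp add: norm_outer mult.commute)
  qed
  have q1: "(\<lambda>n. q n x) \<longlonglongrightarrow> 1" for x
  proof -
    have "(\<lambda>n. 1 / (1 + \<epsilon> n * (1 + x \<bullet> x))) \<longlonglongrightarrow> 1 / (1 + 0 * (1 + x \<bullet> x))"
      by (intro tendsto_intros \<epsilon>0) auto
    then show ?thesis by (simp add: q_def)
  qed
  have lim: "(\<lambda>n. \<psi>' n x) \<longlonglongrightarrow> \<psi> x" for x
    using tendsto_mult[OF tendsto_const q1, of "\<psi> x" x] by (simp add: \<psi>'_def)
  have gq0: "(\<lambda>n. gq n x) \<longlonglongrightarrow> 0" for x
  proof -
    have "(\<lambda>n. (2 * (- \<epsilon> n * (q n x)\<^sup>2)) *\<^sub>R x) \<longlonglongrightarrow> (2 * (- 0 * 1\<^sup>2)) *\<^sub>R x"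
      by (intro tendsto_intros \<epsilon>0 q1)
    then show ?thesis by (simp add: gq_def)
  qed
  have Hq0: "(\<lambda>n. Hq n x) \<longlonglongrightarrow> 0" for x
  proof -
    have "(\<lambda>n. Hq n x) \<longlonglongrightarrow> (2 * (- 0 * 1\<^sup>2)) *\<^sub>R (mat 1 :: real^'d^'d) + (4 * (2 * 0\<^sup>2 * 1^3)) *\<^sub>R outer x x"
      unfolding Hq_def by (intro tendsto_intros \<epsilon>0 q1)
    then show ?thesis by simp
  qed
  have o0: "(\<lambda>n. outer (gq n x) (g x)) \<longlonglongrightarrow> 0" "(\<lambda>n. outer (g x) (gq n x)) \<longlonglongrightarrow> 0" for x
  proof -
    have z: "(\<lambda>n. norm (gq n x) * norm (g x)) \<longlonglongrightarrow> 0"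
      using tendsto_mult[OF tendsto_norm[OF gq0] tendsto_const, of x "norm (g x)"] by simp
    show "(\<lambda>n. outer (gq n x) (g x)) \<longlonglongrightarrow> 0"
      by (rule tendsto_norm_zero_cancel) (simp add: norm_outer z)
    show "(\<lambda>n. outer (g x) (gq n x)) \<longlonglongrightarrow> 0"
      by (rule tendsto_norm_zero_cancel) (use z in \<open>simp add: norm_outer mult.commute\<close>)
  qed
  have limH: "(\<lambda>n. H' n x) \<longlonglongrightarrow> H x" for x
  proof -
    have "(\<lambda>n. H' n x) \<longlonglongrightarrow> \<psi> x *\<^sub>R 0 + 0 + (1 *\<^sub>R H x + 0)"
      unfolding H'_def by (intro tendsto_intros Hq0 o0 q1)
    then show ?thesis by simp
  qed
  show ?thesis using C2' bdd le Hb lim limH by blast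
qed

lemma mat_integral_simple:
  fixes l :: "'a set \<Rightarrow> real^'d^'d" and s :: "'a \<Rightarrow> real^'d^'d"
  assumes l: "l \<in> psd_measures M" and s: "simple_function M s"
  shows "mat_integral M l s = (\<Sum>c\<in>s ` space M. c \<bullet> l (s -` {c} \<inter> space M))"
proof -
  let ?T = "total_variation M l" and ?g = "polar_density M l"
  note fin = simple_functionD(1)[OF s] and ms = simple_functionD(2)[OF s]
  have i: "integrable ?T (\<lambda>x. indicat_real (s -` {c} \<inter> space M) x *\<^sub>R ?g x)" for c
    using ms by (intro integrable_mult_indicator polar_density_integrable[OF l]) auto
  have "mat_integral M l s = (\<integral>x. (\<Sum>c\<in>s ` space M. c \<bullet> (indicat_real (s -` {c} \<inter> space M) x *\<^sub>R ?g x)) \<partial>?T)"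
    unfolding mat_integral_def
  proof (rule Bochner_Integration.integral_cong[OF refl])
    fix x assume "x \<in> space ?T"
    then have x: "x \<in> space M" by simp
    have "(\<Sum>c\<in>s ` space M. c \<bullet> (indicat_real (s -` {c} \<inter> space M) x *\<^sub>R ?g x))
      = (\<Sum>c\<in>s ` space M. if c = s x then c \<bullet> ?g x else 0)"
      using x by (intro sum.cong) (auto split: split_indicator)
    then show "s x \<bullet> ?g x = (\<Sum>c\<in>s ` space M. c \<bullet> (indicat_real (s -` {c} \<inter> space M) x *\<^sub>R ?g x))"
      using fin x by simp
  qed
  also have "\<dots> = (\<Sum>c\<in>s ` space M. c \<bullet> (\<integral>x. indicat_real (s -` {c} \<inter> space M) x *\<^sub>R ?g x \<partial>?T))"
    by (subst Bochner_Integration.integral_sum)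
       (intro integrable_inner_right i, intro sum.cong refl integral_inner_right i)
  also have "\<dots> = (\<Sum>c\<in>s ` space M. c \<bullet> l (s -` {c} \<inter> space M))"
    using polar_density_integral[OF l ms] by (simp add: set_lebesgue_integral_def)
  finally show ?thesis .
qed

lemma mat_integral_dominated_convergence:
  fixes \<Phi> :: "'a \<Rightarrow> real^'d^'d"
  assumes l: "l \<in> psd_measures M" and \<Phi>: "\<Phi> \<in> borel_measurable M" "\<And>n. \<Phi>' n \<in> borel_measurable M"
    and B: "\<And>n x. x \<in> space M \<Longrightarrow> norm (\<Phi>' n x) \<le> B" and lim: "\<And>x. x \<in> space M \<Longrightarrow> (\<lambda>n. \<Phi>' n x) \<longlonglongrightarrow> \<Phi> x"
  shows "(\<lambda>n. mat_integral M l (\<Phi>' n)) \<longlonglongrightarrow> mat_integral M l \<Phi>"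
  unfolding mat_integral_def
proof (rule integral_dominated_convergence)
  let ?T = "total_variation M l" and ?g = "polar_density M l"
  have mT: "f \<in> borel_measurable ?T" if "f \<in> borel_measurable M" for f :: "'a \<Rightarrow> real^'d^'d"
    by (rule measurable_sets_eq[OF that sets_total_variation[symmetric]])
  show "integrable ?T (\<lambda>x. B * norm (?g x))" using polar_density_integrable[OF l] by auto
  show "(\<lambda>x. \<Phi> x \<bullet> ?g x) \<in> borel_measurable ?T" "\<And>n. (\<lambda>x. \<Phi>' n x \<bullet> ?g x) \<in> borel_measurable ?T"
    using mT[OF \<Phi>(1)] mT[OF \<Phi>(2)] mT[OF polar_density_measurable[OF l]] by auto
  show "AE x in ?T. (\<lambda>n. \<Phi>' n x \<bullet> ?g x) \<longlonglongrightarrow> \<Phi> x \<bullet> ?g x"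
    using lim by (intro AE_I2 tendsto_inner) auto
  show "AE x in ?T. norm (\<Phi>' n x \<bullet> ?g x) \<le> B * norm (?g x)" for n
  proof (rule AE_I2)
    fix x assume "x \<in> space ?T"
    then have "norm (\<Phi>' n x) \<le> B" using B by simp
    then show "norm (\<Phi>' n x \<bullet> ?g x) \<le> B * norm (?g x)"
      using Cauchy_Schwarz_ineq2[of "\<Phi>' n x" "?g x"] mult_right_mono[of "norm (\<Phi>' n x)" B "norm (?g x)"] by simp
  qed
qed

text \<open>
  Immediate for simple fields, and preserved under bounded pointwise limits.
\<close>

lemma mat_integral_measurable_family:
  fixes l :: "'t \<Rightarrow> 'a set \<Rightarrow> real^'d^'d"
  assumes l: "\<And>t. t \<in> space N \<Longrightarrow> l t \<in> psd_measures M"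
    and meas: "\<And>B. B \<in> sets M \<Longrightarrow> (\<lambda>t. l t B) \<in> borel_measurable N"
    and \<Phi>: "\<Phi> \<in> borel_measurable M" "\<And>x. norm (\<Phi> x) \<le> B"
  shows "(\<lambda>t. mat_integral M (l t) \<Phi>) \<in> borel_measurable N"
proof -
  obtain s where s: "\<And>n. simple_function M (s n)" "\<And>x. x \<in> space M \<Longrightarrow> (\<lambda>n. s n x) \<longlonglongrightarrow> \<Phi> x"
    "\<And>n x. x \<in> space M \<Longrightarrow> dist (s n x) 0 \<le> 2 * dist (\<Phi> x) 0"
    using borel_measurable_implies_sequence_metric[OF \<Phi>(1), of 0] by blast
  show ?thesis
  proof (rule borel_measurable_LIMSEQ_real)
    show "(\<lambda>t. mat_integral M (l t) (s n)) \<in> borel_measurable N" for n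
    proof -
      have "(\<lambda>t. \<Sum>c\<in>s n ` space M. c \<bullet> l t (s n -` {c} \<inter> space M)) \<in> borel_measurable N"
        using s(1)[of n] by (intro borel_measurable_sum borel_measurable_inner meas) (auto simp: simple_function_def)
      then show ?thesis
        by (subst measurable_cong) (rule mat_integral_simple[OF l s(1)], auto)
    qed
    show "(\<lambda>n. mat_integral M (l t) (s n)) \<longlonglongrightarrow> mat_integral M (l t) \<Phi>" if "t \<in> space N" for t
    proof (rule mat_integral_dominated_convergence[OF l[OF that] \<Phi>(1)])
      show "s n \<in> borel_measurable M" for n using s(1) by (rule borel_measurable_simple_function)
      show "norm (s n x) \<le> 2 * B" if "x \<in> space M" for n x using s(3)[OF that, of n] \<Phi>(2)[of x] by simp
    qed (use s in auto)
  qed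
qed

lemma ennreal_integral_le_nn_integral:
  fixes h :: "'a \<Rightarrow> real"
  assumes h: "integrable M h"
  shows "ennreal (\<integral>x. h x \<partial>M) \<le> (\<integral>\<^sup>+x. ennreal (h x) \<partial>M)"
proof -
  have i: "integrable M (\<lambda>x. max 0 (h x))" using h by (intro integrable_max) auto
  have "ennreal (\<integral>x. h x \<partial>M) \<le> ennreal (\<integral>x. max 0 (h x) \<partial>M)"
    using h i by (intro ennreal_leI integral_mono) auto
  also have "\<dots> = (\<integral>\<^sup>+x. ennreal (max 0 (h x)) \<partial>M)" using i by (intro nn_integral_eq_integral[symmetric]) auto
  also have "\<dots> = (\<integral>\<^sup>+x. ennreal (h x) \<partial>M)" by (intro nn_integral_cong) (simp add: max_def ennreal_neg)
  finally show ?thesis .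
qed

text \<open>
  With a cutoff \<open>\<eta>(t)\<close> as the time factor, the Fokker-Planck equation says that \<open>t \<mapsto> \<integral> \<psi> dr\<^sub>t\<close> has the weak
  derivative \<open>\<integral> 1/2 \<nabla>\<^sup>2\<psi> : dl\<^sub>t\<close>.  Narrow continuity gives continuity of the former up to the end points
  only for bounded functions; so this is done for the truncations of \<open>\<psi>\<close>, followed by a limit.
\<close>

lemma weak_duality:
  fixes f :: "real^'d^'d \<Rightarrow> ennreal"
  assumes fp: "fokker_planck \<rho> \<Lambda> r l" and nc: "narrowly_continuous r"
    and \<psi>: "C2_with \<psi> g H" "bounded (range H)" and slope: "\<And>x. (1/2) *\<^sub>R H x \<in> slopes f"
  shows "ennreal ((\<integral>x. \<psi> x \<partial>r 1) - (\<integral>x. \<psi> x \<partial>r 0)) \<le> action f l"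
proof -
  obtain C \<psi>' g' H' where C2: "\<And>n::nat. C2_with (\<psi>' n) (g' n) (H' n)" and bdd: "\<And>n. bounded (range (\<psi>' n))"
    and le: "\<And>n x. \<bar>\<psi>' n x\<bar> \<le> \<bar>\<psi> x\<bar>" and C: "\<And>n x. norm (H' n x) \<le> C"
    and lim: "\<And>x. (\<lambda>n. \<psi>' n x) \<longlonglongrightarrow> \<psi> x" "\<And>x. (\<lambda>n. H' n x) \<longlonglongrightarrow> H x"
    using C2b_truncation[OF \<psi>] by metis
  have lt: "l t \<in> psd_measures borel" if "t \<in> {0<..<1}" for t
    using fp that by (auto simp: fokker_planck_def disintegrates_psd_def)
  have lmeas: "(\<lambda>t. l t B) \<in> borel_measurable U01" if "B \<in> sets borel" for B
    using fp that by (auto simp: fokker_planck_def disintegrates_psd_def measurable_U01)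
  have C0: "0 \<le> C" using C norm_ge_zero order_trans by blast
  have normH: "norm (H x) \<le> C" for x
    using lim(2)[of x] C by (intro LIMSEQ_le_const2[OF tendsto_norm]) auto
  have Hm: "(\<lambda>x. (1/2) *\<^sub>R H x) \<in> borel_measurable borel" "(\<lambda>x. (1/2) *\<^sub>R H' n x) \<in> borel_measurable borel" for n
    using C2_continuous(3)[OF \<psi>(1)] C2_continuous(3)[OF C2]
    by (auto intro!: borel_measurable_continuous_onI continuous_intros)
  have half: "norm ((1/2) *\<^sub>R H x) \<le> C" "norm ((1/2) *\<^sub>R H' n x) \<le> C" for n x
    using normH[of x] C[of n x] C0 by auto
  define \<beta>' where "\<beta>' = (\<lambda>n t. mat_integral borel (l t) (\<lambda>x. (1/2) *\<^sub>R H' n x))"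
  define \<beta> where "\<beta> = (\<lambda>t. mat_integral borel (l t) (\<lambda>x. (1/2) *\<^sub>R H x))"
  define \<alpha> where "\<alpha> = (\<lambda>n t. \<integral>x. \<psi>' n x \<partial>r t)"
  define w where "w = (\<lambda>t. C * trace (l t UNIV))"
  have w: "integrable U01 w"
  proof -
    have E: "{0<..<1} \<times> UNIV \<in> sets (time_space :: (real \<times> (real^'d)) measure)"
      unfolding time_space_def by (subst sets_restrict_space_iff) (auto simp: borel_Times)
    then have "integrable U01 (\<lambda>t. l t (Pair t -` ({0<..<1} \<times> UNIV)))"
      using fp unfolding fokker_planck_def disintegrates_psd_def set_integrable_U01 by blast
    then have "integrable U01 (\<lambda>t. l t UNIV)"
      by (rule Bochner_Integration.integrable_cong[THEN iffD1, rotated -1]) auto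
    then have "integrable U01 (\<lambda>t. l t UNIV \<bullet> mat 1)" by auto
    then show ?thesis unfolding w_def inner_mat_1 by auto
  qed
  have bw: "\<bar>mat_integral borel (l t) \<Phi>\<bar> \<le> w t"
    if "t \<in> {0<..<1}" "\<Phi> \<in> borel_measurable borel" "\<And>x. norm (\<Phi> x) \<le> C" for t \<Phi>
  proof -
    have "\<bar>mat_integral borel (l t) \<Phi>\<bar> \<le> C * measure (total_variation borel (l t)) UNIV"
      using abs_mat_integral_le[OF lt[OF that(1)] that(2,3)] by simp
    also have "measure (total_variation borel (l t)) UNIV \<le> trace (l t UNIV)"
      using emeasure_total_variation_le[OF lt[OF that(1)], of UNIV] psd_trace_nonneg[OF psd_measure_psd[OF lt[OF that(1)]], of UNIV]
      by (simp add: finite_measure.emeasure_eq_measure[OF finite_total_variation[OF lt[OF that(1)]]])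
    finally show ?thesis using C0 by (simp add: w_def mult_left_mono)
  qed
  have m\<beta>: "\<beta> \<in> borel_measurable U01" "\<And>n. \<beta>' n \<in> borel_measurable U01"
    unfolding \<beta>_def \<beta>'_def using lt lmeas
    by (auto intro!: mat_integral_measurable_family[where B = C] Hm half simp del: norm_scaleR)
  have i\<beta>': "integrable U01 (\<beta>' n)" for n
    by (rule Bochner_Integration.integrable_bound[OF w m\<beta>(2)])
       (auto intro!: AE_I2 order_trans[OF bw[OF _ Hm(2) half(2)]] simp: \<beta>'_def simp del: norm_scaleR)
  have i\<beta>: "integrable U01 \<beta>"
    by (rule Bochner_Integration.integrable_bound[OF w m\<beta>(1)])
       (auto intro!: AE_I2 order_trans[OF bw[OF _ Hm(1) half(1)]] simp: \<beta>_def simp del: norm_scaleR)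
  have FTC: "\<alpha> n 1 - \<alpha> n 0 = (\<integral>t. \<beta>' n t \<partial>U01)" for n
  proof (rule weak_derivative_FTC[OF _ i\<beta>'])
    show "continuous_on {0..1} (\<alpha> n)"
      using nc bdd C2_continuous(1)[OF C2] unfolding narrowly_continuous_def \<alpha>_def by blast
    fix \<eta> \<eta>' :: "real \<Rightarrow> real" and \<delta> :: real
    assume \<delta>: "0 < \<delta>" and d\<eta>: "\<And>t. (\<eta> has_real_derivative \<eta>' t) (at t)" and c\<eta>': "continuous_on UNIV \<eta>'"
      and z: "\<And>t. t < \<delta> \<or> t > 1 - \<delta> \<Longrightarrow> \<eta> t = 0"
    have c\<eta>: "continuous_on UNIV \<eta>" using d\<eta> by (intro continuous_at_imp_continuous_on ballI DERIV_isCont)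
    define \<phi> \<phi>t gg HH where "\<phi> = (\<lambda>(t, x). \<eta> t * \<psi>' n x)" and "\<phi>t = (\<lambda>(t, x). \<eta>' t * \<psi>' n x)"
      and "gg = (\<lambda>(t, x). \<eta> t *\<^sub>R g' n x)" and "HH = (\<lambda>(t, x). \<eta> t *\<^sub>R H' n x)"
    have bounded_time: "\<exists>b. \<forall>t\<in>{0<..<1}. \<bar>h t\<bar> \<le> b" if "continuous_on UNIV h" for h :: "real \<Rightarrow> real"
    proof -
      have "bounded (h ` {0..1})"
        using that by (intro compact_imp_bounded compact_continuous_image) (auto intro: continuous_on_subset)
      then show ?thesis unfolding bounded_iff by force
    qed
    obtain b1 b2 where b: "\<And>t. t \<in> {0<..<1} \<Longrightarrow> \<bar>\<eta> t\<bar> \<le> b1" "\<And>t. t \<in> {0<..<1} \<Longrightarrow> \<bar>\<eta>' t\<bar> \<le> b2"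
      using bounded_time[OF c\<eta>] bounded_time[OF c\<eta>'] by blast
    have b0: "0 \<le> b1" "0 \<le> b2" using b[of "1/2"] by auto
    obtain b3 where b3: "\<And>x. \<bar>\<psi>' n x\<bar> \<le> b3" using bdd[of n] by (auto simp: bounded_iff)
    have C12: "C12b \<phi> \<phi>t gg HH"
      unfolding C12b_def
    proof (intro conjI ballI allI)
      fix t :: real and x :: "real^'d"
      have d: "(\<psi>' n has_derivative (\<lambda>h. g' n x \<bullet> h)) (at x)" "(g' n has_derivative (\<lambda>h. H' n x *v h)) (at x)"
        using C2[of n] by (auto simp: C2_with_def)
      show "((\<lambda>s. \<phi> (s, x)) has_real_derivative \<phi>t (t, x)) (at t)"
        by (simp add: \<phi>_def \<phi>t_def) (rule DERIV_cmult_right[OF d\<eta>])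
      show "((\<lambda>y. \<phi> (t, y)) has_derivative (\<lambda>h. gg (t, x) \<bullet> h)) (at x)"
        unfolding \<phi>_def gg_def prod.case inner_scaleR_left by (rule has_derivative_mult_right[OF d(1)])
      show "((\<lambda>y. gg (t, y)) has_derivative (\<lambda>h. HH (t, x) *v h)) (at x)"
        unfolding gg_def HH_def prod.case scaleR_matrix_vector_assoc[symmetric] by (rule has_derivative_scaleR_right[OF d(2)])
    next
      have cs: "continuous_on S (\<lambda>z. \<eta> (fst z))" "continuous_on S (\<lambda>z. \<eta>' (fst z))" for S :: "(real \<times> (real^'d)) set"
        by (auto intro!: continuous_on_compose2[OF c\<eta>] continuous_on_compose2[OF c\<eta>'] continuous_intros)
      have cx: "continuous_on S (\<lambda>z. \<psi>' n (snd z))" "continuous_on S (\<lambda>z. g' n (snd z))" "continuous_on S (\<lambda>z. H' n (snd z))"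
        for S :: "(real \<times> (real^'d)) set"
        by (auto intro!: continuous_on_compose2[OF C2_continuous(1)[OF C2]] continuous_on_compose2[OF C2_continuous(2)[OF C2]]
            continuous_on_compose2[OF C2_continuous(3)[OF C2]] continuous_intros)
      show "continuous_on ({0<..<1} \<times> UNIV) \<phi>" "continuous_on ({0<..<1} \<times> UNIV) \<phi>t"
        "continuous_on ({0<..<1} \<times> UNIV) gg" "continuous_on ({0<..<1} \<times> UNIV) HH"
        unfolding \<phi>_def \<phi>t_def gg_def HH_def case_prod_beta by (intro continuous_intros cs cx)+
      show "bounded (\<phi>t ` ({0<..<1} \<times> UNIV))"
        using b(2) b3 b0 by (intro boundedI[where B = "b2 * b3"]) (auto simp: \<phi>t_def abs_mult intro!: mult_mono)
      show "bounded (HH ` ({0<..<1} \<times> UNIV))"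
        using b(1) C b0 by (intro boundedI[where B = "b1 * C"]) (auto simp: HH_def intro!: mult_mono)
    qed
    have "closure {(t, x). t \<in> {0<..<1} \<and> \<phi> (t, x) \<noteq> 0} \<subseteq> {\<delta>..1 - \<delta>} \<times> UNIV"
    proof (rule closure_minimal)
      show "{(t, x). t \<in> {0<..<1} \<and> \<phi> (t, x) \<noteq> 0} \<subseteq> {\<delta>..1 - \<delta>} \<times> UNIV"
        using z by (force simp: \<phi>_def)
    qed (intro closed_Times, auto)
    also have "\<dots> \<subseteq> {0<..<1} \<times> UNIV" using \<delta> by auto
    finally have supp: "closure {(t, x). t \<in> {0<..<1} \<and> \<phi> (t, x) \<noteq> 0} \<subseteq> {0<..<1} \<times> UNIV" .
    have "(LINT t:{0<..<1}|lborel. (LINT x|r t. \<phi>t (t, x))) =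
        - (LINT t:{0<..<1}|lborel. mat_integral borel (l t) (\<lambda>x. (1/2) *\<^sub>R HH (t, x)))"
      using fp C12 supp unfolding fokker_planck_def by blast
    moreover have "(LINT x|r t. \<phi>t (t, x)) = \<eta>' t * \<alpha> n t" for t by (simp add: \<phi>t_def \<alpha>_def)
    moreover have "mat_integral borel (l t) (\<lambda>x. (1/2) *\<^sub>R HH (t, x)) = \<eta> t * \<beta>' n t" for t
      unfolding mat_integral_def HH_def \<beta>'_def
      by (subst integral_mult_right_zero[symmetric]) (simp add: algebra_simps)
    ultimately show "(\<integral>t. \<eta>' t * \<alpha> n t \<partial>U01) = - (\<integral>t. \<eta> t * \<beta>' n t \<partial>U01)"
      by (simp add: set_integral_U01)
  qed
  have lim\<alpha>: "(\<lambda>n. \<alpha> n t) \<longlonglongrightarrow> (\<integral>x. \<psi> x \<partial>r t)" if t: "t \<in> {0..1}" for t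
    unfolding \<alpha>_def
  proof (rule integral_dominated_convergence[where w = "\<lambda>x. norm (\<psi> x)"])
    have p: "r t \<in> P2" using nc t by (auto simp: narrowly_continuous_def)
    have i: "integrable (r t) \<psi>" using \<psi> by (intro C2b_integrable[OF _ p]) (auto simp: C2b_iff)
    then show "\<psi> \<in> borel_measurable (r t)" "integrable (r t) (\<lambda>x. norm (\<psi> x))" by auto
    show "\<psi>' n \<in> borel_measurable (r t)" for n
      using C2_continuous(1)[OF C2] P2D(2)[OF p] by (intro measurable_sets_eq[OF borel_measurable_continuous_onI]) auto
  qed (use le lim in auto)
  have "(\<lambda>n. \<integral>t. \<beta>' n t \<partial>U01) \<longlonglongrightarrow> (\<integral>t. \<beta> t \<partial>U01)"
  proof (rule integral_dominated_convergence[OF m\<beta> w])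
    show "AE t in U01. norm (\<beta>' n t) \<le> w t" for n
      using bw[OF _ Hm(2) half(2)] by (intro AE_I2) (simp add: \<beta>'_def)
    show "AE t in U01. (\<lambda>n. \<beta>' n t) \<longlonglongrightarrow> \<beta> t"
    proof (rule AE_I2)
      fix t assume "t \<in> space U01"
      then show "(\<lambda>n. \<beta>' n t) \<longlonglongrightarrow> \<beta> t"
        unfolding \<beta>'_def \<beta>_def
        by (intro mat_integral_dominated_convergence[OF lt Hm half(2)] tendsto_intros lim(2)) auto
    qed
  qed
  moreover have "(\<lambda>n. \<integral>t. \<beta>' n t \<partial>U01) \<longlonglongrightarrow> (\<integral>x. \<psi> x \<partial>r 1) - (\<integral>x. \<psi> x \<partial>r 0)"
    unfolding FTC[symmetric] by (intro tendsto_diff lim\<alpha>) auto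
  ultimately have "(\<integral>x. \<psi> x \<partial>r 1) - (\<integral>x. \<psi> x \<partial>r 0) = (\<integral>t. \<beta> t \<partial>U01)"
    using LIMSEQ_unique by blast
  also have "ennreal \<dots> \<le> (\<integral>\<^sup>+t. ennreal (\<beta> t) \<partial>U01)"
    by (rule ennreal_integral_le_nn_integral[OF i\<beta>])
  also have "\<dots> \<le> (\<integral>\<^sup>+t. (\<integral>\<^sup>+x. f (polar_density borel (l t) x) \<partial>total_variation borel (l t)) \<partial>U01)"
  proof (rule nn_integral_mono)
    fix t assume "t \<in> space U01"
    then have t: "l t \<in> psd_measures borel" by (simp add: lt)
    have "ennreal (\<beta> t) \<le> (\<integral>\<^sup>+x. ennreal ((1/2) *\<^sub>R H x \<bullet> polar_density borel (l t) x) \<partial>total_variation borel (l t))"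
      unfolding \<beta>_def mat_integral_def
      by (rule ennreal_integral_le_nn_integral[OF mat_integral_integrable[OF t Hm(1) half(1)]])
    also have "\<dots> \<le> (\<integral>\<^sup>+x. f (polar_density borel (l t) x) \<partial>total_variation borel (l t))"
      by (intro nn_integral_mono slopesD[OF slope] polar_density_sym[OF t])
    finally show "ennreal (\<beta> t) \<le> (\<integral>\<^sup>+x. f (polar_density borel (l t) x) \<partial>total_variation borel (l t))" .
  qed
  also have "\<dots> = action f l" by (simp add: action_def nn_integral_U01)
  finally show ?thesis .
qed

section \<open>Time-independent solutions\<close>

text \<open>
  The interpolation \<open>(1 - t) \<mu> + t \<nu>\<close> written as a two-stage experiment, a coin toss followed by a
  draw, so that it is visibly a kernel in \<open>t\<close>.
\<close>

definition mixture :: "'a::topological_space measure \<Rightarrow> 'a measure \<Rightarrow> real \<Rightarrow> 'a measure" where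
  "mixture \<mu> \<nu> t = measure_pmf (bernoulli_pmf t) \<bind> (\<lambda>b. if b then \<nu> else \<mu>)"

context
  fixes \<mu> \<nu> :: "'a::topological_space measure"
  assumes \<mu>: "prob_space \<mu>" "sets \<mu> = sets borel" and \<nu>: "prob_space \<nu>" "sets \<nu> = sets borel"
begin

lemma mixture_kernel: "(\<lambda>b. if b then \<nu> else \<mu>) \<in> measurable (measure_pmf (bernoulli_pmf t)) (subprob_algebra borel)"
  using \<mu> \<nu> prob_space_imp_subprob_space
  by (auto simp: measurable_def space_subprob_algebra split: if_splits)

lemma sets_mixture: "sets (mixture \<mu> \<nu> t) = sets borel"
  unfolding mixture_def using \<mu> \<nu> by (intro sets_bind) auto

lemma space_mixture: "space (mixture \<mu> \<nu> t) = UNIV"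
  using sets_eq_imp_space_eq[OF sets_mixture] by simp

lemma nn_integral_mixture:
  assumes t: "t \<in> {0..1}" and h: "h \<in> borel_measurable borel"
  shows "(\<integral>\<^sup>+x. h x \<partial>mixture \<mu> \<nu> t) = ennreal (1 - t) * (\<integral>\<^sup>+x. h x \<partial>\<mu>) + ennreal t * (\<integral>\<^sup>+x. h x \<partial>\<nu>)"
  unfolding mixture_def using t
  by (subst nn_integral_bind[OF h mixture_kernel]) (simp add: mult.commute add.commute)

lemma emeasure_mixture:
  assumes t: "t \<in> {0..1}" and E: "E \<in> sets borel"
  shows "emeasure (mixture \<mu> \<nu> t) E = ennreal (1 - t) * emeasure \<mu> E + ennreal t * emeasure \<nu> E"
  using nn_integral_mixture[OF t, of "indicator E"] E \<mu>(2) \<nu>(2) sets_mixture by simp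

lemma prob_space_mixture: "t \<in> {0..1} \<Longrightarrow> prob_space (mixture \<mu> \<nu> t)"
  using emeasure_mixture[of t UNIV] prob_space.emeasure_space_1[OF \<mu>(1)] prob_space.emeasure_space_1[OF \<nu>(1)]
    sets_eq_imp_space_eq[OF \<mu>(2)] sets_eq_imp_space_eq[OF \<nu>(2)]
  by (intro prob_spaceI) (simp add: space_mixture ennreal_plus[symmetric] del: ennreal_plus)

lemma mixture_0: "mixture \<mu> \<nu> 0 = \<mu>"
  by (rule measure_eqI) (use emeasure_mixture[of 0] \<mu>(2) in \<open>auto simp: sets_mixture\<close>)

lemma mixture_1: "mixture \<mu> \<nu> 1 = \<nu>"
  by (rule measure_eqI) (use emeasure_mixture[of 1] \<nu>(2) in \<open>auto simp: sets_mixture\<close>)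

lemma integral_mixture:
  fixes h :: "'a \<Rightarrow> real"
  assumes t: "t \<in> {0..1}" and h: "h \<in> borel_measurable borel" and B: "\<And>x. \<bar>h x\<bar> \<le> B"
  shows "(\<integral>x. h x \<partial>mixture \<mu> \<nu> t) = (1 - t) * (\<integral>x. h x \<partial>\<mu>) + t * (\<integral>x. h x \<partial>\<nu>)"
proof -
  interpret \<mu>: prob_space \<mu> by fact
  interpret \<nu>: prob_space \<nu> by fact
  interpret m: prob_space "mixture \<mu> \<nu> t" by (rule prob_space_mixture[OF t])
  have hm: "h \<in> borel_measurable \<mu>" "h \<in> borel_measurable \<nu>" "h \<in> borel_measurable (mixture \<mu> \<nu> t)"
    using measurable_sets_eq[OF h] \<mu>(2) \<nu>(2) sets_mixture by metis+
  have B0: "0 \<le> B" using B abs_ge_zero order_trans by blast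
  have i: "integrable \<mu> h" "integrable \<nu> h" "integrable (mixture \<mu> \<nu> t) h"
    using hm B by (auto intro!: \<mu>.integrable_const_bound[where B = B] \<nu>.integrable_const_bound[where B = B]
      m.integrable_const_bound[where B = B])
  have hB: "0 \<le> h x + B" for x using B[of x] by linarith
  have shift: "ennreal ((\<integral>x. h x \<partial>M) + B) = (\<integral>\<^sup>+x. ennreal (h x + B) \<partial>M)"
    if M: "prob_space M" "integrable M h" for M
  proof -
    interpret M: prob_space M by fact
    have "(\<integral>\<^sup>+x. ennreal (h x + B) \<partial>M) = ennreal (\<integral>x. h x + B \<partial>M)"
      using M(2) hB by (intro nn_integral_eq_integral AE_I2) auto
    then show ?thesis using M(2) by (simp add: M.prob_space)
  qed
  have nn: "0 \<le> (\<integral>x. h x \<partial>M) + B" if M: "prob_space M" "integrable M h" for M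
  proof -
    interpret M: prob_space M by fact
    have "0 \<le> (\<integral>x. h x + B \<partial>M)" using hB by (intro integral_nonneg_AE AE_I2)
    then show ?thesis using M(2) by (simp add: M.prob_space)
  qed
  have "ennreal ((\<integral>x. h x \<partial>mixture \<mu> \<nu> t) + B)
    = ennreal (1 - t) * ennreal ((\<integral>x. h x \<partial>\<mu>) + B) + ennreal t * ennreal ((\<integral>x. h x \<partial>\<nu>) + B)"
    unfolding shift[OF \<mu>(1) i(1)] shift[OF \<nu>(1) i(2)] shift[OF m.prob_space_axioms i(3)]
    by (rule nn_integral_mixture[OF t]) (use h in auto)
  also have "\<dots> = ennreal ((1 - t) * ((\<integral>x. h x \<partial>\<mu>) + B) + t * ((\<integral>x. h x \<partial>\<nu>) + B))"
    using t nn[OF \<mu>(1) i(1)] nn[OF \<nu>(1) i(2)] by (simp add: ennreal_mult ennreal_plus)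
  finally have "(\<integral>x. h x \<partial>mixture \<mu> \<nu> t) + B = (1 - t) * ((\<integral>x. h x \<partial>\<mu>) + B) + t * ((\<integral>x. h x \<partial>\<nu>) + B)"
    using t nn[OF \<mu>(1) i(1)] nn[OF \<nu>(1) i(2)] nn[OF m.prob_space_axioms i(3)]
    by (subst (asm) ennreal_inj) auto
  then show ?thesis by (simp add: algebra_simps)
qed

lemma mixture_measurable: "mixture \<mu> \<nu> \<in> measurable U01 (prob_algebra borel)"
proof (rule measurable_prob_algebraI)
  show "mixture \<mu> \<nu> \<in> measurable U01 (subprob_algebra borel)"
  proof (rule measurable_subprob_algebra)
    fix A :: "'a set" assume A: "A \<in> sets borel"
    have "(\<lambda>t. ennreal (1 - t) * emeasure \<mu> A + ennreal t * emeasure \<nu> A) \<in> borel_measurable U01"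
      using U01_continuous_measurable[of "\<lambda>t. 1 - t"] U01_continuous_measurable[of "\<lambda>t. t"]
      by (intro borel_measurable_add borel_measurable_times_ennreal measurable_compose[OF _ measurable_ennreal]
          measurable_const) (auto intro!: continuous_intros)
    then show "(\<lambda>t. emeasure (mixture \<mu> \<nu> t) A) \<in> borel_measurable U01"
      by (rule measurable_cong[THEN iffD1, rotated]) (use A in \<open>simp add: emeasure_mixture\<close>)
  qed (auto simp: sets_mixture intro!: prob_space_imp_subprob_space prob_space_mixture)
qed (auto intro!: prob_space_mixture)

end

lemma mixture_P2:
  assumes \<mu>: "\<mu> \<in> P2" and \<nu>: "\<nu> \<in> P2" and t: "t \<in> {0..1}"
  shows "mixture \<mu> \<nu> t \<in> P2"
  unfolding P2_def
proof (intro CollectI conjI)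
  note ps = P2D(1,2)[OF \<mu>] P2D(1,2)[OF \<nu>]
  show "prob_space (mixture \<mu> \<nu> t)" "sets (mixture \<mu> \<nu> t) = sets borel"
    using prob_space_mixture[OF ps t] sets_mixture[OF ps] by auto
  have "(\<integral>\<^sup>+x. ennreal ((norm x)\<^sup>2) \<partial>\<mu>) < \<infinity>" "(\<integral>\<^sup>+x. ennreal ((norm x)\<^sup>2) \<partial>\<nu>) < \<infinity>"
    using \<mu> \<nu> by (auto simp: P2_def)
  then show "(\<integral>\<^sup>+x. ennreal ((norm x)\<^sup>2) \<partial>mixture \<mu> \<nu> t) < \<infinity>"
    by (subst nn_integral_mixture[OF ps t]) (auto simp: ennreal_mult_less_top)
qed

lemma U01_times_measurable:
  assumes N: "sets N = sets (borel :: 'b::second_countable_topology measure)"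
  shows "(\<lambda>z. z) \<in> measurable (U01 \<Otimes>\<^sub>M N) (restrict_space borel ({0<..<1} \<times> UNIV))"
proof (rule measurable_restrict_space2)
  have "(\<lambda>x. x) \<in> measurable U01 borel" by (intro U01_continuous_measurable continuous_intros)
  then have f: "fst \<in> measurable (U01 \<Otimes>\<^sub>M N) borel"
    using measurable_compose[OF measurable_fst] by blast
  have s: "snd \<in> measurable (U01 \<Otimes>\<^sub>M N) borel"
    using measurable_snd[of U01 N] measurable_cong_sets[OF refl N] by blast
  have "(\<lambda>z. (fst z, snd z)) \<in> measurable (U01 \<Otimes>\<^sub>M N) (borel \<Otimes>\<^sub>M borel)"
    by (rule measurable_Pair[OF f s])
  then show "(\<lambda>z. z) \<in> measurable (U01 \<Otimes>\<^sub>M N) borel" by (simp add: borel_prod)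
qed (auto simp: space_pair_measure)

lemma time_space_slice:
  assumes E: "E \<in> sets (time_space :: (real \<times> (real^'d)) measure)"
  shows "Pair t -` E \<in> sets borel"
proof -
  have "E \<in> sets borel"
    using E unfolding time_space_def by (subst (asm) sets_restrict_space_iff) (auto simp: borel_Times)
  moreover have "Pair t \<in> measurable borel (borel :: (real \<times> (real^'d)) measure)"
    by (intro borel_measurable_continuous_onI continuous_intros)
  ultimately show ?thesis using measurable_sets[of "Pair t" borel borel E] by simp
qed

text \<open>
  For the time slices of a test function, which are defined on \<open>(0, 1)\<close> only and vanish near the ends.
\<close>

lemma U01_vanishing_FTC:
  fixes u v :: "real \<Rightarrow> real"
  assumes d: "\<And>t. t \<in> {0<..<1} \<Longrightarrow> (u has_real_derivative v t) (at t)" and cv: "continuous_on {0<..<1} v"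
    and ab: "0 < a" "b < 1" and z: "\<And>t. t \<in> {0<..<1} \<Longrightarrow> t < a \<or> b < t \<Longrightarrow> u t = 0"
  shows "(\<integral>t. v t \<partial>U01) = 0"
proof -
  define F F' where "F = (\<lambda>t. if t \<in> {0<..<1} then u t else 0)" and "F' = (\<lambda>t. if t \<in> {0<..<1} then v t else 0)"
  have vz: "v t = 0" if t: "t \<in> {0<..<1}" "t < a \<or> b < t" for t
  proof -
    have "((\<lambda>_. 0) has_real_derivative v t) (at t)"
      by (rule has_field_derivative_transform_within_open[OF d[OF t(1)], of "{0<..<1} \<inter> ({..<a} \<union> {b<..})"])
         (use t z in \<open>auto intro!: open_Int open_Un\<close>)
    moreover have "((\<lambda>_. 0::real) has_real_derivative 0) (at t)" by simp
    ultimately show ?thesis by (rule DERIV_unique)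
  qed
  have F0: "F t = 0" "F' t = 0" if "t < a \<or> b < t" for t using that z vz by (auto simp: F_def F'_def)
  have "(F has_real_derivative F' t) (at t)" for t
  proof -
    consider "t \<in> {0<..<1}" | "t < a" | "b < t" using ab by force
    then show ?thesis
    proof cases
      case 1
      have "(F has_real_derivative v t) (at t)"
        by (rule has_field_derivative_transform_within_open[OF d[OF 1], of "{0<..<1}"]) (use 1 in \<open>auto simp: F_def\<close>)
      then show ?thesis using 1 by (simp add: F'_def)
    next
      case 2
      have "((\<lambda>_. 0::real) has_real_derivative 0) (at t)" by simp
      then have "(F has_real_derivative 0) (at t)"
        by (rule has_field_derivative_transform_within_open[of _ _ _ "{..<a}"]) (use 2 F0 in auto)
      then show ?thesis using 2 F0 by simp
    next
      case 3
      have "((\<lambda>_. 0::real) has_real_derivative 0) (at t)" by simp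
      then have "(F has_real_derivative 0) (at t)"
        by (rule has_field_derivative_transform_within_open[of _ _ _ "{b<..}"]) (use 3 F0 in auto)
      then show ?thesis using 3 F0 by simp
    qed
  qed
  moreover have "continuous_on {0..1} F'"
  proof -
    have 1: "continuous_on {0<..<1} F'" using cv by (rule continuous_on_eq) (simp add: F'_def)
    have 2: "continuous_on {..<a} F'" by (rule continuous_on_eq[OF continuous_on_const[of _ 0]]) (simp add: F0)
    have 3: "continuous_on {b<..} F'" by (rule continuous_on_eq[OF continuous_on_const[of _ 0]]) (simp add: F0)
    have "continuous_on ({0<..<1} \<union> {..<a} \<union> {b<..}) F'"
      by (intro continuous_on_open_Un 1 2 3) auto
    then show ?thesis by (rule continuous_on_subset) (use ab in force)
  qed
  ultimately have "(\<integral>t. F' t \<partial>U01) = F 1 - F 0" by (intro U01_FTC) auto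
  moreover have "(\<integral>t. F' t \<partial>U01) = (\<integral>t. v t \<partial>U01)"
    by (intro Bochner_Integration.integral_cong) (auto simp: F'_def)
  ultimately show ?thesis by (simp add: F_def)
qed

lemma psd_measure_norm_le:
  assumes l: "l \<in> psd_measures M" and B: "B \<in> sets M"
  shows "trace (l B) \<le> trace (l (space M))" "norm (l B) \<le> trace (l (space M))"
proof -
  obtain \<tau> where \<tau>: "sets \<tau> = sets M" "finite_measure \<tau>" "\<And>E. E \<in> sets M \<Longrightarrow> measure \<tau> E = trace (l E)"
    using ex_trace_measure[OF l] by blast
  show "trace (l B) \<le> trace (l (space M))"
    using finite_measure.finite_measure_mono[OF \<tau>(2), of B "space M"] \<tau>(1,3) B sets.sets_into_space[OF B] by auto
  then show "norm (l B) \<le> trace (l (space M))"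
    using psd_norm_le_trace[OF psd_measure_psd[OF l B]] by simp
qed

lemma static_slices:
  fixes l :: "(real^'d) set \<Rightarrow> real^'d^'d"
  assumes l: "l \<in> psd_measures borel" and E: "E \<in> sets time_space"
  shows "integrable U01 (\<lambda>t. l (Pair t -` E))"
proof -
  let ?T = "total_variation borel l" and ?g = "polar_density borel l"
  interpret U: prob_space U01 by (rule prob_space_U01)
  interpret T: finite_measure ?T by (rule finite_total_variation[OF l])
  have ind: "(\<lambda>z. indicat_real E z) \<in> borel_measurable (U01 \<Otimes>\<^sub>M ?T)"
  proof -
    have "indicat_real E \<in> borel_measurable (restrict_space borel ({0<..<1} \<times> UNIV))"
      using E unfolding time_space_def by (intro borel_measurable_indicator)
    from measurable_compose[OF U01_times_measurable[of ?T] this] show ?thesis by simp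
  qed
  have "(\<lambda>z. indicat_real E z *\<^sub>R ?g (snd z)) \<in> borel_measurable (U01 \<Otimes>\<^sub>M ?T)"
    using measurable_sets_eq[OF polar_density_measurable[OF l] sets_total_variation[symmetric]]
    by (intro borel_measurable_scaleR ind measurable_compose[OF measurable_snd]) auto
  then have "(\<lambda>t. \<integral>x. indicat_real E (t, x) *\<^sub>R ?g x \<partial>?T) \<in> borel_measurable U01"
    by (intro T.borel_measurable_lebesgue_integral) (simp add: case_prod_beta')
  moreover have "(\<integral>x. indicat_real E (t, x) *\<^sub>R ?g x \<partial>?T) = l (Pair t -` E)" for t
    unfolding polar_density_integral[OF l time_space_slice[OF E]] set_lebesgue_integral_def
    by (intro Bochner_Integration.integral_cong) (auto split: split_indicator)
  ultimately have "(\<lambda>t. l (Pair t -` E)) \<in> borel_measurable U01" by simp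
  then show ?thesis
    using psd_measure_norm_le(2)[OF l time_space_slice[OF E]]
    by (intro U.integrable_const_bound[where B = "trace (l UNIV)"]) auto
qed

text \<open>
  The product of \<open>l\<close> with Lebesgue measure on \<open>(0, 1)\<close>.
\<close>

lemma static_psd_measure:
  fixes l :: "(real^'d) set \<Rightarrow> real^'d^'d"
  assumes l: "l \<in> psd_measures borel"
  shows "(\<lambda>E. \<integral>t. l (Pair t -` E) \<partial>U01) \<in> psd_measures time_space"
  unfolding psd_measures_def
proof (intro CollectI conjI ballI allI impI)
  interpret U: prob_space U01 by (rule prob_space_U01)
  fix E :: "(real \<times> (real^'d)) set" assume E: "E \<in> sets time_space"
  note i = static_slices[OF l E]
  have psd: "l (Pair t -` E) \<in> psd_mats" for t by (rule psd_measure_psd[OF l time_space_slice[OF E]])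
  let ?A = "\<integral>t. l (Pair t -` E) \<partial>U01"
  have ip: "?A \<bullet> k = (\<integral>t. l (Pair t -` E) \<bullet> k \<partial>U01)" for k
    using i by (intro integral_inner_left[symmetric])
  show "?A \<in> psd_mats"
    unfolding psd_mats_def
  proof (intro CollectI conjI allI)
    show "?A \<in> sym_mats"
    proof (rule sym_matsI)
      fix i j
      show "?A $ i $ j = ?A $ j $ i"
        unfolding inner_unit_mat[symmetric] ip using sym_matsD[OF psd_sym[OF psd]] by (simp add: inner_unit_mat)
    qed
    fix v show "0 \<le> v \<bullet> (?A *v v)"
      unfolding inner_outer[symmetric] ip using psd by (intro integral_nonneg_AE AE_I2) (auto simp: inner_outer psd_mats_def)
  qed
next
  interpret U: prob_space U01 by (rule prob_space_U01)
  fix A :: "nat \<Rightarrow> (real \<times> (real^'d)) set" assume A: "range A \<subseteq> sets time_space" "disjoint_family A"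
  have AE: "A i \<in> sets time_space" for i using A by auto
  have sl: "Pair t -` A i \<in> sets borel" for t i by (rule time_space_slice[OF AE])
  have sums: "(\<lambda>i. l (Pair t -` A i)) sums l (Pair t -` (\<Union>i. A i))" for t
  proof -
    have "(\<lambda>i. l (Pair t -` A i)) sums l (\<Union>i. Pair t -` A i)"
      using A(2) sl by (intro psd_measure_sums[OF l]) (auto simp: disjoint_family_on_def)
    then show ?thesis by (simp add: vimage_UN)
  qed
  have bd: "norm (\<Sum>i<n. l (Pair t -` A i)) \<le> trace (l UNIV)" for n t
  proof -
    have "norm (\<Sum>i<n. l (Pair t -` A i)) \<le> (\<Sum>i<n. trace (l (Pair t -` A i)))"
      by (intro sum_norm_le psd_norm_le_trace psd_measure_psd[OF l] sl)
    also have "\<dots> \<le> (\<Sum>i. trace (l (Pair t -` A i)))"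
      using trace_sums[OF sums[of t]]
      by (intro sum_le_suminf psd_trace_nonneg psd_measure_psd[OF l] sl) (auto simp: sums_iff)
    also have "\<dots> = trace (l (Pair t -` (\<Union>i. A i)))"
      using trace_sums[OF sums[of t]] by (simp add: sums_iff)
    also have "\<dots> \<le> trace (l UNIV)"
      using psd_measure_norm_le(1)[OF l time_space_slice[of "\<Union>i. A i" t]] AE by auto
    finally show ?thesis .
  qed
  have "(\<lambda>n. \<integral>t. (\<Sum>i<n. l (Pair t -` A i)) \<partial>U01) \<longlonglongrightarrow> (\<integral>t. l (Pair t -` (\<Union>i. A i)) \<partial>U01)"
  proof (rule integral_dominated_convergence[where w = "\<lambda>_. trace (l UNIV)"])
    show "(\<lambda>t. l (Pair t -` (\<Union>i. A i))) \<in> borel_measurable U01"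
      using static_slices[OF l, of "\<Union>i. A i"] AE by auto
    show "(\<lambda>t. \<Sum>i<n. l (Pair t -` A i)) \<in> borel_measurable U01" for n
      using static_slices[OF l AE] by (intro borel_measurable_sum) auto
  qed (use bd sums in \<open>auto simp: sums_def\<close>)
  then show "(\<lambda>i. \<integral>t. l (Pair t -` A i) \<partial>U01) sums (\<integral>t. l (Pair t -` (\<Union>i. A i)) \<partial>U01)"
    unfolding sums_def by (subst Bochner_Integration.integral_sum[symmetric]) (rule static_slices[OF l AE])
qed

text \<open>
  A static measure \<open>\<lambda>\<close> with \<open>\<nu> - \<mu> = tr (1/2 \<nabla>\<^sup>2 \<lambda>)\<close> drives the affine interpolation from \<open>\<mu>\<close> to
  \<open>\<nu>\<close>: integrating by parts in time turns the Fokker-Planck equation for the interpolation into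
  the static equation for the slices of the test function.
\<close>

lemma static_fokker_planck:
  fixes \<mu> \<nu> :: "(real^'d) measure"
  assumes \<mu>: "\<mu> \<in> P2" and \<nu>: "\<nu> \<in> P2" and l: "l \<in> psd_measures borel"
    and eq: "\<And>\<psi> g H. C2_with \<psi> g H \<Longrightarrow> bounded (range H) \<Longrightarrow>
      mat_integral borel l (\<lambda>x. (1/2) *\<^sub>R H x) = (\<integral>x. \<psi> x \<partial>\<nu>) - (\<integral>x. \<psi> x \<partial>\<mu>)"
  shows "\<exists>\<rho> \<Lambda>. fokker_planck \<rho> \<Lambda> (mixture \<mu> \<nu>) (\<lambda>_. l)"
proof -
  interpret \<mu>: prob_space \<mu> by (rule P2D(1)[OF \<mu>])
  interpret \<nu>: prob_space \<nu> by (rule P2D(1)[OF \<nu>])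
  interpret U: prob_space U01 by (rule prob_space_U01)
  note ps = P2D(1,2)[OF \<mu>] P2D(1,2)[OF \<nu>]
  let ?r = "mixture \<mu> \<nu>"
  let ?TS = "time_space :: (real \<times> (real^'d)) measure"
  define K where "K = (\<lambda>t. distr (?r t) ?TS (Pair t))"
  define \<rho> where "\<rho> = U01 \<bind> K"
  define \<Lambda> where "\<Lambda> = (\<lambda>E. \<integral>t. l (Pair t -` E) \<partial>U01)"
  have pair_id: "(\<lambda>z. z) \<in> measurable (U01 \<Otimes>\<^sub>M N) ?TS" if "sets N = sets (borel :: (real^'d) measure)" for N
    using U01_times_measurable[OF that] unfolding time_space_def .
  have K: "K \<in> measurable U01 (subprob_algebra ?TS)"
    unfolding K_def
    by (rule measurable_distr2[OF _ measurable_prob_algebraD[OF mixture_measurable[OF ps]]])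
       (use pair_id[of borel] in \<open>simp add: case_prod_beta'\<close>)
  have Pt: "Pair t \<in> measurable (?r t) ?TS" if "t \<in> {0<..<1}" for t
  proof -
    have "Pair t \<in> measurable (?r t) (U01 \<Otimes>\<^sub>M ?r t)" using that by (intro measurable_Pair1') auto
    from measurable_compose[OF this pair_id[OF sets_mixture[OF ps]]] show ?thesis .
  qed
  have rt: "?r t \<in> P2" if "t \<in> {0<..<1}" for t using that by (intro mixture_P2 \<mu> \<nu>) auto
  have s\<rho>: "sets \<rho> = sets ?TS" unfolding \<rho>_def K_def by (rule sets_bind) auto
  have nn\<rho>: "(\<integral>\<^sup>+z. h z \<partial>\<rho>) = (\<integral>\<^sup>+t. (\<integral>\<^sup>+x. h (t, x) \<partial>?r t) \<partial>U01)" if h: "h \<in> borel_measurable ?TS" for h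
  proof -
    have "(\<integral>\<^sup>+z. h z \<partial>\<rho>) = (\<integral>\<^sup>+t. (\<integral>\<^sup>+z. h z \<partial>K t) \<partial>U01)"
      unfolding \<rho>_def by (rule nn_integral_bind[OF h K])
    also have "\<dots> = (\<integral>\<^sup>+t. (\<integral>\<^sup>+x. h (t, x) \<partial>?r t) \<partial>U01)"
      unfolding K_def by (intro nn_integral_cong nn_integral_distr Pt) (use h in auto)
    finally show ?thesis .
  qed
  have em\<rho>: "emeasure \<rho> E = (\<integral>\<^sup>+t. emeasure (?r t) (Pair t -` E) \<partial>U01)" if E: "E \<in> sets ?TS" for E
  proof -
    have "emeasure \<rho> E = (\<integral>\<^sup>+z. indicator E z \<partial>\<rho>)" using E s\<rho> by simp
    also have "\<dots> = (\<integral>\<^sup>+t. (\<integral>\<^sup>+x. indicator E (t, x) \<partial>?r t) \<partial>U01)"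
      using E by (intro nn\<rho>) simp
    also have "\<dots> = (\<integral>\<^sup>+t. emeasure (?r t) (Pair t -` E) \<partial>U01)"
    proof (rule nn_integral_cong)
      fix t
      have "(\<integral>\<^sup>+x. indicator E (t, x) \<partial>?r t) = (\<integral>\<^sup>+x. indicator (Pair t -` E) x \<partial>?r t)"
        by (intro nn_integral_cong) (simp add: indicator_def)
      also have "\<dots> = emeasure (?r t) (Pair t -` E)"
        using time_space_slice[OF E] sets_mixture[OF ps] by (intro nn_integral_indicator) simp
      finally show "(\<integral>\<^sup>+x. indicator E (t, x) \<partial>?r t) = emeasure (?r t) (Pair t -` E)" .
    qed
    finally show ?thesis .
  qed
  have sp: "space ?TS = {0<..<1} \<times> UNIV" by (simp add: time_space_def space_restrict_space)
  have "prob_space \<rho>"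
  proof (rule prob_spaceI)
    have "emeasure \<rho> (space \<rho>) = emeasure \<rho> (space ?TS)" using sets_eq_imp_space_eq[OF s\<rho>] by simp
    also have "\<dots> = (\<integral>\<^sup>+t. emeasure (?r t) (Pair t -` space ?TS) \<partial>U01)" by (rule em\<rho>) simp
    also have "\<dots> = (\<integral>\<^sup>+t. 1 \<partial>U01)"
    proof (rule nn_integral_cong)
      fix t assume t: "t \<in> space U01"
      then have "Pair t -` space ?TS = space (?r t)" by (auto simp: sp space_mixture[OF ps])
      then show "emeasure (?r t) (Pair t -` space ?TS) = 1"
        using prob_space.emeasure_space_1[OF P2D(1)[OF rt]] t by simp
    qed
    finally show "emeasure \<rho> (space \<rho>) = 1" using U.emeasure_space_1 by simp
  qed
  moreover have "(\<integral>\<^sup>+z. ennreal ((norm (snd z))\<^sup>2) \<partial>\<rho>) < \<infinity>"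
  proof -
    let ?m = "\<lambda>p. \<integral>\<^sup>+x. ennreal ((norm x)\<^sup>2) \<partial>p"
    have "(\<lambda>z. ennreal ((norm (snd z))\<^sup>2)) \<in> borel_measurable ?TS"
      unfolding time_space_def
      by (intro measurable_restrict_space1 measurable_compose[OF _ measurable_ennreal] borel_measurable_continuous_onI continuous_intros)
    then have "(\<integral>\<^sup>+z. ennreal ((norm (snd z))\<^sup>2) \<partial>\<rho>) = (\<integral>\<^sup>+t. ?m (?r t) \<partial>U01)" by (simp add: nn\<rho>)
    also have "\<dots> \<le> (\<integral>\<^sup>+t. ?m \<mu> + ?m \<nu> \<partial>U01)"
    proof (rule nn_integral_mono)
      fix t assume "t \<in> space U01"
      then have t: "t \<in> {0..1}" by auto
      have "?m (?r t) = ennreal (1 - t) * ?m \<mu> + ennreal t * ?m \<nu>" by (rule nn_integral_mixture[OF ps t]) measurable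
      also have "\<dots> \<le> 1 * ?m \<mu> + 1 * ?m \<nu>" using t by (intro add_mono mult_right_mono) auto
      finally show "?m (?r t) \<le> ?m \<mu> + ?m \<nu>" by simp
    qed
    also have "\<dots> = ?m \<mu> + ?m \<nu>" using U.emeasure_space_1 by simp
    also have "\<dots> < \<infinity>" using \<mu> \<nu> by (auto simp: P2_def)
    finally show ?thesis .
  qed
  ultimately have \<rho>P: "\<rho> \<in> P2_time_space" using s\<rho> by (simp add: P2_time_space_def)
  have dp: "disintegrates_prob \<rho> ?r"
    using mixture_measurable[OF ps] em\<rho> by (auto simp: disintegrates_prob_def nn_integral_U01 measurable_U01)
  have \<Lambda>: "\<Lambda> \<in> psd_measures ?TS" unfolding \<Lambda>_def by (rule static_psd_measure[OF l])
  have dl: "disintegrates_psd \<Lambda> (\<lambda>_. l)"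
    unfolding disintegrates_psd_def set_integrable_U01 set_integral_U01 \<Lambda>_def
    using l static_slices[OF l] by auto
  have fin: "(\<integral>\<^sup>+t\<in>{0<..<1::real}. emeasure (total_variation borel l) UNIV \<partial>lborel) < \<infinity>"
  proof -
    have "(\<integral>\<^sup>+t\<in>{0<..<1::real}. emeasure (total_variation borel l) UNIV \<partial>lborel) = emeasure (total_variation borel l) UNIV"
      using nn_integral_U01[of "\<lambda>_. emeasure (total_variation borel l) UNIV"] U.emeasure_space_1 by simp
    then show ?thesis
      using finite_measure.emeasure_finite[OF finite_total_variation[OF l], of UNIV] by (simp add: less_top)
  qed
  have weak: "(LINT t:{0<..<1}|lborel. (LINT x|?r t. \<phi>t (t, x))) =
        - (LINT t:{0<..<1}|lborel. mat_integral borel l (\<lambda>x. (1/2) *\<^sub>R H (t, x)))"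
    if C12: "C12b \<phi> \<phi>t g H" and supp: "closure {(t, x). t \<in> {0<..<1} \<and> \<phi> (t, x) \<noteq> 0} \<subseteq> {0<..<1} \<times> UNIV"
    for \<phi> \<phi>t g H
  proof -
    have dt: "((\<lambda>s. \<phi> (s, x)) has_real_derivative \<phi>t (t, x)) (at t)" if "t \<in> {0<..<1}" for t x
      using C12 that unfolding C12b_def by blast
    have C2: "C2_with (\<lambda>x. \<phi> (t, x)) (\<lambda>x. g (t, x)) (\<lambda>x. H (t, x))" "bounded (range (\<lambda>x. H (t, x)))"
      if t: "t \<in> {0<..<1}" for t
    proof -
      have "continuous_on ({0<..<1} \<times> UNIV) H" using C12 unfolding C12b_def by blast
      then have "continuous_on UNIV (\<lambda>x. H (t, x))"
        by (rule continuous_on_compose2) (use t in \<open>auto intro!: continuous_intros\<close>)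
      then show "C2_with (\<lambda>x. \<phi> (t, x)) (\<lambda>x. g (t, x)) (\<lambda>x. H (t, x))"
        using C12 t unfolding C2_with_def C12b_def by blast
      have "bounded (H ` ({0<..<1} \<times> UNIV))" using C12 unfolding C12b_def by blast
      then show "bounded (range (\<lambda>x. H (t, x)))" by (rule bounded_subset) (use t in auto)
    qed
    have c\<phi>: "continuous_on ({0<..<1} \<times> UNIV) \<phi>" "continuous_on ({0<..<1} \<times> UNIV) \<phi>t"
      using C12 unfolding C12b_def by blast+
    have ct: "continuous_on {0<..<1} (\<lambda>t. \<phi> (t, x))" "continuous_on {0<..<1} (\<lambda>t. \<phi>t (t, x))" for x
      by (rule continuous_on_compose2[OF c\<phi>(1)], auto intro!: continuous_intros)
         (rule continuous_on_compose2[OF c\<phi>(2)], auto intro!: continuous_intros)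
    have cx: "continuous_on UNIV (\<lambda>x. \<phi>t (t, x))" if "t \<in> {0<..<1}" for t
      by (rule continuous_on_compose2[OF c\<phi>(2)]) (use that in \<open>auto intro!: continuous_intros\<close>)
    obtain B where B: "\<And>t x. t \<in> {0<..<1} \<Longrightarrow> \<bar>\<phi>t (t, x)\<bar> \<le> B"
    proof -
      have "bounded (\<phi>t ` ({0<..<1} \<times> UNIV))" using C12 unfolding C12b_def by blast
      then show ?thesis using that unfolding bounded_iff by force
    qed
    have B0: "0 \<le> B" using B[of "1/2"] by force
    have vanish: "\<exists>a>0. \<exists>b<1. \<forall>t\<in>{0<..<1}. t < a \<or> b < t \<longrightarrow> \<phi> (t, x) = 0" for x
    proof -
      define S where "S = {(t, x). t \<in> {0<..<1} \<and> \<phi> (t, x) \<noteq> 0}"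
      have far: "\<exists>e>0. \<forall>z\<in>S. e \<le> dist z (s, x)" if "s = 0 \<or> s = 1" for s
      proof -
        have "(s, x) \<notin> closure S" using supp that by (auto simp: S_def)
        then show ?thesis unfolding closure_approachable by (meson not_less)
      qed
      obtain e0 where e0: "e0 > 0" "\<And>z. z \<in> S \<Longrightarrow> e0 \<le> dist z (0, x)" using far[of 0] by blast
      obtain e1 where e1: "e1 > 0" "\<And>z. z \<in> S \<Longrightarrow> e1 \<le> dist z (1, x)" using far[of 1] by blast
      have "\<forall>t\<in>{0<..<1}. t < e0 \<or> 1 - e1 < t \<longrightarrow> \<phi> (t, x) = 0"
      proof (intro ballI impI)
        fix t :: real assume t: "t \<in> {0<..<1}" "t < e0 \<or> 1 - e1 < t"
        show "\<phi> (t, x) = 0"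
        proof (rule ccontr)
          assume "\<phi> (t, x) \<noteq> 0"
          then have "(t, x) \<in> S" using t by (auto simp: S_def)
          from e0(2)[OF this] e1(2)[OF this] show False using t by (auto simp: dist_Pair_Pair dist_real_def)
        qed
      qed
      moreover have "1 - e1 < 1" using e1(1) by simp
      ultimately show ?thesis using e0(1) by blast
    qed
    have by_parts: "(\<integral>t. (1 - t) * \<phi>t (t, x) \<partial>U01) = (\<integral>t. \<phi> (t, x) \<partial>U01)"
      "(\<integral>t. t * \<phi>t (t, x) \<partial>U01) = - (\<integral>t. \<phi> (t, x) \<partial>U01)"
      "\<And>t. t \<in> {0<..<1} \<Longrightarrow> \<bar>\<phi> (t, x)\<bar> \<le> B" for x
    proof -
      obtain a b where ab: "0 < a" "b < 1" "\<And>t. t \<in> {0<..<1} \<Longrightarrow> t < a \<or> b < t \<Longrightarrow> \<phi> (t, x) = 0"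
        using vanish[of x] by blast
      show bd: "\<bar>\<phi> (t, x)\<bar> \<le> B" if t: "t \<in> {0<..<1}" for t
      proof -
        define s where "s = min t a / 2"
        have s: "0 < s" "s < t" "s < a" "s < 1" using t ab by (auto simp: s_def)
        have "norm (\<phi> (t, x) - \<phi> (s, x)) \<le> B * norm (t - s)"
        proof (rule field_differentiable_bound[where S = "{s..t}" and f' = "\<lambda>t. \<phi>t (t, x)"])
          show "((\<lambda>t. \<phi> (t, x)) has_field_derivative \<phi>t (z, x)) (at z within {s..t})" if "z \<in> {s..t}" for z
            using that s t by (intro has_field_derivative_at_within[OF dt]) auto
          show "norm (\<phi>t (z, x)) \<le> B" if "z \<in> {s..t}" for z using that s t B[of z x] by auto
        qed (use s in auto)
        also have "\<dots> \<le> B * 1" using B0 s t by (intro mult_left_mono) auto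
        finally show ?thesis using ab(3)[of s] s by simp
      qed
      have i\<phi>: "integrable U01 (\<lambda>t. \<phi> (t, x))"
        using bd U01_continuous_measurable[OF ct(1)] by (intro U.integrable_const_bound[where B = B]) auto
      have i\<phi>t: "integrable U01 (\<lambda>t. h t * \<phi>t (t, x))" if h: "continuous_on UNIV h" "\<And>t. t \<in> {0<..<1} \<Longrightarrow> \<bar>h t\<bar> \<le> 1" for h
      proof (rule U.integrable_const_bound[where B = B])
        show "(\<lambda>t. h t * \<phi>t (t, x)) \<in> borel_measurable U01"
          using ct(2)[of x] h(1) by (intro U01_continuous_measurable continuous_intros) (auto intro: continuous_on_subset)
        show "AE t in U01. norm (h t * \<phi>t (t, x)) \<le> B"
          using mult_mono[OF h(2) B, of _ _ x] by (intro AE_I2) (auto simp: abs_mult)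
      qed
      have "(\<integral>t. (1 - t) * \<phi>t (t, x) - \<phi> (t, x) \<partial>U01) = 0"
      proof (rule U01_vanishing_FTC[where u = "\<lambda>t. (1 - t) * \<phi> (t, x)" and a = a and b = b])
        fix t :: real assume t: "t \<in> {0<..<1}"
        show "((\<lambda>t. (1 - t) * \<phi> (t, x)) has_real_derivative (1 - t) * \<phi>t (t, x) - \<phi> (t, x)) (at t)"
          by (rule DERIV_cong[OF DERIV_mult[OF _ dt[OF t]]]) (auto intro!: derivative_eq_intros)
      qed (use ab ct in \<open>auto intro!: continuous_intros\<close>)
      then show "(\<integral>t. (1 - t) * \<phi>t (t, x) \<partial>U01) = (\<integral>t. \<phi> (t, x) \<partial>U01)"
        using Bochner_Integration.integral_diff[OF i\<phi>t i\<phi>, of "\<lambda>t. 1 - t"] by (simp add: continuous_intros)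
      have "(\<integral>t. t * \<phi>t (t, x) + \<phi> (t, x) \<partial>U01) = 0"
      proof (rule U01_vanishing_FTC[where u = "\<lambda>t. t * \<phi> (t, x)" and a = a and b = b])
        fix t :: real assume t: "t \<in> {0<..<1}"
        show "((\<lambda>t. t * \<phi> (t, x)) has_real_derivative t * \<phi>t (t, x) + \<phi> (t, x)) (at t)"
          by (rule DERIV_cong[OF DERIV_mult[OF _ dt[OF t]]]) (auto intro!: derivative_eq_intros)
      qed (use ab ct in \<open>auto intro!: continuous_intros\<close>)
      then show "(\<integral>t. t * \<phi>t (t, x) \<partial>U01) = - (\<integral>t. \<phi> (t, x) \<partial>U01)"
        using Bochner_Integration.integral_add[OF i\<phi>t i\<phi>, of "\<lambda>t. t"] by (simp add: continuous_intros)
    qed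
    have swap: "(\<integral>t. (\<integral>x. h t * w (t, x) \<partial>p) \<partial>U01) = (\<integral>x. (\<integral>t. h t * w (t, x) \<partial>U01) \<partial>p)"
      "integrable U01 (\<lambda>t. \<integral>x. h t * w (t, x) \<partial>p)" "integrable p (\<lambda>x. \<integral>t. h t * w (t, x) \<partial>U01)"
      if p: "p \<in> P2" and w: "continuous_on ({0<..<1} \<times> UNIV) w" "\<And>t x. t \<in> {0<..<1} \<Longrightarrow> \<bar>w (t, x)\<bar> \<le> B"
        and h: "continuous_on UNIV h" "\<And>t. t \<in> {0<..<1} \<Longrightarrow> \<bar>h t\<bar> \<le> 1"
      for p :: "(real^'d) measure" and h :: "real \<Rightarrow> real" and w :: "real \<times> (real^'d) \<Rightarrow> real"
    proof -
      interpret p: prob_space p by (rule P2D(1)[OF p])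
      interpret pp: pair_prob_space U01 p by unfold_locales
      have "w \<in> borel_measurable (restrict_space borel ({0<..<1} \<times> UNIV))"
        by (rule borel_measurable_continuous_on_restrict[OF w(1)])
      from measurable_compose[OF U01_times_measurable[OF P2D(2)[OF p]] this]
      have mw: "w \<in> borel_measurable (U01 \<Otimes>\<^sub>M p)" by simp
      have "h \<in> borel_measurable U01" using h(1) by (intro U01_continuous_measurable) (auto intro: continuous_on_subset)
      from measurable_compose[OF measurable_fst this]
      have "(\<lambda>z. h (fst z) * w z) \<in> borel_measurable (U01 \<Otimes>\<^sub>M p)" using mw by measurable
      then have i: "integrable (U01 \<Otimes>\<^sub>M p) (\<lambda>z. h (fst z) * w z)"
      proof (rule pp.integrable_const_bound[where B = B, rotated])
        show "AE z in U01 \<Otimes>\<^sub>M p. norm (h (fst z) * w z) \<le> B"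
        proof (rule AE_I2)
          fix z assume "z \<in> space (U01 \<Otimes>\<^sub>M p)"
          then have z: "fst z \<in> {0<..<1}" by (auto simp: space_pair_measure)
          show "norm (h (fst z) * w z) \<le> B"
            using mult_mono[OF h(2)[OF z] w(2)[OF z, of "snd z"]] by (simp add: abs_mult)
        qed
      qed
      then have i': "integrable (U01 \<Otimes>\<^sub>M p) (\<lambda>(t, x). h t * w (t, x))" by (simp add: case_prod_beta')
      show "(\<integral>t. (\<integral>x. h t * w (t, x) \<partial>p) \<partial>U01) = (\<integral>x. (\<integral>t. h t * w (t, x) \<partial>U01) \<partial>p)"
        by (rule pp.Fubini_integral[OF i', symmetric])
      show "integrable U01 (\<lambda>t. \<integral>x. h t * w (t, x) \<partial>p)"
        by (rule pp.integrable_fst[OF i'])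
      show "integrable p (\<lambda>x. \<integral>t. h t * w (t, x) \<partial>U01)"
        by (rule pp.integrable_snd[OF i'])
    qed
    have c1: "continuous_on UNIV (\<lambda>t::real. 1 - t)" "continuous_on UNIV (\<lambda>t::real. t)" "continuous_on UNIV (\<lambda>t::real. 1::real)"
      by (auto intro!: continuous_intros)
    note sw1 = swap[OF \<mu> c\<phi>(2) B c1(1)] and sw2 = swap[OF \<nu> c\<phi>(2) B c1(2)]
      and sw3 = swap[OF \<mu> c\<phi>(1) by_parts(3) c1(3)] and sw4 = swap[OF \<nu> c\<phi>(1) by_parts(3) c1(3)]
    have "(\<integral>t. (LINT x|?r t. \<phi>t (t, x)) \<partial>U01)
      = (\<integral>t. (\<integral>x. (1 - t) * \<phi>t (t, x) \<partial>\<mu>) + (\<integral>x. t * \<phi>t (t, x) \<partial>\<nu>) \<partial>U01)"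
    proof (intro Bochner_Integration.integral_cong refl)
      fix t assume "t \<in> space U01"
      then have t: "t \<in> {0<..<1}" by simp
      then show "(LINT x|?r t. \<phi>t (t, x)) = (\<integral>x. (1 - t) * \<phi>t (t, x) \<partial>\<mu>) + (\<integral>x. t * \<phi>t (t, x) \<partial>\<nu>)"
        by (subst integral_mixture[OF ps _ borel_measurable_continuous_onI[OF cx[OF t]] B[OF t]]) auto
    qed
    also have "\<dots> = (\<integral>x. (\<integral>t. (1 - t) * \<phi>t (t, x) \<partial>U01) \<partial>\<mu>) + (\<integral>x. (\<integral>t. t * \<phi>t (t, x) \<partial>U01) \<partial>\<nu>)"
      using sw1 sw2 by (subst Bochner_Integration.integral_add) auto
    also have "\<dots> = (\<integral>x. (\<integral>t. \<phi> (t, x) \<partial>U01) \<partial>\<mu>) - (\<integral>x. (\<integral>t. \<phi> (t, x) \<partial>U01) \<partial>\<nu>)"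
      by (simp add: by_parts)
    also have "\<dots> = (\<integral>t. (\<integral>x. \<phi> (t, x) \<partial>\<mu>) - (\<integral>x. \<phi> (t, x) \<partial>\<nu>) \<partial>U01)"
      using sw3 sw4 by (subst Bochner_Integration.integral_diff) auto
    also have "\<dots> = (\<integral>t. - mat_integral borel l (\<lambda>x. (1/2) *\<^sub>R H (t, x)) \<partial>U01)"
      by (intro Bochner_Integration.integral_cong refl) (use eq[OF C2] in simp)
    finally show ?thesis by (simp add: set_integral_U01)
  qed
  have "fokker_planck \<rho> \<Lambda> ?r (\<lambda>_. l)"
    unfolding fokker_planck_def using \<rho>P \<Lambda> dp dl fin weak by blast
  then show ?thesis by blast
qed

lemma static_upper_bound:
  fixes \<mu> \<nu> :: "(real^'d) measure" and f :: "real^'d^'d \<Rightarrow> ennreal"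
  assumes \<mu>: "\<mu> \<in> P2" and \<nu>: "\<nu> \<in> P2" and l: "l \<in> psd_measures borel"
    and eq: "\<And>\<psi> g H. C2_with \<psi> g H \<Longrightarrow> bounded (range H) \<Longrightarrow>
      mat_integral borel l (\<lambda>x. (1/2) *\<^sub>R H x) = (\<integral>x. \<psi> x \<partial>\<nu>) - (\<integral>x. \<psi> x \<partial>\<mu>)"
  shows "dyn_cost f \<mu> \<nu> \<le> (\<integral>\<^sup>+x. f (polar_density borel l x) \<partial>total_variation borel l)"
proof -
  note ps = P2D(1,2)[OF \<mu>] P2D(1,2)[OF \<nu>]
  obtain \<rho> \<Lambda> where fp: "fokker_planck \<rho> \<Lambda> (mixture \<mu> \<nu>) (\<lambda>_. l)"
    using static_fokker_planck[OF \<mu> \<nu> l] eq by blast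
  have nc: "narrowly_continuous (mixture \<mu> \<nu>)"
    unfolding narrowly_continuous_def
  proof (intro conjI ballI allI impI)
    show "mixture \<mu> \<nu> t \<in> P2" if "t \<in> {0..1}" for t by (rule mixture_P2[OF \<mu> \<nu> that])
    fix h :: "real^'d \<Rightarrow> real" assume h: "continuous_on UNIV h" "bounded (range h)"
    then obtain B where B: "\<And>x. \<bar>h x\<bar> \<le> B" by (auto simp: bounded_iff)
    have "continuous_on {0..1} (\<lambda>t. (1 - t) * (\<integral>x. h x \<partial>\<mu>) + t * (\<integral>x. h x \<partial>\<nu>))" by (intro continuous_intros)
    then show "continuous_on {0..1} (\<lambda>t. LINT x|mixture \<mu> \<nu> t. h x)"
      by (rule continuous_on_eq) (simp add: integral_mixture[OF ps _ borel_measurable_continuous_onI[OF h(1)] B])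
  qed
  have "dyn_cost f \<mu> \<nu> \<le> action f (\<lambda>_. l)"
    unfolding dyn_cost_def using fp nc mixture_0[OF ps] mixture_1[OF ps] by (intro Inf_lower) blast
  also have "\<dots> = (\<integral>\<^sup>+x. f (polar_density borel l x) \<partial>total_variation borel l)"
    using nn_integral_U01[of "\<lambda>_. \<integral>\<^sup>+x. f (polar_density borel l x) \<partial>total_variation borel l"]
      prob_space.emeasure_space_1[OF prob_space_U01] by (simp add: action_def)
  finally show ?thesis .
qed

section \<open>Solutions issuing from a point mass\<close>

lemma integrable_compact_support:
  fixes h :: "'a::euclidean_space \<Rightarrow> real"
  assumes h: "continuous_on UNIV h" and z: "\<And>w. R < norm w \<Longrightarrow> h w = 0"
  shows "integrable lborel h"
proof -
  have "integrable lborel (\<lambda>x. indicator (cball 0 R) x *\<^sub>R h x)"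
    using h by (intro borel_integrable_compact) (auto intro: continuous_on_subset)
  moreover have "(\<lambda>x. indicator (cball 0 R) x *\<^sub>R h x) = h"
    using z by (force simp: fun_eq_iff split: split_indicator)
  ultimately show ?thesis by simp
qed

text \<open>The difference quotients of a compactly supported function integrate to zero by translation invariance.\<close>

lemma integral_directional_derivative:
  fixes F :: "'a::euclidean_space \<Rightarrow> real"
  assumes F: "\<And>w. (F has_derivative F' w) (at w)" and cF': "continuous_on UNIV (\<lambda>w. F' w v)"
    and z: "\<And>w. R < norm w \<Longrightarrow> F w = 0"
  shows "(\<integral>w. F' w v \<partial>lborel) = 0"
proof -
  have cF: "continuous_on UNIV F" using F by (intro has_derivative_continuous_on) (auto intro: has_derivative_at_withinI)
  have iF: "integrable lborel F" by (rule integrable_compact_support[OF cF z])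
  define D where "D = (\<lambda>n w. real (Suc n) * (F ((1 / real (Suc n)) *\<^sub>R v + w) - F w))"
  have shift: "integrable lborel (\<lambda>w. F (c + w))" "(\<integral>w. F (c + w) \<partial>lborel) = (\<integral>w. F w \<partial>lborel)" for c
  proof -
    have [measurable]: "F \<in> borel_measurable borel" using cF by (rule borel_measurable_continuous_onI)
    have "integrable (distr lborel borel ((+) c)) F" unfolding lborel_distr_plus by (rule iF)
    then show "integrable lborel (\<lambda>w. F (c + w))" by (subst (asm) integrable_distr_eq) auto
    have "(\<integral>w. F w \<partial>distr lborel borel ((+) c)) = (\<integral>w. F (c + w) \<partial>lborel)" by (rule integral_distr) auto
    then show "(\<integral>w. F (c + w) \<partial>lborel) = (\<integral>w. F w \<partial>lborel)" unfolding lborel_distr_plus by simp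
  qed
  have D0: "(\<integral>w. D n w \<partial>lborel) = 0" for n
    unfolding D_def using shift iF by simp
  have line: "((\<lambda>s. F (w + s *\<^sub>R v)) has_real_derivative F' (w + s *\<^sub>R v) v) (at s)" for w s
  proof -
    have "((\<lambda>s. F (w + s *\<^sub>R v)) has_derivative (\<lambda>h. F' (w + s *\<^sub>R v) (h *\<^sub>R v))) (at s)"
      by (rule has_derivative_compose[OF _ F]) (auto intro!: derivative_eq_intros)
    moreover have "(\<lambda>h. F' (w + s *\<^sub>R v) (h *\<^sub>R v)) = (\<lambda>h. F' (w + s *\<^sub>R v) v * h)"
      using linear_scale[OF has_derivative_linear[OF F]] by (simp add: fun_eq_iff)
    ultimately show ?thesis unfolding has_field_derivative_def by simp
  qed
  have "bounded ((\<lambda>w. F' w v) ` cball 0 (R + 2 * norm v))"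
    using cF' by (intro compact_imp_bounded compact_continuous_image) (auto intro: continuous_on_subset)
  then obtain C where C: "\<And>w. norm w \<le> R + 2 * norm v \<Longrightarrow> \<bar>F' w v\<bar> \<le> C"
    unfolding bounded_iff by force
  have "(\<lambda>n. \<integral>w. D n w \<partial>lborel) \<longlonglongrightarrow> (\<integral>w. F' w v \<partial>lborel)"
  proof (rule integral_dominated_convergence[where w = "\<lambda>w. indicat_real (cball 0 (R + norm v)) w *\<^sub>R \<bar>C\<bar>"])
    show "(\<lambda>w. F' w v) \<in> borel_measurable lborel"
      using cF' by (simp add: borel_measurable_continuous_onI)
    show "D n \<in> borel_measurable lborel" for n
      unfolding D_def using shift(1) iF by (intro borel_measurable_times borel_measurable_diff) auto
    show "integrable lborel (\<lambda>w. indicat_real (cball 0 (R + norm v)) w *\<^sub>R \<bar>C\<bar>)"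
      by (rule borel_integrable_compact) auto
    show "AE w in lborel. norm (D n w) \<le> indicat_real (cball 0 (R + norm v)) w *\<^sub>R \<bar>C\<bar>" for n
    proof (rule AE_I2)
      fix w
      let ?t = "1 / real (Suc n)"
      have t: "0 < ?t" "?t \<le> 1" by auto
      show "norm (D n w) \<le> indicat_real (cball 0 (R + norm v)) w *\<^sub>R \<bar>C\<bar>"
      proof (cases "norm w \<le> R + norm v")
        case True
        have "norm (F (w + ?t *\<^sub>R v) - F (w + 0 *\<^sub>R v)) \<le> \<bar>C\<bar> * norm (?t - 0)"
        proof (rule field_differentiable_bound[where S = "{0..?t}" and f = "\<lambda>s. F (w + s *\<^sub>R v)" and f' = "\<lambda>s. F' (w + s *\<^sub>R v) v"])
          fix s assume s: "s \<in> {0..?t}"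
          show "((\<lambda>s. F (w + s *\<^sub>R v)) has_field_derivative F' (w + s *\<^sub>R v) v) (at s within {0..?t})"
            by (rule has_field_derivative_at_within[OF line])
          have "\<bar>s\<bar> \<le> 1" using s t(2) unfolding atLeastAtMost_iff by linarith
          then have "norm (s *\<^sub>R v) \<le> 1 * norm v" unfolding norm_scaleR by (intro mult_right_mono) auto
          then have "norm (w + s *\<^sub>R v) \<le> R + 2 * norm v" using True norm_triangle_ineq[of w "s *\<^sub>R v"] by linarith
          then show "norm (F' (w + s *\<^sub>R v) v) \<le> \<bar>C\<bar>" using C by (force intro: order_trans)
        qed (use t in auto)
        then have "real (Suc n) * \<bar>F (w + ?t *\<^sub>R v) - F w\<bar> \<le> real (Suc n) * (\<bar>C\<bar> * ?t)"
          by (intro mult_left_mono) auto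
        then show ?thesis using True by (simp add: D_def abs_mult add.commute del: of_nat_Suc)
      next
        case False
        have "norm (?t *\<^sub>R v) \<le> 1 * norm v" using t unfolding norm_scaleR by (intro mult_right_mono) auto
        then have "R < norm (?t *\<^sub>R v + w)" using False norm_triangle_ineq2[of w "- (?t *\<^sub>R v)"] by (simp add: add.commute)
        moreover have "R < norm w" using False norm_ge_zero[of v] by linarith
        ultimately show ?thesis using z by (simp add: D_def)
      qed
    qed
    show "AE w in lborel. (\<lambda>n. D n w) \<longlonglongrightarrow> F' w v"
    proof (rule AE_I2)
      fix w
      have "((\<lambda>h. (F (w + h *\<^sub>R v) - F w) / h) \<longlongrightarrow> F' w v) (at 0)"
        using line[of w 0] by (simp add: DERIV_def)
      moreover have "filterlim (\<lambda>n. 1 / real (Suc n)) (at 0) sequentially"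
        unfolding filterlim_at using LIMSEQ_Suc[OF lim_1_over_n] by auto
      ultimately have "(\<lambda>n. (F (w + (1 / real (Suc n)) *\<^sub>R v) - F w) / (1 / real (Suc n))) \<longlonglongrightarrow> F' w v"
        by (rule filterlim_compose)
      then show "(\<lambda>n. D n w) \<longlonglongrightarrow> F' w v" by (simp add: D_def add.commute mult.commute)
    qed
  qed
  then show ?thesis using D0 by (simp add: LIMSEQ_const_iff)
qed

lemma mat_inner_sym_trace:
  assumes "A \<in> sym_mats"
  shows "(\<Sum>i\<in>UNIV. (H *v (A *v axis i 1)) $ i) = H \<bullet> (A::real^'d^'d)"
  unfolding matrix_vector_mult_basis using sym_matsD[OF assms]
  by (simp add: mat_inner_sum matrix_vector_mult_def column_def)

context
  fixes A :: "real^'d^'d"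
  assumes A: "A \<in> pd_mats"
begin

text \<open>
  The bump and the kernel are matched: the gradient of the bump at \<open>z\<close> is minus the kernel times \<open>A z\<close>,
  so that integration by parts turns the first order term along \<open>A z\<close> into a second order one with
  the constant matrix \<open>A\<close>.
\<close>

definition quad_form where "quad_form z = z \<bullet> (A *v z)"
definition quad_bump where "quad_bump z = (max 0 (1 - quad_form z))\<^sup>2"
definition quad_kernel where "quad_kernel z = 4 * max 0 (1 - quad_form z)"

lemma pd_mat_sym: "A \<in> sym_mats" using A by (simp add: pd_mats_def)

lemma pd_mat_inner_commute: "z \<bullet> (A *v h) = h \<bullet> (A *v z)"
proof -
  have "transpose A = A" using pd_mat_sym by (simp add: sym_mats_def)
  then have "z \<bullet> (A *v h) = (A *v z) \<bullet> h"
    using dot_lmul_matrix[of z A h] transpose_matrix_vector[of A z] by simp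
  then show ?thesis by (simp add: inner_commute)
qed

lemma pd_mat_bounded_linear: "bounded_linear ((*v) A)"
  by (rule matrix_vector_mul_bounded_linear)

lemma pd_mat_continuous: "continuous_on S f \<Longrightarrow> continuous_on S (\<lambda>x. A *v f x)"
  by (rule bounded_linear.continuous_on[OF pd_mat_bounded_linear])

lemma quad_form_coercive: "\<exists>R>0. \<forall>z. R < norm z \<longrightarrow> 1 < quad_form z"
proof -
  have "continuous_on (sphere 0 1) quad_form" unfolding quad_form_def by (intro continuous_intros pd_mat_continuous)
  moreover have "sphere (0::real^'d) 1 \<noteq> {}" by auto
  ultimately obtain u where u: "u \<in> sphere 0 1" "\<And>z. z \<in> sphere 0 1 \<Longrightarrow> quad_form u \<le> quad_form z"
    using continuous_attains_inf[OF compact_sphere] by blast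
  have "u \<noteq> 0" using u(1) by auto
  then have c: "0 < quad_form u" using A by (simp add: quad_form_def pd_mats_def)
  define R where "R = max 1 (1 / quad_form u)"
  have "1 < quad_form z" if z: "R < norm z" for z
  proof -
    have z0: "1 < norm z" "1 / quad_form u < norm z" using z by (auto simp: R_def)
    have "quad_form z = (norm z)\<^sup>2 * quad_form ((1 / norm z) *\<^sub>R z)"
      using z0 by (simp add: quad_form_def matrix_vector_mult_scaleR power2_eq_square)
    also have "\<dots> \<ge> (norm z)\<^sup>2 * quad_form u" using z0 by (intro mult_left_mono u(2)) auto
    finally have "(norm z)\<^sup>2 * quad_form u \<le> quad_form z" .
    moreover have "1 < norm z * quad_form u" using z0 c by (simp add: field_simps)
    moreover have "norm z * quad_form u \<le> (norm z)\<^sup>2 * quad_form u"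
    proof (rule mult_right_mono)
      show "norm z \<le> (norm z)\<^sup>2"
        using z0 mult_left_mono[of 1 "norm z" "norm z"] by (simp add: power2_eq_square)
    qed (use c in simp)
    ultimately show ?thesis by linarith
  qed
  moreover have "0 < R" by (simp add: R_def)
  ultimately show ?thesis by blast
qed

lemma quad_form_derivative: "(quad_form has_derivative (\<lambda>h. 2 * ((A *v z) \<bullet> h))) (at z)"
proof -
  have "((\<lambda>z. z \<bullet> (A *v z)) has_derivative (\<lambda>h. z \<bullet> (A *v h) + h \<bullet> (A *v z))) (at z)"
    by (intro has_derivative_inner has_derivative_ident bounded_linear.has_derivative[OF pd_mat_bounded_linear])
  moreover have "z \<bullet> (A *v h) + h \<bullet> (A *v z) = 2 * ((A *v z) \<bullet> h)" for h
    using pd_mat_inner_commute[of z h] inner_commute[of h "A *v z"] by linarith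
  ultimately show ?thesis unfolding quad_form_def[abs_def] by simp
qed

lemma quad_form_continuous: "continuous_on S quad_form"
  unfolding quad_form_def[abs_def] by (intro continuous_intros pd_mat_continuous)

lemma quad_bump_derivative: "(quad_bump has_derivative (\<lambda>h. - quad_kernel z * ((A *v z) \<bullet> h))) (at z)"
proof -
  have 1: "((\<lambda>s::real. (max 0 (s - 0))\<^sup>2) has_derivative (\<lambda>h. 2 * max 0 (1 - quad_form z - 0) * h)) (at (1 - quad_form z))"
    by (rule DERIV_max_sq[unfolded has_field_derivative_def])
  have 2: "((\<lambda>z. 1 - quad_form z) has_derivative (\<lambda>h. - (2 * ((A *v z) \<bullet> h)))) (at z)"
    by (auto intro!: derivative_eq_intros quad_form_derivative)
  show ?thesis
    using has_derivative_compose[OF 2 1] by (simp add: quad_bump_def[abs_def] quad_kernel_def algebra_simps)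
qed

lemma quad_bump_continuous: "continuous_on S quad_bump" and quad_kernel_continuous: "continuous_on S quad_kernel"
  unfolding quad_bump_def[abs_def] quad_kernel_def[abs_def] by (intro continuous_intros quad_form_continuous)+

lemma quad_bump_nonneg: "0 \<le> quad_bump z" and quad_kernel_nonneg: "0 \<le> quad_kernel z"
  by (auto simp: quad_bump_def quad_kernel_def)

lemma quad_bump_outside: "1 < quad_form z \<Longrightarrow> quad_bump z = 0" and quad_kernel_outside: "1 < quad_form z \<Longrightarrow> quad_kernel z = 0"
  by (auto simp: quad_bump_def quad_kernel_def)

lemma quad_kernel_integration_by_parts:
  assumes \<psi>: "C2_with \<psi> g H"
  shows "(\<integral>z. quad_kernel z * (g (x + \<sigma> *\<^sub>R (A *v z)) \<bullet> (A *v z)) \<partial>lborel)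
    = \<sigma> * (\<integral>z. quad_bump z * (H (x + \<sigma> *\<^sub>R (A *v z)) \<bullet> A) \<partial>lborel)"
proof -
  obtain R where R: "\<And>z. R < norm z \<Longrightarrow> 1 < quad_form z" using quad_form_coercive by blast
  let ?y = "\<lambda>z. x + \<sigma> *\<^sub>R (A *v z)"
  define F where "F = (\<lambda>i z. quad_bump z * (g (?y z) $ i))"
  define F' where "F' = (\<lambda>i z h. quad_bump z * ((H (?y z) *v (\<sigma> *\<^sub>R (A *v h))) $ i) + (- quad_kernel z * ((A *v z) \<bullet> h)) * (g (?y z) $ i))"
  have cy: "continuous_on UNIV ?y" by (intro continuous_intros pd_mat_continuous)
  have cg: "continuous_on UNIV (\<lambda>z. g (?y z))" and cH: "continuous_on UNIV (\<lambda>z. H (?y z))"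
    by (simp_all add: continuous_on_compose2[OF C2_continuous(2)[OF \<psi>] cy] continuous_on_compose2[OF C2_continuous(3)[OF \<psi>] cy])
  have dF: "(F i has_derivative F' i z) (at z)" for i z
  proof -
    have "(?y has_derivative (\<lambda>h. \<sigma> *\<^sub>R (A *v h))) (at z)"
      by (auto intro!: derivative_eq_intros bounded_linear.has_derivative[OF pd_mat_bounded_linear])
    moreover have "(g has_derivative (\<lambda>h. H (?y z) *v h)) (at (?y z))" using \<psi> by (simp add: C2_with_def)
    ultimately have "((\<lambda>z. g (?y z)) has_derivative (\<lambda>h. H (?y z) *v (\<sigma> *\<^sub>R (A *v h)))) (at z)"
      by (rule has_derivative_compose)
    from bounded_linear.has_derivative[OF bounded_linear_vec_nth[of i] this]
    have "((\<lambda>z. g (?y z) $ i) has_derivative (\<lambda>h. (H (?y z) *v (\<sigma> *\<^sub>R (A *v h))) $ i)) (at z)" .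
    from has_derivative_mult[OF quad_bump_derivative this] show ?thesis unfolding F_def F'_def .
  qed
  have cF': "continuous_on UNIV (\<lambda>z. F' i z h)" for i h
    unfolding F'_def matrix_vector_mult_def
    using cg cH quad_bump_continuous quad_kernel_continuous
    by (auto intro!: continuous_intros simp: matrix_vector_mult_def[symmetric] intro!: pd_mat_continuous)
  have zF': "F' i z h = 0" if "R < norm z" for i z h
    using quad_bump_outside[OF R[OF that]] quad_kernel_outside[OF R[OF that]] by (simp add: F'_def)
  have iF': "integrable lborel (\<lambda>z. F' i z (axis i 1))" for i
    by (rule integrable_compact_support[OF cF' zF'])
  have "(\<integral>z. F' i z (axis i 1) \<partial>lborel) = 0" for i
    by (rule integral_directional_derivative[OF dF cF', of R]) (use quad_bump_outside R in \<open>simp add: F_def\<close>)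
  then have "0 = (\<integral>z. (\<Sum>i\<in>UNIV. F' i z (axis i 1)) \<partial>lborel)"
    using iF' by (subst Bochner_Integration.integral_sum) auto
  also have "\<dots> = (\<integral>z. \<sigma> * (quad_bump z * (H (?y z) \<bullet> A)) - quad_kernel z * (g (?y z) \<bullet> (A *v z)) \<partial>lborel)"
  proof (intro Bochner_Integration.integral_cong refl)
    fix z
    have "(\<Sum>i\<in>UNIV. F' i z (axis i 1)) = quad_bump z * (\<sigma> * (\<Sum>i\<in>UNIV. (H (?y z) *v (A *v axis i 1)) $ i))
        - quad_kernel z * (\<Sum>i\<in>UNIV. (A *v z) $ i * g (?y z) $ i)"
      by (simp add: F'_def sum.distrib sum_distrib_left sum_subtractf matrix_vector_mult_scaleR inner_axis algebra_simps sum_negf)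
    then show "(\<Sum>i\<in>UNIV. F' i z (axis i 1)) = \<sigma> * (quad_bump z * (H (?y z) \<bullet> A)) - quad_kernel z * (g (?y z) \<bullet> (A *v z))"
      unfolding mat_inner_sym_trace[OF pd_mat_sym] by (simp add: inner_vec_def mult.commute)
  qed
  also have "\<dots> = \<sigma> * (\<integral>z. quad_bump z * (H (?y z) \<bullet> A) \<partial>lborel) - (\<integral>z. quad_kernel z * (g (?y z) \<bullet> (A *v z)) \<partial>lborel)"
  proof -
    have "integrable lborel (\<lambda>z. quad_bump z * (H (?y z) \<bullet> A))"
      using quad_bump_outside[OF R] by (intro integrable_compact_support[of _ R] continuous_intros quad_bump_continuous cH) auto
    moreover have "integrable lborel (\<lambda>z. quad_kernel z * (g (?y z) \<bullet> (A *v z)))"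
      using quad_kernel_outside[OF R] by (intro integrable_compact_support[of _ R] continuous_intros quad_kernel_continuous cg pd_mat_continuous) auto
    ultimately show ?thesis by simp
  qed
  finally show ?thesis by simp
qed

end

lemma return_P2: "return borel x \<in> (P2 :: (real^'d) measure set)"
  by (auto simp: P2_def prob_space_return nn_integral_return)

lemma integral_return_C2:
  fixes \<psi> :: "real^'d \<Rightarrow> real"
  assumes "continuous_on UNIV \<psi>"
  shows "(\<integral>y. \<psi> y \<partial>return borel x) = \<psi> x"
  using assms by (intro integral_return borel_measurable_continuous_onI) auto

text \<open>
  Let \<open>p\<close> be the law of \<open>x + r A z\<close>, \<open>z\<close> having the density \<open>quad_kernel A\<close>.  Differentiating in the
  scale \<open>r\<close> and integrating by parts gives \<open>p - \<delta>\<^sub>x = tr (1/2 \<nabla>\<^sup>2 (A m))\<close> with an explicit positive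
  measure \<open>m\<close>, supported as close to \<open>x\<close> as desired.
\<close>

lemma point_mass_spreading:
  fixes A :: "real^'d^'d"
  assumes A: "A \<in> pd_mats" and e: "0 < e"
  shows "\<exists>p m. p \<in> P2 \<and> sets m = sets borel \<and> finite_measure m \<and> 0 < measure m UNIV \<and> (AE y in m. dist y x < e) \<and>
    (\<forall>\<psi> g H. C2_with \<psi> g H \<longrightarrow> bounded (range H) \<longrightarrow>
      (\<integral>y. ((1/2) *\<^sub>R H y) \<bullet> A \<partial>m) = (\<integral>y. \<psi> y \<partial>p) - \<psi> x)"
proof -
  let ?k = "quad_kernel A" and ?b = "quad_bump A"
  obtain R where R: "0 < R" "\<And>z. R < norm z \<Longrightarrow> 1 < quad_form A z" using quad_form_coercive[OF A] by blast
  have kz: "?k z = 0" "?b z = 0" if "R < norm z" for z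
    using quad_kernel_outside[OF A R(2)[OF that]] quad_bump_outside[OF A R(2)[OF that]] by auto
  have ck: "continuous_on S ?k" "continuous_on S ?b" for S
    using quad_kernel_continuous[OF A] quad_bump_continuous[OF A] by auto
  have nn: "0 \<le> ?k z" "0 \<le> ?b z" for z using quad_kernel_nonneg[OF A] quad_bump_nonneg[OF A] by auto
  have ik: "integrable lborel ?k" "integrable lborel ?b"
    using kz by (auto intro!: integrable_compact_support[of _ R] ck)
  have mk[measurable]: "?k \<in> borel_measurable borel" "?b \<in> borel_measurable borel"
    using ck by (auto intro!: borel_measurable_continuous_onI)
  have pos: "0 < (\<integral>z. h z \<partial>lborel)"
    if h: "continuous_on UNIV h" "\<And>z. 0 \<le> h z" "0 < h 0" "integrable lborel h" for h :: "real^'d \<Rightarrow> real"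
  proof -
    have "open {z. 0 < h z}" using h(1) by (intro open_Collect_less continuous_intros) auto
    moreover have "{z. 0 < h z} \<noteq> {}" using h(3) by auto
    ultimately have n: "\<not> negligible {z. 0 < h z}" by (rule open_not_negligible)
    have [measurable]: "h \<in> borel_measurable borel" using h(1) by (rule borel_measurable_continuous_onI)
    have "\<not> (AE z in lborel. h z = 0)"
    proof
      assume "AE z in lborel. h z = 0"
      then have "{z \<in> space lborel. h z \<noteq> 0} \<in> null_sets lborel" by (subst (asm) AE_iff_null) auto
      moreover have "h z \<noteq> 0 \<longleftrightarrow> 0 < h z" for z using h(2)[of z] by (cases "h z = 0") auto
      ultimately have "{z. 0 < h z} \<in> null_sets lborel" by simp
      then have "{z. 0 < h z} \<in> null_sets lebesgue" by (rule null_sets_completionI)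
      then show False using n by (simp add: negligible_iff_null_sets)
    qed
    then have "(\<integral>z. h z \<partial>lborel) \<noteq> 0" using integral_nonneg_eq_0_iff_AE[OF h(4)] h(2) by auto
    moreover have "0 \<le> (\<integral>z. h z \<partial>lborel)" using h(2) by (intro integral_nonneg_AE) auto
    ultimately show ?thesis by simp
  qed
  have kb0: "0 < ?k 0" "0 < ?b 0" by (simp_all add: quad_kernel_def[OF A] quad_bump_def[OF A] quad_form_def[OF A])
  define N where "N = (\<integral>z. ?k z \<partial>lborel)"
  define N' where "N' = (\<integral>z. ?b z \<partial>lborel)"
  have N: "0 < N" "0 < N'" unfolding N_def N'_def using pos nn kb0 ik ck by auto
  obtain a where a: "0 < a" "\<And>z. norm (A *v z) \<le> norm z * a"
    using bounded_linear.pos_bounded[OF matrix_vector_mul_bounded_linear[of A]] by blast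
  define r where "r = e / (2 * (R * a))"
  have r: "0 < r" using e R a by (simp add: r_def)
  have small: "norm (r *\<^sub>R s *\<^sub>R (A *v z)) < e" if "norm z \<le> R" "0 \<le> s" "s \<le> 1" for s z
  proof -
    have "norm (r *\<^sub>R s *\<^sub>R (A *v z)) = s * (r * norm (A *v z))" using r that by simp
    also have "\<dots> \<le> 1 * (r * (R * a))"
      using that r a R by (intro mult_mono order_trans[OF a(2)] mult_right_mono) auto
    also have "\<dots> = e / 2" using R a by (simp add: r_def)
    finally show ?thesis using e by linarith
  qed
  define Y where "Y = (\<lambda>s z. x + (r * s) *\<^sub>R (A *v z))"
  have Y_cont: "continuous_on S (\<lambda>w. Y (f w) (h w))" if "continuous_on S f" "continuous_on S h" for S f and h :: "'z::topological_space \<Rightarrow> real^'d"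
    unfolding Y_def using that by (intro continuous_intros bounded_linear.continuous_on[OF matrix_vector_mul_bounded_linear])
  interpret U: prob_space U01 by (rule prob_space_U01)
  interpret P: pair_sigma_finite U01 "lborel :: (real^'d) measure" by unfold_locales
  let ?P = "U01 \<Otimes>\<^sub>M (lborel :: (real^'d) measure)"
  have spP: "space ?P = {0<..<1} \<times> UNIV" by (simp add: space_pair_measure)
  have mP: "h \<in> borel_measurable ?P" if "continuous_on UNIV h" for h :: "real \<times> (real^'d) \<Rightarrow> 'b::topological_space"
  proof -
    have "h \<in> borel_measurable (restrict_space borel ({0<..<1} \<times> UNIV))"
      using that by (intro borel_measurable_continuous_on_restrict) (auto intro: continuous_on_subset)
    from measurable_compose[OF U01_times_measurable[of "lborel :: (real^'d) measure"] this] show ?thesis by simp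
  qed
  have iP: "integrable ?P h" if h: "continuous_on UNIV h" "\<And>s z. R < norm z \<Longrightarrow> h (s, z) = 0"
    for h :: "real \<times> (real^'d) \<Rightarrow> real"
  proof -
    have "compact ({0..1::real} \<times> cball (0::real^'d) R)" by (intro compact_Times) auto
    then have "bounded (h ` ({0..1} \<times> cball 0 R))"
      using h(1) by (intro compact_imp_bounded compact_continuous_image) (auto intro: continuous_on_subset)
    then obtain B where B: "\<forall>w\<in>{0..1} \<times> cball 0 R. norm (h w) \<le> B" unfolding bounded_iff by blast
    have S: "{0<..<1::real} \<times> cball (0::real^'d) R \<in> sets ?P"
      using sets.top[of U01] by (intro pair_measureI) auto
    have "emeasure ?P ({0<..<1} \<times> cball 0 R) = emeasure U01 {0<..<1} * emeasure lborel (cball (0::real^'d) R)"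
      using sets.top[of U01] by (intro lborel.emeasure_pair_measure_Times) auto
    also have "\<dots> < \<infinity>"
      using U.emeasure_space_1 emeasure_compact_finite[of "cball (0::real^'d) R"] by simp
    finally have "integrable ?P (\<lambda>w. indicat_real ({0<..<1} \<times> cball 0 R) w * B)"
      using S by (intro integrable_mult_left integrable_real_indicator) auto
    then show ?thesis
    proof (rule Bochner_Integration.integrable_bound)
      show "AE w in ?P. norm (h w) \<le> norm (indicat_real ({0<..<1} \<times> cball 0 R) w * B)"
      proof (rule AE_I2)
        fix w assume w: "w \<in> space ?P"
        obtain s z where sz: "w = (s, z)" by (cases w)
        show "norm (h w) \<le> norm (indicat_real ({0<..<1} \<times> cball 0 R) w * B)"
        proof (cases "norm z \<le> R")
          case True
          then have "norm (h (s, z)) \<le> B" using B w sz by (auto simp: spP)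
          then show ?thesis using True w sz by (auto simp: spP indicator_def)
        next
          case False then show ?thesis using h(2)[of z s] sz by simp
        qed
      qed
    qed (rule mP[OF h(1)])
  qed
  define p where "p = distr (density lborel (\<lambda>z. ennreal (?k z / N))) borel (Y 1)"
  (* The s-derivative of the mean of \<psi> (Y s z) is r (g \<bullet> A z), which integration by parts with
     \<sigma> = r s turns into r^2 s (H \<bullet> A) against the bump; the 2 makes up for the 1/2 before H. *)
  define w where "w = (\<lambda>(s, z). 2 * r\<^sup>2 * s * ?b z / N)"
  define m where "m = distr (density ?P (\<lambda>v. ennreal (w v))) borel (\<lambda>(s, z). Y s z)"
  have [measurable]: "Y 1 \<in> borel_measurable borel"
    by (intro borel_measurable_continuous_onI Y_cont continuous_intros)
  have cY2: "continuous_on UNIV (\<lambda>(s, z). Y s z)"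
    unfolding case_prod_beta by (intro Y_cont continuous_intros)
  have [measurable]: "(\<lambda>(s, z). Y s z) \<in> borel_measurable ?P" by (rule mP[OF cY2])
  have cw: "continuous_on UNIV w"
    unfolding w_def case_prod_beta
    by (intro continuous_intros continuous_on_compose2[OF ck(2)[of UNIV]]) (use N in auto)
  have [measurable]: "w \<in> borel_measurable ?P" by (rule mP[OF cw])
  have w_nn: "0 \<le> w v" if "v \<in> space ?P" for v
    using that nn N r by (auto simp: w_def spP intro!: mult_nonneg_nonneg divide_nonneg_pos)
  have w_out: "w (s, z) = 0" if "R < norm z" for s z using kz[OF that] by (simp add: w_def)
  have iw: "integrable ?P w" by (rule iP[OF cw w_out])
  have int_p: "(\<integral>y. u y \<partial>p) = (\<integral>z. ?k z / N * u (Y 1 z) \<partial>lborel)"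
    if u: "continuous_on UNIV u" for u :: "real^'d \<Rightarrow> real"
  proof -
    have [measurable]: "u \<in> borel_measurable borel" using u by (rule borel_measurable_continuous_onI)
    show ?thesis unfolding p_def
      using nn N by (subst integral_distr, simp, simp) (subst integral_density, auto)
  qed
  have nn_p: "(\<integral>\<^sup>+y. u y \<partial>p) = (\<integral>\<^sup>+z. ennreal (?k z / N) * u (Y 1 z) \<partial>lborel)"
    if [measurable]: "u \<in> borel_measurable borel" for u
    unfolding p_def by (subst nn_integral_distr, simp, simp) (subst nn_integral_density, auto)
  have int_m: "(\<integral>y. u y \<partial>m) = (\<integral>v. w v * u (case_prod Y v) \<partial>?P)"
    if u: "continuous_on UNIV u" for u :: "real^'d \<Rightarrow> real"
  proof -
    have [measurable]: "u \<in> borel_measurable borel" using u by (rule borel_measurable_continuous_onI)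
    show ?thesis unfolding m_def
      using w_nn by (subst integral_distr, simp, simp) (subst integral_density, auto)
  qed
  have sm: "sets m = sets borel" "space m = UNIV" by (simp_all add: m_def)
  have sp: "sets p = sets borel" "space p = UNIV" by (simp_all add: p_def)
  have mass: "emeasure m UNIV = ennreal (\<integral>v. w v \<partial>?P)"
  proof -
    have "emeasure m UNIV = (\<integral>\<^sup>+y. 1 \<partial>m)" using sm by simp
    also have "\<dots> = (\<integral>\<^sup>+v. ennreal (w v) \<partial>?P)"
      unfolding m_def by (subst nn_integral_distr, simp, simp) (subst nn_integral_density, auto)
    also have "\<dots> = ennreal (\<integral>v. w v \<partial>?P)" using w_nn iw by (intro nn_integral_eq_integral) auto
    finally show ?thesis .
  qed
  have fm: "finite_measure m" by (rule finite_measureI) (simp add: sm mass)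
  have mass_pos: "0 < measure m UNIV"
  proof -
    have "(\<integral>v. w v \<partial>?P) = (\<integral>s. (\<integral>z. w (s, z) \<partial>lborel) \<partial>U01)" by (rule P.integral_fst'[OF iw, symmetric])
    also have "\<dots> = (\<integral>s. 2 * s * (r\<^sup>2 * N' / N) \<partial>U01)"
      by (intro Bochner_Integration.integral_cong) (auto simp: w_def N'_def)
    also have "\<dots> = 1\<^sup>2 * (r\<^sup>2 * N' / N) - 0\<^sup>2 * (r\<^sup>2 * N' / N)"
      by (rule U01_FTC) (use N in \<open>auto intro!: derivative_eq_intros continuous_intros\<close>)
    also have "\<dots> > 0" using r N by simp
    finally show ?thesis using mass by (simp add: measure_def)
  qed
  have near: "AE y in m. dist y x < e"
  proof -
    have "AE v in density ?P (\<lambda>v. ennreal (w v)). dist (case_prod Y v) x < e"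
    proof (subst AE_density, simp, rule AE_I2, rule impI)
      fix v assume v: "v \<in> space ?P" "0 < ennreal (w v)"
      obtain s z where sz: "v = (s, z)" by (cases v)
      have "norm z \<le> R" using v w_out[of z s] sz by (cases "norm z \<le> R") auto
      then show "dist (case_prod Y v) x < e" using small[of z s] v sz by (auto simp: spP Y_def dist_norm)
    qed
    then show ?thesis unfolding m_def by (subst AE_distr_iff) (auto simp: case_prod_beta')
  qed
  have "p \<in> P2"
    unfolding P2_def
  proof (intro CollectI conjI)
    show "prob_space p"
    proof (rule prob_spaceI)
      have "emeasure p (space p) = (\<integral>\<^sup>+y. 1 \<partial>p)" by simp
      also have "\<dots> = (\<integral>\<^sup>+z. ennreal (?k z / N) \<partial>lborel)" by (subst nn_p) auto
      also have "\<dots> = ennreal (\<integral>z. ?k z / N \<partial>lborel)" using ik nn N by (intro nn_integral_eq_integral) auto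
      also have "\<dots> = 1" using N by (simp add: N_def)
      finally show "emeasure p (space p) = 1" .
    qed
    show "sets p = sets borel" by (rule sp)
    have "integrable lborel (\<lambda>z. ?k z / N * (norm (Y 1 z))\<^sup>2)"
      using kz N by (intro integrable_compact_support[of _ R] continuous_intros ck Y_cont) auto
    then have "(\<integral>\<^sup>+z. ennreal (?k z / N * (norm (Y 1 z))\<^sup>2) \<partial>lborel) < \<infinity>"
      using nn N by (subst nn_integral_eq_integral) auto
    moreover have "(\<integral>\<^sup>+y. ennreal ((norm y)\<^sup>2) \<partial>p) = (\<integral>\<^sup>+z. ennreal (?k z / N * (norm (Y 1 z))\<^sup>2) \<partial>lborel)"
    proof -
      have "(\<integral>\<^sup>+y. ennreal ((norm y)\<^sup>2) \<partial>p) = (\<integral>\<^sup>+z. ennreal (?k z / N) * ennreal ((norm (Y 1 z))\<^sup>2) \<partial>lborel)"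
        by (rule nn_p) measurable
      also have "\<dots> = (\<integral>\<^sup>+z. ennreal (?k z / N * (norm (Y 1 z))\<^sup>2) \<partial>lborel)"
        using nn N by (intro nn_integral_cong ennreal_mult[symmetric]) auto
      finally show ?thesis .
    qed
    ultimately show "(\<integral>\<^sup>+y. ennreal ((norm y)\<^sup>2) \<partial>p) < \<infinity>" by simp
  qed
  moreover have "(\<integral>y. ((1/2) *\<^sub>R H y) \<bullet> A \<partial>m) = (\<integral>y. \<psi> y \<partial>p) - \<psi> x"
    if \<psi>: "C2_with \<psi> g H" for \<psi> g H
  proof -
    note c\<psi> = C2_continuous[OF \<psi>]
    have cg: "continuous_on S (\<lambda>v. g (Y (f v) (h v)))" "continuous_on S (\<lambda>v. H (Y (f v) (h v)))" "continuous_on S (\<lambda>v. \<psi> (Y (f v) (h v)))"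
      if "continuous_on S f" "continuous_on S h" for S f and h :: "'z::topological_space \<Rightarrow> real^'d"
      using continuous_on_compose2[OF c\<psi>(1) Y_cont[OF that]] continuous_on_compose2[OF c\<psi>(2) Y_cont[OF that]]
        continuous_on_compose2[OF c\<psi>(3) Y_cont[OF that]] by auto
    have cA: "continuous_on S (\<lambda>v. A *v h v)" if "continuous_on S h" for S and h :: "'z::topological_space \<Rightarrow> real^'d"
      by (rule bounded_linear.continuous_on[OF matrix_vector_mul_bounded_linear that])
    have ckc: "continuous_on S (\<lambda>v. ?k (h v))" "continuous_on S (\<lambda>v. ?b (h v))" if "continuous_on S h" for S and h :: "'z::topological_space \<Rightarrow> real^'d"
      using continuous_on_compose2[OF ck(1)[of UNIV] that] continuous_on_compose2[OF ck(2)[of UNIV] that] by auto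
    define G where "G = (\<lambda>(s, z). ?k z * (r * (g (Y s z) \<bullet> (A *v z))))"
    have iG: "integrable ?P G"
      unfolding G_def case_prod_beta
      by (rule iP, intro continuous_intros ckc cg cA) (use kz in auto)
    have line: "(\<integral>s. r * (g (Y s z) \<bullet> (A *v z)) \<partial>U01) = \<psi> (Y 1 z) - \<psi> x" for z
    proof -
      have "(\<integral>s. r * (g (Y s z) \<bullet> (A *v z)) \<partial>U01) = \<psi> (Y 1 z) - \<psi> (Y 0 z)"
      proof (rule U01_FTC)
        fix s :: real
        have "((\<lambda>s. Y s z) has_derivative (\<lambda>h. (r * h) *\<^sub>R (A *v z))) (at s)"
          unfolding Y_def by (auto intro!: derivative_eq_intros)
        moreover have "(\<psi> has_derivative (\<lambda>h. g (Y s z) \<bullet> h)) (at (Y s z))" using \<psi> by (simp add: C2_with_def)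
        ultimately have "((\<lambda>s. \<psi> (Y s z)) has_derivative (\<lambda>h. g (Y s z) \<bullet> ((r * h) *\<^sub>R (A *v z)))) (at s)"
          by (rule has_derivative_compose)
        moreover have "(\<lambda>h. g (Y s z) \<bullet> ((r * h) *\<^sub>R (A *v z))) = (\<lambda>h. (r * (g (Y s z) \<bullet> (A *v z))) * h)"
          by (simp add: fun_eq_iff)
        ultimately show "((\<lambda>s. \<psi> (Y s z)) has_real_derivative r * (g (Y s z) \<bullet> (A *v z))) (at s)"
          unfolding has_field_derivative_def by simp
      next
        show "continuous_on {0..1} (\<lambda>s. r * (g (Y s z) \<bullet> (A *v z)))"
          by (intro continuous_intros cg)
      qed
      then show ?thesis by (simp add: Y_def)
    qed
    have c\<psi>Y: "continuous_on UNIV (\<lambda>z. \<psi> (Y 1 z))" by (intro cg continuous_intros)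
    have i1: "integrable lborel (\<lambda>z. ?k z * \<psi> (Y 1 z))"
      using kz by (intro integrable_compact_support[of _ R] continuous_intros ck c\<psi>Y) auto
    have "N * ((\<integral>y. \<psi> y \<partial>p) - \<psi> x) = (\<integral>z. ?k z * \<psi> (Y 1 z) \<partial>lborel) - (\<integral>z. ?k z * \<psi> x \<partial>lborel)"
      using N by (simp add: int_p[OF c\<psi>(1)] N_def[symmetric] right_diff_distrib)
    also have "\<dots> = (\<integral>z. ?k z * (\<psi> (Y 1 z) - \<psi> x) \<partial>lborel)"
      using i1 ik by (subst Bochner_Integration.integral_diff[symmetric]) (auto simp: algebra_simps)
    also have "\<dots> = (\<integral>z. (\<integral>s. G (s, z) \<partial>U01) \<partial>lborel)"
      unfolding line[symmetric] G_def by simp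
    also have "\<dots> = (\<integral>s. (\<integral>z. G (s, z) \<partial>lborel) \<partial>U01)"
      using P.Fubini_integral[of "\<lambda>s z. G (s, z)"] iG by simp
    also have "\<dots> = (\<integral>s. (\<integral>z. r\<^sup>2 * s * (?b z * (H (Y s z) \<bullet> A)) \<partial>lborel) \<partial>U01)"
    proof (rule Bochner_Integration.integral_cong[OF refl])
      fix s
      have "(\<integral>z. G (s, z) \<partial>lborel) = r * (\<integral>z. ?k z * (g (x + (r * s) *\<^sub>R (A *v z)) \<bullet> (A *v z)) \<partial>lborel)"
        by (simp add: G_def Y_def mult.left_commute)
      also have "\<dots> = r * ((r * s) * (\<integral>z. ?b z * (H (x + (r * s) *\<^sub>R (A *v z)) \<bullet> A) \<partial>lborel))"
        by (subst quad_kernel_integration_by_parts[OF A \<psi>]) simp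
      also have "\<dots> = (\<integral>z. r\<^sup>2 * s * (?b z * (H (Y s z) \<bullet> A)) \<partial>lborel)"
        by (simp add: Y_def power2_eq_square)
      finally show "(\<integral>z. G (s, z) \<partial>lborel) = (\<integral>z. r\<^sup>2 * s * (?b z * (H (Y s z) \<bullet> A)) \<partial>lborel)" .
    qed
    also have "\<dots> = (\<integral>s. (\<integral>z. N * (w (s, z) * (((1/2) *\<^sub>R H (Y s z)) \<bullet> A)) \<partial>lborel) \<partial>U01)"
      using N by (intro Bochner_Integration.integral_cong refl) (simp add: w_def)
    also have "\<dots> = N * (\<integral>s. (\<integral>z. w (s, z) * (((1/2) *\<^sub>R H (Y s z)) \<bullet> A) \<partial>lborel) \<partial>U01)"
      by (simp only: integral_mult_right_zero)
    also have "(\<integral>s. (\<integral>z. w (s, z) * (((1/2) *\<^sub>R H (Y s z)) \<bullet> A) \<partial>lborel) \<partial>U01)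
      = (\<integral>v. w v * (((1/2) *\<^sub>R H (case_prod Y v)) \<bullet> A) \<partial>?P)"
    proof -
      have i2: "integrable ?P (\<lambda>v. w v * (((1/2) *\<^sub>R H (case_prod Y v)) \<bullet> A))"
        by (rule iP, unfold case_prod_beta, intro continuous_intros cw cg) (use w_out in auto)
      from P.integral_fst'[OF i2] show ?thesis by simp
    qed
    also have "\<dots> = (\<integral>y. ((1/2) *\<^sub>R H y) \<bullet> A \<partial>m)"
      using c\<psi>(3) by (intro int_m[symmetric] continuous_intros)
    finally show ?thesis using N by simp
  qed
  ultimately show ?thesis using sm fm mass_pos near by blast
qed

lemma scalar_psd_measure:
  fixes A :: "real^'d^'d" and m :: "'b::topological_space measure"
  assumes A: "A \<in> psd_mats" and m: "finite_measure m" "sets m = sets borel"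
  shows "(\<lambda>E. measure m E *\<^sub>R A) \<in> psd_measures borel"
  unfolding psd_measures_def
proof (intro CollectI conjI ballI allI impI)
  interpret finite_measure m by fact
  fix E
  show "measure m E *\<^sub>R A \<in> psd_mats"
    using A by (auto simp: psd_mats_def scaleR_matrix_vector_assoc[symmetric] intro!: sym_mats_scaleR)
next
  interpret finite_measure m by fact
  fix S :: "nat \<Rightarrow> 'b set" assume "range S \<subseteq> sets borel" "disjoint_family S"
  then show "(\<lambda>i. measure m (S i) *\<^sub>R A) sums (measure m (\<Union>i. S i) *\<^sub>R A)"
    using m(2) by (intro bounded_linear.sums[OF bounded_linear_scaleR_left] finite_measure_UNION) auto
qed

text \<open>
  The polar density of \<open>m A\<close> is the constant \<open>A / |A|\<close>.
\<close>

lemma scalar_psd_measure_integrals: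
  fixes A :: "real^'d^'d" and m :: "'b::topological_space measure" and f :: "real^'d^'d \<Rightarrow> ennreal"
  assumes A: "A \<in> psd_mats" "A \<noteq> 0" and m: "finite_measure m" "sets m = sets borel" and f: "pos_homogeneous f"
  defines "l \<equiv> \<lambda>E. measure m E *\<^sub>R A"
  shows "\<Phi> \<in> borel_measurable borel \<Longrightarrow> mat_integral borel l \<Phi> = (\<integral>x. \<Phi> x \<bullet> A \<partial>m)"
    and "(\<integral>\<^sup>+x. f (polar_density borel l x) \<partial>total_variation borel l) = f A * emeasure m UNIV"
proof -
  interpret finite_measure m by fact
  have l: "l \<in> psd_measures borel" unfolding l_def by (rule scalar_psd_measure[OF A(1) m])
  have sp: "space m = UNIV" using sets_eq_imp_space_eq[OF m(2)] by simp
  have lE: "l E = (LINT x:E|m. A)" if "E \<in> sets borel" for E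
    using that m(2) by (simp add: l_def set_lebesgue_integral_def emeasure_finite less_top[symmetric])
  have iA: "integrable m (\<lambda>_. A)" by simp
  show "mat_integral borel l \<Phi> = (\<integral>x. \<Phi> x \<bullet> A \<partial>m)" if "\<Phi> \<in> borel_measurable borel"
    by (rule mat_integral_density[OF l m iA lE that])
  have T: "total_variation borel l = density m (\<lambda>_. ennreal (norm A))"
    by (rule total_variation_density(1)[OF m iA lE])
  have "AE x in m. norm A *\<^sub>R polar_density borel l x = A"
    by (rule polar_density_AE[OF l m iA lE])
  then have "AE x in m. polar_density borel l x = (1 / norm A) *\<^sub>R A"
  proof eventually_elim
    case (elim x)
    then have "(1 / norm A) *\<^sub>R (norm A *\<^sub>R polar_density borel l x) = (1 / norm A) *\<^sub>R A" by simp
    then show ?case using A by simp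
  qed
  then have "AE x in total_variation borel l. polar_density borel l x = (1 / norm A) *\<^sub>R A"
    unfolding T by (subst AE_density) auto
  then have "(\<integral>\<^sup>+x. f (polar_density borel l x) \<partial>total_variation borel l)
    = (\<integral>\<^sup>+x. f ((1 / norm A) *\<^sub>R A) \<partial>total_variation borel l)"
    by (intro nn_integral_cong_AE) auto
  also have "\<dots> = f ((1 / norm A) *\<^sub>R A) * (ennreal (norm A) * emeasure m UNIV)"
    using m(2) sp by (simp add: T emeasure_density nn_integral_cmult)
  also have "f ((1 / norm A) *\<^sub>R A) = ennreal (1 / norm A) * f A"
    using f psd_sym[OF A(1)] unfolding pos_homogeneous_def by simp
  also have "ennreal (1 / norm A) * f A * (ennreal (norm A) * emeasure m UNIV)
    = (ennreal (1 / norm A) * ennreal (norm A)) * (f A * emeasure m UNIV)" by (simp add: ac_simps)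
  also have "ennreal (1 / norm A) * ennreal (norm A) = 1"
    using A(2) by (simp add: ennreal_mult[symmetric])
  finally show "(\<integral>\<^sup>+x. f (polar_density borel l x) \<partial>total_variation borel l) = f A * emeasure m UNIV" by simp
qed

lemma pd_psd: "A \<in> pd_mats \<Longrightarrow> A \<in> psd_mats"
proof -
  assume A: "A \<in> pd_mats"
  have "0 \<le> v \<bullet> (A *v v)" for v using A by (cases "v = 0") (auto simp: pd_mats_def less_imp_le)
  then show ?thesis using A by (simp add: pd_mats_def psd_mats_def)
qed

lemma pd_nonzero: "A \<in> pd_mats \<Longrightarrow> A \<noteq> (0 :: real^'d^'d)"
proof
  assume A: "A \<in> pd_mats" "A = (0 :: real^'d^'d)"
  have "axis undefined 1 \<noteq> (0 :: real^'d)" by (simp add: axis_eq_0_iff)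
  then show False using A by (auto simp: pd_mats_def)
qed

text \<open>
  If \<open>1/2 \<nabla>\<^sup>2\<psi> : A > f(A)\<close> at \<open>x\<close>, then also in a neighbourhood; spreading the point mass at \<open>x\<close> inside this
  neighbourhood by a multiple of \<open>A\<close> gains more than it costs.
\<close>

lemma slope_from_transport_bound:
  fixes f :: "real^'d^'d \<Rightarrow> ennreal"
  assumes conv: "convex_fun f" and hom: "pos_homogeneous f" and dom: "eff_dom f \<subseteq> psd_mats"
    and P: "P \<in> eff_dom f \<inter> pd_mats"
    and \<psi>: "C2_with \<psi> g H" "bounded (range H)"
    and bound: "\<And>p. p \<in> P2 \<Longrightarrow> ennreal ((\<integral>y. \<psi> y \<partial>p) - \<psi> x) \<le> G_cost f x p"
  shows "(1/2) *\<^sub>R H x \<in> slopes f"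
proof (rule slope_if_pd[OF conv dom P])
  fix A assume A: "A \<in> eff_dom f \<inter> pd_mats"
  then obtain a where a: "f A = ennreal a" "0 \<le> a" by (cases "f A") (auto simp: eff_dom_def)
  show "ennreal ((1/2) *\<^sub>R H x \<bullet> A) \<le> f A"
  proof (rule ccontr)
    assume "\<not> ennreal ((1/2) *\<^sub>R H x \<bullet> A) \<le> f A"
    then have lt: "a < (1/2) *\<^sub>R H x \<bullet> A" using a by (simp add: ennreal_less_iff not_le)
    define b where "b = (a + (1/2) *\<^sub>R H x \<bullet> A) / 2"
    have b: "a < b" "b < (1/2) *\<^sub>R H x \<bullet> A" using lt by (auto simp: b_def)
    have cu: "continuous_on UNIV (\<lambda>y. (1/2) *\<^sub>R H y \<bullet> A)" using C2_continuous(3)[OF \<psi>(1)] by (intro continuous_intros)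
    have "open {y. b < (1/2) *\<^sub>R H y \<bullet> A}" by (rule open_Collect_less[OF continuous_on_const cu])
    then obtain e where e: "0 < e" "\<And>y. dist y x < e \<Longrightarrow> b < (1/2) *\<^sub>R H y \<bullet> A"
      using b(2) unfolding open_dist by blast
    obtain p m where p: "p \<in> P2" and m: "sets m = sets borel" "finite_measure m" "0 < measure m UNIV" "AE y in m. dist y x < e"
      and id: "\<And>\<psi> g H. C2_with \<psi> g H \<Longrightarrow> bounded (range H) \<Longrightarrow>
        (\<integral>y. ((1/2) *\<^sub>R H y) \<bullet> A \<partial>m) = (\<integral>y. \<psi> y \<partial>p) - \<psi> x"
      using point_mass_spreading[of A e x] A e(1) by blast
    interpret m: finite_measure m by fact
    have psd: "A \<in> psd_mats" "A \<noteq> 0" using A pd_psd pd_nonzero by auto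
    define l where "l = (\<lambda>E. measure m E *\<^sub>R A)"
    have spm: "space m = UNIV" using sets_eq_imp_space_eq[OF m(1)] by simp
    have "dyn_cost f (return borel x) p \<le> (\<integral>\<^sup>+x. f (polar_density borel l x) \<partial>total_variation borel l)"
    proof (rule static_upper_bound[OF return_P2 p])
      show "l \<in> psd_measures borel" unfolding l_def by (rule scalar_psd_measure[OF psd(1) m(2,1)])
      fix \<psi> :: "real^'d \<Rightarrow> real" and g H assume C: "C2_with \<psi> g H" "bounded (range H)"
      have mH: "(\<lambda>x. (1/2) *\<^sub>R H x) \<in> borel_measurable borel"
        using C2_continuous(3)[OF C(1)] by (intro borel_measurable_continuous_onI continuous_intros)
      show "mat_integral borel l (\<lambda>x. (1/2) *\<^sub>R H x) = (\<integral>x. \<psi> x \<partial>p) - (\<integral>x. \<psi> x \<partial>return borel x)"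
        unfolding l_def scalar_psd_measure_integrals(1)[OF psd m(2,1) hom mH] id[OF C]
        using integral_return_C2[OF C2_continuous(1)[OF C(1)]] by simp
    qed
    also have "\<dots> = ennreal (a * measure m UNIV)"
      unfolding l_def scalar_psd_measure_integrals(2)[OF psd m(2,1) hom]
      using a by (simp add: m.emeasure_eq_measure ennreal_mult)
    finally have "ennreal ((\<integral>y. \<psi> y \<partial>p) - \<psi> x) \<le> ennreal (a * measure m UNIV)"
      using bound[OF p] by (simp add: G_cost_def)
    then have "(\<integral>y. ((1/2) *\<^sub>R H y) \<bullet> A \<partial>m) \<le> a * measure m UNIV"
      unfolding id[OF \<psi>] using a by (subst (asm) ennreal_le_iff) auto
    moreover have "b * measure m UNIV \<le> (\<integral>y. ((1/2) *\<^sub>R H y) \<bullet> A \<partial>m)"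
    proof -
      obtain B where B: "\<And>y. norm (H y) \<le> B" using \<psi>(2) by (auto simp: bounded_iff)
      have "(\<integral>y. b \<partial>m) \<le> (\<integral>y. ((1/2) *\<^sub>R H y) \<bullet> A \<partial>m)"
      proof (rule integral_mono_AE)
        show "integrable m (\<lambda>y. ((1/2) *\<^sub>R H y) \<bullet> A)"
        proof (rule integrable_inner_bounded[where B = B])
          show "(\<lambda>y. (1/2) *\<^sub>R H y) \<in> borel_measurable m"
            using C2_continuous(3)[OF \<psi>(1)]
            by (intro measurable_sets_eq[OF _ m(1)[symmetric]] borel_measurable_continuous_onI continuous_intros)
          show "norm ((1/2) *\<^sub>R H y) \<le> B" for y using B[of y] order_trans[OF norm_ge_zero B[of y]] by simp
        qed simp
        show "AE y in m. b \<le> (1/2) *\<^sub>R H y \<bullet> A" using m(4) by eventually_elim (rule less_imp_le[OF e(2)])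
      qed simp
      then show ?thesis using spm by (simp add: mult.commute)
    qed
    ultimately have "b * measure m UNIV \<le> a * measure m UNIV" by linarith
    then show False using b(1) m(3) by (simp add: mult_le_cancel_right)
  qed
qed

section \<open>The linear functional behind the dual problem\<close>

text \<open>
  A system of constraints \<open>L x \<le> c\<close> that is stable under sums and positive multiples has a linear
  solution as soon as it does not contain \<open>L 0 < 0\<close>: the least admissible bound for \<open>L x\<close> is a
  sublinear function of \<open>x\<close>.
\<close>

lemma linear_functional_below_cone:
  fixes adm :: "'a::real_vector \<Rightarrow> real \<Rightarrow> bool"
  assumes add: "\<And>x y c d. adm x c \<Longrightarrow> adm y d \<Longrightarrow> adm (x + y) (c + d)"
    and scale: "\<And>t x c. 0 < t \<Longrightarrow> adm x c \<Longrightarrow> adm (t *\<^sub>R x) (t * c)"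
    and ex: "\<And>x. \<exists>c. adm x c" and zero: "\<And>c. adm 0 c \<Longrightarrow> 0 \<le> c"
  shows "\<exists>L. linear L \<and> (\<forall>x c. adm x c \<longrightarrow> L x \<le> c)"
proof -
  define p where "p = (\<lambda>x. Inf {c. adm x c})"
  have bdd: "bdd_below {c. adm x c}" for x
  proof -
    obtain d where d: "adm (- x) d" using ex by blast
    have "- d \<le> c" if "adm x c" for c using zero[of "c + d"] add[OF that d] by simp
    then show ?thesis by (intro bdd_belowI) auto
  qed
  have p_le: "p x \<le> c" if "adm x c" for x c unfolding p_def using that bdd by (intro cInf_lower) auto
  have p_ge: "b \<le> p x" if "\<And>c. adm x c \<Longrightarrow> b \<le> c" for x b
    unfolding p_def using that ex[of x] by (intro cInf_greatest) auto
  have half: "p (t *\<^sub>R x) \<le> t * p x" if t: "0 < t" for t x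
  proof -
    have "p (t *\<^sub>R x) / t \<le> p x"
      using p_le[OF scale[OF t]] t by (intro p_ge) (simp add: field_simps)
    then show ?thesis using t by (simp add: field_simps)
  qed
  have "sublinear p"
    unfolding sublinear_def
  proof (intro conjI allI impI)
    fix x y
    have "p (x + y) - d \<le> p x" if "adm y d" for d
      using p_le[OF add[OF _ that]] by (intro p_ge) (simp add: algebra_simps)
    then have "p (x + y) - p x \<le> p y" by (intro p_ge) (simp add: algebra_simps)
    then show "p (x + y) \<le> p x + p y" by simp
  next
    fix t :: real and x assume t: "0 < t"
    have "p ((1 / t) *\<^sub>R (t *\<^sub>R x)) \<le> (1 / t) * p (t *\<^sub>R x)" using t by (intro half) auto
    then have "t * p x \<le> p (t *\<^sub>R x)" using t by (simp add: field_simps)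
    with half[OF t, of x] show "p (t *\<^sub>R x) = t * p x" by simp
  qed
  from hahn_banach_sublinear[OF this] obtain L where "linear L" "\<And>x. L x \<le> p x" by blast
  then show ?thesis using p_le order_trans by blast
qed

definition scaled_slopes :: "(real^'d^'d \<Rightarrow> ennreal) \<Rightarrow> real \<Rightarrow> (real^'d^'d) set" where
  "scaled_slopes f s = {k. \<forall>A\<in>sym_mats. ennreal (k \<bullet> A) \<le> ennreal s * f A}"

lemma ennreal_plus_le: "ennreal (x + y) \<le> ennreal x + ennreal y"
proof -
  have "ennreal (x + y) \<le> ennreal (max 0 x + max 0 y)" by (intro ennreal_leI) auto
  also have "\<dots> = ennreal x + ennreal y" by (simp add: ennreal_plus max_def ennreal_neg)
  finally show ?thesis .
qed

lemma scaled_slopes_1: "scaled_slopes f 1 = slopes f"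
  by (simp add: scaled_slopes_def slopes_def)

lemma scaled_slopes_add:
  assumes "k \<in> scaled_slopes f s" "j \<in> scaled_slopes f t" "0 \<le> s" "0 \<le> t"
  shows "k + j \<in> scaled_slopes f (s + t)"
  unfolding scaled_slopes_def
proof (intro CollectI ballI)
  fix A :: "real^'a^'a" assume A: "A \<in> sym_mats"
  have "ennreal ((k + j) \<bullet> A) \<le> ennreal (k \<bullet> A) + ennreal (j \<bullet> A)"
    unfolding inner_add_left by (rule ennreal_plus_le)
  also have "\<dots> \<le> ennreal s * f A + ennreal t * f A"
    using assms A by (intro add_mono) (auto simp: scaled_slopes_def)
  also have "\<dots> = ennreal (s + t) * f A" using assms by (simp add: ennreal_plus distrib_right)
  finally show "ennreal ((k + j) \<bullet> A) \<le> ennreal (s + t) * f A" .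
qed

lemma scaled_slopes_scale:
  assumes "k \<in> scaled_slopes f s" "0 \<le> s" "0 < t"
  shows "t *\<^sub>R k \<in> scaled_slopes f (t * s)"
  unfolding scaled_slopes_def
proof (intro CollectI ballI)
  fix A :: "real^'a^'a" assume A: "A \<in> sym_mats"
  have "ennreal ((t *\<^sub>R k) \<bullet> A) = ennreal t * ennreal (k \<bullet> A)" using assms by (simp add: ennreal_mult')
  also have "\<dots> \<le> ennreal t * (ennreal s * f A)" using assms A by (intro mult_left_mono) (auto simp: scaled_slopes_def)
  also have "\<dots> = ennreal (t * s) * f A" using assms by (simp add: ennreal_mult mult.assoc)
  finally show "ennreal ((t *\<^sub>R k) \<bullet> A) \<le> ennreal (t * s) * f A" .
qed

lemma nonpos_scaled_slope:
  fixes f :: "real^'d^'d \<Rightarrow> ennreal"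
  assumes dom: "eff_dom f \<subseteq> psd_mats" and k: "\<And>A. A \<in> psd_mats \<Longrightarrow> k \<bullet> A \<le> 0" and s: "0 < s"
  shows "k \<in> scaled_slopes f s"
  unfolding scaled_slopes_def
proof (intro CollectI ballI)
  fix A :: "real^'d^'d" assume A: "A \<in> sym_mats"
  show "ennreal (k \<bullet> A) \<le> ennreal s * f A"
  proof (cases "f A = \<infinity>")
    case True then show ?thesis using s by (simp add: ennreal_mult_top)
  next
    case False
    then have "A \<in> psd_mats" using A dom by (auto simp: eff_dom_def less_top)
    then show ?thesis using k by (simp add: ennreal_neg)
  qed
qed

definition bscale :: "('a::topological_space \<Rightarrow>\<^sub>C real) \<Rightarrow> 'b::real_normed_vector \<Rightarrow> 'a \<Rightarrow>\<^sub>C 'b" where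
  "bscale g k = Bcontfun (\<lambda>x. apply_bcontfun g x *\<^sub>R k)"

lemma bscale_apply: "apply_bcontfun (bscale g k) x = apply_bcontfun g x *\<^sub>R k"
proof -
  have "apply_bcontfun (Bcontfun (\<lambda>x. apply_bcontfun g x *\<^sub>R k)) = (\<lambda>x. apply_bcontfun g x *\<^sub>R k)"
    by (rule Bcontfun_apply[where B = "norm g * norm k"])
       (auto intro!: continuous_intros mult_right_mono simp: bcontfun_abs_le)
  then show ?thesis by (simp add: bscale_def)
qed

lemma linear_bscale: "linear (\<lambda>g. bscale g k)"
  by (intro linearI bcontfun_eqI) (simp_all add: bscale_apply plus_bcontfun.rep_eq scaleR_bcontfun.rep_eq scaleR_add_left)

text \<open>
  \<open>L\<close> is the pairing with the measure to be found: a linear functional on the bounded continuous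
  matrix fields that reproduces \<open>\<nu> - \<mu>\<close> on Hessians, is at most \<open>D\<close> on fields of slopes, and is
  nonpositive on fields that are nonpositive against \<open>S\<^sub>d\<^sup>+\<close>.  The constraints imposed are
  \<open>L \<Phi> \<le> s D + J \<psi>\<close>, with \<open>J \<psi> = \<integral> \<psi> d\<nu> - \<integral> \<psi> d\<mu>\<close>, whenever \<open>\<Phi> - 1/2 \<nabla>\<^sup>2\<psi>\<close> consists of slopes scaled by
  \<open>s > 0\<close>.  They are consistent at \<open>\<Phi> = 0\<close>: there \<open>- \<psi> / s\<close> is admissible in the dual problem, so
  \<open>J (- \<psi>) \<le> s D\<close>.
\<close>

lemma ex_dual_functional:
  fixes f :: "real^'d^'d \<Rightarrow> ennreal" and \<mu> \<nu> :: "(real^'d) measure"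
  assumes dom: "eff_dom f \<subseteq> psd_mats" and \<mu>: "\<mu> \<in> P2" and \<nu>: "\<nu> \<in> P2" and D: "0 \<le> D"
    and bound: "\<And>\<psi> g H. C2_with \<psi> g H \<Longrightarrow> bounded (range H) \<Longrightarrow> (\<And>x. (1/2) *\<^sub>R H x \<in> slopes f) \<Longrightarrow>
      (\<integral>x. \<psi> x \<partial>\<nu>) - (\<integral>x. \<psi> x \<partial>\<mu>) \<le> D"
  shows "\<exists>L::((real^'d) \<Rightarrow>\<^sub>C (real^'d^'d)) \<Rightarrow> real. linear L \<and>
    (\<forall>\<Phi> \<psi> g H. C2_with \<psi> g H \<longrightarrow> bounded (range H) \<longrightarrow> (\<forall>x. apply_bcontfun \<Phi> x = (1/2) *\<^sub>R H x) \<longrightarrow>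
      L \<Phi> = (\<integral>x. \<psi> x \<partial>\<nu>) - (\<integral>x. \<psi> x \<partial>\<mu>)) \<and>
    (\<forall>\<Phi>. (\<forall>x. apply_bcontfun \<Phi> x \<in> slopes f) \<longrightarrow> L \<Phi> \<le> D) \<and>
    (\<forall>\<Phi>. (\<forall>x. \<forall>A\<in>psd_mats. apply_bcontfun \<Phi> x \<bullet> A \<le> 0) \<longrightarrow> L \<Phi> \<le> 0)"
proof -
  define J where "J = (\<lambda>\<psi> :: real^'d \<Rightarrow> real. (\<integral>x. \<psi> x \<partial>\<nu>) - (\<integral>x. \<psi> x \<partial>\<mu>))"
  have J_add: "J (\<lambda>x. \<psi> x + \<psi>' x) = J \<psi> + J \<psi>'" if "C2b \<psi>" "C2b \<psi>'" for \<psi> \<psi>'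
    using C2b_integrable[OF that(1)] C2b_integrable[OF that(2)] \<mu> \<nu> by (simp add: J_def)
  have J_scale: "J (\<lambda>x. c * \<psi> x) = c * J \<psi>" for c \<psi> by (simp add: J_def right_diff_distrib)
  define adm where "adm = (\<lambda>\<Phi> c. \<exists>s \<psi> g H. 0 < s \<and> C2_with \<psi> g H \<and> bounded (range H) \<and>
    (\<forall>x. apply_bcontfun \<Phi> x - (1/2) *\<^sub>R H x \<in> scaled_slopes f s) \<and> c = s * D + J \<psi>)"
  have Jb: "J \<psi> \<le> s * D"
    if s: "0 < s" and \<psi>: "C2_with \<psi> g H" "bounded (range H)" and k: "\<And>x. (1/2) *\<^sub>R H x \<in> scaled_slopes f s" for s \<psi> g H
  proof -
    have "J (\<lambda>x. (1 / s) * \<psi> x) \<le> D"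
      unfolding J_def
    proof (rule bound[OF C2_scale[OF \<psi>(1)]])
      show "bounded (range (\<lambda>x. (1 / s) *\<^sub>R H x))"
        using bounded_scaling[OF \<psi>(2), of "1 / s"] by (simp add: image_image)
      fix x
      have "(1 / s) *\<^sub>R ((1/2) *\<^sub>R H x) \<in> scaled_slopes f ((1 / s) * s)"
        using s k by (intro scaled_slopes_scale) auto
      then show "(1/2) *\<^sub>R (1 / s) *\<^sub>R H x \<in> slopes f" using s by (simp add: scaled_slopes_1 mult.commute)
    qed
    then show ?thesis unfolding J_scale using s by (simp add: field_simps)
  qed
  have "\<exists>L. linear L \<and> (\<forall>\<Phi> c. adm \<Phi> c \<longrightarrow> L \<Phi> \<le> c)"
  proof (rule linear_functional_below_cone)
    fix \<Phi> \<Phi>' c c' assume "adm \<Phi> c" "adm \<Phi>' c'"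
    then obtain s \<psi> g H s' \<psi>' g' H' where
      1: "0 < s" "C2_with \<psi> g H" "bounded (range H)" "\<And>x. apply_bcontfun \<Phi> x - (1/2) *\<^sub>R H x \<in> scaled_slopes f s" "c = s * D + J \<psi>" and
      2: "0 < s'" "C2_with \<psi>' g' H'" "bounded (range H')" "\<And>x. apply_bcontfun \<Phi>' x - (1/2) *\<^sub>R H' x \<in> scaled_slopes f s'" "c' = s' * D + J \<psi>'"
      unfolding adm_def by metis
    show "adm (\<Phi> + \<Phi>') (c + c')"
      unfolding adm_def
    proof (intro exI conjI allI)
      show "0 < s + s'" using 1 2 by simp
      show "C2_with (\<lambda>x. \<psi> x + \<psi>' x) (\<lambda>x. g x + g' x) (\<lambda>x. H x + H' x)" by (rule C2_add[OF 1(2) 2(2)])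
      show "bounded (range (\<lambda>x. H x + H' x))" by (rule bounded_plus_comp[OF 1(3) 2(3)])
      show "c + c' = (s + s') * D + J (\<lambda>x. \<psi> x + \<psi>' x)"
        using 1 2 by (subst J_add) (auto simp: C2b_iff algebra_simps)
      fix x
      have "(apply_bcontfun \<Phi> x - (1/2) *\<^sub>R H x) + (apply_bcontfun \<Phi>' x - (1/2) *\<^sub>R H' x) \<in> scaled_slopes f (s + s')"
        using 1 2 by (intro scaled_slopes_add) auto
      then show "apply_bcontfun (\<Phi> + \<Phi>') x - (1/2) *\<^sub>R (H x + H' x) \<in> scaled_slopes f (s + s')"
        by (simp add: plus_bcontfun.rep_eq algebra_simps)
    qed
  next
    fix t :: real and \<Phi> c assume t: "0 < t" and "adm \<Phi> c"
    then obtain s \<psi> g H where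
      1: "0 < s" "C2_with \<psi> g H" "bounded (range H)" "\<And>x. apply_bcontfun \<Phi> x - (1/2) *\<^sub>R H x \<in> scaled_slopes f s" "c = s * D + J \<psi>"
      unfolding adm_def by metis
    show "adm (t *\<^sub>R \<Phi>) (t * c)"
      unfolding adm_def
    proof (intro exI conjI allI)
      show "0 < t * s" using 1 t by simp
      show "C2_with (\<lambda>x. t * \<psi> x) (\<lambda>x. t *\<^sub>R g x) (\<lambda>x. t *\<^sub>R H x)" by (rule C2_scale[OF 1(2)])
      show "bounded (range (\<lambda>x. t *\<^sub>R H x))" using bounded_scaling[OF 1(3), of t] by (simp add: image_image)
      show "t * c = (t * s) * D + J (\<lambda>x. t * \<psi> x)" using 1 by (simp add: J_scale algebra_simps)
      fix x
      have "t *\<^sub>R (apply_bcontfun \<Phi> x - (1/2) *\<^sub>R H x) \<in> scaled_slopes f (t * s)"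
        using 1 t by (intro scaled_slopes_scale) auto
      then show "apply_bcontfun (t *\<^sub>R \<Phi>) x - (1/2) *\<^sub>R (t *\<^sub>R H x) \<in> scaled_slopes f (t * s)"
        by (simp add: scaleR_bcontfun.rep_eq algebra_simps)
    qed
  next
    fix \<Phi> :: "(real^'d) \<Rightarrow>\<^sub>C (real^'d^'d)"
    (* half the Hessian of norm \<Phi> |x|^2 dominates \<Phi> *)
    have "adm \<Phi> (1 * D + J (\<lambda>x. norm \<Phi> * (x \<bullet> x)))"
      unfolding adm_def
    proof (intro exI conjI allI)
      show "C2_with (\<lambda>x::real^'d. norm \<Phi> * (x \<bullet> x)) (\<lambda>x. norm \<Phi> *\<^sub>R 2 *\<^sub>R x) (\<lambda>x. norm \<Phi> *\<^sub>R 2 *\<^sub>R mat 1)"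
        by (rule C2_scale[OF C2_square])
      fix x
      show "apply_bcontfun \<Phi> x - (1/2) *\<^sub>R (norm \<Phi> *\<^sub>R 2 *\<^sub>R mat 1) \<in> scaled_slopes f 1"
      proof (rule nonpos_scaled_slope[OF dom])
        fix A :: "real^'d^'d" assume A: "A \<in> psd_mats"
        have "apply_bcontfun \<Phi> x \<bullet> A \<le> norm (apply_bcontfun \<Phi> x) * norm A" by (rule norm_cauchy_schwarz)
        also have "\<dots> \<le> norm \<Phi> * trace A"
          using psd_norm_le_trace[OF A] norm_bounded[of \<Phi> x] by (intro mult_mono) auto
        finally show "(apply_bcontfun \<Phi> x - (1/2) *\<^sub>R (norm \<Phi> *\<^sub>R 2 *\<^sub>R mat 1)) \<bullet> A \<le> 0"
          using inner_mat_1[of A] by (simp add: inner_diff_left inner_commute[of "mat 1"])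
      qed simp
    qed auto
    then show "\<exists>c. adm \<Phi> c" by blast
  next
    fix c assume "adm 0 c"
    then obtain s \<psi> g H where
      1: "0 < s" "C2_with \<psi> g H" "bounded (range H)" "\<And>x. - ((1/2) *\<^sub>R H x) \<in> scaled_slopes f s" "c = s * D + J \<psi>"
      unfolding adm_def by (auto simp: zero_bcontfun.rep_eq)
    have "J (\<lambda>x. - 1 * \<psi> x) \<le> s * D"
    proof (rule Jb[OF 1(1) C2_scale[OF 1(2)]])
      show "bounded (range (\<lambda>x. - 1 *\<^sub>R H x))" using bounded_scaling[OF 1(3), of "- 1"] by (simp add: image_image)
    qed (use 1(4) in simp)
    then show "0 \<le> c" using 1(5) unfolding J_scale by simp
  qed
  then obtain L where L: "linear L" "\<And>\<Phi> c. adm \<Phi> c \<Longrightarrow> L \<Phi> \<le> c" by blast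
  have zero_in: "0 \<in> scaled_slopes f s" for s by (simp add: scaled_slopes_def)
  (* Hessians and nonpositive fields are admissible with every s > 0, so the term s D drops out. *)
  have squeeze: "a \<le> b" if "\<And>s. 0 < s \<Longrightarrow> a \<le> s * D + b" for a b :: real
  proof (rule field_le_epsilon)
    fix e :: real assume e: "0 < e"
    have "a \<le> e / (D + 1) * D + b" using e D by (intro that) (simp add: add_nonneg_pos)
    also have "e / (D + 1) * D = e * (D / (D + 1))" by simp
    also have "\<dots> \<le> e * 1" using D e by (intro mult_left_mono) (auto simp: divide_le_eq_1)
    finally show "a \<le> b + e" by simp
  qed
  have hess: "L \<Phi> \<le> J \<psi>"
    if "C2_with \<psi> g H" "bounded (range H)" "\<And>x. apply_bcontfun \<Phi> x = (1/2) *\<^sub>R H x" for \<Phi> \<psi> g H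
  proof (rule squeeze)
    fix s :: real assume s: "0 < s"
    show "L \<Phi> \<le> s * D + J \<psi>"
      by (rule L(2), unfold adm_def, intro exI[of _ s] exI[of _ \<psi>] exI[of _ g] exI[of _ H])
         (use that s zero_in in auto)
  qed
  have "L \<Phi> = J \<psi>"
    if h: "C2_with \<psi> g H" "bounded (range H)" "\<And>x. apply_bcontfun \<Phi> x = (1/2) *\<^sub>R H x" for \<Phi> \<psi> g H
  proof (rule antisym[OF hess[OF h]])
    have "L (- \<Phi>) \<le> J (\<lambda>x. - 1 * \<psi> x)"
    proof (rule hess[OF C2_scale[OF h(1)]])
      show "bounded (range (\<lambda>x. - 1 *\<^sub>R H x))" using bounded_scaling[OF h(2), of "- 1"] by (simp add: image_image)
    qed (simp add: uminus_bcontfun.rep_eq h(3))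
    then show "J \<psi> \<le> L \<Phi>" unfolding J_scale linear_neg[OF L(1)] by simp
  qed
  moreover have field: "L \<Phi> \<le> s * D" if "0 < s" "\<And>x. apply_bcontfun \<Phi> x \<in> scaled_slopes f s" for \<Phi> s
  proof -
    have "L \<Phi> \<le> s * D + J (\<lambda>x. 0 * (x \<bullet> x))"
      by (rule L(2), unfold adm_def, intro exI conjI, rule that(1), rule C2_scale[OF C2_square, of 0])
         (use that in auto)
    then show ?thesis unfolding J_scale by simp
  qed
  moreover have "L \<Phi> \<le> D" if "\<And>x. apply_bcontfun \<Phi> x \<in> slopes f" for \<Phi>
    using field[of 1 \<Phi>] that by (simp add: scaled_slopes_1)
  moreover have "L \<Phi> \<le> 0" if "\<And>x A. A \<in> psd_mats \<Longrightarrow> apply_bcontfun \<Phi> x \<bullet> A \<le> 0" for \<Phi>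
  proof (rule squeeze)
    fix s :: real assume s: "0 < s"
    have "L \<Phi> \<le> s * D" by (rule field[OF s nonpos_scaled_slope[OF dom that s]])
    then show "L \<Phi> \<le> s * D + 0" by simp
  qed
  ultimately show ?thesis using L(1) unfolding J_def by blast
qed

section \<open>Test functions concentrated at infinity\<close>

text \<open>
  \<open>\<psi>\<^sub>a(x) = v - arctan v\<close> with \<open>v = (|x|\<^sup>2 - a)\<^sub>+\<close> vanishes on a large ball, while its Hessian dominates
  the identity outside a slightly larger one.
\<close>

lemma ex_tail_function:
  assumes a: "0 \<le> a"
  shows "\<exists>\<psi> g H. C2_with \<psi> g H \<and> bounded (range H) \<and>
    (\<forall>x::real^'d. 0 \<le> \<psi> x \<and> \<psi> x \<le> x \<bullet> x \<and> (x \<bullet> x \<le> a \<longrightarrow> \<psi> x = 0) \<and>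
      (\<forall>A\<in>psd_mats. 0 \<le> H x \<bullet> A \<and> (a + 1 \<le> x \<bullet> x \<longrightarrow> trace A \<le> H x \<bullet> A)))"
proof -
  define k where "k = (\<lambda>v::real. v - arctan v)"
  define k' where "k' = (\<lambda>v::real. v\<^sup>2 / (1 + v\<^sup>2))"
  define k'' where "k'' = (\<lambda>v::real. 2 * v / (1 + v\<^sup>2)\<^sup>2)"
  have p: "0 < 1 + v\<^sup>2" for v :: real by (rule add_pos_nonneg) auto
  have dk: "(k has_real_derivative k' v) (at v)" for v
    unfolding k_def k'_def using p[of v] by (auto intro!: derivative_eq_intros simp: divide_simps add_nonneg_eq_0_iff)
  have dk': "(k' has_real_derivative k'' v) (at v)" for v
    unfolding k'_def k''_def using p[of v]
    by (auto intro!: derivative_eq_intros simp: field_simps power2_eq_square)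
  define v where "v = (\<lambda>u. max 0 (u - a))"
  define H where "H = (\<lambda>x::real^'d. (2 * k' (v (x \<bullet> x))) *\<^sub>R mat 1 + (4 * k'' (v (x \<bullet> x))) *\<^sub>R outer x x)"
  have C2: "C2_with (\<lambda>x::real^'d. k (v (x \<bullet> x))) (\<lambda>x. (2 * k' (v (x \<bullet> x))) *\<^sub>R x) H"
    unfolding H_def
  proof (rule C2_radial)
    show "((\<lambda>u. k (v u)) has_real_derivative k' (v u)) (at u)" for u
      unfolding v_def by (rule DERIV_max_comp[OF dk]) (simp add: k'_def)
    show "((\<lambda>u. k' (v u)) has_real_derivative k'' (v u)) (at u)" for u
      unfolding v_def by (rule DERIV_max_comp[OF dk']) (simp add: k''_def)
    show "continuous_on {0..} (\<lambda>u. k'' (v u))"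
      unfolding k''_def v_def using p by (intro continuous_intros) (auto simp: less_imp_neq[symmetric])
  qed
  have k'b: "0 \<le> k' v" "k' v \<le> 1" for v using p[of v] by (auto simp: k'_def)
  have k'': "0 \<le> k'' v" if "0 \<le> v" for v using that by (simp add: k''_def)
  have v0: "0 \<le> v u" for u by (simp add: v_def)
  have bd: "k'' (v u) * u \<le> 2 + 2 * a" if u: "0 \<le> u" for u
  proof (cases "u \<le> a")
    case True then show ?thesis using a by (simp add: v_def k''_def)
  next
    case False
    then have uv: "u = v u + a" by (simp add: v_def)
    define w where "w = v u"
    have w: "0 \<le> w" by (simp add: w_def v0)
    have s: "1 \<le> (1 + w\<^sup>2)\<^sup>2" by simp
    have "w\<^sup>2 \<le> (1 + w\<^sup>2)\<^sup>2" using zero_le_power2[of "w\<^sup>2"] by (simp add: power2_sum)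
    moreover have "w \<le> (1 + w\<^sup>2)\<^sup>2"
    proof -
      have "w \<le> 1 + w\<^sup>2" using zero_le_power2[of "w - 1"] w by (simp add: power2_diff)
      also have "\<dots> \<le> (1 + w\<^sup>2)\<^sup>2" using mult_left_mono[of 1 "1 + w\<^sup>2" "1 + w\<^sup>2"] by (simp add: power2_eq_square)
      finally show ?thesis .
    qed
    ultimately have "2 * w\<^sup>2 + 2 * a * w \<le> 2 * (1 + w\<^sup>2)\<^sup>2 + 2 * a * (1 + w\<^sup>2)\<^sup>2"
      using a by (intro add_mono mult_left_mono) auto
    then have "(2 * w\<^sup>2 + 2 * a * w) / (1 + w\<^sup>2)\<^sup>2 \<le> 2 + 2 * a"
      using p[of w] by (simp add: divide_le_eq algebra_simps)
    moreover have "k'' w * (w + a) = (2 * w\<^sup>2 + 2 * a * w) / (1 + w\<^sup>2)\<^sup>2"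
      by (simp add: k''_def power2_eq_square algebra_simps)
    ultimately show ?thesis using uv by (simp add: w_def)
  qed
  have "norm (H x) \<le> 2 * norm (mat 1 :: real^'d^'d) + 4 * (2 + 2 * a)" for x
  proof -
    have "norm ((2 * k' (v (x \<bullet> x))) *\<^sub>R (mat 1 :: real^'d^'d)) \<le> 2 * norm (mat 1 :: real^'d^'d)"
      using k'b[of "v (x \<bullet> x)"] by (simp add: mult_right_mono)
    moreover have "norm ((4 * k'' (v (x \<bullet> x))) *\<^sub>R outer x x) \<le> 4 * (2 + 2 * a)"
    proof -
      have "norm ((4 * k'' (v (x \<bullet> x))) *\<^sub>R outer x x) = 4 * (k'' (v (x \<bullet> x)) * (x \<bullet> x))"
        using k''[OF v0] by (simp add: norm_outer dot_square_norm power2_eq_square)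
      also have "\<dots> \<le> 4 * (2 + 2 * a)" by (intro mult_left_mono bd) auto
      finally show ?thesis .
    qed
    ultimately show ?thesis unfolding H_def by (rule norm_triangle_mono)
  qed
  then have "bounded (range H)" by (auto simp: bounded_iff)
  moreover have "0 \<le> k (v (x \<bullet> x)) \<and> k (v (x \<bullet> x)) \<le> x \<bullet> x \<and> (x \<bullet> x \<le> a \<longrightarrow> k (v (x \<bullet> x)) = 0)" for x :: "real^'d"
  proof -
    have "arctan w \<le> w" if "0 \<le> w" for w :: real using arctan_le_self[OF that] .
    then have "0 \<le> k (v (x \<bullet> x))" using v0[of "x \<bullet> x"] by (simp add: k_def)
    moreover have "0 \<le> arctan (v (x \<bullet> x))" using v0 by simp
    then have "k (v (x \<bullet> x)) \<le> v (x \<bullet> x)" by (simp add: k_def)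
    moreover have "v (x \<bullet> x) \<le> x \<bullet> x" using a by (simp add: v_def)
    moreover have "k (v (x \<bullet> x)) = 0" if "x \<bullet> x \<le> a" using that by (simp add: v_def k_def)
    ultimately show ?thesis by linarith
  qed
  moreover have "0 \<le> H x \<bullet> A \<and> (a + 1 \<le> x \<bullet> x \<longrightarrow> trace A \<le> H x \<bullet> A)" if A: "A \<in> psd_mats" for x A
  proof -
    have HA: "H x \<bullet> A = 2 * k' (v (x \<bullet> x)) * trace A + 4 * k'' (v (x \<bullet> x)) * (x \<bullet> (A *v x))"
      unfolding H_def inner_add_left inner_scaleR_left
      by (simp add: inner_commute[of _ A] inner_mat_1 inner_outer)
    have xx: "0 \<le> 4 * k'' (v (x \<bullet> x)) * (x \<bullet> (A *v x))"
      using A k''[OF v0] by (intro mult_nonneg_nonneg) (auto simp: psd_mats_def)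
    have tr: "0 \<le> trace A" by (rule psd_trace_nonneg[OF A])
    have "trace A \<le> H x \<bullet> A" if "a + 1 \<le> x \<bullet> x"
    proof -
      have "1 \<le> v (x \<bullet> x)" using that by (simp add: v_def)
      then have "1 \<le> (v (x \<bullet> x))\<^sup>2" by simp
      then have "1 \<le> 2 * k' (v (x \<bullet> x))" using p[of "v (x \<bullet> x)"] by (simp add: k'_def field_simps)
      then have "1 * trace A \<le> 2 * k' (v (x \<bullet> x)) * trace A" using tr by (intro mult_right_mono)
      then show ?thesis using xx unfolding HA by linarith
    qed
    moreover have "0 \<le> 2 * k' (v (x \<bullet> x)) * trace A" using tr k'b by simp
    ultimately show ?thesis using xx unfolding HA by simp
  qed
  ultimately show ?thesis using C2 by blast
qed

section \<open>Representation by a matrix-valued measure\<close>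

lemma Dini:
  fixes G :: "nat \<Rightarrow> 'a::topological_space \<Rightarrow> real"
  assumes K: "compact K" and G: "\<And>n. continuous_on UNIV (G n)" and dec: "\<And>x. decseq (\<lambda>n. G n x)"
    and lim: "\<And>x. (\<lambda>n. G n x) \<longlonglongrightarrow> 0" and e: "0 < e"
  shows "\<exists>N. \<forall>n\<ge>N. \<forall>x\<in>K. G n x < e"
proof -
  have cov: "K \<subseteq> (\<Union>n\<in>UNIV. {x. G n x < e})"
  proof
    fix x
    obtain n where "G n x < e" using order_tendstoD(2)[OF lim e, of x] unfolding eventually_sequentially by blast
    then show "x \<in> (\<Union>n\<in>UNIV. {x. G n x < e})" by blast
  qed
  have op: "open {x. G n x < e}" for n using G by (intro open_Collect_less continuous_intros)
  obtain C where C: "finite C" "K \<subseteq> (\<Union>n\<in>C. {x. G n x < e})"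
    by (rule compactE_image[OF K op cov])
  show ?thesis
  proof (intro exI[of _ "Max (insert 0 C)"] allI impI ballI)
    fix n x assume n: "Max (insert 0 C) \<le> n" and "x \<in> K"
    then obtain m where m: "m \<in> C" "G m x < e" using C by blast
    then have "m \<le> n" using n C(1) by auto
    then have "G n x \<le> G m x" using decseqD[OF dec] by blast
    then show "G n x < e" using m by simp
  qed
qed

text \<open>
  On scalar multiples of a matrix \<open>k\<close> that pairs nonnegatively with \<open>S\<^sub>d\<^sup>+\<close> the functional is a positive
  one.  No mass escapes to infinity, so Dini's theorem on a large ball yields the monotone
  continuity that makes it an integral.
\<close>

lemma scalar_representation:
  fixes L :: "((real^'d) \<Rightarrow>\<^sub>C (real^'d^'d)) \<Rightarrow> real"
  assumes lin: "linear L"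
    and neg: "\<And>\<Phi>. (\<And>x A. A \<in> psd_mats \<Longrightarrow> apply_bcontfun \<Phi> x \<bullet> A \<le> 0) \<Longrightarrow> L \<Phi> \<le> 0"
    and tail: "\<And>e. 0 < e \<Longrightarrow> \<exists>R \<Psi>. (\<forall>x. \<forall>A\<in>psd_mats. 0 \<le> apply_bcontfun \<Psi> x \<bullet> A \<and>
      (R \<le> norm x \<longrightarrow> trace A \<le> apply_bcontfun \<Psi> x \<bullet> A)) \<and> L \<Psi> \<le> e"
    and k: "\<And>A. A \<in> psd_mats \<Longrightarrow> 0 \<le> k \<bullet> A" "\<And>A. A \<in> psd_mats \<Longrightarrow> k \<bullet> A \<le> 2 * trace A"
  shows "\<exists>M. sets M = sets borel \<and> finite_measure M \<and> (\<forall>g. L (bscale g k) = (\<integral>x. apply_bcontfun g x \<partial>M))"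
proof (rule daniell_stone)
  have mono: "L \<Phi> \<le> L \<Psi>" if "\<And>x A. A \<in> psd_mats \<Longrightarrow> apply_bcontfun \<Phi> x \<bullet> A \<le> apply_bcontfun \<Psi> x \<bullet> A" for \<Phi> \<Psi>
    using neg[of "\<Phi> - \<Psi>"] that by (simp add: linear_diff[OF lin] minus_bcontfun.rep_eq inner_diff_left)
  show "linear (\<lambda>g. L (bscale g k))"
    using linear_compose[OF linear_bscale lin] by (simp add: o_def)
  show pos: "0 \<le> L (bscale g k)" if "\<forall>x. 0 \<le> apply_bcontfun g x" for g
  proof -
    have "L 0 \<le> L (bscale g k)"
      using that k by (intro mono) (simp add: zero_bcontfun.rep_eq bscale_apply)
    then show ?thesis by (simp add: linear_0[OF lin])
  qed
  fix G :: "nat \<Rightarrow> (real^'d) \<Rightarrow>\<^sub>C real"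
  assume dec: "\<And>x. decseq (\<lambda>n. apply_bcontfun (G n) x)" and lim: "\<And>x. (\<lambda>n. apply_bcontfun (G n) x) \<longlonglongrightarrow> 0"
  have G0: "0 \<le> apply_bcontfun (G n) x" "apply_bcontfun (G n) x \<le> norm (G 0)" for n x
  proof -
    show "0 \<le> apply_bcontfun (G n) x" using decseq_ge[OF dec lim] .
    have "apply_bcontfun (G n) x \<le> apply_bcontfun (G 0) x" using decseqD[OF dec] by blast
    then show "apply_bcontfun (G n) x \<le> norm (G 0)" using bcontfun_abs_le[of "G 0" x] by linarith
  qed
  define E where "E = (const_bcontfun (mat 1) :: (real^'d) \<Rightarrow>\<^sub>C (real^'d^'d))"
  have E: "apply_bcontfun E x = mat 1" for x by (simp add: E_def const_bcontfun.rep_eq)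
  define T where "T = \<bar>L E\<bar>"
  define B where "B = norm (G 0)"
  show "(\<lambda>n. L (bscale (G n) k)) \<longlonglongrightarrow> 0"
    unfolding LIMSEQ_def
  proof (intro allI impI)
    fix e :: real assume e: "0 < e"
    define e1 where "e1 = e / (8 * (T + 1))"
    define e2 where "e2 = e / (8 * (B + 1))"
    have B0: "0 \<le> B" and T0: "0 \<le> T" by (simp_all add: B_def T_def)
    have e12: "0 < e1" "0 < e2" using e B0 T0 by (simp_all add: e1_def e2_def add_nonneg_pos)
    obtain R \<Psi> where \<Psi>: "\<And>x A. A \<in> psd_mats \<Longrightarrow> 0 \<le> apply_bcontfun \<Psi> x \<bullet> A"
      "\<And>x A. A \<in> psd_mats \<Longrightarrow> R \<le> norm x \<Longrightarrow> trace A \<le> apply_bcontfun \<Psi> x \<bullet> A" "L \<Psi> \<le> e2"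
      using tail[OF e12(2)] by blast
    obtain N where N: "\<And>n x. N \<le> n \<Longrightarrow> x \<in> cball 0 R \<Longrightarrow> apply_bcontfun (G n) x < e1"
      using Dini[where G = "\<lambda>n. apply_bcontfun (G n)",
          OF compact_cball[of "0::real^'d" R] continuous_on_apply_bcontfun dec lim e12(1)] by blast
    have "L (bscale (G n) k) < e" if n: "N \<le> n" for n
    proof -
      have "L (bscale (G n) k) \<le> L ((2 * e1) *\<^sub>R E + (2 * B) *\<^sub>R \<Psi>)"
      proof (rule mono)
        fix x and A :: "real^'d^'d" assume A: "A \<in> psd_mats"
        have tr: "0 \<le> trace A" by (rule psd_trace_nonneg[OF A])
        have "apply_bcontfun (G n) x * (k \<bullet> A) \<le> apply_bcontfun (G n) x * (2 * trace A)"
          using G0 k(2)[OF A] by (intro mult_left_mono) auto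
        also have "\<dots> \<le> 2 * e1 * trace A + 2 * B * (apply_bcontfun \<Psi> x \<bullet> A)"
        proof (cases "norm x \<le> R")
          case True
          then have "apply_bcontfun (G n) x * (2 * trace A) \<le> e1 * (2 * trace A)"
            using N[OF n, of x] tr by (intro mult_right_mono) auto
          moreover have "0 \<le> 2 * B * (apply_bcontfun \<Psi> x \<bullet> A)" using B0 \<Psi>(1)[OF A] by simp
          ultimately show ?thesis by simp
        next
          case False
          then have "trace A \<le> apply_bcontfun \<Psi> x \<bullet> A" using \<Psi>(2)[OF A] by simp
          then have "B * (2 * trace A) \<le> B * (2 * (apply_bcontfun \<Psi> x \<bullet> A))" using B0 by (intro mult_left_mono) auto
          moreover have "apply_bcontfun (G n) x * (2 * trace A) \<le> B * (2 * trace A)"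
            using G0 tr by (intro mult_right_mono) (auto simp: B_def)
          moreover have "0 \<le> 2 * e1 * trace A" using e12 tr by simp
          ultimately show ?thesis by simp
        qed
        finally show "apply_bcontfun (bscale (G n) k) x \<bullet> A \<le> apply_bcontfun ((2 * e1) *\<^sub>R E + (2 * B) *\<^sub>R \<Psi>) x \<bullet> A"
          using inner_mat_1[of A]
          by (simp add: bscale_apply plus_bcontfun.rep_eq scaleR_bcontfun.rep_eq E inner_add_left inner_commute[of "mat 1"])
      qed
      also have "\<dots> = 2 * e1 * L E + 2 * B * L \<Psi>" by (simp add: linear_add[OF lin] linear_scale[OF lin])
      also have "\<dots> \<le> 2 * e1 * T + 2 * B * e2"
        using e12 B0 \<Psi>(3) by (intro add_mono mult_left_mono) (auto simp: T_def)
      also have "\<dots> < e"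
      proof -
        have "e1 * T \<le> e1 * (T + 1)" "B * e2 \<le> (B + 1) * e2" using e12 by auto
        moreover have "e1 * (T + 1) = e / 8" "(B + 1) * e2 = e / 8"
          using B0 T0 by (simp_all add: e1_def e2_def divide_simps)
        ultimately have "e1 * T \<le> e / 8" "B * e2 \<le> e / 8" by simp_all
        then show ?thesis using e unfolding mult.assoc by linarith
      qed
      finally show ?thesis .
    qed
    moreover have "0 \<le> L (bscale (G n) k)" for n using G0 by (intro pos) auto
    ultimately show "\<exists>no. \<forall>n\<ge>no. dist (L (bscale (G n) k)) 0 < e" by (auto simp: dist_real_def)
  qed
qed

text \<open>
  Decreases to the indicator of \<open>C\<close>, for closed \<open>C\<close>, as \<open>m\<close> grows.  The empty set needs its own case
  because \<open>infdist x {} = 0\<close>.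
\<close>

definition cutoff :: "'a::metric_space set \<Rightarrow> nat \<Rightarrow> 'a \<Rightarrow> real" where
  "cutoff C m x = (if C = {} then 0 else max 0 (1 - real m * infdist x C))"

lemma cutoff_continuous: "continuous_on S (cutoff C m)"
  unfolding cutoff_def by (cases "C = {}") (auto intro!: continuous_intros)

lemma cutoff_bounds: "0 \<le> cutoff C m x" "cutoff C m x \<le> 1"
  by (auto simp: cutoff_def infdist_nonneg)

lemma cutoff_tendsto:
  assumes C: "closed C" shows "(\<lambda>m. cutoff C m x) \<longlonglongrightarrow> indicator C x"
proof (cases "x \<in> C")
  case True
  then have "C \<noteq> {}" by auto
  then show ?thesis using True by (simp add: cutoff_def)
next
  case False
  show ?thesis
  proof (cases "C = {}")
    case nonempty: False
    then have d: "0 < infdist x C" using False C by (intro infdist_pos_not_in_closed)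
    obtain n where n: "1 / infdist x C < real n" using reals_Archimedean2 by blast
    have "cutoff C m x = 0" if "m \<ge> n" for m
    proof -
      have "1 / infdist x C < real m" using n that by linarith
      then show ?thesis using d by (simp add: cutoff_def field_simps)
    qed
    then have "eventually (\<lambda>m. cutoff C m x = indicator C x) sequentially"
      using False by (intro eventually_sequentiallyI[of n]) auto
    then show ?thesis by (rule tendsto_eventually)
  qed (simp add: cutoff_def)
qed

lemma ex_cutoff_bcontfun: "\<exists>u::'a::metric_space \<Rightarrow>\<^sub>C real. \<forall>x. apply_bcontfun u x = cutoff C m x"
proof (intro exI allI, subst Bcontfun_apply[where B = 1])
  show "continuous_on UNIV (cutoff C m)" by (rule cutoff_continuous)
  show "norm (cutoff C m x) \<le> 1" for x using cutoff_bounds[of C m x] by simp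
qed simp

lemma compact_inner_approximation:
  fixes M :: "'a::polish_space measure"
  assumes M: "sets M = sets borel" "finite_measure M" and E: "E \<in> sets borel" and e: "0 < e"
  shows "\<exists>C\<subseteq>E. compact C \<and> measure M (E - C) < e"
proof -
  interpret finite_measure M by fact
  have sup: "emeasure M E = (SUP K \<in> {K. K \<subseteq> E \<and> compact K}. emeasure M K)"
    using M(1) E by (intro inner_regular) auto
  have "\<exists>K\<in>{K. K \<subseteq> E \<and> compact K}. emeasure M E < emeasure M K + ennreal e"
    using e sup emeasure_finite[of E] by (intro SUP_approx_ennreal[of e]) auto
  then obtain C where C: "C \<subseteq> E" "compact C" "emeasure M E < emeasure M C + ennreal e" by blast
  have CM: "C \<in> sets M" "E \<in> sets M" unfolding M(1) using borel_compact[OF C(2)] E by auto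
  have "measure M E < measure M C + e"
    using C(3) e by (simp add: emeasure_eq_measure ennreal_plus[symmetric] ennreal_less_iff del: ennreal_plus)
  then have "measure M (E - C) < e" using finite_measure_Diff[OF CM(2,1) C(1)] by simp
  then show ?thesis using C by blast
qed

lemma compact_inner_approximation_finite:
  fixes M :: "'i \<Rightarrow> 'a::polish_space measure"
  assumes I: "finite I" and M: "\<And>i. i \<in> I \<Longrightarrow> sets (M i) = sets borel" "\<And>i. i \<in> I \<Longrightarrow> finite_measure (M i)"
    and E: "E \<in> sets borel" and e: "0 < e"
  shows "\<exists>C\<subseteq>E. compact C \<and> (\<forall>i\<in>I. measure (M i) (E - C) < e)"
proof -
  have "\<forall>i\<in>I. \<exists>C\<subseteq>E. compact C \<and> measure (M i) (E - C) < e"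
    using compact_inner_approximation M E e by blast
  then obtain K where K: "\<And>i. i \<in> I \<Longrightarrow> K i \<subseteq> E" "\<And>i. i \<in> I \<Longrightarrow> compact (K i)" "\<And>i. i \<in> I \<Longrightarrow> measure (M i) (E - K i) < e"
    by metis
  show ?thesis
  proof (intro exI[of _ "\<Union>i\<in>I. K i"] conjI ballI)
    show "(\<Union>i\<in>I. K i) \<subseteq> E" using K by blast
    show cK: "compact (\<Union>i\<in>I. K i)" using I K by (intro compact_UN) auto
    fix i assume i: "i \<in> I"
    have "measure (M i) (E - (\<Union>i\<in>I. K i)) \<le> measure (M i) (E - K i)"
    proof (rule finite_measure.finite_measure_mono[OF M(2)[OF i]])
      show "E - K i \<in> sets (M i)" unfolding M(1)[OF i] using borel_compact[OF K(2)[OF i]] E by auto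
    qed (use i in blast)
    then show "measure (M i) (E - (\<Union>i\<in>I. K i)) < e" using K(3)[OF i] by simp
  qed
qed

lemma integral_simple_function:
  fixes s :: "'a \<Rightarrow> real"
  assumes N: "finite_measure N" and s: "simple_function N s"
  shows "(\<integral>x. s x \<partial>N) = (\<Sum>c\<in>s ` space N. c * measure N (s -` {c} \<inter> space N))"
proof -
  interpret finite_measure N by fact
  note fin = simple_functionD(1)[OF s] and ms = simple_functionD(2)[OF s]
  have "(\<integral>x. s x \<partial>N) = (\<integral>x. (\<Sum>c\<in>s ` space N. c * indicat_real (s -` {c} \<inter> space N) x) \<partial>N)"
  proof (rule Bochner_Integration.integral_cong[OF refl])
    fix x assume x: "x \<in> space N"
    have "(\<Sum>c\<in>s ` space N. c * indicat_real (s -` {c} \<inter> space N) x) = (\<Sum>c\<in>s ` space N. if c = s x then c else 0)"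
      using x by (intro sum.cong) (auto split: split_indicator)
    then show "s x = (\<Sum>c\<in>s ` space N. c * indicat_real (s -` {c} \<inter> space N) x)" using fin x by simp
  qed
  also have "\<dots> = (\<Sum>c\<in>s ` space N. c * measure N (s -` {c} \<inter> space N))"
    using ms by (subst Bochner_Integration.integral_sum) (auto simp: emeasure_finite less_top[symmetric])
  finally show ?thesis .
qed

lemma integral_difference_density:
  fixes g u :: "'a \<Rightarrow> real"
  assumes N: "finite_measure N" "sets N = sets T" and M: "finite_measure M" "sets M = sets T"
    and g: "integrable T g" and eq: "\<And>E. E \<in> sets T \<Longrightarrow> measure N E - measure M E = (LINT x:E|T. g x)"
    and u: "u \<in> borel_measurable T" "\<And>x. \<bar>u x\<bar> \<le> B"
  shows "(\<integral>x. u x \<partial>N) - (\<integral>x. u x \<partial>M) = (\<integral>x. u x * g x \<partial>T)"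
proof -
  obtain s where s: "\<And>n. simple_function T (s n)" "\<And>x. x \<in> space T \<Longrightarrow> (\<lambda>n. s n x) \<longlonglongrightarrow> u x"
    "\<And>n x. x \<in> space T \<Longrightarrow> dist (s n x) 0 \<le> 2 * dist (u x) 0"
    using borel_measurable_implies_sequence_metric[OF u(1), of 0] by blast
  have sp: "space N = space T" "space M = space T" using sets_eq_imp_space_eq[OF N(2)] sets_eq_imp_space_eq[OF M(2)] by auto
  have sf: "simple_function N (s n)" "simple_function M (s n)" for n
    using s(1)[of n] N(2) M(2) sp by (simp_all add: simple_function_def)
  have sb: "\<bar>s n x\<bar> \<le> 2 * B" if "x \<in> space T" for n x using s(3)[OF that, of n] u(2)[of x] by (simp add: dist_real_def)
  have ms: "s n -` {c} \<inter> space T \<in> sets T" for n c using simple_functionD(2)[OF s(1)] .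
  have step: "(\<integral>x. s n x \<partial>N) - (\<integral>x. s n x \<partial>M) = (\<integral>x. s n x * g x \<partial>T)" for n
  proof -
    have "(\<integral>x. s n x * g x \<partial>T) = (\<integral>x. (\<Sum>c\<in>s n ` space T. c * (indicat_real (s n -` {c} \<inter> space T) x * g x)) \<partial>T)"
    proof (rule Bochner_Integration.integral_cong[OF refl])
      fix x assume x: "x \<in> space T"
      have "(\<Sum>c\<in>s n ` space T. c * (indicat_real (s n -` {c} \<inter> space T) x * g x)) = (\<Sum>c\<in>s n ` space T. if c = s n x then c * g x else 0)"
        using x by (intro sum.cong) (auto split: split_indicator)
      then show "s n x * g x = (\<Sum>c\<in>s n ` space T. c * (indicat_real (s n -` {c} \<inter> space T) x * g x))"
        using simple_functionD(1)[OF s(1)[of n]] x by simp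
    qed
    also have "\<dots> = (\<Sum>c\<in>s n ` space T. c * (LINT x:(s n -` {c} \<inter> space T)|T. g x))"
      using integrable_mult_indicator[OF ms g]
      by (subst Bochner_Integration.integral_sum) (auto simp: set_lebesgue_integral_def)
    also have "\<dots> = (\<Sum>c\<in>s n ` space T. c * (measure N (s n -` {c} \<inter> space T) - measure M (s n -` {c} \<inter> space T)))"
      using eq[OF ms] by simp
    finally show ?thesis
      using integral_simple_function[OF N(1) sf(1)] integral_simple_function[OF M(1) sf(2)]
      by (simp add: sp right_diff_distrib sum_subtractf)
  qed
  have dc: "(\<lambda>n. \<integral>x. s n x \<partial>P) \<longlonglongrightarrow> (\<integral>x. u x \<partial>P)" if P: "finite_measure P" "sets P = sets T" for P
  proof (rule integral_dominated_convergence[where w = "\<lambda>_. 2 * B"])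
    interpret P: finite_measure P by fact
    have spP: "space P = space T" using sets_eq_imp_space_eq[OF P(2)] .
    show "u \<in> borel_measurable P" by (rule measurable_sets_eq[OF u(1) P(2)[symmetric]])
    show "s n \<in> borel_measurable P" for n
      by (rule measurable_sets_eq[OF borel_measurable_simple_function[OF s(1)] P(2)[symmetric]])
    show "integrable P (\<lambda>_. 2 * B)" by simp
    show "AE x in P. (\<lambda>n. s n x) \<longlonglongrightarrow> u x" using s(2) by (intro AE_I2) (simp add: spP)
    show "AE x in P. norm (s n x) \<le> 2 * B" for n using sb by (intro AE_I2) (simp add: spP)
  qed
  have "(\<lambda>n. (\<integral>x. s n x \<partial>N) - (\<integral>x. s n x \<partial>M)) \<longlonglongrightarrow> (\<integral>x. u x \<partial>N) - (\<integral>x. u x \<partial>M)"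
    by (intro tendsto_diff dc N M)
  moreover have "(\<lambda>n. \<integral>x. s n x * g x \<partial>T) \<longlonglongrightarrow> (\<integral>x. u x * g x \<partial>T)"
  proof (rule integral_dominated_convergence[where w = "\<lambda>x. 2 * B * \<bar>g x\<bar>"])
    have gm: "g \<in> borel_measurable T" using g by auto
    show "(\<lambda>x. u x * g x) \<in> borel_measurable T" using u(1) gm by auto
    show "(\<lambda>x. s n x * g x) \<in> borel_measurable T" for n
      using borel_measurable_simple_function[OF s(1)[of n]] gm by auto
    show "integrable T (\<lambda>x. 2 * B * \<bar>g x\<bar>)" using g by auto
    show "AE x in T. (\<lambda>n. s n x * g x) \<longlonglongrightarrow> u x * g x" using s(2) by (intro AE_I2 tendsto_mult) auto
    show "AE x in T. norm (s n x * g x) \<le> 2 * B * \<bar>g x\<bar>" for n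
      using sb by (intro AE_I2) (simp add: abs_mult mult_right_mono)
  qed
  ultimately show ?thesis unfolding step using LIMSEQ_unique by blast
qed

text \<open>
  The matrices \<open>I\<close> and \<open>I + E\<^sub>i\<^sub>j\<close> pair nonnegatively with \<open>S\<^sub>d\<^sup>+\<close> because \<open>|A\<^sub>i\<^sub>j| \<le> tr A\<close>, so \<open>L\<close> is represented
  by measures \<open>M\<close> and \<open>N\<^sub>i\<^sub>j\<close> on their multiples, and \<open>N\<^sub>i\<^sub>j - M\<close> are the entries of the measure wanted.
  That \<open>k : l(E) \<ge> 0\<close> whenever \<open>k\<close> pairs nonnegatively with \<open>S\<^sub>d\<^sup>+\<close> is inherited from \<open>L\<close> for closed \<open>E\<close>, and
  from the closed sets by inner regularity for all \<open>E\<close>.  It contains the symmetry of \<open>l(E)\<close>, with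
  \<open>k = E\<^sub>i\<^sub>j - E\<^sub>j\<^sub>i\<close>, and its positivity, with \<open>k = v v\<^sup>T\<close>.
\<close>

lemma matrix_representation:
  fixes L :: "((real^'d) \<Rightarrow>\<^sub>C (real^'d^'d)) \<Rightarrow> real"
  assumes lin: "linear L"
    and neg: "\<And>\<Phi>. (\<And>x A. A \<in> psd_mats \<Longrightarrow> apply_bcontfun \<Phi> x \<bullet> A \<le> 0) \<Longrightarrow> L \<Phi> \<le> 0"
    and tail: "\<And>e. 0 < e \<Longrightarrow> \<exists>R \<Psi>. (\<forall>x. \<forall>A\<in>psd_mats. 0 \<le> apply_bcontfun \<Psi> x \<bullet> A \<and>
      (R \<le> norm x \<longrightarrow> trace A \<le> apply_bcontfun \<Psi> x \<bullet> A)) \<and> L \<Psi> \<le> e"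
  shows "\<exists>l\<in>psd_measures borel. \<forall>\<Phi>. mat_integral borel l (apply_bcontfun \<Phi>) = L \<Phi>"
proof -
  have pos: "0 \<le> L \<Phi>" if "\<And>x A. A \<in> psd_mats \<Longrightarrow> 0 \<le> apply_bcontfun \<Phi> x \<bullet> A" for \<Phi>
    using neg[of "- \<Phi>"] that by (simp add: linear_neg[OF lin] uminus_bcontfun.rep_eq)
  have "\<exists>M. sets M = sets borel \<and> finite_measure M \<and> (\<forall>g. L (bscale g (mat 1)) = (\<integral>x. apply_bcontfun g x \<partial>M))"
  proof (rule scalar_representation[OF lin neg tail])
    fix A :: "real^'d^'d" assume "A \<in> psd_mats"
    then show "0 \<le> mat 1 \<bullet> A" "mat 1 \<bullet> A \<le> 2 * trace A"
      using psd_trace_nonneg[of A] inner_mat_1[of A] by (simp_all add: inner_commute[of "mat 1"])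
  qed
  then obtain M where M: "sets M = sets (borel :: (real^'d) measure)" "finite_measure M"
    "\<And>g. L (bscale g (mat 1)) = (\<integral>x. apply_bcontfun g x \<partial>M)" by blast
  have "\<exists>N. sets N = sets borel \<and> finite_measure N \<and>
    (\<forall>g. L (bscale g (mat 1 + unit_mat i j)) = (\<integral>x. apply_bcontfun g x \<partial>N))" for i j
  proof (rule scalar_representation[OF lin neg tail])
    fix A :: "real^'d^'d" assume A: "A \<in> psd_mats"
    have "(mat 1 + unit_mat i j) \<bullet> A = trace A + A $ i $ j"
      using inner_mat_1[of A] inner_unit_mat[of A i j]
      by (simp add: inner_add_left inner_commute[of "mat 1"] inner_commute[of "unit_mat i j"])
    then show "0 \<le> (mat 1 + unit_mat i j) \<bullet> A" "(mat 1 + unit_mat i j) \<bullet> A \<le> 2 * trace A"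
      using psd_entry_le_trace[OF A, of i j] by (auto simp: abs_le_iff)
  qed
  then obtain N where N: "\<And>i j. sets (N i j) = sets (borel :: (real^'d) measure)" "\<And>i j. finite_measure (N i j)"
    "\<And>i j g. L (bscale g (mat 1 + unit_mat i j)) = (\<integral>x. apply_bcontfun g x \<partial>N i j)" by metis
  interpret M: finite_measure M by fact
  interpret N: finite_measure "N i j" for i j by fact
  have Lij: "L (bscale g (unit_mat i j)) = (\<integral>x. apply_bcontfun g x \<partial>N i j) - (\<integral>x. apply_bcontfun g x \<partial>M)" for g i j
  proof -
    have "bscale g (mat 1 + unit_mat i j) = bscale g (mat 1) + bscale g (unit_mat i j)"
      by (rule bcontfun_eqI) (simp add: bscale_apply plus_bcontfun.rep_eq scaleR_add_right)
    then show ?thesis using M(3)[of g] N(3)[of g i j] by (simp add: linear_add[OF lin])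
  qed
  define l where "l = (\<lambda>E. \<Sum>i\<in>UNIV. \<Sum>j\<in>UNIV. (measure (N i j) E - measure M E) *\<^sub>R unit_mat i j)"
  have l_nth: "l E $ i $ j = measure (N i j) E - measure M E" for E i j
    unfolding l_def using mat_expand[of "\<chi> i j. measure (N i j) E - measure M E"] by (metis (no_types, lifting) sum.cong vec_lambda_beta)
  have expand: "L (\<Sum>i\<in>UNIV. \<Sum>j\<in>UNIV. bscale (h i j) (unit_mat i j))
    = (\<Sum>i\<in>UNIV. \<Sum>j\<in>UNIV. L (bscale (h i j) (unit_mat i j)))" for h
    by (simp add: linear_sum[OF lin])
  have bsum: "apply_bcontfun (\<Sum>i\<in>I. F i) x = (\<Sum>i\<in>I. apply_bcontfun (F i) x)"
    for F :: "'i \<Rightarrow> (real^'d) \<Rightarrow>\<^sub>C (real^'d^'d)" and I x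
    by (induction I rule: infinite_finite_induct) (auto simp: plus_bcontfun.rep_eq zero_bcontfun.rep_eq)
  have closed_nonneg: "0 \<le> k \<bullet> l C" if C: "closed C" and k: "\<And>A. A \<in> psd_mats \<Longrightarrow> 0 \<le> k \<bullet> A" for C k
  proof -
    obtain u :: "nat \<Rightarrow> (real^'d) \<Rightarrow>\<^sub>C real" where u: "\<And>m x. apply_bcontfun (u m) x = cutoff C m x"
      using ex_cutoff_bcontfun[of C] by metis
    have lim: "(\<lambda>m. \<integral>x. apply_bcontfun (u m) x \<partial>P) \<longlonglongrightarrow> measure P C" if P: "finite_measure P" "sets P = sets borel" for P
    proof -
      interpret P: finite_measure P by fact
      have CP: "C \<in> sets P" using C P(2) by simp
      have "(\<lambda>m. \<integral>x. apply_bcontfun (u m) x \<partial>P) \<longlonglongrightarrow> (\<integral>x. indicator C x \<partial>P)"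
      proof (rule integral_dominated_convergence[where w = "\<lambda>_. 1"])
        show "apply_bcontfun (u m) \<in> borel_measurable P" for m
          by (rule measurable_sets_eq[OF _ P(2)[symmetric]]) (intro borel_measurable_continuous_onI continuous_on_apply_bcontfun)
        show "AE x in P. norm (apply_bcontfun (u m) x) \<le> 1" for m
          using cutoff_bounds[of C m] by (simp add: u)
        show "AE x in P. (\<lambda>m. apply_bcontfun (u m) x) \<longlonglongrightarrow> indicator C x"
          unfolding u using cutoff_tendsto[OF C] by simp
      qed (use CP in auto)
      then show ?thesis using CP sets_eq_imp_space_eq[OF P(2)] by simp
    qed
    have kl: "k \<bullet> A = (\<Sum>i\<in>UNIV. \<Sum>j\<in>UNIV. k $ i $ j * A $ i $ j)" for A by (rule mat_inner_sum)
    have "L (bscale (u m) k) = (\<Sum>i\<in>UNIV. \<Sum>j\<in>UNIV. k $ i $ j *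
      ((\<integral>x. apply_bcontfun (u m) x \<partial>N i j) - (\<integral>x. apply_bcontfun (u m) x \<partial>M)))" for m
    proof -
      have "bscale (u m) k = (\<Sum>i\<in>UNIV. \<Sum>j\<in>UNIV. bscale (k $ i $ j *\<^sub>R u m) (unit_mat i j))"
      proof (rule bcontfun_eqI)
        fix x
        have "apply_bcontfun (u m) x *\<^sub>R k = (\<Sum>i\<in>UNIV. \<Sum>j\<in>UNIV. (apply_bcontfun (u m) x *\<^sub>R k) $ i $ j *\<^sub>R unit_mat i j)"
          by (rule mat_expand)
        then show "apply_bcontfun (bscale (u m) k) x = apply_bcontfun (\<Sum>i\<in>UNIV. \<Sum>j\<in>UNIV. bscale (k $ i $ j *\<^sub>R u m) (unit_mat i j)) x"
          by (simp add: bsum bscale_apply scaleR_bcontfun.rep_eq mult.commute)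
      qed
      then have "L (bscale (u m) k) = (\<Sum>i\<in>UNIV. \<Sum>j\<in>UNIV. L (bscale (k $ i $ j *\<^sub>R u m) (unit_mat i j)))"
        by (simp only: expand)
      also have "\<dots> = (\<Sum>i\<in>UNIV. \<Sum>j\<in>UNIV. k $ i $ j * L (bscale (u m) (unit_mat i j)))"
        by (simp add: linear_scale[OF linear_bscale] linear_scale[OF lin])
      finally show ?thesis by (simp add: Lij)
    qed
    moreover have "(\<lambda>m. \<Sum>i\<in>UNIV. \<Sum>j\<in>UNIV. k $ i $ j *
      ((\<integral>x. apply_bcontfun (u m) x \<partial>N i j) - (\<integral>x. apply_bcontfun (u m) x \<partial>M))) \<longlonglongrightarrow> k \<bullet> l C"
      unfolding kl l_nth by (intro tendsto_intros lim N M)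
    moreover have "0 \<le> L (bscale (u m) k)" for m
      using k cutoff_bounds[of C m] by (intro pos) (simp add: bscale_apply u)
    ultimately show ?thesis by (intro LIMSEQ_le_const) auto
  qed
  have nonneg: "0 \<le> k \<bullet> l E" if E: "E \<in> sets borel" and k: "\<And>A. A \<in> psd_mats \<Longrightarrow> 0 \<le> k \<bullet> A" for E k
  proof (rule field_le_epsilon)
    fix e :: real assume e: "0 < e"
    define s where "s = (\<Sum>i\<in>UNIV. \<Sum>j\<in>UNIV. \<bar>k $ i $ j\<bar>)"
    have s: "0 \<le> s" unfolding s_def by (intro sum_nonneg) auto
    define d where "d = e / (2 * (s + 1))"
    have d: "0 < d" using e s by (simp add: d_def add_nonneg_pos)
    define P where "P = (\<lambda>z. case z of None \<Rightarrow> M | Some (i, j) \<Rightarrow> N i j)"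
    have "\<exists>C\<subseteq>E. compact C \<and> (\<forall>z\<in>UNIV. measure (P z) (E - C) < d)"
      by (rule compact_inner_approximation_finite) (use M N E d in \<open>auto simp: P_def split: option.split\<close>)
    then obtain C where C: "C \<subseteq> E" "compact C" "\<And>z. measure (P z) (E - C) < d" by blast
    have mC: "measure M (E - C) < d" "measure (N i j) (E - C) < d" for i j
      using C(3)[of None] C(3)[of "Some (i, j)"] by (auto simp: P_def)
    have cC: "closed C" using C(2) by (rule compact_imp_closed)
    have diff: "measure (N i j) (E - C) = measure (N i j) E - measure (N i j) C"
      "measure M (E - C) = measure M E - measure M C" for i j
      using E cC C(1) N(1) M(1) by (auto intro!: N.finite_measure_Diff M.finite_measure_Diff)
    have "k \<bullet> l C - k \<bullet> l E \<le> (\<Sum>i\<in>UNIV. \<Sum>j\<in>UNIV. \<bar>k $ i $ j\<bar> * (2 * d))"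
      unfolding mat_inner_sum[of k] sum_subtractf[symmetric]
    proof (intro sum_mono)
      fix i j
      have "\<bar>l C $ i $ j - l E $ i $ j\<bar> \<le> 2 * d"
        unfolding l_nth using mC(1) mC(2)[of i j] diff(1)[of i j] diff(2)
          measure_nonneg[of M "E - C"] measure_nonneg[of "N i j" "E - C"] by linarith
      then have "\<bar>k $ i $ j\<bar> * \<bar>l C $ i $ j - l E $ i $ j\<bar> \<le> \<bar>k $ i $ j\<bar> * (2 * d)" by (intro mult_left_mono) auto
      then show "k $ i $ j * l C $ i $ j - k $ i $ j * l E $ i $ j \<le> \<bar>k $ i $ j\<bar> * (2 * d)"
        unfolding right_diff_distrib[symmetric] abs_mult[symmetric] by linarith
    qed
    also have "\<dots> = s * (2 * d)" by (simp add: s_def sum_distrib_right)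
    also have "\<dots> \<le> (s + 1) * (2 * d)" using d by (intro mult_right_mono) auto
    also have "\<dots> = e"
    proof -
      have "0 < s + 1" using s by simp
      then show ?thesis unfolding d_def by (simp add: divide_simps)
    qed
    finally show "0 \<le> k \<bullet> l E + e" using closed_nonneg[OF cC k] by simp
  qed
  have l: "l \<in> psd_measures borel"
    unfolding psd_measures_def
  proof (intro CollectI conjI ballI allI impI)
    fix E :: "(real^'d) set" assume E: "E \<in> sets borel"
    show "l E \<in> psd_mats"
      unfolding psd_mats_def
    proof (intro CollectI conjI allI)
      show "l E \<in> sym_mats"
      proof (rule sym_matsI)
        fix i j
        have "0 \<le> (unit_mat i j - unit_mat j i) \<bullet> l E" for i j
        proof (rule nonneg[OF E])
          fix A :: "real^'d^'d" assume "A \<in> psd_mats"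
          then show "0 \<le> (unit_mat i j - unit_mat j i) \<bullet> A"
            using sym_matsD[OF psd_sym, of A i j] inner_unit_mat[of A i j] inner_unit_mat[of A j i]
            by (simp add: inner_commute[of _ A] inner_diff_right)
        qed
        from this[of i j] this[of j i] show "l E $ i $ j = l E $ j $ i"
          by (simp add: inner_commute[of _ "l E"] inner_diff_right inner_unit_mat)
      qed
      fix v :: "real^'d"
      have "0 \<le> outer v v \<bullet> l E"
        by (rule nonneg[OF E]) (simp add: inner_commute[of "outer v v"] inner_outer psd_mats_def)
      then show "0 \<le> v \<bullet> (l E *v v)" by (simp add: inner_commute[of "outer v v"] inner_outer)
    qed
  next
    fix S :: "nat \<Rightarrow> (real^'d) set" assume S: "range S \<subseteq> sets borel" "disjoint_family S"
    show "(\<lambda>n. l (S n)) sums l (\<Union>n. S n)"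
      unfolding l_def
    proof (intro sums_sum bounded_linear.sums[OF bounded_linear_scaleR_left] sums_diff)
      show "(\<lambda>n. measure (N i j) (S n)) sums measure (N i j) (\<Union>n. S n)" for i j
        using S N(1) by (intro N.finite_measure_UNION) auto
      show "(\<lambda>n. measure M (S n)) sums measure M (\<Union>n. S n)"
        using S M(1) by (intro M.finite_measure_UNION) auto
    qed
  qed
  have "mat_integral borel l (apply_bcontfun \<Phi>) = L \<Phi>" for \<Phi>
  proof -
    let ?T = "total_variation borel l" and ?g = "polar_density borel l"
    have comp: "\<exists>h::(real^'d) \<Rightarrow>\<^sub>C real. \<forall>x. apply_bcontfun h x = apply_bcontfun \<Phi> x $ i $ j" for i j
    proof (intro exI allI, subst Bcontfun_apply[where B = "norm \<Phi>"])
      show "continuous_on UNIV (\<lambda>x. apply_bcontfun \<Phi> x $ i $ j)" by (intro continuous_intros continuous_on_apply_bcontfun)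
      show "norm (apply_bcontfun \<Phi> x $ i $ j) \<le> norm \<Phi>" for x
        using norm_bounded[of \<Phi> x] component_le_norm_cart[of "apply_bcontfun \<Phi> x $ i" j]
          Finite_Cartesian_Product.norm_nth_le[of "apply_bcontfun \<Phi> x" i] by simp
    qed simp
    then obtain h where h: "\<And>i j x. apply_bcontfun (h i j) x = apply_bcontfun \<Phi> x $ i $ j" by metis
    have ig: "integrable ?T (\<lambda>x. ?g x $ i $ j)" for i j
      using integrable_inner_left[OF polar_density_integrable[OF l], of "unit_mat i j"] by (simp add: inner_unit_mat)
    have hm: "apply_bcontfun (h i j) \<in> borel_measurable ?T" for i j
      by (rule measurable_sets_eq[OF _ sets_total_variation[symmetric]])
         (intro borel_measurable_continuous_onI continuous_on_apply_bcontfun)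
    have part: "(\<integral>x. apply_bcontfun (h i j) x \<partial>N i j) - (\<integral>x. apply_bcontfun (h i j) x \<partial>M)
      = (\<integral>x. apply_bcontfun (h i j) x * ?g x $ i $ j \<partial>?T)" for i j
    proof (rule integral_difference_density[OF N(2) _ M(2) _ ig _ hm bcontfun_abs_le])
      fix E assume "E \<in> sets ?T"
      then have E: "E \<in> sets borel" by simp
      have iE: "integrable ?T (\<lambda>x. indicat_real E x *\<^sub>R ?g x)"
        using E by (intro integrable_mult_indicator polar_density_integrable[OF l]) simp
      have "measure (N i j) E - measure M E = l E \<bullet> unit_mat i j" by (simp add: inner_unit_mat l_nth)
      also have "\<dots> = (\<integral>x. (indicat_real E x *\<^sub>R ?g x) \<bullet> unit_mat i j \<partial>?T)"
        unfolding polar_density_integral[OF l E] set_lebesgue_integral_def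
        using iE by (intro integral_inner_left[symmetric])
      finally show "measure (N i j) E - measure M E = (LINT x:E|?T. ?g x $ i $ j)"
        by (simp add: set_lebesgue_integral_def inner_unit_mat)
    qed (simp_all add: N(1) M(1))
    have ih: "integrable ?T (\<lambda>x. apply_bcontfun (h i j) x * ?g x $ i $ j)" for i j
    proof (rule Bochner_Integration.integrable_bound)
      show "integrable ?T (\<lambda>x. norm (h i j) * (?g x $ i $ j))" using ig by auto
      show "AE x in ?T. norm (apply_bcontfun (h i j) x * ?g x $ i $ j) \<le> norm (norm (h i j) * (?g x $ i $ j))"
        using bcontfun_abs_le by (intro AE_I2) (auto simp: abs_mult intro!: mult_right_mono)
    qed (use hm ig in auto)
    have "mat_integral borel l (apply_bcontfun \<Phi>) = (\<integral>x. (\<Sum>i\<in>UNIV. \<Sum>j\<in>UNIV. apply_bcontfun (h i j) x * ?g x $ i $ j) \<partial>?T)"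
      unfolding mat_integral_def by (simp add: mat_inner_sum h)
    also have "\<dots> = (\<Sum>i\<in>UNIV. \<Sum>j\<in>UNIV. L (bscale (h i j) (unit_mat i j)))"
      using ih by (simp add: Lij part)
    also have "\<dots> = L (\<Sum>i\<in>UNIV. \<Sum>j\<in>UNIV. bscale (h i j) (unit_mat i j))" by (simp only: expand)
    also have "(\<Sum>i\<in>UNIV. \<Sum>j\<in>UNIV. bscale (h i j) (unit_mat i j)) = \<Phi>"
      by (rule bcontfun_eqI) (simp add: bsum bscale_apply h mat_expand[symmetric])
    finally show ?thesis .
  qed
  then show ?thesis using l by blast
qed

section \<open>The cost of the representing measure\<close>

text \<open>
  A simple field of slopes is approximated by continuous ones: shrink its level sets to disjoint
  compact sets, and smear out their indicators.  Dividing by \<open>max 1\<close> of the sum of the smeared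
  indicators keeps the approximation a subconvex combination of slopes, hence a slope.
\<close>

lemma simple_slope_field_bound:
  fixes f :: "real^'d^'d \<Rightarrow> ennreal" and l :: "(real^'d) set \<Rightarrow> real^'d^'d"
  assumes l: "l \<in> psd_measures borel"
    and bound: "\<And>\<Phi>. (\<And>x. apply_bcontfun \<Phi> x \<in> slopes f) \<Longrightarrow> mat_integral borel l (apply_bcontfun \<Phi>) \<le> D"
    and s: "simple_function borel s" "\<And>x. s x \<in> slopes f"
  shows "mat_integral borel l s \<le> D"
proof (rule field_le_epsilon)
  fix e :: real assume e: "0 < e"
  let ?T = "total_variation borel l" and ?g = "polar_density borel l"
  interpret T: finite_measure ?T by (rule finite_total_variation[OF l])
  define I where "I = range s"
  have fin: "finite I" using simple_functionD(1)[OF s(1)] by (simp add: I_def)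
  have Isl: "c \<in> slopes f" if "c \<in> I" for c using that s(2) by (auto simp: I_def)
  define S where "S = (\<lambda>c. s -` {c})"
  have S: "S c \<in> sets borel" for c using simple_functionD(2)[OF s(1), of "{c}"] by (simp add: S_def)
  define w where "w = (\<Sum>c\<in>I. norm c)"
  have w: "0 \<le> w" unfolding w_def by (intro sum_nonneg) auto
  define d where "d = e / (w + 1)"
  have d: "0 < d" using e w by (simp add: d_def add_nonneg_pos)
  have "\<exists>C\<subseteq>S c. compact C \<and> measure ?T (S c - C) < d" for c
    by (rule compact_inner_approximation[OF _ T.finite_measure_axioms S d]) simp
  then obtain C where C: "\<And>c. C c \<subseteq> S c" "\<And>c. compact (C c)" "\<And>c. measure ?T (S c - C c) < d" by metis
  have cC: "closed (C c)" for c using C(2) by (rule compact_imp_closed)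
  have CB: "C c \<in> sets borel" for c using cC by simp
  define \<Phi> where "\<Phi> = (\<lambda>m x. \<Sum>c\<in>I. (cutoff (C c) m x / max 1 (\<Sum>c'\<in>I. cutoff (C c') m x)) *\<^sub>R c)"
  define \<Phi>0 where "\<Phi>0 = (\<lambda>x. \<Sum>c\<in>I. indicat_real (C c) x *\<^sub>R c)"
  have one: "1 \<le> max 1 (\<Sum>c'\<in>I. cutoff (C c') m x)" for m x by simp
  have slope: "\<Phi> m x \<in> slopes f" for m x
    unfolding \<Phi>_def
  proof (rule slope_combination)
    show "0 \<le> cutoff (C c) m x / max 1 (\<Sum>c'\<in>I. cutoff (C c') m x)" for c
      using cutoff_bounds(1)[of "C c" m x] one[of m x] by (intro divide_nonneg_pos) auto
    have "(\<Sum>c\<in>I. cutoff (C c) m x / max 1 (\<Sum>c'\<in>I. cutoff (C c') m x))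
      = (\<Sum>c\<in>I. cutoff (C c) m x) / max 1 (\<Sum>c'\<in>I. cutoff (C c') m x)" by (rule sum_divide_distrib[symmetric])
    also have "\<dots> \<le> 1" using one[of m x] by (subst divide_le_eq_1_pos) auto
    finally show "(\<Sum>c\<in>I. cutoff (C c) m x / max 1 (\<Sum>c'\<in>I. cutoff (C c') m x)) \<le> 1" .
  qed (rule Isl)
  have cont: "continuous_on UNIV (\<Phi> m)" for m
    unfolding \<Phi>_def using one
    by (intro continuous_intros cutoff_continuous) (metis not_one_le_zero)
  have bd: "norm (\<Phi> m x) \<le> w" for m x
    unfolding \<Phi>_def w_def
  proof (intro sum_norm_le)
    fix c
    have "cutoff (C c) m x / max 1 (\<Sum>c'\<in>I. cutoff (C c') m x) \<le> 1"
      using cutoff_bounds(2)[of "C c" m x] one[of m x] by (subst divide_le_eq_1_pos) auto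
    moreover have "0 \<le> cutoff (C c) m x / max 1 (\<Sum>c'\<in>I. cutoff (C c') m x)"
      using cutoff_bounds(1)[of "C c" m x] one[of m x] by (intro divide_nonneg_pos) auto
    ultimately have "\<bar>cutoff (C c) m x / max 1 (\<Sum>c'\<in>I. cutoff (C c') m x)\<bar> \<le> 1" by linarith
    from mult_right_mono[OF this norm_ge_zero, of c]
    show "norm ((cutoff (C c) m x / max 1 (\<Sum>c'\<in>I. cutoff (C c') m x)) *\<^sub>R c) \<le> norm c"
      unfolding norm_scaleR by simp
  qed
  have lim: "(\<lambda>m. \<Phi> m x) \<longlonglongrightarrow> \<Phi>0 x" for x
  proof -
    have "(\<Sum>c\<in>I. indicat_real (C c) x) \<le> 1"
    proof -
      have "(\<Sum>c\<in>I. indicat_real (C c) x) \<le> (\<Sum>c\<in>I. if c = s x then 1 else 0)"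
        using C(1) by (intro sum_mono) (auto simp: S_def split: split_indicator)
      also have "\<dots> \<le> 1" using fin by (simp add: sum.delta)
      finally show ?thesis .
    qed
    then have m1: "max 1 (\<Sum>c\<in>I. indicat_real (C c) x) = 1" by simp
    have "(\<lambda>m. \<Phi> m x) \<longlonglongrightarrow> (\<Sum>c\<in>I. (indicat_real (C c) x / max 1 (\<Sum>c'\<in>I. indicat_real (C c') x)) *\<^sub>R c)"
      unfolding \<Phi>_def by (intro tendsto_intros tendsto_max cutoff_tendsto cC) auto
    then show ?thesis unfolding m1 by (simp add: \<Phi>0_def)
  qed
  have "mat_integral borel l (\<Phi> m) \<le> D" for m
  proof -
    have a: "apply_bcontfun (Bcontfun (\<Phi> m)) = \<Phi> m" by (rule Bcontfun_apply[OF cont bd])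
    show ?thesis using bound[of "Bcontfun (\<Phi> m)"] slope by (simp add: a)
  qed
  moreover have "(\<lambda>m. mat_integral borel l (\<Phi> m)) \<longlonglongrightarrow> mat_integral borel l \<Phi>0"
  proof (rule mat_integral_dominated_convergence[OF l])
    show "\<Phi>0 \<in> borel_measurable borel" unfolding \<Phi>0_def using CB by measurable
    show "\<Phi> m \<in> borel_measurable borel" for m by (rule borel_measurable_continuous_onI[OF cont])
  qed (use bd lim in auto)
  ultimately have "mat_integral borel l \<Phi>0 \<le> D" by (intro LIMSEQ_le_const2) auto
  moreover have "mat_integral borel l \<Phi>0 = (\<Sum>c\<in>I. c \<bullet> l (C c))"
  proof -
    have i: "integrable ?T (\<lambda>x. indicat_real (C c) x *\<^sub>R ?g x)" for c
      using CB by (intro integrable_mult_indicator polar_density_integrable[OF l]) simp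
    have "mat_integral borel l \<Phi>0 = (\<integral>x. (\<Sum>c\<in>I. c \<bullet> (indicat_real (C c) x *\<^sub>R ?g x)) \<partial>?T)"
      unfolding mat_integral_def \<Phi>0_def by (simp add: inner_sum_left)
    also have "\<dots> = (\<Sum>c\<in>I. c \<bullet> (\<integral>x. indicat_real (C c) x *\<^sub>R ?g x \<partial>?T))"
      by (subst Bochner_Integration.integral_sum)
         (intro integrable_inner_right i, intro sum.cong refl integral_inner_right i)
    finally show ?thesis using polar_density_integral[OF l CB] by (simp add: set_lebesgue_integral_def)
  qed
  moreover have "(\<Sum>c\<in>I. c \<bullet> l (S c)) - (\<Sum>c\<in>I. c \<bullet> l (C c)) \<le> e"
  proof -
    have "c \<bullet> l (S c) - c \<bullet> l (C c) \<le> norm c * d" for c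
    proof -
      have "l (S c) - l (C c) = l (S c - C c)"
      proof -
        have i: "integrable ?T (\<lambda>x. indicat_real E x *\<^sub>R ?g x)" if "E \<in> sets borel" for E
          using that by (intro integrable_mult_indicator polar_density_integrable[OF l]) simp
        have SC: "S c - C c \<in> sets borel" using S CB by auto
        have "(\<integral>x. indicat_real (S c) x *\<^sub>R ?g x \<partial>?T) - (\<integral>x. indicat_real (C c) x *\<^sub>R ?g x \<partial>?T)
          = (\<integral>x. indicat_real (S c) x *\<^sub>R ?g x - indicat_real (C c) x *\<^sub>R ?g x \<partial>?T)"
          by (rule Bochner_Integration.integral_diff[symmetric, OF i[OF S] i[OF CB]])
        also have "\<dots> = (\<integral>x. indicat_real (S c - C c) x *\<^sub>R ?g x \<partial>?T)"
          using C(1)[of c] by (intro Bochner_Integration.integral_cong refl) (auto split: split_indicator)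
        finally show ?thesis
          using polar_density_integral[OF l S[of c]] polar_density_integral[OF l CB[of c]] polar_density_integral[OF l SC]
          by (simp add: set_lebesgue_integral_def)
      qed
      then have "c \<bullet> l (S c) - c \<bullet> l (C c) = c \<bullet> l (S c - C c)" by (simp add: inner_diff_right[symmetric])
      also have "\<dots> \<le> norm c * norm (l (S c - C c))" by (rule norm_cauchy_schwarz)
      also have "\<dots> \<le> norm c * d"
      proof (rule mult_left_mono)
        have "ennreal (norm (l (S c - C c))) \<le> emeasure ?T (S c - C c)"
          using S CB by (intro norm_le_total_variation[OF l]) auto
        then have "norm (l (S c - C c)) \<le> measure ?T (S c - C c)"
          by (simp add: T.emeasure_eq_measure)
        then show "norm (l (S c - C c)) \<le> d" using C(3)[of c] by simp
      qed simp
      finally show ?thesis .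
    qed
    then have "(\<Sum>c\<in>I. c \<bullet> l (S c)) - (\<Sum>c\<in>I. c \<bullet> l (C c)) \<le> (\<Sum>c\<in>I. norm c * d)"
      unfolding sum_subtractf[symmetric] by (intro sum_mono)
    also have "\<dots> = w * d" by (simp add: w_def sum_distrib_right)
    also have "\<dots> \<le> (w + 1) * d" using d by (intro mult_right_mono) auto
    also have "\<dots> = e"
    proof -
      have "0 < w + 1" using w by simp
      then show ?thesis by (simp add: d_def)
    qed
    finally show ?thesis .
  qed
  ultimately show "mat_integral borel l s \<le> D + e"
    unfolding mat_integral_simple[OF l s(1)] by (simp add: I_def S_def)
qed

text \<open>
  Along an enumeration of countably many slopes that already determine \<open>f\<close>, the running maximiser
  at \<open>G x\<close> is a simple function of \<open>x\<close>.
\<close>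

primrec slope_selection :: "(nat \<Rightarrow> 'b::real_inner) \<Rightarrow> ('a \<Rightarrow> 'b) \<Rightarrow> nat \<Rightarrow> 'a \<Rightarrow> 'b" where
  "slope_selection K G 0 = (\<lambda>x. 0)"
| "slope_selection K G (Suc n) =
    (\<lambda>x. if slope_selection K G n x \<bullet> G x < K n \<bullet> G x then K n else slope_selection K G n x)"

lemma action_bound:
  fixes f :: "real^'d^'d \<Rightarrow> ennreal" and l :: "(real^'d) set \<Rightarrow> real^'d^'d"
  assumes f: "convex_fun f" "pos_homogeneous f" "lsc_fun f" and l: "l \<in> psd_measures borel"
    and bound: "\<And>\<Phi>. (\<And>x. apply_bcontfun \<Phi> x \<in> slopes f) \<Longrightarrow> mat_integral borel l (apply_bcontfun \<Phi>) \<le> D"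
  shows "(\<integral>\<^sup>+x. f (polar_density borel l x) \<partial>total_variation borel l) \<le> ennreal D"
proof -
  let ?T = "total_variation borel l" and ?g = "polar_density borel l"
  obtain K :: "nat \<Rightarrow> real^'d^'d" where K: "\<And>n. K n \<in> slopes f" "\<And>A. A \<in> sym_mats \<Longrightarrow> f A = (SUP n. ennreal (K n \<bullet> A))"
    using countable_slopes[OF f] by blast
  define sel where "sel = slope_selection K ?g"
  have sel0: "sel 0 = (\<lambda>x. 0)" and selS: "sel (Suc n) = (\<lambda>x. if sel n x \<bullet> ?g x < K n \<bullet> ?g x then K n else sel n x)" for n
    unfolding sel_def by simp_all
  have [measurable]: "?g \<in> borel_measurable borel" by (rule polar_density_measurable[OF l])
  have simple: "simple_function borel (sel n)" for n
  proof (induction n)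
    case (Suc n)
    have [measurable]: "sel n \<in> borel_measurable borel" by (rule borel_measurable_simple_function[OF Suc])
    show ?case unfolding selS
      by (rule simple_function_If[OF simple_function_const Suc]) measurable
  qed (simp add: sel0)
  have slope: "sel n x \<in> slopes f" for n x
    by (induction n) (auto simp: sel0 selS zero_slope K)
  have mono: "sel n x \<bullet> ?g x \<le> sel (Suc n) x \<bullet> ?g x" for n x by (simp add: selS)
  have nonneg: "0 \<le> sel n x \<bullet> ?g x" for n x
  proof (induction n)
    case (Suc n)
    then show ?case using mono[of n x] by simp
  qed (simp add: sel0)
  have sup: "f (?g x) = (SUP n. ennreal (sel n x \<bullet> ?g x))" for x
  proof (rule antisym)
    show "f (?g x) \<le> (SUP n. ennreal (sel n x \<bullet> ?g x))"
      unfolding K(2)[OF polar_density_sym[OF l]]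
    proof (rule SUP_least)
      fix n
      have "K n \<bullet> ?g x \<le> sel (Suc n) x \<bullet> ?g x" by (simp add: selS)
      then show "ennreal (K n \<bullet> ?g x) \<le> (SUP n. ennreal (sel n x \<bullet> ?g x))"
        by (intro SUP_upper2[of "Suc n"] ennreal_leI) auto
    qed
    show "(SUP n. ennreal (sel n x \<bullet> ?g x)) \<le> f (?g x)"
      by (intro SUP_least slopesD[OF slope] polar_density_sym[OF l])
  qed
  have selm: "(\<lambda>x. sel n x \<bullet> ?g x) \<in> borel_measurable ?T" for n
  proof -
    have "(\<lambda>x. sel n x \<bullet> ?g x) \<in> borel_measurable borel"
      using borel_measurable_simple_function[OF simple[of n]] by measurable
    then show ?thesis by (rule measurable_sets_eq) simp
  qed
  have int: "integrable ?T (\<lambda>x. sel n x \<bullet> ?g x)" for n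
  proof -
    have "finite (range (sel n))" using simple_functionD(1)[OF simple[of n]] by simp
    then have "bounded (range (sel n))" by (rule finite_imp_bounded)
    then obtain B where "\<And>x. norm (sel n x) \<le> B" by (auto simp: bounded_iff)
    then show ?thesis by (intro mat_integral_integrable[OF l] borel_measurable_simple_function[OF simple])
  qed
  have "(\<integral>\<^sup>+x. f (?g x) \<partial>?T) = (SUP n. \<integral>\<^sup>+x. ennreal (sel n x \<bullet> ?g x) \<partial>?T)"
    unfolding sup using selm mono
    by (intro nn_integral_monotone_convergence_SUP incseq_SucI le_funI ennreal_leI) auto
  also have "\<dots> \<le> ennreal D"
  proof (rule SUP_least)
    fix n
    have "(\<integral>\<^sup>+x. ennreal (sel n x \<bullet> ?g x) \<partial>?T) = ennreal (mat_integral borel l (sel n))"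
      unfolding mat_integral_def using int nonneg by (intro nn_integral_eq_integral) auto
    also have "\<dots> \<le> ennreal D"
      by (intro ennreal_leI simple_slope_field_bound[OF l bound simple slope])
    finally show "(\<integral>\<^sup>+x. ennreal (sel n x \<bullet> ?g x) \<partial>?T) \<le> ennreal D" .
  qed
  finally show ?thesis .
qed

section \<open>Duality\<close>

text \<open>
  For the tail functions \<open>0 \<le> \<psi>\<^sub>n \<le> |x|\<^sup>2\<close>, which vanish on balls growing with \<open>n\<close>, the integrals \<open>\<integral> \<psi>\<^sub>n d\<nu>\<close>
  tend to 0 by dominated convergence.  So does the upper bound that they give for the mass of \<open>L\<close>
  far out, which is what the representation by a measure needs.
\<close>

lemma strong_duality:
  fixes f :: "real^'d^'d \<Rightarrow> ennreal" and \<mu> \<nu> :: "(real^'d) measure"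
  assumes f: "convex_fun f" "pos_homogeneous f" "lsc_fun f" and dom: "eff_dom f \<subseteq> psd_mats"
    and \<mu>: "\<mu> \<in> P2" and \<nu>: "\<nu> \<in> P2" and D: "0 \<le> D"
    and bound: "\<And>\<psi> g H. C2_with \<psi> g H \<Longrightarrow> bounded (range H) \<Longrightarrow> (\<And>x. (1/2) *\<^sub>R H x \<in> slopes f) \<Longrightarrow>
      (\<integral>x. \<psi> x \<partial>\<nu>) - (\<integral>x. \<psi> x \<partial>\<mu>) \<le> D"
  shows "dyn_cost f \<mu> \<nu> \<le> ennreal D"
proof -
  have "\<exists>L::((real^'d) \<Rightarrow>\<^sub>C (real^'d^'d)) \<Rightarrow> real. linear L \<and>
    (\<forall>\<Phi> \<psi> g H. C2_with \<psi> g H \<longrightarrow> bounded (range H) \<longrightarrow> (\<forall>x. apply_bcontfun \<Phi> x = (1/2) *\<^sub>R H x) \<longrightarrow>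
      L \<Phi> = (\<integral>x. \<psi> x \<partial>\<nu>) - (\<integral>x. \<psi> x \<partial>\<mu>)) \<and>
    (\<forall>\<Phi>. (\<forall>x. apply_bcontfun \<Phi> x \<in> slopes f) \<longrightarrow> L \<Phi> \<le> D) \<and>
    (\<forall>\<Phi>. (\<forall>x. \<forall>A\<in>psd_mats. apply_bcontfun \<Phi> x \<bullet> A \<le> 0) \<longrightarrow> L \<Phi> \<le> 0)"
    by (rule ex_dual_functional[OF dom \<mu> \<nu> D]) (rule bound)
  then obtain L :: "((real^'d) \<Rightarrow>\<^sub>C (real^'d^'d)) \<Rightarrow> real" where L: "linear L"
    and hess: "\<And>\<Phi> \<psi> g H. C2_with \<psi> g H \<Longrightarrow> bounded (range H) \<Longrightarrow> (\<And>x. apply_bcontfun \<Phi> x = (1/2) *\<^sub>R H x) \<Longrightarrow>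
      L \<Phi> = (\<integral>x. \<psi> x \<partial>\<nu>) - (\<integral>x. \<psi> x \<partial>\<mu>)"
    and slopes: "\<And>\<Phi>. (\<And>x. apply_bcontfun \<Phi> x \<in> slopes f) \<Longrightarrow> L \<Phi> \<le> D"
    and neg: "\<And>\<Phi>. (\<And>x A. A \<in> psd_mats \<Longrightarrow> apply_bcontfun \<Phi> x \<bullet> A \<le> 0) \<Longrightarrow> L \<Phi> \<le> 0"
    by fast
  have half_bcontfun: "\<exists>\<Phi>. \<forall>x. apply_bcontfun \<Phi> x = (1/2) *\<^sub>R H x"
    if H: "C2_with \<psi> g H" "bounded (range H)" for \<psi> g and H :: "real^'d \<Rightarrow> real^'d^'d"
  proof -
    obtain B where B: "\<And>x. norm (H x) \<le> B" using H(2) by (auto simp: bounded_iff)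
    have "apply_bcontfun (Bcontfun (\<lambda>x. (1/2) *\<^sub>R H x)) = (\<lambda>x. (1/2) *\<^sub>R H x)"
    proof (rule Bcontfun_apply[where B = B])
      show "continuous_on UNIV (\<lambda>x. (1/2) *\<^sub>R H x)" using C2_continuous(3)[OF H(1)] by (intro continuous_intros)
      show "norm ((1/2) *\<^sub>R H x) \<le> B" for x using B[of x] order_trans[OF norm_ge_zero B[of x]] by simp
    qed
    then show ?thesis by metis
  qed
  have "\<exists>l\<in>psd_measures borel. \<forall>\<Phi>. mat_integral borel l (apply_bcontfun \<Phi>) = L \<Phi>"
  proof (rule matrix_representation[OF L neg])
    fix e :: real assume e: "0 < e"
    obtain \<psi> g H where \<psi>: "\<And>n. C2_with (\<psi> n) (g n) (H n)" "\<And>n. bounded (range (H n))"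
      and pos: "\<And>n (x::real^'d). 0 \<le> \<psi> n x \<and> \<psi> n x \<le> x \<bullet> x \<and> (x \<bullet> x \<le> real n \<longrightarrow> \<psi> n x = 0)"
      and HA: "\<And>n x A. A \<in> psd_mats \<Longrightarrow> 0 \<le> H n x \<bullet> A \<and> (real n + 1 \<le> x \<bullet> x \<longrightarrow> trace A \<le> H n x \<bullet> A)"
      using ex_tail_function[where 'd = 'd, OF of_nat_0_le_iff] by metis
    have "(\<lambda>n. \<integral>x. \<psi> n x \<partial>\<nu>) \<longlonglongrightarrow> (\<integral>x. 0 \<partial>\<nu>)"
    proof (rule integral_dominated_convergence[where w = "\<lambda>x. x \<bullet> x"])
      show "integrable \<nu> (\<lambda>x. x \<bullet> x)" by (rule P2D(4)[OF \<nu>])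
      show "\<psi> n \<in> borel_measurable \<nu>" for n
        using C2b_integrable[OF _ \<nu>, of "\<psi> n"] \<psi> by (auto simp: C2b_iff)
      show "AE x in \<nu>. norm (\<psi> n x) \<le> x \<bullet> x" for n using pos by (intro AE_I2) simp
      show "AE x in \<nu>. (\<lambda>n. \<psi> n x) \<longlonglongrightarrow> 0"
      proof (rule AE_I2)
        fix x :: "real^'d"
        obtain n where "x \<bullet> x < real n" using reals_Archimedean2 by blast
        then have "\<psi> m x = 0" if "m \<ge> n" for m using pos[of m x] that by simp
        then show "(\<lambda>n. \<psi> n x) \<longlonglongrightarrow> 0" by (intro tendsto_eventually eventually_sequentiallyI[of n])
      qed
    qed simp
    then have "eventually (\<lambda>n. (\<integral>x. \<psi> n x \<partial>\<nu>) < e / 2) sequentially"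
      using e by (intro order_tendstoD(2)) auto
    then obtain n where n: "(\<integral>x. \<psi> n x \<partial>\<nu>) < e / 2" by (metis eventually_happens sequentially_bot)
    have C2': "C2_with (\<lambda>x. 2 * \<psi> n x) (\<lambda>x. 2 *\<^sub>R g n x) (\<lambda>x. 2 *\<^sub>R H n x)" by (rule C2_scale[OF \<psi>(1)])
    have b2: "bounded (range (\<lambda>x. 2 *\<^sub>R H n x))" using bounded_scaling[OF \<psi>(2)[of n], of 2] by (simp add: image_image)
    obtain \<Psi> where "\<And>x. apply_bcontfun \<Psi> x = (1/2) *\<^sub>R (2 *\<^sub>R H n x)" using half_bcontfun[OF C2' b2] by blast
    then have \<Psi>: "\<And>x. apply_bcontfun \<Psi> x = (1/2) *\<^sub>R (2 *\<^sub>R H n x)" "\<And>x. apply_bcontfun \<Psi> x = H n x" by simp_all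
    have "L \<Psi> = (\<integral>x. 2 * \<psi> n x \<partial>\<nu>) - (\<integral>x. 2 * \<psi> n x \<partial>\<mu>)" by (rule hess[OF C2' b2 \<Psi>(1)])
    also have "\<dots> \<le> e"
    proof -
      have "0 \<le> (\<integral>x. \<psi> n x \<partial>\<mu>)" using pos by (intro integral_nonneg_AE) simp
      then show ?thesis using n by simp
    qed
    finally have "L \<Psi> \<le> e" .
    moreover
    have "real n + 1 \<le> x \<bullet> x" if "sqrt (real n + 1) \<le> norm x" for x :: "real^'d"
      using sqrt_le_D[OF that] by (simp add: power2_norm_eq_inner)
    then have "\<forall>x. \<forall>A\<in>psd_mats. 0 \<le> apply_bcontfun \<Psi> x \<bullet> A \<and>
      (sqrt (real n + 1) \<le> norm x \<longrightarrow> trace A \<le> apply_bcontfun \<Psi> x \<bullet> A)"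
      unfolding \<Psi>(2) using HA by blast
    ultimately show "\<exists>R \<Psi>. (\<forall>x. \<forall>A\<in>psd_mats. 0 \<le> apply_bcontfun \<Psi> x \<bullet> A \<and>
      (R \<le> norm x \<longrightarrow> trace A \<le> apply_bcontfun \<Psi> x \<bullet> A)) \<and> L \<Psi> \<le> e" by blast
  qed
  then obtain l where l: "l \<in> psd_measures borel" and rep: "\<And>\<Phi>. mat_integral borel l (apply_bcontfun \<Phi>) = L \<Phi>" by blast
  have "dyn_cost f \<mu> \<nu> \<le> (\<integral>\<^sup>+x. f (polar_density borel l x) \<partial>total_variation borel l)"
  proof (rule static_upper_bound[OF \<mu> \<nu> l])
    fix \<psi> :: "real^'d \<Rightarrow> real" and g H assume H: "C2_with \<psi> g H" "bounded (range H)"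
    obtain \<Phi> where \<Phi>: "\<And>x. apply_bcontfun \<Phi> x = (1/2) *\<^sub>R H x" using half_bcontfun[OF H] by blast
    then have "(\<lambda>x. (1/2) *\<^sub>R H x) = apply_bcontfun \<Phi>" by auto
    then show "mat_integral borel l (\<lambda>x. (1/2) *\<^sub>R H x) = (\<integral>x. \<psi> x \<partial>\<nu>) - (\<integral>x. \<psi> x \<partial>\<mu>)"
      using rep hess[OF H \<Phi>] by simp
  qed
  also have "\<dots> \<le> ennreal D" by (rule action_bound[OF f l]) (simp add: rep slopes)
  finally show ?thesis .
qed

text \<open>
  The zero measure drives the constant curve.
\<close>

lemma zero_cost:
  fixes f :: "real^'d^'d \<Rightarrow> ennreal"
  assumes p: "p \<in> P2"
  shows "dyn_cost f p p = 0"
proof -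
  define l :: "(real^'d) set \<Rightarrow> real^'d^'d" where "l = (\<lambda>_. 0)"
  have l: "l \<in> psd_measures borel"
    by (auto simp: psd_measures_def psd_mats_def l_def intro!: subspace_0[OF subspace_sym_mats])
  have "emeasure (total_variation borel l) UNIV \<le> ennreal (trace (l UNIV))"
    by (rule emeasure_total_variation_le[OF l]) simp
  then have T: "emeasure (total_variation borel l) UNIV = 0" by (simp add: l_def trace_def)
  have "UNIV \<in> null_sets (total_variation borel l)" using T by (auto simp: null_sets_def)
  then have AE: "AE x in total_variation borel l. P x" for P
    by (rule AE_I'[of UNIV]) auto
  have "dyn_cost f p p \<le> (\<integral>\<^sup>+x. f (polar_density borel l x) \<partial>total_variation borel l)"
  proof (rule static_upper_bound[OF p p l])
    fix \<psi> :: "real^'d \<Rightarrow> real" and g H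
    have "mat_integral borel l (\<lambda>x. (1/2) *\<^sub>R H x) = 0"
      unfolding mat_integral_def by (rule integral_eq_zero_AE[OF AE])
    then show "mat_integral borel l (\<lambda>x. (1/2) *\<^sub>R H x) = (\<integral>x. \<psi> x \<partial>p) - (\<integral>x. \<psi> x \<partial>p)" by simp
  qed
  also have "\<dots> = (\<integral>\<^sup>+x. 0 \<partial>total_variation borel l)" by (rule nn_integral_cong_AE[OF AE])
  finally show ?thesis by simp
qed

lemma weak_duality_dyn_cost:
  fixes f :: "real^'d^'d \<Rightarrow> ennreal"
  assumes "C2_with \<psi> g H" "bounded (range H)" "\<And>x. (1/2) *\<^sub>R H x \<in> slopes f"
  shows "ennreal ((\<integral>x. \<psi> x \<partial>\<nu>) - (\<integral>x. \<psi> x \<partial>\<mu>)) \<le> dyn_cost f \<mu> \<nu>"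
  unfolding dyn_cost_def
proof (rule Inf_greatest)
  fix c assume "c \<in> {action f l |\<rho> \<Lambda> r l. fokker_planck \<rho> \<Lambda> r l \<and> narrowly_continuous r \<and> r 0 = \<mu> \<and> r 1 = \<nu>}"
  then obtain \<rho> \<Lambda> r l where c: "c = action f l" "r 0 = \<mu>" "r 1 = \<nu>"
    and sol: "fokker_planck \<rho> \<Lambda> r l" "narrowly_continuous r" by blast
  have "ennreal ((\<integral>x. \<psi> x \<partial>r 1) - (\<integral>x. \<psi> x \<partial>r 0)) \<le> action f l"
    by (rule weak_duality[OF sol assms(1,2)]) (rule assms(3))
  then show "ennreal ((\<integral>x. \<psi> x \<partial>\<nu>) - (\<integral>x. \<psi> x \<partial>\<mu>)) \<le> c" unfolding c .
qed

text \<open>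
  The condition \<open>-\<psi> = (-\<psi>)\<^sup>G\<close> says that \<open>\<integral>\<psi> dp - \<psi>(x) \<le> F(\<delta>\<^sub>x, p)\<close> for all \<open>p\<close>; infinitesimally this is a
  pointwise bound on the Hessian, and weak duality integrates that bound back.
\<close>

lemma G_transform_iff_slopes:
  fixes f :: "real^'d^'d \<Rightarrow> ennreal"
  assumes f: "convex_fun f" "pos_homogeneous f" and dom: "eff_dom f \<subseteq> psd_mats"
    and P: "P \<in> eff_dom f \<inter> pd_mats" and \<psi>: "C2_with \<psi> g H" "bounded (range H)"
  shows "(\<forall>x. ereal (- \<psi> x) = G_transform f (\<lambda>y. - \<psi> y) x) \<longleftrightarrow> (\<forall>x. (1/2) *\<^sub>R H x \<in> slopes f)"
proof -
  have C: "(LINT y|completion p. - \<psi> y) = - (\<integral>y. \<psi> y \<partial>p)" if p: "p \<in> P2" for p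
  proof -
    have "integrable p \<psi>" using \<psi> by (intro C2b_integrable[OF _ p]) (auto simp: C2b_iff)
    then have "(\<lambda>y. - \<psi> y) \<in> borel_measurable p" by auto
    from integral_completion[OF this] show ?thesis by simp
  qed
  have conv: "ereal (- \<psi> x) \<le> ereal (- (\<integral>y. \<psi> y \<partial>p)) + enn2ereal c \<longleftrightarrow> ennreal ((\<integral>y. \<psi> y \<partial>p) - \<psi> x) \<le> c" for x p c
    by (cases c) (auto simp: ennreal_le_iff2)
  show ?thesis
  proof
    assume G: "\<forall>x. ereal (- \<psi> x) = G_transform f (\<lambda>y. - \<psi> y) x"
    show "\<forall>x. (1/2) *\<^sub>R H x \<in> slopes f"
    proof
      fix x :: "real^'d"
      show "(1/2) *\<^sub>R H x \<in> slopes f"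
      proof (rule slope_from_transport_bound[OF f dom P \<psi>])
        fix p :: "(real^'d) measure" assume p: "p \<in> P2"
        have "ereal (- \<psi> x) \<le> ereal (LINT y|completion p. - \<psi> y) + enn2ereal (G_cost f x p)"
          unfolding G[rule_format] G_transform_def by (rule INF_lower[OF p])
        then show "ennreal ((\<integral>y. \<psi> y \<partial>p) - \<psi> x) \<le> G_cost f x p" unfolding C[OF p] conv .
      qed
    qed
  next
    assume sl: "\<forall>x. (1/2) *\<^sub>R H x \<in> slopes f"
    have r: "(\<integral>y. \<psi> y \<partial>return borel x) = \<psi> x" for x by (rule integral_return_C2[OF C2_continuous(1)[OF \<psi>(1)]])
    show "\<forall>x. ereal (- \<psi> x) = G_transform f (\<lambda>y. - \<psi> y) x"
    proof (intro allI antisym)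
      fix x :: "real^'d"
      show "ereal (- \<psi> x) \<le> G_transform f (\<lambda>y. - \<psi> y) x"
        unfolding G_transform_def
      proof (rule INF_greatest)
        fix p :: "(real^'d) measure" assume p: "p \<in> P2"
        have "ennreal ((\<integral>y. \<psi> y \<partial>p) - (\<integral>y. \<psi> y \<partial>return borel x)) \<le> dyn_cost f (return borel x) p"
          using sl by (intro weak_duality_dyn_cost[OF \<psi>]) auto
        then show "ereal (- \<psi> x) \<le> ereal (LINT y|completion p. - \<psi> y) + enn2ereal (G_cost f x p)"
          unfolding C[OF p] conv by (simp add: r G_cost_def)
      qed
      have "G_transform f (\<lambda>y. - \<psi> y) x \<le> ereal (LINT y|completion (return borel x). - \<psi> y) + enn2ereal (G_cost f x (return borel x))"
        unfolding G_transform_def by (rule INF_lower[OF return_P2])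
      also have "\<dots> = ereal (- \<psi> x)"
        unfolding C[OF return_P2] r G_cost_def zero_cost[OF return_P2] by (simp add: zero_ennreal.rep_eq)
      finally show "G_transform f (\<lambda>y. - \<psi> y) x \<le> ereal (- \<psi> x)" .
    qed
  qed
qed

theorem theorem3p27:
  fixes f :: "real^'d^'d \<Rightarrow> ennreal"
    and \<mu> \<nu> :: "(real^'d) measure"
  assumes "convex_fun f"
    and "pos_homogeneous f"
    and "lsc_fun f"
    and "eff_dom f \<subseteq> psd_mats"
    and "eff_dom f \<noteq> {}"
    and "eff_dom f \<subseteq> closure (eff_dom f \<inter> pd_mats)"
    and "\<mu> \<in> P2"
    and "\<nu> \<in> P2"
  shows "enn2ereal (dyn_cost f \<mu> \<nu>) =
    (SUP \<psi>\<in>{\<psi>. C2b \<psi> \<and> (\<forall>x. ereal (- \<psi> x) = G_transform f (\<lambda>y. - \<psi> y) x)}.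
       ereal ((LINT x|\<nu>. \<psi> x) - (LINT x|\<mu>. \<psi> x)))"
proof -
  obtain P where P: "P \<in> eff_dom f \<inter> pd_mats"
    using assms(5,6) by (metis closure_empty ex_in_conv subset_empty)
  define S where "S = {\<psi>. C2b \<psi> \<and> (\<forall>x. ereal (- \<psi> x) = G_transform f (\<lambda>y. - \<psi> y) x)}"
  define J where "J = (\<lambda>\<psi> :: real^'d \<Rightarrow> real. (LINT x|\<nu>. \<psi> x) - (LINT x|\<mu>. \<psi> x))"
  have S_slopes: "\<exists>g H. C2_with \<psi> g H \<and> bounded (range H) \<and> (\<forall>x. (1/2) *\<^sub>R H x \<in> slopes f)" if "\<psi> \<in> S" for \<psi>
    using that G_transform_iff_slopes[OF assms(1,2,4) P] unfolding S_def C2b_iff by blast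
  have slopes_S: "\<psi> \<in> S" if "C2_with \<psi> g H" "bounded (range H)" "\<And>x. (1/2) *\<^sub>R H x \<in> slopes f" for \<psi> g H
    using that G_transform_iff_slopes[OF assms(1,2,4) P that(1,2)] unfolding S_def C2b_iff by blast
  have "enn2ereal (dyn_cost f \<mu> \<nu>) = (SUP \<psi>\<in>S. ereal (J \<psi>))"
  proof (rule antisym)
    show "(SUP \<psi>\<in>S. ereal (J \<psi>)) \<le> enn2ereal (dyn_cost f \<mu> \<nu>)"
    proof (rule SUP_least)
      fix \<psi> assume "\<psi> \<in> S"
      then obtain g H where "C2_with \<psi> g H" "bounded (range H)" "\<And>x. (1/2) *\<^sub>R H x \<in> slopes f"
        using S_slopes by blast
      then have "ennreal (J \<psi>) \<le> dyn_cost f \<mu> \<nu>" unfolding J_def by (rule weak_duality_dyn_cost)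
      then have "enn2ereal (ennreal (J \<psi>)) \<le> enn2ereal (dyn_cost f \<mu> \<nu>)" by (simp add: less_eq_ennreal.rep_eq)
      moreover have "ereal (J \<psi>) \<le> enn2ereal (ennreal (J \<psi>))" 
        by (cases "0 \<le> J \<psi>") (simp_all add: ennreal_neg zero_ennreal.rep_eq enn2ereal_ennreal)
      ultimately show "ereal (J \<psi>) \<le> enn2ereal (dyn_cost f \<mu> \<nu>)" by (rule order_trans[rotated])
    qed
    show "enn2ereal (dyn_cost f \<mu> \<nu>) \<le> (SUP \<psi>\<in>S. ereal (J \<psi>))"
    proof (cases "(SUP \<psi>\<in>S. ereal (J \<psi>)) = \<infinity>")
      case False
      have "(\<lambda>x::real^'d. 0 * (x \<bullet> x)) \<in> S"
        by (rule slopes_S[OF C2_scale[OF C2_square, of 0]]) (auto simp: zero_slope)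
      then have "ereal (J (\<lambda>x. 0 * (x \<bullet> x))) \<le> (SUP \<psi>\<in>S. ereal (J \<psi>))" by (rule SUP_upper)
      then have "0 \<le> (SUP \<psi>\<in>S. ereal (J \<psi>))" by (simp add: J_def zero_ereal_def)
      then obtain D where D: "(SUP \<psi>\<in>S. ereal (J \<psi>)) = ereal D" "0 \<le> D"
        using False by (cases "SUP \<psi>\<in>S. ereal (J \<psi>)") auto
      have "dyn_cost f \<mu> \<nu> \<le> ennreal D"
      proof (rule strong_duality[OF assms(1-4,7,8) D(2)])
        fix \<psi> g H assume "C2_with \<psi> g H" "bounded (range H)" "\<And>x. (1/2) *\<^sub>R H x \<in> slopes f"
        then have "\<psi> \<in> S" by (rule slopes_S)
        then have "ereal (J \<psi>) \<le> ereal D" unfolding D(1)[symmetric] by (rule SUP_upper)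
        then show "(\<integral>x. \<psi> x \<partial>\<nu>) - (\<integral>x. \<psi> x \<partial>\<mu>) \<le> D" by (simp add: J_def)
      qed
      then have "enn2ereal (dyn_cost f \<mu> \<nu>) \<le> enn2ereal (ennreal D)" by (simp add: less_eq_ennreal.rep_eq)
      then show ?thesis using D by simp
    qed simp
  qed
  then show ?thesis unfolding S_def J_def .
qed

end
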